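(* Let $n\ge2$, $\lambda=(\lambda_1|\lambda_2)\in\Lambda_n$ and $l=|\lambda_1|$. Let $\sigma_\lambda\in\mathfrak{S}_\lambda$ be the longest element and let $\mathfrak{C}_\lambda$ be the left cell of $W_n$ (with respect to the "asymptotic case") containing $\sigma_\lambda a_l\in W_n$. Then $\mathfrak{C}_\lambda$ has type $(\lambda_2^*|\lambda_1)$ and $$\mathfrak{C}_\lambda=\{d(\mathfrak{t})\,\sigma_\lambda\,a_l\mid\mathfrak{t}\in\mathbb{T}(\lambda)\},$$ where $\ell(d(\mathfrak{t})\sigma_\lambda a_l)=\ell(d(\mathfrak{t}))+\ell(\sigma_\lambda a_l)$ for all $\mathfrak{t}\in\mathbb{T}(\lambda)$.
   Context: **Group and algebra.** $W_n$ ($n\ge2$) is the Coxeter group of type $B_n$ with generators $t,s_1,\dots,s_{n-1}$ ($ts_1$ of order 4, $s_is_{i+1}$ of order 3, all other pairs of distinct generators commute), length function $\ell$. $\mathfrak{S}_n=\langle s_1,\dots,s_{n-1}\rangle$ is identified with the symmetric group, $s_i=(i,i+1)$. $A=\mathbb{Z}[V^{\pm1},v^{\pm1}]$ with independent indeterminates $V,v$. $\mathcal{H}_n$ is the free $A$-algebra with basis $T_w$ ($w\in W_n$) and multiplication, for a generator $s$: $T_sT_w=T_{sw}$ if $\ell(sw)>\ell(w)$, and $T_sT_w=T_{sw}+(v_s-v_s^{-1})T_w$ if $\ell(sw)<\ell(w)$, where $v_t=V$ and $v_{s_i}=v$. **Kazhdan--Lusztig basis and left cells ("asymptotic case").** Order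 monomials by $V^iv^j<V^{i'}v^{j'}$ iff $i<i'$, or $i=i'$ and $j<j'$. Let $A_{<0}$ be the $\mathbb{Z}$-span of the monomials $<1$. $C_w$ is the unique element of $T_w+\sum_{y<w}A_{<0}T_y$ ($<$ the Bruhat--Chevalley order) fixed by the ring involution of $\mathcal{H}_n$ with $V\mapsto V^{-1}$, $v\mapsto v^{-1}$, $T_w\mapsto T_{w^{-1}}^{-1}$; $\{C_w\}$ is an $A$-basis of $\mathcal{H}_n$. $\le_{\mathcal{L}}$ is the pre-order (reflexive, transitive) on $W_n$ generated by: $z\le_{\mathcal L}y$ if $C_z$ occurs with non-zero coefficient in $C_sC_y$ (expanded in the $C$-basis) for some generator $s$. Left cells are the equivalence classes of the associated equivalence relation. **Combinatorics.** $\Lambda_n$ is the set of bipartitions $\lambda=(\lambda_1|\lambda_2)$ with $|\lambda_1|+|\lambda_2|=n$; $\mu^*$ denotes the conjugate (transpose) of a partition $\mu$. $\lambda$-bitableaux are filled by $1,\dots,n$ (each once); $\mathbb{T}(\lambda)$ is the set of standard ones (in each component, rows and columns increase). $\mathfrak{t}^\lambda$ is the bitableau whose first component has its rows filled in order, left to right, by $1,\dots,l$ and whose second component has its rows filled in order by $l+1,\dots,n$. $\mathfrak{S}_n$ acts on the left on bitableaux by permuting entries; $d(\mathfrak{t})\in\mathfrak{S}_n$ is defined by $d(\mathfrak{t}).\mathfrak{t}^\lambda=\mathfrak{t}$. $\mathfrak{S}_\lambda\subseteq\mathfrak{S}_n$ is the row stabilizer of $\mathfrak{t}^\lambda$ (a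 parabolic subgroup). $a_0=1$ and $a_l=t(s_1t)(s_2s_1t)\cdots(s_{l-1}\cdots s_1t)$ for $l>0$. **Type.** Identify $W_n$ with the group of signed permutations of $\{\pm1,\dots,\pm n\}$, $t$ exchanging $1$ and $-1$ and $s_i$ exchanging $i,i+1$ (and $-i,-i-1$). The generalized Robinson--Schensted correspondence attaches to $w\in W_n$ a pair $(P(w),Q(w))$ of standard bitableaux of the same shape: apply the usual Robinson--Schensted row insertion to the subsequence of positive entries of the word $w(1),\dots,w(n)$ (recording positions) to get the first components of $P(w)$ and $Q(w)$, and to the absolute values of the subsequence of negative entries to get the second components. The common shape $(\nu_1|\nu_2)\in\Lambda_n$ is called the type of $w$. $Q$ is constant on each left cell (asymptotic case), and the type of a left cell $\mathfrak{C}$ is the shape of $Q(x)$, $x\in\mathfrak{C}$. *)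

theory Defs
  imports
    "HOL-Library.Poly_Mapping"
    "HOL-Library.Product_Plus"
    "HOL-Combinatorics.Permutations"
begin

section \<open>The Coxeter group of type B as the group of signed permutations\<close>

text \<open>A signed permutation of $\{\pm 1,\dots,\pm n\}$ is a function on all integers that fixes
  everything outside this set. The product of the group is \<^term>\<open>(\<circ>)\<close>, its unit is
  \<^term>\<open>id\<close>, inverses are given by \<^term>\<open>inv\<close>.\<close>

type_synonym sperm = "int \<Rightarrow> int"

definition W :: "nat \<Rightarrow> sperm set" where
  "W n = {w. w permutes {i. 1 \<le> \<bar>i\<bar> \<and> \<bar>i\<bar> \<le> int n} \<and> (\<forall>i. w (- i) = - w i)}"

definition gen_t :: sperm where
  "gen_t = Transposition.transpose 1 (- 1)"

definition gen_s :: "nat \<Rightarrow> sperm" where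
  "gen_s i = Transposition.transpose (int i) (int i + 1) \<circ> Transposition.transpose (- int i) (- int i - 1)"

definition gens :: "nat \<Rightarrow> sperm set" where
  "gens n = insert gen_t (gen_s ` {1..<n})"

definition word_prod :: "sperm list \<Rightarrow> sperm" where
  "word_prod ss = foldr (\<circ>) ss id"

definition len :: "nat \<Rightarrow> sperm \<Rightarrow> nat" where
  "len n w = (LEAST k. \<exists>ss. set ss \<subseteq> gens n \<and> length ss = k \<and> word_prod ss = w)"

definition reflections :: "nat \<Rightarrow> sperm set" where
  "reflections n = {x \<circ> s \<circ> inv x | x s. x \<in> W n \<and> s \<in> gens n}"

definition bruhat_less :: "nat \<Rightarrow> (sperm \<times> sperm) set" where
  "bruhat_less n = {(x, y). x \<in> W n \<and> y \<in> W n \<and> len n x < len n y \<and>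
                            (\<exists>r \<in> reflections n. y = r \<circ> x)}\<^sup>+"

text \<open>Since the generators are involutions, the words in $s_1,\dots,s_{n-1}$ already form the
  subgroup generated by them.\<close>

definition Sym :: "nat \<Rightarrow> sperm set" where
  "Sym n = {word_prod ss | ss. set ss \<subseteq> gen_s ` {1..<n}}"

text \<open>\<^term>\<open>a_block k\<close> is $s_k \cdots s_1 t$.\<close>

primrec a_block :: "nat \<Rightarrow> sperm" where
  "a_block 0 = gen_t"
| "a_block (Suc k) = gen_s (Suc k) \<circ> a_block k"

primrec a_elt :: "nat \<Rightarrow> sperm" where
  "a_elt 0 = id"
| "a_elt (Suc l) = a_elt l \<circ> a_block l"


section \<open>The generic Iwahori-Hecke algebra\<close>

text \<open>$A = \mathbb{Z}[V^{\pm 1}, v^{\pm 1}]$ is the group ring of $\mathbb{Z}^2$: the pair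
  $(i, j)$ is the exponent of the monomial $V^i v^j$, and the multiplication of
  \<^type>\<open>poly_mapping\<close> is convolution.\<close>

type_synonym laurent = "(int \<times> int) \<Rightarrow>\<^sub>0 int"

definition laurent_monom :: "int \<Rightarrow> int \<Rightarrow> laurent" where
  "laurent_monom i j = Poly_Mapping.single (i, j) 1"

definition laurent_bar :: "laurent \<Rightarrow> laurent" where
  "laurent_bar p = Poly_Mapping.map_key uminus p"

text \<open>The order on monomials of the asymptotic case enters here.\<close>

definition A_neg :: "laurent set" where
  "A_neg = {p. \<forall>(i, j) \<in> Poly_Mapping.keys p. i < 0 \<or> (i = 0 \<and> j < 0)}"

text \<open>The parameter difference $v_s - v_s^{-1}$.\<close>

definition xi :: "sperm \<Rightarrow> laurent" where
  "xi s = (if s = gen_t then laurent_monom 1 0 - laurent_monom (- 1) 0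
           else laurent_monom 0 1 - laurent_monom 0 (- 1))"

text \<open>Elements of $\mathcal{H}_n$ are given by their coefficients with respect to the basis $T_w$.\<close>

type_synonym hecke = "sperm \<Rightarrow> laurent"

definition H :: "nat \<Rightarrow> hecke set" where
  "H n = {h. \<forall>w. w \<notin> W n \<longrightarrow> h w = 0}"

definition T :: "sperm \<Rightarrow> hecke" where
  "T w = (\<lambda>x. if x = w then 1 else 0)"

definition hadd :: "hecke \<Rightarrow> hecke \<Rightarrow> hecke" where
  "hadd h k = (\<lambda>x. h x + k x)"

definition hscale :: "laurent \<Rightarrow> hecke \<Rightarrow> hecke" where
  "hscale c h = (\<lambda>x. c * h x)"

text \<open>An associative unital \<open>A\<close>-algebra structure on the free module \<^term>\<open>H n\<close>
  with the defining multiplication rule for the products $T_s T_w$.\<close>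

definition is_hecke_mult :: "nat \<Rightarrow> (hecke \<Rightarrow> hecke \<Rightarrow> hecke) \<Rightarrow> bool" where
  "is_hecke_mult n m \<longleftrightarrow>
     (\<forall>h \<in> H n. \<forall>k \<in> H n. m h k \<in> H n) \<and>
     (\<forall>g \<in> H n. \<forall>h \<in> H n. \<forall>k \<in> H n. m (hadd g h) k = hadd (m g k) (m h k)) \<and>
     (\<forall>g \<in> H n. \<forall>h \<in> H n. \<forall>k \<in> H n. m g (hadd h k) = hadd (m g h) (m g k)) \<and>
     (\<forall>c. \<forall>h \<in> H n. \<forall>k \<in> H n. m (hscale c h) k = hscale c (m h k)) \<and>
     (\<forall>c. \<forall>h \<in> H n. \<forall>k \<in> H n. m h (hscale c k) = hscale c (m h k)) \<and>
     (\<forall>g \<in> H n. \<forall>h \<in> H n. \<forall>k \<in> H n. m (m g h) k = m g (m h k)) \<and>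
     (\<forall>h \<in> H n. m (T id) h = h \<and> m h (T id) = h) \<and>
     (\<forall>s \<in> gens n. \<forall>w \<in> W n.
        (len n w < len n (s \<circ> w) \<longrightarrow> m (T s) (T w) = T (s \<circ> w)) \<and>
        (len n (s \<circ> w) < len n w \<longrightarrow>
           m (T s) (T w) = hadd (T (s \<circ> w)) (hscale (xi s) (T w))))"

text \<open>Such a multiplication exists, and its values on \<^term>\<open>H n\<close> are uniquely determined;
  no use is made of its values on other arguments.\<close>

definition hmult :: "nat \<Rightarrow> hecke \<Rightarrow> hecke \<Rightarrow> hecke" where
  "hmult n = (SOME m. is_hecke_mult n m)"

definition T_inverse :: "nat \<Rightarrow> sperm \<Rightarrow> hecke" where
  "T_inverse n w = (THE k. k \<in> H n \<and> hmult n (T w) k = T id \<and> hmult n k (T w) = T id)"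

text \<open>$\sum_w a_w T_w \mapsto \sum_w \overline{a_w}\, T_{w^{-1}}^{-1}$\<close>

definition hbar :: "nat \<Rightarrow> hecke \<Rightarrow> hecke" where
  "hbar n h = (\<lambda>x. \<Sum>w \<in> W n. laurent_bar (h w) * T_inverse n (inv w) x)"


section \<open>Kazhdan--Lusztig basis and left cells in the asymptotic case\<close>

definition KL :: "nat \<Rightarrow> sperm \<Rightarrow> hecke" where
  "KL n w = (THE c. c w = 1 \<and>
                    (\<forall>y. y \<noteq> w \<and> (y, w) \<in> bruhat_less n \<longrightarrow> c y \<in> A_neg) \<and>
                    (\<forall>y. y \<noteq> w \<and> (y, w) \<notin> bruhat_less n \<longrightarrow> c y = 0) \<and>
                    hbar n c = c)"

definition KL_coeff :: "nat \<Rightarrow> hecke \<Rightarrow> sperm \<Rightarrow> laurent" where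
  "KL_coeff n h = (THE c. (\<forall>z. z \<notin> W n \<longrightarrow> c z = 0) \<and>
                          h = (\<lambda>x. \<Sum>z \<in> W n. c z * KL n z x))"

definition left_le :: "nat \<Rightarrow> (sperm \<times> sperm) set" where
  "left_le n = {(z, y). z \<in> W n \<and> y \<in> W n \<and>
                        (\<exists>s \<in> gens n. KL_coeff n (hmult n (KL n s) (KL n y)) z \<noteq> 0)}\<^sup>*"

definition left_cell :: "nat \<Rightarrow> sperm \<Rightarrow> sperm set" where
  "left_cell n w = {z \<in> W n. (z, w) \<in> left_le n \<and> (w, z) \<in> left_le n}"


section \<open>Bipartitions and bitableaux\<close>

type_synonym bipartition = "nat list \<times> nat list"

definition is_partition :: "nat list \<Rightarrow> bool" where
  "is_partition mu \<longleftrightarrow> sorted_wrt (\<ge>) mu \<and> 0 \<notin> set mu"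

definition bipartitions :: "nat \<Rightarrow> bipartition set" where
  "bipartitions n = {(mu, nu). is_partition mu \<and> is_partition nu \<and> sum_list mu + sum_list nu = n}"

text \<open>The parts of the conjugate partition are the column lengths of the diagram.\<close>

definition conjugate :: "nat list \<Rightarrow> nat list" where
  "conjugate mu = map (\<lambda>j. length (filter (\<lambda>r. j < r) mu)) [0..<(if mu = [] then 0 else hd mu)]"

text \<open>A tableau is the list of its rows; entries are integers so that signed permutations
  can be applied to them.\<close>

type_synonym tableau = "int list list"
type_synonym bitableau = "tableau \<times> tableau"

definition bishape :: "bitableau \<Rightarrow> bipartition" where
  "bishape = map_prod (map length) (map length)"

definition is_standard :: "tableau \<Rightarrow> bool" where
  "is_standard t \<longleftrightarrow>
     (\<forall>row \<in> set t. sorted_wrt (<) row) \<and>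
     (\<forall>i j. Suc i < length t \<longrightarrow> j < length (t ! Suc i) \<longrightarrow> t ! i ! j < t ! Suc i ! j)"

definition std_bitableaux :: "nat \<Rightarrow> bipartition \<Rightarrow> bitableau set" where
  "std_bitableaux n la = {(t1, t2). bishape (t1, t2) = la \<and>
      distinct (concat t1 @ concat t2) \<and> set (concat t1 @ concat t2) = {1..int n} \<and>
      is_standard t1 \<and> is_standard t2}"

text \<open>\<^term>\<open>fill_rows k mu\<close> fills the rows of \<^term>\<open>mu\<close> in order with $k, k+1, \dots$\<close>

fun fill_rows :: "int \<Rightarrow> nat list \<Rightarrow> tableau" where
  "fill_rows k [] = []"
| "fill_rows k (r # rs) = [k..k + int r - 1] # fill_rows (k + int r) rs"

definition t_init :: "bipartition \<Rightarrow> bitableau" where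
  "t_init la = (fill_rows 1 (fst la), fill_rows (int (sum_list (fst la)) + 1) (snd la))"

definition act :: "sperm \<Rightarrow> bitableau \<Rightarrow> bitableau" where
  "act w = map_prod (map (map w)) (map (map w))"

definition d_elt :: "nat \<Rightarrow> bitableau \<Rightarrow> sperm" where
  "d_elt n t = (THE d. d \<in> Sym n \<and> act d (t_init (bishape t)) = t)"

definition row_stabilizer :: "nat \<Rightarrow> bipartition \<Rightarrow> sperm set" where
  "row_stabilizer n la = {w \<in> Sym n.
     \<forall>row \<in> set (fst (t_init la)) \<union> set (snd (t_init la)). w ` set row = set row}"

definition sigma_elt :: "nat \<Rightarrow> bipartition \<Rightarrow> sperm" where
  "sigma_elt n la = (ARG_MAX (len n) w. w \<in> row_stabilizer n la)"


section \<open>The generalized Robinson--Schensted correspondence\<close>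

text \<open>Row insertion returns the new row together with the entry that is bumped out of it,
  if there is one.\<close>

fun row_insert :: "int \<Rightarrow> int list \<Rightarrow> int list \<times> int option" where
  "row_insert x [] = ([x], None)"
| "row_insert x (y # ys) =
     (if x < y then (x # ys, Some y) else (let (r, b) = row_insert x ys in (y # r, b)))"

fun tab_insert :: "int \<Rightarrow> tableau \<Rightarrow> tableau" where
  "tab_insert x [] = [[x]]"
| "tab_insert x (r # rs) =
     (case row_insert x r of
        (r', None) \<Rightarrow> r' # rs
      | (r', Some y) \<Rightarrow> r' # tab_insert y rs)"

text \<open>\<^term>\<open>record_box i P Q\<close> puts \<^term>\<open>i\<close> into the box in which the shape of \<^term>\<open>P\<close>
  exceeds that of \<^term>\<open>Q\<close>.\<close>

fun record_box :: "int \<Rightarrow> tableau \<Rightarrow> tableau \<Rightarrow> tableau" where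
  "record_box i (p # ps) (q # qs) =
     (if length p = length q then q # record_box i ps qs else (q @ [i]) # qs)"
| "record_box i (p # ps) [] = [[i]]"
| "record_box i [] Q = Q"

text \<open>The input is a list of pairs consisting of a position and the value at this position.\<close>

definition rs :: "(int \<times> int) list \<Rightarrow> tableau \<times> tableau" where
  "rs xs = foldl (\<lambda>(P, Q) (i, x). let P' = tab_insert x P in (P', record_box i P' Q)) ([], []) xs"

definition pos_word :: "nat \<Rightarrow> sperm \<Rightarrow> (int \<times> int) list" where
  "pos_word n w = map (\<lambda>i. (i, w i)) (filter (\<lambda>i. 0 < w i) [1..int n])"

definition neg_word :: "nat \<Rightarrow> sperm \<Rightarrow> (int \<times> int) list" where
  "neg_word n w = map (\<lambda>i. (i, \<bar>w i\<bar>)) (filter (\<lambda>i. w i < 0) [1..int n])"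

definition RS_P :: "nat \<Rightarrow> sperm \<Rightarrow> bitableau" where
  "RS_P n w = (fst (rs (pos_word n w)), fst (rs (neg_word n w)))"

definition RS_Q :: "nat \<Rightarrow> sperm \<Rightarrow> bitableau" where
  "RS_Q n w = (snd (rs (pos_word n w)), snd (rs (neg_word n w)))"

text \<open>\<^term>\<open>RS_Q n\<close> is constant on left cells, which are non-empty.\<close>

definition cell_has_type :: "nat \<Rightarrow> sperm set \<Rightarrow> bipartition \<Rightarrow> bool" where
  "cell_has_type n C nu \<longleftrightarrow> (\<forall>x \<in> C. bishape (RS_Q n x) = nu)"

end

theory Submission imports Defs HOL.Modules begin

text \<open>The number of sign changes filters the Hecke algebra by left ideals spanned by Kazhdan--Lusztig elements, so the
  left cell of $\sigma_\lambda a_l$ is contained in $\mathfrak{S}_n a_l$. Right descents are constant on left cells, and the right star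
  operations map left cells to left cells. The descents force $d$ to increase along rows if $d \sigma_\lambda a_l$ is in the cell.
  If a column of $d$ decreased, star operations on the window of the two rows concerned would move the pair
  $\sigma_\lambda a_l$, $d \sigma_\lambda a_l$ to a pair whose common descent set bounds the length of a decreasing subsequence by the
  longer row, although the second element has a decreasing subsequence longer than that.

  Conversely, let $d$ be standard and $d = a u$ with $u \in \mathfrak{S}_l \times \mathfrak{S}_{n-l}$ and $a$ a minimal coset representative. A
  comparison of leading coefficients in $V$ shows $u \sigma_\lambda a_l \le_{\mathcal L} a u \sigma_\lambda a_l$, which reduces the claim to $d = u$. The row
  indices of $1, \dots, n$ in $u$ form a pair of lattice words. Lattice words of the same content are connected by the
  exchanges of $bac$ and $bca$ for $a \le b < c$, and each exchange is a Knuth move inside a left cell.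

  For the type, inserting the rows of the first tableau from the last to the first reproduces it, and inserting the
  reversed rows of the second tableau from the first to the last produces its transpose.\<close>

section \<open>Coxeter combinatorics of signed permutations: length, exchange, Bruhat order\<close>

section \<open>Signed permutations of finite support\<close>

text \<open>The decisive construction is
  \<open>CA (Suc m) = (tt 0 * Pm m + sc (vgi 0) (Qm m)) * CA m\<close>, modelled on a_(m+1) = t s_1
  ... s_m a_m: \<open>Qm m\<close> is the bar image of \<open>Pm m\<close>, and V^-1 times it is the
  term that restores bar invariance. The product C(\<sigma>) C(a_m) is then bar invariant, and it is
  the Kazhdan-Lusztig element of \<sigma> a_m because the remainder of \<open>CA m\<close> has
  negative V-degree, which factors from the symmetric group cannot raise. This is where the
  asymptotic order enters: a power of V outweighs all powers of v.

  The same order is an obstacle for the generator t. For s_i, structure constants are constant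
  terms, since v times a negative monomial is at most 1; for V this is false. The action of T_t is
  therefore computed on the elements T_\<sigma> C(a_m), which are only triangularly related to the
  Kazhdan-Lusztig basis.

  The bound on decreasing subsequences arises as follows: star operations sort the two rows into
  adjacent ascending pairs, as many as the shorter row permits, and a decreasing subsequence
  contains at most one member of each pair.\<close>

lemma W_mono: "m \<le> n ==> W m \<subseteq> W n"
  unfolding W_def by (auto intro: permutes_subset)

lemma W_comp: "x \<in> W n ==> y \<in> W n ==> x \<circ> y \<in> W n"
  unfolding W_def by (auto intro: permutes_compose)

lemma W_inv: assumes "x \<in> W n" shows "inv x \<in> W n"
proof -
  have p: "x permutes {i. 1 \<le> \<bar>i\<bar> \<and> \<bar>i\<bar> \<le> int n}" and m: "\<And>i. x (- i) = - x i"
    using assms by (auto simp: W_def)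
  have "inv x (- i) = - inv x i" for i
    by (metis m p permutes_inverses(1) permutes_inverses(2))
  then show ?thesis using p by (auto simp: W_def permutes_inv)
qed

text \<open>All groups \<^term>\<open>W n\<close> are embedded into one group, so that the group and its Hecke algebra can be types;
  \<open>Wn n\<close> below recovers the group of rank \<open>n\<close>.\<close>

typedef bperm = "\<Union>n. W n" morphisms bap Abs_bperm
  by (rule exI[of _ id]) (auto simp: W_def permutes_id)

notation bap (infixl "$" 90)

setup_lifting type_definition_bperm

instantiation bperm :: "{monoid_mult, inverse}"
begin
lift_definition one_bperm :: bperm is id by (auto simp: W_def permutes_id)
lift_definition times_bperm :: "bperm => bperm => bperm" is "(\<circ>)"
proof -
  fix x y :: sperm assume "x \<in> (\<Union>n. W n)" "y \<in> (\<Union>n. W n)"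
  then obtain m n where "x \<in> W m" "y \<in> W n" by auto
  then have "x \<in> W (max m n)" "y \<in> W (max m n)"
    using W_mono[of m "max m n"] W_mono[of n "max m n"] by auto
  then show "x \<circ> y \<in> (\<Union>n. W n)" using W_comp by blast
qed
lift_definition inverse_bperm :: "bperm => bperm" is inv using W_inv by auto
definition divide_bperm :: "bperm => bperm => bperm" where "divide_bperm x y = x * inverse y"
instance by standard (transfer; auto simp: fun_eq_iff)+
end

lemma bap_times [simp]: "(x * y) $ i = x $ (y $ i)"
  by transfer simp
lemma bap_one [simp]: "1 $ i = i"
  by transfer simp
lemma bap_inverse [simp]: "inverse x $ (x $ i) = i" "x $ (inverse x $ i) = i"
  by (transfer, auto simp: W_def permutes_inverses)+
lemma bap_minus [simp]: "x $ (- i) = - (x $ i)"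
  by transfer (auto simp: W_def)
lemma bap_zero [simp]: "x $ 0 = 0"
  using bap_minus[of x 0] by simp
lemma bap_eq [simp]: "x $ i = x $ j \<longleftrightarrow> i = j"
  by (metis bap_inverse(1))
lemma bap_eq_0 [simp]: "x $ i = 0 \<longleftrightarrow> i = 0"
  by (metis bap_eq bap_zero)
lemma bperm_eqI: "(\<And>i. x $ i = y $ i) ==> x = y"
  by (simp add: bap_inject[symmetric] fun_eq_iff)
lemma bperm_eqI_pos: "(\<And>i. i > 0 ==> x $ i = y $ i) ==> x = y"
proof (rule bperm_eqI)
  fix i assume *: "\<And>i. i > 0 ==> x $ i = y $ i"
  show "x $ i = y $ i"
    using *[of i] *[of "-i"] by (cases "i > 0"; cases "i = 0") auto
qed
lemma binv_left [simp]: "inverse x * x = (1::bperm)" and binv_right [simp]: "x * inverse x = (1::bperm)"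
  by (auto intro!: bperm_eqI)
lemma binv_left2 [simp]: "inverse x * (x * y) = (y::bperm)" and binv_right2 [simp]: "x * (inverse x * y) = (y::bperm)"
  by (auto intro!: bperm_eqI)
lemma binv_binv [simp]: "inverse (inverse x) = (x::bperm)"
  by (metis binv_left binv_left2 mult.right_neutral)
lemma binv_times [simp]: "inverse (x * y) = inverse y * inverse (x::bperm)"
  by (metis binv_left binv_right2 mult.assoc mult.right_neutral)
lemma binv_one [simp]: "inverse 1 = (1::bperm)"
  by (metis binv_left mult.right_neutral)
lemma bcancel [simp]: "x * y = x * z \<longleftrightarrow> y = (z::bperm)" "y * x = z * x \<longleftrightarrow> y = (z::bperm)"
   apply (metis binv_left2)
  by (metis binv_right mult.assoc mult.right_neutral)
lemma binv_bapI: "x $ i = j ==> inverse x $ j = i"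
  by auto

definition Wn :: "nat => bperm set" where "Wn n = {w. \<forall>i > int n. w $ i = i}"

lemma bap_Wn: "w \<in> Wn n \<longleftrightarrow> bap w \<in> W n"
proof
  assume "w \<in> Wn n"
  then have f: "w $ i = i" if "i > int n" for i using that by (auto simp: Wn_def)
  have f': "w $ i = i" if "\<bar>i\<bar> > int n" for i
    using f[of i] f[of "-i"] that by (cases "i > 0") auto
  have "bap w permutes {i. 1 \<le> \<bar>i\<bar> \<and> \<bar>i\<bar> \<le> int n}"
  proof -
    have bij: "bij (bap w)" by (rule bijI') (auto intro: bap_inverse(2)[symmetric])
    have "w $ i = i" if "i \<notin> {i. 1 \<le> \<bar>i\<bar> \<and> \<bar>i\<bar> \<le> int n}" for i
      using that f'[of i] by (cases "i = 0") auto
    then show ?thesis using bij by (auto simp: permutes_def bij_iff)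
  qed
  then show "bap w \<in> W n" by (auto simp: W_def)
next
  assume "bap w \<in> W n"
  then show "w \<in> Wn n" by (auto simp: W_def Wn_def permutes_not_in)
qed

lemma bap_image_Wn: "bap ` Wn n = W n"
proof -
  have "\<exists>y. w = bap y" if "w \<in> W n" for w
    using that by (metis Abs_bperm_inverse UN_I UNIV_I)
  then show ?thesis using bap_Wn by (auto simp: image_iff) (metis bap_Wn)
qed

lemma Wn_fix: "w \<in> Wn n ==> i > int n ==> w $ i = i" by (auto simp: Wn_def)
lemma Wn_one [simp]: "1 \<in> Wn n" by (auto simp: Wn_def)
lemma Wn_times [intro]: "x \<in> Wn n ==> y \<in> Wn n ==> x * y \<in> Wn n" by (auto simp: Wn_def)
lemma Wn_inverse [simp]: "inverse x \<in> Wn n \<longleftrightarrow> x \<in> Wn n"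
proof -
  have "inverse x \<in> Wn n" if "x \<in> Wn n" for x
    using that unfolding Wn_def by (auto intro: binv_bapI)
  from this[of x] this[of "inverse x"] show ?thesis by auto
qed
lemma Wn_ex: "\<exists>n. w \<in> Wn n"
  using bap[of w] by (auto simp: bap_Wn)
lemma Wn_mono: "m \<le> n ==> w \<in> Wn m ==> w \<in> Wn n" by (auto simp: Wn_def)
lemma Wn_abs: assumes "w \<in> Wn n" "\<bar>i\<bar> \<le> int n" shows "\<bar>w $ i\<bar> \<le> int n"
proof (rule ccontr)
  assume "\<not> ?thesis"
  then have a: "\<bar>w $ i\<bar> > int n" by simp
  have "w $ j = j" if "\<bar>j\<bar> > int n" for j
    using that Wn_fix[OF assms(1), of j] Wn_fix[OF assms(1), of "-j"] by (cases "j > 0") auto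
  from this[OF a] have "w $ i = i" by simp
  with a assms(2) show False by simp
qed
lemma finite_Wn [simp]: "finite (Wn n)"
proof -
  have "finite {p. p permutes {i. 1 \<le> \<bar>i\<bar> \<and> \<bar>i\<bar> \<le> int n}}"
  proof (rule finite_permutations)
    show "finite {i. 1 \<le> \<bar>i\<bar> \<and> \<bar>i\<bar> \<le> int n}"
      by (rule finite_subset[of _ "{-int n..int n}"]) auto
  qed
  then have "finite (W n)" by (rule rev_finite_subset) (auto simp: W_def)
  then have "finite (bap ` Wn n)" by (simp add: bap_image_Wn)
  then show ?thesis by (rule finite_imageD) (auto simp: inj_on_def bap_inject)
qed

text \<open>Index 0 stands for t, so that the generators of rank n are exactly the
  \<open>gen i\<close> with \<open>i < n\<close> and can be treated uniformly.\<close>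

definition gen_fun :: "nat => sperm" where
  "gen_fun i = (if i = 0 then gen_t else gen_s i)"

lemma gen_fun_apply:
  "gen_fun i k = (if i = 0 then (if \<bar>k\<bar> = 1 then - k else k)
     else if k = int i then int i + 1 else if k = int i + 1 then int i
     else if k = - int i then - int i - 1 else if k = - int i - 1 then - int i else k)"
  by (auto simp: gen_fun_def gen_t_def gen_s_def transpose_def)

lemma gen_fun_W: "i < n ==> gen_fun i \<in> W n"
proof -
  assume "i < n"
  have inv: "gen_fun i (gen_fun i k) = k" for k by (auto simp: gen_fun_apply)
  have "gen_fun i permutes {i. 1 \<le> \<bar>i\<bar> \<and> \<bar>i\<bar> \<le> int n}"
    unfolding permutes_def
  proof (intro conjI allI impI)
    fix y
    show "\<exists>!x. gen_fun i x = y"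
    proof (rule ex1I)
      show "gen_fun i (gen_fun i y) = y" by (rule inv)
      show "x = gen_fun i y" if "gen_fun i x = y" for x using inv[of x] unfolding that by (rule sym)
    qed
  next
    fix x assume "x \<notin> {i. 1 \<le> \<bar>i\<bar> \<and> \<bar>i\<bar> \<le> int n}"
    then have "x = 0 \<or> x > int n \<or> x < - int n" by auto
    then show "gen_fun i x = x" using \<open>i < n\<close> by (auto simp: gen_fun_apply)
  qed
  then show ?thesis by (auto simp: W_def gen_fun_apply)
qed

lift_definition gen :: "nat => bperm" is gen_fun
  using gen_fun_W by blast

lemma gen_apply:
  "gen i $ k = (if i = 0 then (if \<bar>k\<bar> = 1 then - k else k)
     else if k = int i then int i + 1 else if k = int i + 1 then int i
     else if k = - int i then - int i - 1 else if k = - int i - 1 then - int i else k)"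
  by transfer (rule gen_fun_apply)

lemma gen_gen [simp]: "gen i * gen i = 1" "gen i * (gen i * w) = w"
  by (auto intro!: bperm_eqI simp: gen_apply)
lemma gen_gen_r [simp]: "w * gen i * gen i = w"
  by (simp add: mult.assoc)
lemma gen_gen_app [simp]: "gen i $ (gen i $ k) = k"
  by (auto simp: gen_apply)
lemma inverse_gen [simp]: "inverse (gen i) = gen i"
  by (metis binv_left2 gen_gen(1) mult.right_neutral)
lemma gen_Wn [simp]: "gen i \<in> Wn n \<longleftrightarrow> i < n"
proof
  assume "gen i \<in> Wn n"
  then have *: "gen i $ (int i + 1) = int i + 1" if "i \<ge> n" using that by (auto simp: Wn_def)
  then show "i < n" by (rule_tac ccontr) (auto simp: gen_apply split: if_splits)
qed (auto simp: Wn_def gen_apply)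
lemma gen_inj: assumes "gen i = gen j" shows "i = j"
proof -
  have "i < Suc j" "j < Suc i"
    using gen_Wn[of j "Suc j"] gen_Wn[of i "Suc i"] gen_Wn[of i "Suc j"] gen_Wn[of j "Suc i"] assms by (auto simp del: gen_Wn)
  then show ?thesis by simp
qed
lemma gen_eq_iff [simp]: "gen i = gen j \<longleftrightarrow> i = j" using gen_inj by auto

text \<open>A generator \<open>s\<close> is a left descent of \<open>w\<close> iff the inverse of \<open>w\<close> reverses the order of the following two
  points, a right descent iff \<open>w\<close> does.\<close>

definition ra :: "nat => int" where "ra i = (if i = 0 then -1 else int i)"
definition rb :: "nat => int" where "rb i = int i + 1"

text \<open>A simple reflection makes only its own positive root negative: among pairs of nonzero
  points, only its own pair and the negated pair change order. Descents, inversions and the exchange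
  property all rest on this.\<close>

lemma gen_flip: "a < b ==> a \<noteq> 0 ==> b \<noteq> 0 ==> gen i $ b < gen i $ a ==> (a = ra i \<and> b = rb i) \<or> (a = - rb i \<and> b = - ra i) "
  by (auto simp: gen_apply ra_def rb_def split: if_splits)
lemma gen_ra [simp]: "gen i $ ra i = rb i" "gen i $ rb i = ra i"
  by (auto simp: gen_apply ra_def rb_def)
lemma ra_less_rb [simp]: "ra i < rb i" by (auto simp: ra_def rb_def)
lemma ra_ne_rb [simp]: "ra i \<noteq> rb i" "rb i \<noteq> ra i" by (auto simp: ra_def rb_def)
lemma ra_rb_le [simp]: "\<not> rb i \<le> ra i" "\<not> rb i < ra i" by (auto simp: ra_def rb_def)
lemma ra_nz [simp]: "ra i \<noteq> 0" "rb i \<noteq> 0" "rb i > 0" by (auto simp: ra_def rb_def)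

section \<open>The length function\<close>

text \<open>A pair \<open>(a, b)\<close> and its negative \<open>(- b, - a)\<close> give the same inversion; \<open>Phi\<close> contains one of the two.\<close>

definition Phi :: "(int \<times> int) set" where "Phi = {(a, b). a \<noteq> 0 \<and> \<bar>a\<bar> \<le> b \<and> a < b}"
definition Ninv :: "bperm => (int \<times> int) set" where
  "Ninv w = {(a, b) \<in> Phi. inverse w $ b < inverse w $ a}"
definition ell :: "bperm => nat" where "ell w = card (Ninv w)"
definition can :: "int \<times> int => int \<times> int" where
  "can p = (if \<bar>fst p\<bar> \<le> snd p then p else (- snd p, - fst p))"

lemma finite_Ninv [simp]: "finite (Ninv w)"
proof -
  obtain n where n: "inverse w \<in> Wn n" using Wn_ex by blast
  have "Ninv w \<subseteq> {-int n..int n} \<times> {-int n..int n}"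
  proof clarify
    fix a b assume "(a, b) \<in> Ninv w"
    then have ab: "a \<noteq> 0" "\<bar>a\<bar> \<le> b" "a < b" and i: "inverse w $ b < inverse w $ a"
      by (auto simp: Ninv_def Phi_def)
    have "b \<le> int n"
    proof (rule ccontr)
      assume "\<not> b \<le> int n"
      then have bb: "inverse w $ b = b" using Wn_fix[OF n] by auto
      have "inverse w \<in> Wn (nat b)" using n \<open>\<not> b \<le> int n\<close> Wn_mono by (metis linorder_not_le nat_int nat_le_linear nat_mono order.strict_implies_order)
      then have "\<bar>inverse w $ a\<bar> \<le> b" using Wn_abs[of "inverse w" "nat b" a] ab(2,3) by (cases "b \<ge> 0") auto
      then show False using i bb by auto
    qed
    then show "a \<in> {-int n..int n} \<and> b \<in> {-int n..int n}" using ab by auto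
  qed
  then show ?thesis by (rule finite_subset) auto
qed

lemma root_in_Phi: "(ra i, rb i) \<in> Phi" by (auto simp: Phi_def ra_def rb_def)

lemma can_Ninv: "a < b ==> a \<noteq> 0 ==> b \<noteq> 0 ==> inverse w $ b < inverse w $ a ==> can (a, b) \<in> Ninv w"
  by (auto simp: can_def Ninv_def Phi_def)

text \<open>A simple reflection permutes the positive roots other than its own. The image pair may
  be the wrong one of two opposite pairs, and \<open>can\<close> returns to the representative in
  \<open>Phi\<close>.\<close>

lemma Ninv_step:
  assumes "(a, b) \<in> Ninv w" "(a, b) \<noteq> (ra i, rb i)"
  shows "can (gen i $ a, gen i $ b) \<in> Ninv (gen i * w) - {(ra i, rb i)}"
proof -
  have ab: "a \<noteq> 0" "\<bar>a\<bar> \<le> b" "a < b" "inverse w $ b < inverse w $ a" using assms by (auto simp: Ninv_def Phi_def)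
  have b0: "b > 0" using ab by linarith
  have "gen i $ a \<noteq> gen i $ b" using ab by simp
  moreover have "\<not> gen i $ b < gen i $ a"
    using gen_flip[of a b i] assms(2) ab b0 by (cases "i = 0") (auto simp: ra_def rb_def)
  ultimately have l: "gen i $ a < gen i $ b" by linarith
  have "can (gen i $ a, gen i $ b) \<in> Ninv (gen i * w)"
    by (rule can_Ninv) (use l ab b0 in auto)
  moreover have "can (gen i $ a, gen i $ b) \<noteq> (ra i, rb i)"
  proof
    assume c: "can (gen i $ a, gen i $ b) = (ra i, rb i)"
    have "gen i $ ra i = rb i" "gen i $ rb i = ra i" by simp_all
    then have "(a = rb i \<and> b = ra i) \<or> (a = - ra i \<and> b = - rb i)" using c
      by (auto simp: can_def split: if_splits) (metis bap_minus gen_gen_app gen_ra minus_minus)+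
    then show False using ab ra_less_rb[of i] ra_nz(3)[of i] by linarith
  qed
  ultimately show ?thesis by auto
qed

lemma card_Ninv_step: "card (Ninv (gen i * w) - {(ra i, rb i)}) = card (Ninv w - {(ra i, rb i)})"
proof -
  let ?f = "\<lambda>p. can (gen i $ fst p, gen i $ snd p)"
  have inv: "?f (?f p) = p" if "p \<in> Phi" for p
  proof -
    obtain a b where p: "p = (a, b)" by fastforce
    then have "\<bar>a\<bar> \<le> b" using that by (simp add: Phi_def)
    note p = p this
    show ?thesis
    proof (cases "\<bar>gen i $ a\<bar> \<le> gen i $ b")
      case True then show ?thesis using p by (simp add: can_def)
    next
      case False then show ?thesis using p by (auto simp: can_def)
    qed
  qed
  have "bij_betw ?f (Ninv w - {(ra i, rb i)}) (Ninv (gen i * w) - {(ra i, rb i)})"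
  proof (rule bij_betw_byWitness[where f' = ?f])
    show "\<forall>p\<in>Ninv w - {(ra i, rb i)}. ?f (?f p) = p"
      using inv by (auto simp: Ninv_def)
    show "\<forall>p\<in>Ninv (gen i * w) - {(ra i, rb i)}. ?f (?f p) = p"
      using inv by (auto simp: Ninv_def)
    show "?f ` (Ninv w - {(ra i, rb i)}) \<subseteq> Ninv (gen i * w) - {(ra i, rb i)}"
      using Ninv_step by (intro image_subsetI) (metis DiffE fst_conv insertCI snd_conv surj_pair)
    show "?f ` (Ninv (gen i * w) - {(ra i, rb i)}) \<subseteq> Ninv w - {(ra i, rb i)}"
      using Ninv_step[of _ _ "gen i * w" i]
      by (intro image_subsetI) (metis DiffE fst_conv gen_gen(2) insertCI snd_conv surj_pair)
  qed
  then show ?thesis by (simp add: bij_betw_same_card)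
qed

lemma root_Ninv: "(ra i, rb i) \<in> Ninv w \<longleftrightarrow> inverse w $ rb i < inverse w $ ra i"
  using root_in_Phi by (auto simp: Ninv_def)

lemma ell_gen_left:
  "ell (gen i * w) = (if inverse w $ rb i < inverse w $ ra i then ell w - 1 else Suc (ell w))"
  "inverse w $ rb i < inverse w $ ra i ==> ell w > 0"
proof -
  let ?r = "(ra i, rb i)"
  have a: "?r \<in> Ninv w \<longleftrightarrow> inverse w $ rb i < inverse w $ ra i" by (rule root_Ninv)
  have "inverse w $ rb i \<noteq> inverse w $ ra i" by simp
  then have b: "?r \<in> Ninv (gen i * w) \<longleftrightarrow> \<not> inverse w $ rb i < inverse w $ ra i"
    unfolding root_Ninv binv_times bap_times inverse_gen gen_ra by linarith
  show "inverse w $ rb i < inverse w $ ra i ==> ell w > 0"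
    using a by (auto simp: ell_def card_gt_0_iff)
  show "ell (gen i * w) = (if inverse w $ rb i < inverse w $ ra i then ell w - 1 else Suc (ell w))"
  proof (cases "inverse w $ rb i < inverse w $ ra i")
    case True
    then have "?r \<in> Ninv w" "?r \<notin> Ninv (gen i * w)" using a b by auto
    then have "Ninv (gen i * w) - {?r} = Ninv (gen i * w)" "card (Ninv w - {?r}) = card (Ninv w) - 1" by auto
    then show ?thesis using card_Ninv_step[of i w] True unfolding ell_def by simp
  next
    case False
    then have "?r \<notin> Ninv w" "?r \<in> Ninv (gen i * w)" using a b by auto
    then have "Ninv w - {?r} = Ninv w" "card (Ninv (gen i * w)) = Suc (card (Ninv (gen i * w) - {?r}))"
      using card_Suc_Diff1[OF finite_Ninv] by auto
    then show ?thesis using card_Ninv_step[of i w] False unfolding ell_def by simp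
  qed
qed

lemma ell_less_left: "ell (gen i * w) < ell w \<longleftrightarrow> inverse w $ rb i < inverse w $ ra i"
  using ell_gen_left[where i=i and w=w] by (auto split: if_splits)

lemma ell_left_cases: "ell (gen i * w) = Suc (ell w) \<or> ell w = Suc (ell (gen i * w))"
  using ell_gen_left[where i=i and w=w] by (auto split: if_splits)

lemma ell_one [simp]: "ell 1 = 0"
  by (auto simp: ell_def Ninv_def card_eq_0_iff Phi_def)

text \<open>The hypothesis extends to all i because w fixes the points beyond n. Then w is positive
  and strictly increasing on 1, 2, ..., so its value at k is at least k; counting down from the
  fixed point n + 1 gives the reverse inequality.\<close>

lemma increasing_imp_id:
  assumes "w \<in> Wn n" "\<And>i. i < n ==> w $ ra i < w $ rb i"
  shows "w = 1"
proof -
  have step: "w $ ra i < w $ rb i" for i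
  proof (cases "i < n")
    case False
    then have "w \<in> Wn i" using assms(1) Wn_mono by (metis not_less)
    then have "w $ rb i = rb i" "\<bar>ra i\<bar> \<le> int i ==> \<bar>w $ ra i\<bar> \<le> int i"
      by (auto simp: rb_def Wn_fix intro: Wn_abs)
    then show ?thesis using Wn_fix[OF assms(1), of 1] False by (cases "i = 0") (auto simp: ra_def rb_def)
  qed (use assms in auto)
  have pos: "w $ 1 > 0" using step[of 0] by (auto simp: ra_def rb_def)
  have mono: "w $ i < w $ (i + 1)" if "i > 0" for i
    using step[of "nat i"] that by (auto simp: ra_def rb_def)
  have ge: "w $ int (Suc k) \<ge> int (Suc k)" for k
  proof (induction k)
    case (Suc k) then show ?case using mono[of "int (Suc k)"] by (simp add: algebra_simps)
  qed (use pos in simp)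
  have le: "w $ int k \<le> int k" if "k \<ge> 1" "k \<le> n + 1" for k
    using that(2,1)
  proof (induction k rule: inc_induct)
    case base then show ?case using Wn_fix[OF assms(1), of "int n + 1"] by (simp add: algebra_simps)
  next
    case (step k) then show ?case using mono[of "int k"] by (simp add: algebra_simps)
  qed
  show ?thesis
  proof (rule bperm_eqI_pos)
    fix i :: int assume "i > 0"
    show "w $ i = 1 $ i"
    proof (cases "i > int n")
      case False
      then show ?thesis using ge[of "nat i - 1"] le[of "nat i"] \<open>i > 0\<close> by auto
    qed (use Wn_fix assms in auto)
  qed
qed

text \<open>Only the identity preserves the order of all simple pairs. Hence the number of
  inversions can be lowered one by one to 0, which makes it the word length.\<close>

lemma ex_left_descent: assumes "w \<in> Wn n" "w \<noteq> 1" shows "\<exists>i<n. ell w = Suc (ell (gen i * w))"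
proof (rule ccontr)
  assume "\<not> ?thesis"
  then have "\<not> ell (gen i * w) < ell w" if "i < n" for i using that ell_left_cases by (metis less_Suc_eq less_asym)
  then have "inverse w $ ra i \<le> inverse w $ rb i" if "i < n" for i using that by (auto simp: ell_less_left not_less)
  moreover have "inverse w $ ra i \<noteq> inverse w $ rb i" for i by simp
  ultimately have "inverse w $ ra i < inverse w $ rb i" if "i < n" for i using that by (simp add: order_less_le)
  then have "inverse w = 1" using increasing_imp_id[of "inverse w" n] assms by auto
  then show False using assms by (metis binv_binv binv_one)
qed

lemma ell_0_iff [simp]: "ell w = 0 \<longleftrightarrow> w = 1"
  using ex_left_descent Wn_ex by (metis ell_one nat.distinct(1))

lemma ell_induct [case_names one step]:
  assumes "P 1" "\<And>i w. ell (gen i * w) = Suc (ell w) ==> P w ==> P (gen i * w)"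
  shows "P w"
proof (induction "ell w" arbitrary: w)
  case 0 then show ?case using assms(1) by simp
next
  case (Suc k)
  then have "w \<noteq> 1" by auto
  then obtain i where i: "ell w = Suc (ell (gen i * w))" using ex_left_descent Wn_ex by metis
  then have "P (gen i * w)" using Suc by simp
  then show ?case using assms(2)[of i "gen i * w"] i by simp
qed

lemma ell_Wn_induct [consumes 1, case_names one step]:
  assumes "w \<in> Wn n" "P 1"
    "\<And>i w. i < n ==> w \<in> Wn n ==> ell (gen i * w) = Suc (ell w) ==> P w ==> P (gen i * w)"
  shows "P w"
  using assms(1)
proof (induction "ell w" arbitrary: w)
  case 0 then show ?case using assms(2) by simp
next
  case (Suc k)
  then have "w \<noteq> 1" by auto
  then obtain i where i: "i < n" "ell w = Suc (ell (gen i * w))" using ex_left_descent Suc by metis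
  then have w: "gen i * w \<in> Wn n" using Suc by auto
  then have "P (gen i * w)" using Suc i by simp
  then show ?case using assms(3)[of i "gen i * w"] i w by simp
qed

definition wprod :: "nat list => bperm" where "wprod is = foldr (\<lambda>i. (*) (gen i)) is 1"
lemma wprod_simps [simp]: "wprod [] = 1" "wprod (i # is) = gen i * wprod is" by (auto simp: wprod_def)
lemma wprod_append: "wprod (is @ js) = wprod is * wprod js" by (induction "is") (auto simp: mult.assoc)
lemma wprod_rev: "wprod (rev is) = inverse (wprod is)" by (induction "is") (auto simp: wprod_append)
lemma ell_wprod: "ell (wprod is) \<le> length is"
proof (induction "is")
  case (Cons i "is") then show ?case using ell_left_cases[of i "wprod is"] by auto
qed auto
lemma wprod_ex: "w \<in> Wn n ==> \<exists>is. set is \<subseteq> {..<n} \<and> length is = ell w \<and> wprod is = w"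
proof (induction rule: ell_Wn_induct)
  case (step i w)
  then obtain "is" where "set is \<subseteq> {..<n} \<and> length is = ell w \<and> wprod is = w" by auto
  then show ?case using step by (intro exI[of _ "i # is"]) auto
qed auto

lemma ell_inverse [simp]: "ell (inverse w) = ell w"
proof -
  have "ell (inverse w) \<le> ell w" for w
    using Wn_ex wprod_ex ell_wprod wprod_rev by (metis length_rev)
  from this[of w] this[of "inverse w"] show ?thesis by simp
qed

lemma ell_gen_right_inv: "ell (w * gen i) = ell (gen i * inverse w)"
  using ell_inverse[of "w * gen i"] by simp
lemma ell_less_right: "ell (w * gen i) < ell w \<longleftrightarrow> w $ rb i < w $ ra i"
  using ell_less_left[of i "inverse w"] by (simp add: ell_gen_right_inv)
lemma ell_right_cases: "ell (w * gen i) = Suc (ell w) \<or> ell w = Suc (ell (w * gen i))"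
  using ell_left_cases[of i "inverse w"] by (simp add: ell_gen_right_inv)
lemma ell_gen [simp]: "ell (gen i) = 1"
  using ell_left_cases[of i 1] by auto

lemma ell_times_le: "ell (x * y) \<le> ell x + ell y"
proof (induction x rule: ell_induct)
  case (step i w) then show ?case using ell_left_cases[of i "w * y"] by (auto simp: mult.assoc)
qed auto

text \<open>No inversion of y is undone by x. Induction moves one left generator of y over to x; by
  \<open>gen_flip\<close> the hypothesis survives, the only critical pair being that of the
  generator.\<close>

lemma ell_add:
  assumes "\<And>a b. a < b ==> a \<noteq> 0 ==> b \<noteq> 0 ==> inverse y $ b < inverse y $ a ==> x $ a < x $ b"
  shows "ell (x * y) = ell x + ell y"
  using assms
proof (induction y arbitrary: x rule: ell_induct)
  case (step i y)
  have d: "inverse (gen i * y) $ rb i < inverse (gen i * y) $ ra i"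
    using step.hyps ell_less_left[of i "gen i * y"] by simp
  then have "x $ ra i < x $ rb i" using step.prems[of "ra i" "rb i"] by simp
  then have l: "ell (x * gen i) = Suc (ell x)" using ell_less_right[of x i] ell_right_cases[of x i] by auto
  have "ell ((x * gen i) * y) = ell (x * gen i) + ell y"
  proof (rule step.IH)
    fix a b :: int assume ab: "a < b" "inverse y $ b < inverse y $ a" "a \<noteq> 0" "b \<noteq> 0"
    show "(x * gen i) $ a < (x * gen i) $ b"
    proof (cases "gen i $ a < gen i $ b")
      case True then show ?thesis using step.prems[of "gen i $ a" "gen i $ b"] ab by simp
    next
      case False
      moreover have "gen i $ b \<noteq> gen i $ a" using ab by simp
      ultimately have "gen i $ b < gen i $ a" by linarith
      then have "inverse y $ rb i < inverse y $ ra i"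
        using gen_flip[OF ab(1,3,4), of i] ab(2) by auto
      then show ?thesis using d by simp
    qed
  qed
  then show ?case using l step.hyps by (simp add: mult.assoc)
qed auto

section \<open>Reflections and exchange\<close>

text \<open>If \<open>gen j\<close> reverses the image of the pair of i under the inverse of w, then
  by \<open>gen_flip\<close> this image is the pair of j up to sign and order, so w conjugates one
  reflection into the other.\<close>

lemma flip_conj:
  assumes "(inverse w $ rb i < inverse w $ ra i) \<noteq> (gen j $ (inverse w $ rb i) < gen j $ (inverse w $ ra i))"
  shows "gen i * w = w * gen j"
proof -
  have n: "ra i \<noteq> rb i" by simp
  have nz: "inverse w $ ra i \<noteq> 0" "inverse w $ rb i \<noteq> 0" by simp_all
  have c: "(inverse w $ ra i = ra j \<and> inverse w $ rb i = rb j) \<or> (inverse w $ ra i = - rb j \<and> inverse w $ rb i = - ra j) \<or>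
     (inverse w $ ra i = rb j \<and> inverse w $ rb i = ra j) \<or> (inverse w $ ra i = - ra j \<and> inverse w $ rb i = - rb j)"
  proof (cases "inverse w $ ra i < inverse w $ rb i")
    case True
    then have "gen j $ (inverse w $ rb i) < gen j $ (inverse w $ ra i)" using assms by auto
    from gen_flip[OF True nz this] show ?thesis by blast
  next
    case False
    moreover have "inverse w $ ra i \<noteq> inverse w $ rb i" using n by simp
    ultimately have l: "inverse w $ rb i < inverse w $ ra i" by linarith
    have "gen j $ (inverse w $ ra i) \<noteq> gen j $ (inverse w $ rb i)" using n by simp
    then have "gen j $ (inverse w $ ra i) < gen j $ (inverse w $ rb i)" using assms l by linarith
    from gen_flip[OF l nz(2,1) this] show ?thesis by blast
  qed
  then have c': "(ra i = w $ ra j \<and> rb i = w $ rb j) \<or> (ra i = - (w $ rb j) \<and> rb i = - (w $ ra j)) \<or>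
     (ra i = w $ rb j \<and> rb i = w $ ra j) \<or> (ra i = - (w $ ra j) \<and> rb i = - (w $ rb j))"
    by (metis bap_inverse(2) bap_minus)
  have gi: "gen i $ k = (if k = ra i then rb i else if k = rb i then ra i else if k = - ra i then - rb i else if k = - rb i then - ra i else k)" for i k
    by (auto simp: gen_apply ra_def rb_def)
  have ne: "w $ k = - (w $ l) \<longleftrightarrow> k = - l" "- (w $ l) = w $ k \<longleftrightarrow> k = - l" for k l
    by (metis bap_eq bap_minus)+
  show ?thesis
  proof (rule bperm_eqI)
    fix k
    have nz: "ra j \<noteq> - ra j" "rb j \<noteq> - rb j" using ra_nz[of j] by linarith+
    show "(gen i * w) $ k = (w * gen j) $ k"
      using c'
    proof (elim disjE conjE)
      assume "ra i = w $ ra j" "rb i = w $ rb j"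
      then show ?thesis unfolding bap_times gi[of i "w $ k"] gi[of j k] by (simp add: ne)
    next
      assume *: "ra i = - (w $ rb j)" "rb i = - (w $ ra j)"
      consider "k = ra j" | "k = rb j" | "k = - ra j" | "k = - rb j"
        | "k \<noteq> ra j" "k \<noteq> rb j" "k \<noteq> - ra j" "k \<noteq> - rb j" by blast
      then show ?thesis using * unfolding bap_times gi[of i "w $ k"] gi[of j k] by cases (auto simp: ne nz)
    next
      assume *: "ra i = w $ rb j" "rb i = w $ ra j"
      consider "k = ra j" | "k = rb j" | "k = - ra j" | "k = - rb j"
        | "k \<noteq> ra j" "k \<noteq> rb j" "k \<noteq> - ra j" "k \<noteq> - rb j" by blast
      then show ?thesis using * unfolding bap_times gi[of i "w $ k"] gi[of j k] by cases (auto simp: ne nz)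
    next
      assume *: "ra i = - (w $ ra j)" "rb i = - (w $ rb j)"
      consider "k = ra j" | "k = rb j" | "k = - ra j" | "k = - rb j"
        | "k \<noteq> ra j" "k \<noteq> rb j" "k \<noteq> - ra j" "k \<noteq> - rb j" by blast
      then show ?thesis using * unfolding bap_times gi[of i "w $ k"] gi[of j k] by cases (auto simp: ne nz)
    qed
  qed
qed

text \<open>A right factor can change whether i is a left descent only if left and right
  multiplication coincide. This isolates the one exceptional case in the proof that
  \<open>lam\<close> and \<open>rho\<close> commute.\<close>

lemma exchange_comm:
  assumes "(ell (gen i * w) < ell w) \<noteq> (ell (gen i * (w * gen j)) < ell (w * gen j))"
  shows "gen i * w = w * gen j"
  using assms by (intro flip_conj) (auto simp: ell_less_left)

lemma exchange_comm':
  assumes "(ell (w * gen j) < ell w) \<noteq> (ell (gen i * (w * gen j)) < ell (gen i * w))"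
  shows "gen i * w = w * gen j"
proof -
  have "(ell (gen j * inverse w) < ell (inverse w)) \<noteq> (ell (gen j * (inverse w * gen i)) < ell (inverse w * gen i))"
    using assms ell_inverse[of "w * gen j"] ell_inverse[of "gen i * (w * gen j)"] ell_inverse[of "gen i * w"]
    by (simp add: mult.assoc)
  from exchange_comm[OF this] have "inverse (gen j * inverse w) = inverse (inverse w * gen i)" by simp
  then show ?thesis by simp
qed

text \<open>If t were conjugate by w to \<open>gen k\<close> with k > 0, the values of w at k and k
  + 1 would agree up to sign, which is impossible. Conjugate generators therefore have the same
  parameter.\<close>

lemma gen_conj_0: assumes "gen i * w = w * gen j" shows "i = 0 \<longleftrightarrow> j = 0"
proof -
  have neg: "w $ 1 = - 1 \<or> w $ 1 = 1" if "gen 0 * w = w * gen k" "k \<noteq> 0" for w k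
  proof -
    have "gen 0 $ (w $ int k) = w $ (int k + 1)" using arg_cong[OF that(1), of "\<lambda>u. u $ int k"] that(2) by (simp add: gen_apply)
    then have "w $ (int k + 1) = - (w $ int k) \<or> w $ (int k + 1) = w $ int k" by (auto simp: gen_apply split: if_splits)
    then show ?thesis using that(2) by (auto simp flip: bap_minus)
  qed
  have "False" if "gen 0 * w = w * gen k" "k \<noteq> 0" for w k
  proof -
    have "gen 0 $ (w $ int k) = w $ (int k + 1)" using arg_cong[OF that(1), of "\<lambda>u. u $ int k"] that(2) by (simp add: gen_apply)
    then have "w $ (int k + 1) = - (w $ int k) \<or> w $ (int k + 1) = w $ int k" by (auto simp: gen_apply split: if_splits)
    then show ?thesis using that(2) by (auto simp flip: bap_minus)
  qed
  note nf = this
  show ?thesis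
  proof
    assume "i = 0" then show "j = 0" using nf[of w j] assms by auto
  next
    assume "j = 0"
    then have "gen 0 * inverse w = inverse w * gen i" using assms
      by (metis binv_left2 binv_right mult.assoc mult.right_neutral)
    then show "i = 0" using nf[of "inverse w" i] by auto
  qed
qed

text \<open>The inverse of w changes the order of the two points interchanged by the reflection x
  s_k x^-1; in other words, this reflection is an inversion of w.\<close>

definition flips :: "bperm => bperm => nat => bool" where
  "flips x w k \<longleftrightarrow> (x $ ra k < x $ rb k) \<noteq> ((inverse w * x) $ ra k < (inverse w * x) $ rb k)"

lemma less_flip: "x $ rb k < x $ ra k \<longleftrightarrow> \<not> x $ ra k < x $ rb k"
proof -
  have "x $ rb k \<noteq> x $ ra k" by simp
  then show ?thesis by linarith
qed

lemma gen_flip_conj: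
  assumes "(x $ ra k < x $ rb k) \<noteq> ((gen j * x) $ ra k < (gen j * x) $ rb k)"
  shows "x * gen k * inverse x = gen j"
proof -
  have "gen k * inverse x = inverse x * gen j"
    by (rule flip_conj) (use assms less_flip[of x k] less_flip[of "gen j * x" k] in auto)
  then show ?thesis by (simp add: mult.assoc)
qed

text \<open>Strong exchange. Strip a left generator j from w: either the pair is still reversed by
  the rest, and induction applies to the conjugated reflection, or the reversal happens at this
  generator, and then the reflection is \<open>gen j\<close> itself.\<close>

lemma flips_ell_less: "flips x w k ==> ell (x * gen k * inverse x * w) < ell w"
proof (induction w arbitrary: x rule: ell_induct)
  case one then show ?case by (simp add: flips_def)
next
  case (step j w)
  show ?case
  proof (cases "(x $ ra k < x $ rb k) = ((gen j * x) $ ra k < (gen j * x) $ rb k)")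
    case True
    then have "flips (gen j * x) w k" using step.prems by (simp add: flips_def mult.assoc)
    from step.IH[OF this] have "ell (gen j * (x * gen k * inverse x * (gen j * w))) < ell w"
      by (simp add: mult.assoc)
    then show ?thesis using ell_left_cases[of j "x * gen k * inverse x * (gen j * w)"] step.hyps by auto
  next
    case False
    then have "x * gen k * inverse x = gen j" by (rule gen_flip_conj)
    then show ?thesis using step.hyps by simp
  qed
qed

lemma refl_ell_less: "ell (x * gen k * inverse x * w) < ell w \<longleftrightarrow> flips x w k"
proof
  show "flips x w k" if l: "ell (x * gen k * inverse x * w) < ell w"
  proof (rule ccontr)
    assume "\<not> flips x w k"
    then have "flips x (x * gen k * inverse x * w) k"
      using less_flip[of "inverse w * x" k] by (simp add: flips_def mult.assoc)
    from flips_ell_less[OF this] l show False by (simp add: mult.assoc)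
  qed
qed (rule flips_ell_less)

definition brefl :: "nat => bperm set" where
  "brefl n = {x * gen k * inverse x | x k. x \<in> Wn n \<and> k < n}"

definition brel :: "nat => (bperm \<times> bperm) set" where
  "brel n = {(x, y). x \<in> Wn n \<and> y \<in> Wn n \<and> ell x < ell y \<and> (\<exists>r \<in> brefl n. y = r * x)}"

lemma refl_conj: "r \<in> brefl n ==> i < n ==> gen i * r * gen i \<in> brefl n"
  unfolding brefl_def
proof clarify
  fix x k assume "x \<in> Wn n" "k < n" "i < n"
  then show "\<exists>y l. gen i * (x * gen k * inverse x) * gen i = y * gen l * inverse y \<and> y \<in> Wn n \<and> l < n"
    by (intro exI[of _ "gen i * x"] exI[of _ k]) (auto simp: mult.assoc)
qed

lemma gen_refl: "i < n ==> gen i \<in> brefl n"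
  unfolding brefl_def by (intro CollectI exI[of _ 1] exI[of _ i]) auto

lemma brel_gen: "i < n ==> w \<in> Wn n ==> ell w < ell (gen i * w) ==> (w, gen i * w) \<in> brel n"
  by (auto simp: brel_def gen_refl intro!: bexI[of _ "gen i"])

lemma brel_conj: assumes "(x, y) \<in> brel n" "i < n" "ell (gen i * x) < ell (gen i * y)"
  shows "(gen i * x, gen i * y) \<in> brel n"
proof -
  obtain r where r: "r \<in> brefl n" "y = r * x" using assms by (auto simp: brel_def)
  then have "gen i * y = (gen i * r * gen i) * (gen i * x)" by (simp add: mult.assoc)
  moreover have "gen i * x \<in> Wn n" "gen i * y \<in> Wn n" using assms by (auto simp: brel_def)
  ultimately show ?thesis using refl_conj[OF r(1) assms(2)] assms(3) unfolding brel_def by blast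
qed

definition up :: "nat => bperm => bperm" where
  "up i y = (if ell y < ell (gen i * y) then gen i * y else y)"

text \<open>The lifting property of the Bruhat order, for a single reflection. The delicate case is
  that \<open>gen i\<close> raises z and lowers y: unless the reflection relating them is
  \<open>gen i\<close>, its conjugate is still an inversion of \<open>gen i * y\<close>, which puts
  \<open>gen i * z\<close> below \<open>gen i * y\<close>.\<close>

lemma brel_up:
  assumes "(z, y) \<in> brel n" "i < n"
  shows "(up i z, up i y) \<in> (brel n)\<^sup>*"
proof -
  have W: "z \<in> Wn n" "y \<in> Wn n" "ell z < ell y" using assms by (auto simp: brel_def)
  show ?thesis
  proof (cases "ell y < ell (gen i * y)")
    case True
    have "(gen i * z, gen i * y) \<in> brel n"
      using brel_conj[OF assms] ell_left_cases[of i z] ell_left_cases[of i y] True W by auto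
    moreover have "(z, y) \<in> brel n" "(y, gen i * y) \<in> brel n"
      using assms brel_gen W True by auto
    ultimately show ?thesis using True by (auto simp: up_def)
  next
    case False
    then have yd: "ell (gen i * y) < ell y" using ell_left_cases[of i y] by auto
    have "gen i * y \<in> Wn n" using W assms by auto
    then have gy: "(gen i * y, y) \<in> brel n" using brel_gen[of i n "gen i * y"] yd assms by simp
    show ?thesis
    proof (cases "ell z < ell (gen i * z)")
      case True
      obtain x k where x: "x \<in> Wn n" "k < n" "y = x * gen k * inverse x * z" using assms by (auto simp: brel_def brefl_def)
      then have z: "z = x * gen k * inverse x * y" by (simp add: mult.assoc)
      have "gen i * z = y \<or> ell (gen i * z) < ell (gen i * y)"
      proof (cases "x * gen k * inverse x = gen i")
        case False
        have "flips x y k" using refl_ell_less[of x k y] z W by simp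
        then have "flips (gen i * x) (gen i * y) k"
          using gen_flip_conj[of x k i] False by (auto simp: flips_def mult.assoc)
        then show ?thesis using z refl_ell_less[of "gen i * x" k "gen i * y"] by (simp add: mult.assoc)
      qed (use x in simp)
      then show ?thesis
      proof
        assume "ell (gen i * z) < ell (gen i * y)"
        then have "(gen i * z, gen i * y) \<in> brel n" using brel_conj assms by blast
        then show ?thesis using gy True False by (auto simp: up_def)
      qed (use True False in \<open>auto simp: up_def\<close>)
    qed (use False assms in \<open>auto simp: up_def\<close>)
  qed
qed

lemma bruhat_lift:
  assumes "(x, y) \<in> (brel n)\<^sup>*" "i < n" "x \<in> Wn n"
  shows "(gen i * x, up i y) \<in> (brel n)\<^sup>*"
  using assms(1)
proof (induction rule: rtrancl_induct)
  case base
  show ?case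
  proof (cases "ell x < ell (gen i * x)")
    case False
    then have "ell (gen i * x) < ell x" using ell_left_cases[of i x] by auto
    moreover have "gen i * x \<in> Wn n" using assms by auto
    ultimately have "(gen i * x, x) \<in> brel n" using brel_gen[of i n "gen i * x"] assms by simp
    then show ?thesis using False by (auto simp: up_def)
  qed (auto simp: up_def)
next
  case (step y z)
  then show ?case using brel_up[OF step(2) assms(2)] by auto
qed

lemma brel_ell: "(x, y) \<in> (brel n)\<^sup>+ ==> ell x < ell y \<and> x \<in> Wn n \<and> y \<in> Wn n"
  by (induction rule: trancl_induct) (auto simp: brel_def)

section \<open>The Hecke algebra, its bar involution and the Kazhdan-Lusztig basis\<close>

section \<open>The generic Hecke algebra of the union of the groups\<close>

definition vg :: "nat => laurent" where "vg i = (if i = 0 then laurent_monom 1 0 else laurent_monom 0 1)"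
definition vgi :: "nat => laurent" where "vgi i = (if i = 0 then laurent_monom (-1) 0 else laurent_monom 0 (-1))"
definition xg :: "nat => laurent" where "xg i = vg i - vgi i"

lemma laurent_monom_mult: "laurent_monom i j * laurent_monom k l = laurent_monom (i + k) (j + l)"
  by (simp add: laurent_monom_def mult_single)
lemma laurent_monom_1: "laurent_monom 0 0 = 1"
  by (simp add: laurent_monom_def zero_prod_def[symmetric] single_one)
lemma vg_vgi [simp]: "vg i * vgi i = 1" "vgi i * vg i = 1" "vg i * (vgi i * c) = c" "vgi i * (vg i * c) = c"
  by (auto simp: vg_def vgi_def laurent_monom_mult laurent_monom_1 mult.assoc[symmetric])
lemma vg_pos: "i > 0 ==> j > 0 ==> vg i = vg j" "i > 0 ==> j > 0 ==> vgi i = vgi j" by (auto simp: vg_def vgi_def)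

typedef hk = "{f :: bperm => laurent. finite {x. f x \<noteq> 0}}" morphisms cf Abs_hk
  by (rule exI[of _ "\<lambda>_. 0"]) auto

setup_lifting type_definition_hk

lemma hk_eqI: "(\<And>x. cf h x = cf k x) ==> h = k"
  by (simp add: cf_inject[symmetric] fun_eq_iff)

lemma finite_cf [simp]: "finite {x. cf h x \<noteq> 0}" using cf[of h] by simp

instantiation hk :: ab_group_add
begin
lift_definition zero_hk :: hk is "\<lambda>_. 0" by simp
lift_definition plus_hk :: "hk => hk => hk" is "\<lambda>f g x. f x + g x"
  by (rename_tac f g, rule_tac B = "{x. f x \<noteq> 0} \<union> {x. g x \<noteq> 0}" in finite_subset) auto
lift_definition minus_hk :: "hk => hk => hk" is "\<lambda>f g x. f x - g x"
  by (rename_tac f g, rule_tac B = "{x. f x \<noteq> 0} \<union> {x. g x \<noteq> 0}" in finite_subset) auto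
lift_definition uminus_hk :: "hk => hk" is "\<lambda>f x. - f x" by simp
instance by standard (transfer; simp add: fun_eq_iff algebra_simps)+
end

definition sc :: "laurent => hk => hk" where "sc c h = Abs_hk (\<lambda>x. c * cf h x)"

lemma cf_sc [simp]: "cf (sc c h) x = c * cf h x"
proof -
  have "finite {x. c * cf h x \<noteq> 0}" by (rule finite_subset[OF _ finite_cf[of h]]) auto
  then show ?thesis by (simp add: sc_def Abs_hk_inverse)
qed

definition Tb :: "bperm => hk" where "Tb w = Abs_hk (\<lambda>x. if x = w then 1 else 0)"

lemma cf_simps [simp]:
  "cf 0 x = 0" "cf (h + k) x = cf h x + cf k x" "cf (h - k) x = cf h x - cf k x" "cf (- h) x = - cf h x"
  by (simp_all add: zero_hk.rep_eq plus_hk.rep_eq minus_hk.rep_eq uminus_hk.rep_eq)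
lemma cf_Tb: "cf (Tb w) x = (if x = w then 1 else 0)"
  unfolding Tb_def by (subst Abs_hk_inverse) auto
lemma cf_Tb_same [simp]: "cf (Tb w) w = 1" by (simp add: cf_Tb)
lemma cf_sum [simp]: "cf (sum f A) x = (\<Sum>i\<in>A. cf (f i) x)"
  by (induction A rule: infinite_finite_induct) auto

interpretation hk: module sc
  by standard (auto intro!: hk_eqI simp: algebra_simps)

abbreviation spT :: "bperm set => hk set" where "spT S \<equiv> hk.span (Tb ` S)"

lemma hk_expand_on: assumes "finite S" "{x. cf h x \<noteq> 0} \<subseteq> S" shows "h = (\<Sum>w\<in>S. sc (cf h w) (Tb w))"
proof (rule hk_eqI)
  fix x
  have "(\<Sum>w\<in>S. cf h w * (if x = w then 1 else 0)) = (\<Sum>w\<in>S. if x = w then cf h w else 0)"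
    by (rule sum.cong) auto
  also have "\<dots> = cf h x" using assms by (auto simp: sum.delta)
  finally show "cf h x = cf (\<Sum>w\<in>S. sc (cf h w) (Tb w)) x" by (simp add: cf_Tb)
qed

lemma hk_expand: "h = (\<Sum>w | cf h w \<noteq> 0. sc (cf h w) (Tb w))"
  by (rule hk_expand_on) auto

definition lin :: "(hk => hk) => bool" where
  "lin p \<longleftrightarrow> (\<forall>x y. p (x + y) = p x + p y) \<and> (\<forall>c x. p (sc c x) = sc c (p x))"

lemma lin_add: "lin p ==> p (x + y) = p x + p y" and lin_sc: "lin p ==> p (sc c x) = sc c (p x)"
  by (auto simp: lin_def)
lemma lin_0: "lin p ==> p 0 = 0" by (metis lin_sc hk.scale_zero_left)
lemma lin_sum: "lin p ==> p (sum f A) = (\<Sum>i\<in>A. p (f i))"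
  by (induction A rule: infinite_finite_induct) (auto simp: lin_add lin_0)
lemma lin_comp: "lin p ==> lin q ==> lin (\<lambda>x. p (q x))" by (auto simp: lin_def)
lemma lin_id: "lin (\<lambda>x. x)" by (auto simp: lin_def)
lemma lin_scale: "lin p ==> lin (\<lambda>x. sc c (p x))" by (auto simp: lin_def hk.scale_right_distrib mult.commute)
lemma lin_sum_fun: "(\<And>i. i \<in> A ==> lin (p i)) ==> lin (\<lambda>x. \<Sum>i\<in>A. p i x)"
  by (auto simp: lin_def sum.distrib hk.scale_sum_right)

lemma lin_eqI: assumes "lin p" "lin q" "\<And>w. p (Tb w) = q (Tb w)" shows "p h = q h"
proof -
  have "p h = (\<Sum>w | cf h w \<noteq> 0. sc (cf h w) (p (Tb w)))"
    by (subst hk_expand[of h]) (simp add: lin_sum[OF assms(1)] lin_sc[OF assms(1)])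
  also have "\<dots> = q h"
    by (subst (3) hk_expand[of h]) (simp add: lin_sum[OF assms(2)] lin_sc[OF assms(2)] assms(3))
  finally show ?thesis .
qed

lemma finite_shift: "finite {x. f x \<noteq> (0::laurent)} ==> finite {x. f (gen i * x) \<noteq> 0}"
  "finite {x. f x \<noteq> (0::laurent)} ==> finite {x. f (x * gen i) \<noteq> 0}"
   apply (rule finite_subset[of _ "(\<lambda>x. gen i * x) ` {x. f x \<noteq> 0}"])
    apply (auto simp: image_iff)[1] apply (metis gen_gen(2)) apply simp
  apply (rule finite_subset[of _ "(\<lambda>x. x * gen i) ` {x. f x \<noteq> 0}"])
   apply (auto simp: image_iff)[1] apply (metis gen_gen_r) apply simp
  done

text \<open>Left multiplication by the generator T_i, written on coefficients; \<open>rho\<close> is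
  right multiplication. The algebra is built from these operators, so that associativity reduces to
  the commutation of left and right operators.\<close>

definition lam :: "nat => hk => hk" where
  "lam i h = Abs_hk (\<lambda>x. cf h (gen i * x) + (if ell (gen i * x) < ell x then xg i * cf h x else 0))"
definition rho :: "nat => hk => hk" where
  "rho i h = Abs_hk (\<lambda>x. cf h (x * gen i) + (if ell (x * gen i) < ell x then xg i * cf h x else 0))"

lemma cf_lam: "cf (lam i h) x = cf h (gen i * x) + (if ell (gen i * x) < ell x then xg i * cf h x else 0)"
proof -
  have "finite {x. cf h (gen i * x) + (if ell (gen i * x) < ell x then xg i * cf h x else 0) \<noteq> 0}"
    by (rule finite_subset[OF _ finite_UnI[OF finite_cf[of h] finite_shift(1)[OF finite_cf[of h], of i]]]) (auto split: if_splits)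
  then show ?thesis by (simp add: lam_def Abs_hk_inverse)
qed
lemma cf_rho: "cf (rho i h) x = cf h (x * gen i) + (if ell (x * gen i) < ell x then xg i * cf h x else 0)"
proof -
  have "finite {x. cf h (x * gen i) + (if ell (x * gen i) < ell x then xg i * cf h x else 0) \<noteq> 0}"
    by (rule finite_subset[OF _ finite_UnI[OF finite_cf[of h] finite_shift(2)[OF finite_cf[of h], of i]]]) (auto split: if_splits)
  then show ?thesis by (simp add: rho_def Abs_hk_inverse)
qed

lemma lin_lam: "lin (lam i)" and lin_rho: "lin (rho i)"
  by (auto simp: lin_def intro!: hk_eqI simp: cf_lam cf_rho algebra_simps)

lemma gen_times_eq: "gen i * x = w \<longleftrightarrow> x = gen i * w" "x * gen i = w \<longleftrightarrow> x = w * gen i"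
  by (auto simp: mult.assoc)

lemma lam_Tb: "lam i (Tb w) = Tb (gen i * w) + (if ell (gen i * w) < ell w then sc (xg i) (Tb w) else 0)"
  by (rule hk_eqI) (auto simp: cf_lam cf_Tb gen_times_eq)
lemma rho_Tb: "rho i (Tb w) = Tb (w * gen i) + (if ell (w * gen i) < ell w then sc (xg i) (Tb w) else 0)"
  by (rule hk_eqI) (auto simp: cf_rho cf_Tb gen_times_eq)

lemma xg_conj: "gen i * w = w * gen j ==> xg i = xg j"
  using gen_conj_0[of i w j] vg_pos[of i j] by (cases "i = 0") (auto simp: xg_def)

text \<open>If \<open>gen i * x\<close> differs from \<open>x * gen j\<close>, the left descent at i
  is unaffected by \<open>gen j\<close> and conversely, so both sides expand identically. If they
  agree, the two generators are conjugate and their parameters coincide.\<close>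

lemma lam_rho: "lam i (rho j h) = rho j (lam i h)"
proof (rule hk_eqI)
  fix x
  have sw: "gen i * x = x * gen j" if "(ell (gen i * x) < ell x) \<noteq> (ell (gen i * (x * gen j)) < ell (x * gen j))"
    using exchange_comm[OF that] .
  have sw': "gen i * x = x * gen j" if "(ell (x * gen j) < ell x) \<noteq> (ell (gen i * (x * gen j)) < ell (gen i * x))"
    using exchange_comm'[OF that] .
  show "cf (lam i (rho j h)) x = cf (rho j (lam i h)) x"
  proof (cases "gen i * x = x * gen j")
    case True
    have "cf (lam i (rho j h)) x = cf h (x * gen j * gen j) +
        (if ell (x * gen j * gen j) < ell (x * gen j) then xg i * cf h (x * gen j) else 0) +
        (if ell (x * gen j) < ell x then xg i * (cf h (x * gen j) + (if ell (x * gen j) < ell x then xg i * cf h x else 0)) else 0)"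
      unfolding cf_lam cf_rho True xg_conj[OF True] by simp
    moreover have "cf (rho j (lam i h)) x = cf h (gen i * (x * gen j)) +
        (if ell (gen i * (x * gen j)) < ell (x * gen j) then xg i * cf h (x * gen j) else 0) +
        (if ell (x * gen j) < ell x then xg i * (cf h (gen i * x) + (if ell (gen i * x) < ell x then xg i * cf h x else 0)) else 0)"
      unfolding cf_lam cf_rho xg_conj[OF True] by simp
    moreover have "gen i * (x * gen j) = x * gen j * gen j" using True by (simp add: mult.assoc[symmetric])
    ultimately show ?thesis using True by simp
  next
    case False
    define A B where "A = (ell (gen i * x) < ell x)" and "B = (ell (x * gen j) < ell x)"
    have A': "ell (gen i * (x * gen j)) < ell (x * gen j) \<longleftrightarrow> A" and B': "ell (gen i * (x * gen j)) < ell (gen i * x) \<longleftrightarrow> B"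
      using False sw sw' unfolding A_def B_def by blast+
    show ?thesis unfolding cf_lam cf_rho mult.assoc A' B' A_def[symmetric] B_def[symmetric]
      by (cases A; cases B) (simp_all add: distrib_left mult.left_commute add.left_commute add.commute)
  qed
qed

text \<open>Every \<open>Tb w\<close> arises from \<open>Tb 1\<close> by right operators along a
  reduced word, so an operator commuting with all \<open>rho i\<close> is determined by its value at
  \<open>Tb 1\<close>. Associativity and the irrelevance of the word chosen in \<open>Lop\<close>
  both follow.\<close>

lemma commuting_eqI:
  assumes "lin p" "lin q" "\<And>i h. p (rho i h) = rho i (p h)" "\<And>i h. q (rho i h) = rho i (q h)" "p (Tb 1) = q (Tb 1)"
  shows "p h = q h"
proof (rule lin_eqI[OF assms(1,2)])
  fix w
  have "p (Tb (inverse w)) = q (Tb (inverse w))" for w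
  proof (induction w rule: ell_induct)
    case (step i w)
    have l: "ell (inverse w * gen i) > ell (inverse w)"
      using step.hyps ell_inverse[of "gen i * w"] by simp
    have "Tb (inverse (gen i * w)) = rho i (Tb (inverse w))" using l by (simp add: rho_Tb)
    then show ?case using step assms(3,4) by simp
  qed (use assms in simp)
  from this[of "inverse w"] show "p (Tb w) = q (Tb w)" by simp
qed

definition lamw :: "nat list => hk => hk" where "lamw is = foldr lam is"
lemma lamw_simps [simp]: "lamw [] h = h" "lamw (i # is) h = lam i (lamw is h)" by (auto simp: lamw_def)
lemma lin_lamw: "lin (lamw is)"
proof (induction "is")
  case Nil have "lamw [] = (\<lambda>x. x)" by (rule ext) simp
  then show ?case using lin_id by simp
next
  case (Cons i "is") then have "lin (\<lambda>x. lam i (lamw is x))" by (rule lin_comp[OF lin_lam])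
  moreover have "lamw (i # is) = (\<lambda>x. lam i (lamw is x))" by (rule ext) simp
  ultimately show ?case by simp
qed
lemma lamw_rho: "lamw is (rho j h) = rho j (lamw is h)"
  by (induction "is") (auto simp: lam_rho)
lemma lamw_1: "ell (wprod is) = length is ==> lamw is (Tb 1) = Tb (wprod is)"
proof (induction "is")
  case (Cons i "is")
  have "ell (wprod is) = length is" using Cons.prems ell_wprod[of "is"] ell_left_cases[of i "wprod is"] by auto
  then show ?case using Cons by (auto simp: lam_Tb)
qed auto

definition rword :: "bperm => nat list" where "rword w = (SOME is. wprod is = w \<and> length is = ell w)"
lemma rword: "wprod (rword w) = w" "length (rword w) = ell w"
proof -
  have "\<exists>is. wprod is = w \<and> length is = ell w" using Wn_ex wprod_ex by metis
  then show "wprod (rword w) = w" "length (rword w) = ell w"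
    unfolding rword_def by (metis (mono_tags, lifting) someI_ex)+
qed

definition Lop :: "hk => hk => hk" where "Lop h k = (\<Sum>w | cf h w \<noteq> 0. sc (cf h w) (lamw (rword w) k))"

lemma Lop_on: assumes "finite S" "{x. cf h x \<noteq> 0} \<subseteq> S" shows "Lop h k = (\<Sum>w\<in>S. sc (cf h w) (lamw (rword w) k))"
  unfolding Lop_def by (rule sum.mono_neutral_left) (use assms in auto)
lemma lin_Lop: "lin (Lop h)"
  unfolding Lop_def by (intro lin_sum_fun lin_scale lin_lamw)
lemma Lop_rho: "Lop h (rho j k) = rho j (Lop h k)"
  unfolding Lop_def by (simp add: lamw_rho lin_sum[OF lin_rho] lin_sc[OF lin_rho])
lemma Lop_1: "Lop h (Tb 1) = h"
proof -
  have "lamw (rword w) (Tb 1) = Tb w" for w using lamw_1[of "rword w"] rword[of w] by simp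
  then show ?thesis unfolding Lop_def using hk_expand[of h] by simp
qed
lemma Lop_add: "Lop (h + h') k = Lop h k + Lop h' k"
proof -
  let ?S = "{x. cf h x \<noteq> 0} \<union> {x. cf h' x \<noteq> 0}"
  have "Lop (h + h') k = (\<Sum>w\<in>?S. sc (cf (h + h') w) (lamw (rword w) k))" by (rule Lop_on) auto
  also have "\<dots> = Lop h k + Lop h' k"
    by (subst (1 2) Lop_on[of ?S]) (auto simp: hk.scale_left_distrib sum.distrib)
  finally show ?thesis .
qed
lemma Lop_sc: "Lop (sc c h) k = sc c (Lop h k)"
proof -
  have "Lop (sc c h) k = (\<Sum>w | cf h w \<noteq> 0. sc (cf (sc c h) w) (lamw (rword w) k))" by (rule Lop_on) auto
  then show ?thesis by (simp add: Lop_def hk.scale_sum_right)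
qed

instantiation hk :: ring_1
begin
definition one_hk where "one_hk = Tb 1"
definition times_hk where "times_hk = Lop"
instance
proof
  fix a b c :: hk
  show "a * b * c = a * (b * c)"
    unfolding times_hk_def
    by (rule commuting_eqI[where q = "\<lambda>c. Lop a (Lop b c)", OF lin_Lop lin_comp[OF lin_Lop lin_Lop]])
      (simp_all add: Lop_rho Lop_1)
  show "1 * a = a"
    unfolding times_hk_def one_hk_def
    by (rule commuting_eqI[where q = "\<lambda>c. c", OF lin_Lop lin_id]) (simp_all add: Lop_rho Lop_1)
  show "a * 1 = a" by (simp add: times_hk_def one_hk_def Lop_1)
  show "(a + b) * c = a * c + b * c" by (simp add: times_hk_def Lop_add)
  show "a * (b + c) = a * b + a * c" by (simp add: times_hk_def lin_add[OF lin_Lop])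
  show "(0::hk) \<noteq> 1" unfolding one_hk_def by (metis cf_Tb_same cf_simps(1) zero_neq_one)
qed
end

lemma sc_mult_left [simp]: "sc c h * k = sc c (h * k)" by (simp add: times_hk_def Lop_sc)
lemma sc_mult_right [simp]: "h * sc c k = sc c (h * k)" by (simp add: times_hk_def lin_sc[OF lin_Lop])
lemma Tb_1 [simp]: "Tb 1 = 1" by (simp add: one_hk_def)

abbreviation tt :: "nat => hk" where "tt i \<equiv> Tb (gen i)"

lemma tt_mult: "tt i * h = lam i h"
proof -
  have "Lop (tt i) h = lam i h"
    by (rule commuting_eqI[OF lin_Lop lin_lam]) (simp_all add: Lop_rho lam_rho lam_Tb Lop_1 del: Tb_1)
  then show ?thesis by (simp add: times_hk_def)
qed
lemma mult_tt: "h * tt i = rho i h"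
proof -
  have "h * rho i 1 = rho i (h * 1)" unfolding times_hk_def by (rule Lop_rho)
  moreover have "rho i 1 = tt i" unfolding one_hk_def by (simp add: rho_Tb del: Tb_1)
  ultimately show ?thesis by simp
qed

lemma tt_Tb: "tt i * Tb w = Tb (gen i * w) + (if ell (gen i * w) < ell w then sc (xg i) (Tb w) else 0)"
  by (simp add: tt_mult lam_Tb)
lemma Tb_tt: "Tb w * tt i = Tb (w * gen i) + (if ell (w * gen i) < ell w then sc (xg i) (Tb w) else 0)"
  by (simp add: mult_tt rho_Tb)
lemma cf_tt_mult: "cf (tt i * h) x = cf h (gen i * x) + (if ell (gen i * x) < ell x then xg i * cf h x else 0)"
  by (simp add: tt_mult cf_lam)
lemma cf_mult_tt: "cf (h * tt i) x = cf h (x * gen i) + (if ell (x * gen i) < ell x then xg i * cf h x else 0)"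
  by (simp add: mult_tt cf_rho)

lemma Tb_mult: "ell (x * y) = ell x + ell y ==> Tb x * Tb y = Tb (x * y)"
proof (induction x rule: ell_induct)
  case (step i x)
  have e: "ell (x * y) = ell x + ell y" "ell (gen i * (x * y)) = Suc (ell (x * y))"
    using step.prems step.hyps ell_times_le[of x y] ell_left_cases[of i "x * y"] unfolding mult.assoc by linarith+
  have "Tb (gen i * x) = tt i * Tb x" using step.hyps by (simp add: tt_Tb)
  then show ?case unfolding mult.assoc \<open>Tb (gen i * x) = tt i * Tb x\<close> step.IH[OF e(1)] using e by (simp add: tt_Tb)
qed simp

definition ti :: "nat => hk" where "ti i = tt i - sc (xg i) 1"

lemma tt_sq: "tt i * tt i = 1 + sc (xg i) (tt i)" by (simp add: tt_Tb)
lemma tt_ti [simp]: "tt i * ti i = 1" "ti i * tt i = 1"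
  by (simp_all add: ti_def algebra_simps tt_sq)
lemma tt_ti2 [simp]: "tt i * (ti i * h) = h" "ti i * (tt i * h) = h"
  by (simp_all add: mult.assoc[symmetric])

section \<open>Laurent polynomials with restricted exponents\<close>

definition KS :: "(int \<times> int) set => laurent set" where "KS S = {p. Poly_Mapping.keys p \<subseteq> S}"

lemma KS_0 [simp]: "0 \<in> KS S" by (auto simp: KS_def)
lemma KS_add: "p \<in> KS S ==> q \<in> KS S ==> p + q \<in> KS S"
  using keys_add[of p q] unfolding KS_def by blast
lemma KS_uminus: "p \<in> KS S ==> - p \<in> KS S" by (auto simp: KS_def)
lemma KS_diff: "p \<in> KS S ==> q \<in> KS S ==> p - q \<in> KS S"
  using KS_add[of p S "-q"] KS_uminus[of q S] by simp
lemma KS_sum: "(\<And>i. i \<in> A ==> f i \<in> KS S) ==> sum f A \<in> KS S"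
  by (induction A rule: infinite_finite_induct) (auto intro: KS_add)
lemma KS_mult: "p \<in> KS S ==> q \<in> KS R ==> (\<And>a b. a \<in> S ==> b \<in> R ==> a + b \<in> U) ==> p * q \<in> KS U"
  using keys_mult[of p q] unfolding KS_def by blast
lemma KS_mono: "p \<in> KS S ==> S \<subseteq> R ==> p \<in> KS R" by (auto simp: KS_def)
lemma KS_monom: "(i, j) \<in> S ==> laurent_monom i j \<in> KS S" by (auto simp: KS_def laurent_monom_def)

text \<open>\<open>VF\<close> below consists of the Laurent polynomials that are free of \<open>V\<close>, \<open>VN\<close> of those with negative powers of \<open>V\<close>
  only; in the asymptotic case \<open>VN\<close> is contained in \<open>AN\<close>.\<close>

definition Neg :: "(int \<times> int) set" where "Neg = {(i, j). i < 0 \<or> (i = 0 \<and> j < 0)}"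
definition Vzero :: "(int \<times> int) set" where "Vzero = {(i, j). i = 0}"
definition Vneg :: "(int \<times> int) set" where "Vneg = {(i, j). i < 0}"

abbreviation AN :: "laurent set" where "AN \<equiv> KS Neg"
abbreviation VF :: "laurent set" where "VF \<equiv> KS Vzero"
abbreviation VN :: "laurent set" where "VN \<equiv> KS Vneg"

lemma A_neg_eq: "A_neg = AN" by (auto simp: A_neg_def KS_def Neg_def)

lemma one_KS: "1 \<in> KS S \<longleftrightarrow> (0, 0) \<in> S"
  by (auto simp: KS_def zero_prod_def)
lemma one_VF [simp]: "1 \<in> VF" by (simp add: one_KS Vzero_def)
lemma AN_AN: "p \<in> AN ==> q \<in> AN ==> p * q \<in> AN"
  by (rule KS_mult[of p Neg q Neg]) (auto simp: Neg_def)
lemma VF_VF: "p \<in> VF ==> q \<in> VF ==> p * q \<in> VF"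
  by (rule KS_mult[of p Vzero q Vzero]) (auto simp: Vzero_def)
lemma vg_VF: "i > 0 ==> vg i \<in> VF" "i > 0 ==> vgi i \<in> VF"
  by (auto simp: vg_def vgi_def Vzero_def intro!: KS_monom)
lemma xg_VF: "i > 0 ==> xg i \<in> VF" by (auto simp: xg_def intro: KS_diff vg_VF)
lemma vgi_AN: "vgi i \<in> AN" by (auto simp: vgi_def Neg_def intro!: KS_monom)
lemma vgi_VN: "vgi 0 \<in> VN" by (auto simp: vgi_def Vneg_def intro!: KS_monom)

definition restr :: "(int \<times> int) set => laurent => laurent" where
  "restr S p = (\<Sum>k\<in>Poly_Mapping.keys p \<inter> S. Poly_Mapping.single k (Poly_Mapping.lookup p k))"

lemma lookup_restr: "Poly_Mapping.lookup (restr S p) k = (if k \<in> S then Poly_Mapping.lookup p k else 0)"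
proof -
  have "Poly_Mapping.lookup (restr S p) k =
    (\<Sum>l\<in>Poly_Mapping.keys p \<inter> S. if k = l then Poly_Mapping.lookup p l else 0)"
    unfolding restr_def lookup_sum by (rule sum.cong) (auto simp: lookup_single when_def)
  then show ?thesis by (auto simp: in_keys_iff)
qed

lemma laurent_induct [case_names zero one diff]:
  assumes "P 0" "\<And>x. P (Poly_Mapping.single x 1)" "\<And>a b. P a ==> P b ==> P (a - b)"
  shows "P (p :: laurent)"
  by (rule frag_induction[OF subset_UNIV]) (use assms in auto)

lemma lookup_monom_mult: "Poly_Mapping.lookup (laurent_monom a b * p) (i, j) = Poly_Mapping.lookup p (i - a, j - b)"
proof -
  have sing: "Poly_Mapping.lookup (laurent_monom a b * Poly_Mapping.single k c) (i, j) = Poly_Mapping.lookup (Poly_Mapping.single k c) (i - a, j - b)" for k c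
    by (cases k) (auto simp: laurent_monom_def mult_single lookup_single when_def)
  show ?thesis
    by (induction p rule: laurent_induct) (auto simp: right_diff_distrib lookup_minus sing)
qed

lemma lookup_bar: "Poly_Mapping.lookup (laurent_bar p) k = Poly_Mapping.lookup p (- k)"
  unfolding laurent_bar_def by (subst map_key.rep_eq) (auto intro: injI)

lemma lbar_lbar [simp]: "laurent_bar (laurent_bar p) = p"
  by (rule poly_mapping_eqI) (simp add: lookup_bar)
lemma lbar_simps [simp]: "laurent_bar 0 = 0" "laurent_bar (p + q) = laurent_bar p + laurent_bar q"
  "laurent_bar (- p) = - laurent_bar p" "laurent_bar (p - q) = laurent_bar p - laurent_bar q"
  by (rule poly_mapping_eqI; simp add: lookup_bar lookup_add lookup_minus)+
lemma lbar_single: "laurent_bar (Poly_Mapping.single k c) = Poly_Mapping.single (- k) c"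
  by (rule poly_mapping_eqI, rename_tac l, case_tac k, case_tac l) (auto simp: lookup_bar lookup_single when_def)
lemma lbar_1 [simp]: "laurent_bar 1 = 1"
  using lbar_single[of 0 1] by (simp add: single_one)
lemma lbar_mult [simp]: "laurent_bar (p * q) = laurent_bar p * laurent_bar q"
proof -
  have s: "laurent_bar (Poly_Mapping.single x 1 * q) = laurent_bar (Poly_Mapping.single x 1) * laurent_bar q" for x
    by (induction q rule: laurent_induct) (simp_all add: right_diff_distrib mult_single lbar_single add.commute)
  show ?thesis
    by (induction p rule: laurent_induct) (simp_all add: s left_diff_distrib)
qed
lemma lbar_vg [simp]: "laurent_bar (vg i) = vgi i" "laurent_bar (vgi i) = vg i"
  by (auto simp: vg_def vgi_def laurent_monom_def lbar_single)
lemma lbar_xg [simp]: "laurent_bar (xg i) = - xg i" by (simp add: xg_def)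

lemma lbar_AN_0: assumes "p \<in> AN" "laurent_bar p = p" shows "p = 0"
proof (rule poly_mapping_eqI)
  fix k
  have "Poly_Mapping.lookup p k = Poly_Mapping.lookup p (- k)" using lookup_bar[of p k] assms(2) by simp
  moreover have "k \<notin> Neg \<or> - k \<notin> Neg" by (cases k) (auto simp: Neg_def)
  ultimately show "Poly_Mapping.lookup p k = Poly_Mapping.lookup 0 k"
    using assms(1) unfolding KS_def lookup_zero by (metis (mono_tags, lifting) in_keys_iff mem_Collect_eq subsetD)
qed

text \<open>Exponents are totally ordered, so for each nonzero one either it or its negative lies in
  \<open>Neg\<close>, and the constant coefficient vanishes by antisymmetry. Thus the negative part
  of r determines r.\<close>

lemma antisym_split: assumes "laurent_bar r = - r" shows "\<exists>q\<in>AN. r = q - laurent_bar q"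
proof
  show "restr Neg r \<in> AN" by (auto simp: KS_def in_keys_iff lookup_restr split: if_splits)
  show "r = restr Neg r - laurent_bar (restr Neg r)"
  proof (rule poly_mapping_eqI)
    fix k
    have "Poly_Mapping.lookup r (- k) = - Poly_Mapping.lookup r k" using lookup_bar[of r k] assms by simp
    moreover have "k = 0 \<or> (k \<in> Neg) \<noteq> (- k \<in> Neg)" by (cases k) (auto simp: Neg_def zero_prod_def)
    ultimately show "Poly_Mapping.lookup r k = Poly_Mapping.lookup (restr Neg r - laurent_bar (restr Neg r)) k"
      by (auto simp: lookup_minus lookup_restr lookup_bar)
  qed
qed

text \<open>Divide by the largest monomial occurring in any of the \<open>c i\<close>. A constant
  term then survives while everything else is negative; this is how linear independence over the
  Laurent ring is obtained.\<close>

lemma leading_shift: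
  assumes "finite I" "i0 \<in> I" "c i0 \<noteq> (0::laurent)"
  shows "\<exists>s. (\<forall>i\<in>I. s * c i \<in> KS (insert 0 Neg)) \<and> (\<exists>i\<in>I. s * c i \<notin> AN)"
proof -
  define K where "K = (\<Union>i\<in>I. Poly_Mapping.keys (c i))"
  have K: "finite K" "K \<noteq> {}" using assms by (auto simp: K_def)
  define m where "m = Max (fst ` K)"
  have m: "fst k \<le> m" if "k \<in> K" for k unfolding m_def using K that by (intro Max_ge) auto
  have "m \<in> fst ` K" unfolding m_def using K by (intro Max_in) auto
  then have L: "finite {j. (m, j) \<in> K}" "{j. (m, j) \<in> K} \<noteq> {}"
    using finite_subset[of "{j. (m, j) \<in> K}" "snd ` K"] K by (force simp: image_iff)+
  define l where "l = Max {j. (m, j) \<in> K}"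
  have l: "j \<le> l" if "(m, j) \<in> K" for j unfolding l_def using L that by (intro Max_ge) auto
  have "l \<in> {j. (m, j) \<in> K}" unfolding l_def using L by (intro Max_in) auto
  then obtain i where i: "i \<in> I" "(m, l) \<in> Poly_Mapping.keys (c i)" by (auto simp: K_def)
  let ?s = "laurent_monom (- m) (- l)"
  have k: "(a, b) \<in> Poly_Mapping.keys (?s * p) \<longleftrightarrow> (a + m, b + l) \<in> Poly_Mapping.keys p" for a b p
    by (simp add: in_keys_iff lookup_monom_mult)
  have "?s * c i \<in> KS (insert 0 Neg)" if "i \<in> I" for i
    unfolding KS_def
  proof clarify
    fix a b assume "(a, b) \<in> Poly_Mapping.keys (?s * c i)" "(a, b) \<notin> Neg"
    then have "(a + m, b + l) \<in> K" "\<not> a < 0" "\<not> (a = 0 \<and> b < 0)" using that by (auto simp: K_def k Neg_def)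
    then show "(a, b) = 0" using m[of "(a + m, b + l)"] l[of "b + l"] by (auto simp: zero_prod_def)
  qed
  moreover have "?s * c i \<notin> AN"
  proof
    assume "?s * c i \<in> AN"
    moreover have "(0, 0) \<in> Poly_Mapping.keys (?s * c i)" using k[of 0 0 "c i"] i by simp
    ultimately have "(0, 0) \<in> Neg" unfolding KS_def by blast
    then show False by (simp add: Neg_def)
  qed
  ultimately show ?thesis using i by blast
qed

section \<open>The bar involution\<close>

text \<open>This is the inverse of the basis element of w^-1, written as a product of inverse
  generators along a reduced word of w.\<close>

definition Tbar :: "bperm => hk" where "Tbar w = foldr (\<lambda>i h. ti i * h) (rword w) 1"

lemma Tb_inverse_wprod: "ell (wprod is) = length is ==> Tb (inverse (wprod is)) * foldr (\<lambda>i h. ti i * h) is 1 = 1"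
proof (induction "is")
  case (Cons i "is")
  have l: "ell (wprod is) = length is" using Cons.prems ell_wprod[of "is"] ell_left_cases[of i "wprod is"] by auto
  have "ell (inverse (wprod is) * gen i) > ell (inverse (wprod is))"
    using Cons.prems l ell_inverse[of "gen i * wprod is"] by simp
  then have "Tb (inverse (wprod (i # is))) = Tb (inverse (wprod is)) * tt i" by (simp add: Tb_tt)
  then show ?case using Cons.IH[OF l] by (simp add: mult.assoc)
qed simp

lemma foldr_inverse: "foldr (\<lambda>i h. ti i * h) is 1 * foldr (\<lambda>i h. h * tt i) is 1 = 1"
  "foldr (\<lambda>i h. h * tt i) is 1 * foldr (\<lambda>i h. ti i * h) is 1 = 1"
proof -
  let ?F = "\<lambda>is. foldr (\<lambda>i h. ti i * h) is 1" and ?G = "\<lambda>is. foldr (\<lambda>i h. h * tt i) is 1"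
  have "?F is * ?G is = 1 \<and> ?G is * ?F is = 1"
  proof (induction "is")
    case (Cons i "is")
    have "?F (i # is) * ?G (i # is) = ti i * (?F is * ?G is) * tt i" "?G (i # is) * ?F (i # is) = ?G is * (tt i * ti i) * ?F is"
      by (simp_all only: foldr.simps comp_apply mult.assoc)
    then show ?case using Cons by simp
  qed simp
  then show "?F is * ?G is = 1" "?G is * ?F is = 1" by auto
qed

lemma Tbar_inv: "Tb (inverse w) * Tbar w = 1" "Tbar w * Tb (inverse w) = 1"
proof -
  show a: "Tb (inverse w) * Tbar w = 1" using Tb_inverse_wprod[of "rword w"] rword[of w] by (simp add: Tbar_def)
  then show "Tbar w * Tb (inverse w) = 1"
    using foldr_inverse[of "rword w"] unfolding Tbar_def by (metis mult.assoc mult.right_neutral mult.left_neutral)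
qed

lemma Tbar_unique: "Tb (inverse w) * k = 1 ==> k = Tbar w"
  by (metis Tbar_inv(2) mult.assoc mult.left_neutral mult.right_neutral)

lemma Tbar_1 [simp]: "Tbar 1 = 1" by (rule Tbar_unique[symmetric]) simp

lemma Tbar_up: assumes "ell w < ell (gen i * w)" shows "Tbar (gen i * w) = ti i * Tbar w"
proof (rule Tbar_unique[symmetric])
  have "ell (inverse w * gen i) > ell (inverse w)" using assms ell_inverse[of "gen i * w"] by simp
  then have "Tb (inverse (gen i * w)) = Tb (inverse w) * tt i" by (simp add: Tb_tt)
  then show "Tb (inverse (gen i * w)) * (ti i * Tbar w) = 1" by (simp add: mult.assoc Tbar_inv)
qed

definition bar :: "hk => hk" where "bar h = (\<Sum>w | cf h w \<noteq> 0. sc (laurent_bar (cf h w)) (Tbar w))"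

definition slin :: "(hk => hk) => bool" where
  "slin p \<longleftrightarrow> (\<forall>x y. p (x + y) = p x + p y) \<and> (\<forall>c x. p (sc c x) = sc (laurent_bar c) (p x))"

lemma slin_sum: "slin p ==> p (sum f A) = (\<Sum>i\<in>A. p (f i))"
proof -
  assume p: "slin p"
  then have "p (sc 0 0) = sc (laurent_bar 0) (p 0)" unfolding slin_def by blast
  then have "p 0 = 0" by simp
  then show ?thesis using p by (induction A rule: infinite_finite_induct) (auto simp: slin_def)
qed

lemma slin_eqI: assumes "slin p" "slin q" "\<And>w. p (Tb w) = q (Tb w)" shows "p h = q h"
proof -
  have "p h = (\<Sum>w | cf h w \<noteq> 0. sc (laurent_bar (cf h w)) (p (Tb w)))"
    by (subst hk_expand[of h]) (use assms(1) in \<open>simp add: slin_sum[OF assms(1)] slin_def\<close>)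
  also have "\<dots> = q h"
    by (subst (3) hk_expand[of h]) (use assms(2) in \<open>simp add: slin_sum[OF assms(2)] slin_def assms(3)\<close>)
  finally show ?thesis .
qed

lemma bar_on: assumes "finite S" "{x. cf h x \<noteq> 0} \<subseteq> S" shows "bar h = (\<Sum>w\<in>S. sc (laurent_bar (cf h w)) (Tbar w))"
  unfolding bar_def by (rule sum.mono_neutral_left) (use assms in auto)

lemma slin_bar: "slin bar"
  unfolding slin_def
proof (intro conjI allI)
  fix x y :: hk and c :: laurent
  let ?S = "{w. cf x w \<noteq> 0} \<union> {w. cf y w \<noteq> 0}"
  have "bar (x + y) = (\<Sum>w\<in>?S. sc (laurent_bar (cf (x + y) w)) (Tbar w))" by (rule bar_on) auto
  also have "\<dots> = bar x + bar y" by (subst (1 2) bar_on[of ?S]) (auto simp: hk.scale_left_distrib sum.distrib)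
  finally show "bar (x + y) = bar x + bar y" .
  have "bar (sc c x) = (\<Sum>w | cf x w \<noteq> 0. sc (laurent_bar (cf (sc c x) w)) (Tbar w))" by (rule bar_on) auto
  then show "bar (sc c x) = sc (laurent_bar c) (bar x)" by (simp add: bar_def hk.scale_sum_right)
qed

lemma bar_add [simp]: "bar (x + y) = bar x + bar y" and bar_sc [simp]: "bar (sc c x) = sc (laurent_bar c) (bar x)"
  using slin_bar by (auto simp: slin_def)
lemma bar_sum: "bar (sum f A) = (\<Sum>i\<in>A. bar (f i))" by (rule slin_sum[OF slin_bar])
lemma bar_0 [simp]: "bar 0 = 0" using bar_sum[of _ "{}"] by simp
lemma bar_minus [simp]: "bar (- x) = - bar x" by (metis add_eq_0_iff bar_0 bar_add)
lemma bar_diff [simp]: "bar (x - y) = bar x - bar y" using bar_add[of x "-y"] by simp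
lemma bar_Tb: "bar (Tb w) = Tbar w"
proof -
  have "{x. cf (Tb w) x \<noteq> 0} = {w}" by (auto simp: cf_Tb)
  then show ?thesis by (simp add: bar_def)
qed
lemma bar_1 [simp]: "bar 1 = 1" using bar_Tb[of 1] by simp
lemma ti_eq: "ti i * h = tt i * h - sc (xg i) h" by (simp add: ti_def algebra_simps)

lemma bar_tt_mult: "bar (tt i * h) = ti i * bar h"
proof (rule slin_eqI[where p = "\<lambda>h. bar (tt i * h)" and q = "\<lambda>h. ti i * bar h"])
  show "slin (\<lambda>h. bar (tt i * h))" "slin (\<lambda>h. ti i * bar h)" by (auto simp: slin_def distrib_left)
  fix w
  show "bar (tt i * Tb w) = ti i * bar (Tb w)"
  proof (cases "ell (gen i * w) < ell w")
    case True
    then have "Tbar w = ti i * Tbar (gen i * w)" using Tbar_up[of "gen i * w" i] by simp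
    then have "tt i * Tbar w = Tbar (gen i * w)" by simp
    then show ?thesis using True by (simp add: tt_Tb bar_Tb ti_eq)
  next
    case False
    then have "ell w < ell (gen i * w)" using ell_left_cases[of i w] by auto
    then show ?thesis using False Tbar_up[of w i] by (simp add: tt_Tb bar_Tb)
  qed
qed

lemma bar_tt [simp]: "bar (tt i) = ti i" using bar_tt_mult[of i 1] by simp

lemma bar_mult [simp]: "bar (h * k) = bar h * bar k"
proof (rule slin_eqI[where p = "\<lambda>h. bar (h * k)" and q = "\<lambda>h. bar h * bar k"])
  show "slin (\<lambda>h. bar (h * k))" "slin (\<lambda>h. bar h * bar k)" by (auto simp: slin_def distrib_right)
  fix w
  show "bar (Tb w * k) = bar (Tb w) * bar k"
  proof (induction w rule: ell_induct)
    case (step i w)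
    then have "Tb (gen i * w) = tt i * Tb w" by (simp add: tt_Tb)
    then show ?case using step by (simp add: mult.assoc bar_tt_mult)
  qed simp
qed

lemma bar_ti [simp]: "bar (ti i) = tt i" by (simp add: ti_def)

lemma bar_bar [simp]: "bar (bar h) = h"
proof (rule lin_eqI[where p = "\<lambda>h. bar (bar h)" and q = "\<lambda>h. h"])
  show "lin (\<lambda>h. bar (bar h))" "lin (\<lambda>h. h)" by (auto simp: lin_def)
  fix w show "bar (bar (Tb w)) = Tb w"
  proof (induction w rule: ell_induct)
    case (step i w)
    then have T: "Tb (gen i * w) = tt i * Tb w" by (simp add: tt_Tb)
    show ?case unfolding T bar_mult bar_tt bar_ti step.IH by (rule refl)
  qed simp
qed

section \<open>The Kazhdan--Lusztig basis\<close>

lemma span_Tb: "h \<in> spT S \<longleftrightarrow> {x. cf h x \<noteq> 0} \<subseteq> S"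
proof
  assume "h \<in> spT S"
  then show "{x. cf h x \<noteq> 0} \<subseteq> S"
  proof (induction rule: hk.span_induct_alt)
    case (step c x y)
    then obtain s where s: "s \<in> S" "x = Tb s" by auto
    have "cf (sc c x + y) z = 0" if "z \<notin> S" for z
    proof -
      have "z \<noteq> s" "cf y z = 0" using that s step by auto
      then show ?thesis by (simp add: s cf_Tb)
    qed
    then show ?case by blast
  qed simp
next
  assume "{x. cf h x \<noteq> 0} \<subseteq> S"
  then show "h \<in> spT S"
    by (subst hk_expand[of h], intro hk.span_sum hk.span_scale hk.span_base) auto
qed

lemma span_mult_left: assumes "\<And>x. x \<in> S ==> a * x \<in> hk.span R" "h \<in> hk.span S" shows "a * h \<in> hk.span R"
  using assms(2) by (induction rule: hk.span_induct_alt) (auto simp: distrib_left intro: hk.span_add hk.span_scale hk.span_zero assms(1))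

lemma span_mult_right: assumes "\<And>x. x \<in> S ==> x * a \<in> hk.span R" "h \<in> hk.span S" shows "h * a \<in> hk.span R"
  using assms(2) by (induction rule: hk.span_induct_alt) (auto simp: distrib_right intro: hk.span_add hk.span_scale hk.span_zero assms(1))

lemma span_image_sum: assumes "finite S" "h \<in> hk.span (f ` S)" shows "\<exists>r. h = (\<Sum>j\<in>S. sc (r j) (f j))"
  using assms(2)
proof (induction rule: hk.span_induct_alt)
  case base then show ?case by (intro exI[of _ "\<lambda>_. 0"]) simp
next
  case (step c x y)
  then obtain r j where r: "y = (\<Sum>j\<in>S. sc (r j) (f j))" and j: "j \<in> S" "x = f j" by auto
  have "sc c x + y = (\<Sum>k\<in>S. sc (r k + (if k = j then c else 0)) (f k))"
    unfolding r hk.scale_left_distrib sum.distrib using j assms(1)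
    by (simp add: if_distrib[of "\<lambda>a. sc a _"] add.commute cong: if_cong)
  then show ?case by (rule exI[of _ "\<lambda>k. r k + (if k = j then c else 0)"])
qed

text \<open>\<open>ti i * Tb y\<close> involves only y and \<open>gen i * y\<close>; for y below w
  both lie below \<open>gen i * w\<close> by the lifting property, and so does w itself.\<close>

lemma Tbar_lower: "w \<in> Wn n ==> bar (Tb w) - Tb w \<in> spT {y. (y, w) \<in> (brel n)\<^sup>+}"
proof (induction rule: ell_Wn_induct)
  case one then show ?case by (simp add: hk.span_zero)
next
  case (step i w)
  let ?S = "{y. (y, gen i * w) \<in> (brel n)\<^sup>+}"
  have up: "up i w = gen i * w" using step by (simp add: up_def)
  have wg: "(w, gen i * w) \<in> brel n" using step brel_gen by simp
  have 1: "ti i * Tb y \<in> spT ?S" if "(y, w) \<in> (brel n)\<^sup>+" for y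
  proof -
    have "y \<noteq> w" using brel_ell[OF that] by auto
    have "(gen i * y, gen i * w) \<in> (brel n)\<^sup>*"
      using bruhat_lift[OF trancl_into_rtrancl[OF that] step(1)] brel_ell[OF that] up by simp
    moreover have "gen i * y \<noteq> gen i * w" using \<open>y \<noteq> w\<close> by simp
    ultimately have "(gen i * y, gen i * w) \<in> (brel n)\<^sup>+" by (meson rtranclD)
    moreover have "(y, gen i * w) \<in> (brel n)\<^sup>+" using that wg by auto
    ultimately have "Tb (gen i * y) \<in> spT ?S" "Tb y \<in> spT ?S" by (auto intro: hk.span_base)
    then show ?thesis by (auto simp: ti_eq tt_Tb intro: hk.span_add hk.span_diff hk.span_scale)
  qed
  have T: "Tb (gen i * w) = tt i * Tb w" using step by (simp add: tt_Tb)
  have "bar (Tb (gen i * w)) - Tb (gen i * w) = ti i * (bar (Tb w) - Tb w) - sc (xg i) (Tb w)"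
    unfolding T by (simp add: ti_eq algebra_simps)
  moreover have "ti i * (bar (Tb w) - Tb w) \<in> spT ?S"
    by (rule span_mult_left[OF _ step.IH]) (use 1 in auto)
  moreover have "sc (xg i) (Tb w) \<in> spT ?S"
    using wg by (intro hk.span_scale hk.span_base) auto
  ultimately show ?case by (simp add: hk.span_diff)
qed

lemma cf_Tbar: "cf (Tbar w) x \<noteq> 0 ==> x \<noteq> w ==> ell x < ell w"
  "cf (Tbar w) w = 1"
proof -
  obtain n where n: "w \<in> Wn n" using Wn_ex by blast
  have *: "{x. cf (Tbar w - Tb w) x \<noteq> 0} \<subseteq> {y. (y, w) \<in> (brel n)\<^sup>+}"
    using Tbar_lower[OF n] unfolding bar_Tb span_Tb .
  show "cf (Tbar w) x \<noteq> 0 ==> x \<noteq> w ==> ell x < ell w"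
    using *[THEN subsetD, of x] brel_ell[of x w n] by (auto simp: cf_Tb)
  show "cf (Tbar w) w = 1"
    using *[THEN subsetD, of w] brel_ell[of w w n] by auto
qed

text \<open>Only congruence modulo negative coefficients is demanded, without triangularity.
  Together with bar invariance it already determines the element, which allows comparing elements
  built from different families.\<close>

definition asymT :: "bperm => hk => bool" where
  "asymT w c \<longleftrightarrow> (\<forall>x. cf c x - cf (Tb w) x \<in> AN)"

text \<open>At a longest element of the support the bar involution acts on the coefficient alone.
  That coefficient is bar fixed with negative exponents, hence zero.\<close>

lemma bar_fixed_AN_0: assumes "bar c = c" "\<And>x. cf c x \<in> AN" shows "c = 0"
proof (rule ccontr)
  assume "c \<noteq> 0"
  then obtain x0 where "cf c x0 \<noteq> 0" using hk_eqI[of c 0] by auto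
  then have ne: "{x. cf c x \<noteq> 0} \<noteq> {}" by auto
  define m where "m = Max (ell ` {x. cf c x \<noteq> 0})"
  have "m \<in> ell ` {x. cf c x \<noteq> 0}" unfolding m_def using ne by (intro Max_in) auto
  then obtain x where x: "cf c x \<noteq> 0" "ell x = m" by auto
  have m: "ell w \<le> m" if "cf c w \<noteq> 0" for w unfolding m_def using that by (intro Max_ge) auto
  have "cf (bar c) x = (\<Sum>w | cf c w \<noteq> 0. laurent_bar (cf c w) * cf (Tbar w) x)" by (simp add: bar_def)
  also have "\<dots> = (\<Sum>w | cf c w \<noteq> 0. if w = x then laurent_bar (cf c x) else 0)"
  proof (rule sum.cong[OF refl])
    fix w assume "w \<in> {w. cf c w \<noteq> 0}"
    then have "ell w \<le> ell x" using m x by simp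
    then have "w \<noteq> x ==> cf (Tbar w) x = 0" using cf_Tbar(1)[of w x] by (metis not_less)
    then show "laurent_bar (cf c w) * cf (Tbar w) x = (if w = x then laurent_bar (cf c x) else 0)"
      by (cases "w = x") (simp_all add: cf_Tbar(2))
  qed
  also have "\<dots> = laurent_bar (cf c x)" using x by simp
  finally have "laurent_bar (cf c x) = cf c x" using assms by simp
  then show False using lbar_AN_0 assms x by blast
qed

lemma asym_unique: "bar c = c ==> asymT w c ==> bar d = d ==> asymT w d ==> c = d"
proof -
  assume a: "bar c = c" "asymT w c" "bar d = d" "asymT w d"
  have "cf (c - d) x \<in> AN" for x
    using KS_diff[of "cf c x - cf (Tb w) x" Neg "cf d x - cf (Tb w) x"] a by (simp add: asymT_def)
  then have "c - d = 0" using bar_fixed_AN_0[of "c - d"] a by simp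
  then show ?thesis by simp
qed

text \<open>After normalising with \<open>leading_shift\<close>, read off the coefficient at
  \<open>w k\<close>: all contributions apart from \<open>s * c k\<close> lie in \<open>AN\<close>,
  so \<open>s * c k\<close> would lie there too.\<close>

lemma lead_indep:
  assumes "finite I" "inj_on w I" "\<And>i. i \<in> I ==> asymT (w i) (E i)" "(\<Sum>i\<in>I. sc (c i) (E i)) = 0" "i \<in> I"
  shows "c i = 0"
proof (rule ccontr)
  assume "c i \<noteq> 0"
  then obtain s k where s: "\<And>i. i \<in> I ==> s * c i \<in> KS (insert 0 Neg)" and k: "k \<in> I" "s * c k \<notin> AN"
    using leading_shift[OF assms(1,5)] by blast
  have "cf (\<Sum>i\<in>I. sc (c i) (E i)) (w k) = 0" using assms(4) by simp
  then have "(\<Sum>i\<in>I. c i * cf (E i) (w k)) = 0" by simp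
  then have "s * (\<Sum>i\<in>I. c i * cf (E i) (w k)) = 0" by simp
  then have 0: "(\<Sum>i\<in>I. (s * c i) * cf (E i) (w k)) = 0" by (simp add: sum_distrib_left mult.assoc)
  have eq: "(\<Sum>i\<in>I. (s * c i) * cf (E i) (w k)) = s * c k +
      (\<Sum>i\<in>I. (s * c i) * (cf (E i) (w k) - cf (Tb (w i)) (w k)))"
  proof -
    have "(\<Sum>i\<in>I. (s * c i) * cf (Tb (w i)) (w k)) = (\<Sum>i\<in>I. if i = k then s * c k else 0)"
      using assms(2) k by (intro sum.cong) (auto simp: cf_Tb dest: inj_onD)
    also have "\<dots> = s * c k" using k assms(1) by simp
    finally show ?thesis by (simp add: right_diff_distrib sum_subtractf)
  qed
  have "(\<Sum>i\<in>I. (s * c i) * (cf (E i) (w k) - cf (Tb (w i)) (w k))) \<in> AN"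
  proof (rule KS_sum)
    fix i assume "i \<in> I"
    then have "cf (E i) (w k) - cf (Tb (w i)) (w k) \<in> AN" using assms(3) by (auto simp: asymT_def)
    then show "(s * c i) * (cf (E i) (w k) - cf (Tb (w i)) (w k)) \<in> AN"
      using s[OF \<open>i \<in> I\<close>] by (rule_tac KS_mult[of _ "insert 0 Neg" _ Neg]) (auto simp: Neg_def zero_prod_def)
  qed
  moreover have "s * c k = - (\<Sum>i\<in>I. (s * c i) * (cf (E i) (w k) - cf (Tb (w i)) (w k)))"
    using 0 unfolding eq by (rule eq_neg_iff_add_eq_0[THEN iffD2])
  ultimately show False using k(2) KS_uminus by simp
qed

text \<open>The Kazhdan-Lusztig algorithm for any family that is bar invariant up to lower terms. It
  is run for the \<open>Tb\<close>, for those of a parabolic subgroup, and for the family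
  \<open>Eb\<close>; as the results satisfy the same characterisation, they are the same
  Kazhdan-Lusztig elements.\<close>

lemma KL_triangular:
  fixes rank :: "'i => nat"
  assumes fin: "finite I" and rank: "\<And>i j. R j i ==> rank j < rank i"
    and trans: "\<And>i j k. R k j ==> R j i ==> R k i" and inj: "inj_on w I"
    and E: "\<And>i. i \<in> I ==> asymT (w i) (E i)"
    and bE: "\<And>i. i \<in> I ==> bar (E i) - E i \<in> hk.span (E ` {j \<in> I. R j i})"
  shows "i \<in> I ==> \<exists>c. bar c = c \<and> asymT (w i) c \<and> c - E i \<in> hk.span (E ` {j \<in> I. R j i})"
proof (induction "rank i" arbitrary: i rule: less_induct)
  case less
  define D where "D i = {j \<in> I. R j i}" for i
  have D: "finite (D i)" "D i \<subseteq> I" for i using fin by (auto simp: D_def)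
  have "\<exists>c. bar c = c \<and> asymT (w j) c \<and> c - E j \<in> hk.span (E ` D j)" if "j \<in> D i" for j
    using less.hyps[of j] that rank by (auto simp: D_def)
  then obtain C where C: "\<And>j. j \<in> D i ==> bar (C j) = C j" "\<And>j. j \<in> D i ==> asymT (w j) (C j)"
    "\<And>j. j \<in> D i ==> C j - E j \<in> hk.span (E ` D j)" by metis
  have Dsub: "D j \<subseteq> D i" if "j \<in> D i" for j using that trans by (auto simp: D_def)
  have EC: "E j \<in> hk.span (C ` D i)" if "j \<in> D i" for j
    using that
  proof (induction "rank j" arbitrary: j rule: less_induct)
    case (less j)
    have "E k \<in> hk.span (C ` D i)" if "k \<in> D j" for k
      using less.hyps[of k] that less.prems Dsub rank by (auto simp: D_def)
    then have "hk.span (E ` D j) \<subseteq> hk.span (C ` D i)" by (intro hk.span_minimal) auto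
    then have "C j - E j \<in> hk.span (C ` D i)" using C(3) less.prems by blast
    moreover have "C j \<in> hk.span (C ` D i)" using less.prems by (auto intro: hk.span_base)
    ultimately have "C j - (C j - E j) \<in> hk.span (C ` D i)" by (rule hk.span_diff[rotated])
    then show ?case by simp
  qed
  have CE: "C j \<in> hk.span (E ` D i)" if "j \<in> D i" for j
  proof -
    have "C j - E j \<in> hk.span (E ` D i)" using C(3)[OF that] hk.span_mono[of "E ` D j" "E ` D i"] Dsub[OF that] by blast
    moreover have "E j \<in> hk.span (E ` D i)" using that by (auto intro: hk.span_base)
    ultimately have "(C j - E j) + E j \<in> hk.span (E ` D i)" by (rule hk.span_add)
    then show ?thesis by simp
  qed
  have "hk.span (E ` D i) \<subseteq> hk.span (C ` D i)" using EC by (intro hk.span_minimal) auto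
  then have "bar (E i) - E i \<in> hk.span (C ` D i)" using bE[OF less.prems] by (auto simp: D_def)
  then obtain r where r: "bar (E i) - E i = (\<Sum>j\<in>D i. sc (r j) (C j))" using span_image_sum D(1) by blast
  have "E i - bar (E i) = (\<Sum>j\<in>D i. sc (laurent_bar (r j)) (C j))"
    using arg_cong[OF r, of bar] C(1) by (simp add: bar_sum)
  \<comment> \<open>The defect of bar invariance is negated by bar, so by independence its
    coefficients are antisymmetric and each has the form q minus its bar image. Adding the terms
    with coefficients q repairs the invariance.\<close>
  then have "(\<Sum>j\<in>D i. sc (r j + laurent_bar (r j)) (C j)) = 0"
    using r unfolding hk.scale_left_distrib sum.distrib by (metis add.right_inverse minus_diff_eq)
  then have "r j + laurent_bar (r j) = 0" if "j \<in> D i" for j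
    using lead_indep[of "D i" w C "\<lambda>j. r j + laurent_bar (r j)" j] D C(2) that inj by (auto intro: inj_on_subset)
  then have "laurent_bar (r j) = - r j" if "j \<in> D i" for j using that by (metis add_eq_0_iff)
  then have "\<forall>j\<in>D i. \<exists>q\<in>AN. r j = q - laurent_bar q" using antisym_split by blast
  then obtain q where q: "\<And>j. j \<in> D i ==> q j \<in> AN" "\<And>j. j \<in> D i ==> r j = q j - laurent_bar (q j)" by metis
  let ?c = "E i + (\<Sum>j\<in>D i. sc (q j) (C j))"
  have "bar ?c = (bar (E i) - E i) + E i + (\<Sum>j\<in>D i. sc (laurent_bar (q j)) (C j))"
    using C(1) by (simp add: bar_sum)
  also have "\<dots> = (\<Sum>j\<in>D i. sc (r j) (C j)) + E i + (\<Sum>j\<in>D i. sc (laurent_bar (q j)) (C j))" unfolding r ..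
  also have "(\<Sum>j\<in>D i. sc (r j) (C j)) = (\<Sum>j\<in>D i. sc (q j) (C j)) - (\<Sum>j\<in>D i. sc (laurent_bar (q j)) (C j))"
    unfolding sum_subtractf[symmetric] hk.scale_left_diff_distrib[symmetric] by (rule sum.cong[OF refl]) (simp add: q(2))
  also have "\<dots> + E i + (\<Sum>j\<in>D i. sc (laurent_bar (q j)) (C j)) = ?c" by simp
  finally have "bar ?c = ?c" .
  moreover have "asymT (w i) ?c"
    unfolding asymT_def
  proof
    fix x
    have "(\<Sum>j\<in>D i. q j * cf (C j) x) \<in> AN"
    proof (rule KS_sum)
      fix j assume j: "j \<in> D i"
      have "q j * (cf (C j) x - cf (Tb (w j)) x) + q j * cf (Tb (w j)) x \<in> AN"
      proof (rule KS_add)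
        show "q j * (cf (C j) x - cf (Tb (w j)) x) \<in> AN"
          using C(2)[OF j] q(1)[OF j] by (intro AN_AN) (simp_all add: asymT_def)
        show "q j * cf (Tb (w j)) x \<in> AN" using q(1)[OF j] by (simp add: cf_Tb)
      qed
      then show "q j * cf (C j) x \<in> AN" by (simp add: right_diff_distrib)
    qed
    moreover have "cf (E i) x - cf (Tb (w i)) x \<in> AN" using E[OF less.prems] by (auto simp: asymT_def)
    ultimately have "(cf (E i) x - cf (Tb (w i)) x) + (\<Sum>j\<in>D i. q j * cf (C j) x) \<in> AN" by (rule KS_add[rotated])
    then show "cf ?c x - cf (Tb (w i)) x \<in> AN" by (simp add: algebra_simps)
  qed
  moreover have "?c - E i \<in> hk.span (E ` D i)" using CE by (auto intro!: hk.span_sum hk.span_scale)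
  ultimately show ?case unfolding D_def by blast
qed

definition KLe :: "bperm => hk" where "KLe w = (THE c. bar c = c \<and> asymT w c)"

abbreviation spC :: "bperm set => hk set" where "spC S \<equiv> hk.span (KLe ` S)"

lemma asym_Tb: "asymT w (Tb w)" by (auto simp: asymT_def)

lemma KLe_ex: assumes "w \<in> Wn n"
  shows "bar (KLe w) = KLe w \<and> asymT w (KLe w) \<and> KLe w - Tb w \<in> spT {y. (y, w) \<in> (brel n)\<^sup>+}"
proof -
  have W: "{j \<in> Wn n. (j, i) \<in> (brel n)\<^sup>+} = {j. (j, i) \<in> (brel n)\<^sup>+}" for i using brel_ell by auto
  have "\<exists>c. bar c = c \<and> asymT w c \<and> c - Tb w \<in> spT {j \<in> Wn n. (j, w) \<in> (brel n)\<^sup>+}"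
    by (rule KL_triangular[where rank = ell and w = "\<lambda>w. w" and R = "\<lambda>y w. (y, w) \<in> (brel n)\<^sup>+"])
      (use assms Tbar_lower brel_ell in \<open>auto simp: asym_Tb W\<close>)
  then obtain c where c: "bar c = c" "asymT w c" "c - Tb w \<in> spT {y. (y, w) \<in> (brel n)\<^sup>+}" by (auto simp: W)
  have "KLe w = c" unfolding KLe_def by (rule the_equality) (use c asym_unique in auto)
  then show ?thesis using c by simp
qed

lemma bar_KLe [simp]: "bar (KLe w) = KLe w" and asym_KLe: "asymT w (KLe w)"
  using KLe_ex Wn_ex by blast+

lemma KLe_unique: "bar c = c ==> asymT w c ==> c = KLe w"
  using asym_unique bar_KLe asym_KLe by blast

lemma KLe_triangular:
  fixes rank :: "'i => nat"
  assumes "finite I" "\<And>i j. R j i ==> rank j < rank i"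
    "\<And>i j k. R k j ==> R j i ==> R k i" "inj_on w I"
    "\<And>i. i \<in> I ==> asymT (w i) (E i)"
    "\<And>i. i \<in> I ==> bar (E i) - E i \<in> hk.span (E ` {j \<in> I. R j i})" "i \<in> I"
  shows "KLe (w i) - E i \<in> hk.span (E ` {j \<in> I. R j i})"
proof -
  obtain c where "bar c = c" "asymT (w i) c" "c - E i \<in> hk.span (E ` {j \<in> I. R j i})"
  proof -
    have "\<exists>c. bar c = c \<and> asymT (w i) c \<and> c - E i \<in> hk.span (E ` {j \<in> I. R j i})"
      by (rule KL_triangular[where I = I and rank = rank and R = R and w = w and E = E]) (fact assms)+
    then show thesis using that by blast
  qed
  then show ?thesis using KLe_unique by metis
qed

lemma cf_KLe: "cf (KLe w) w = 1" "cf (KLe w) x \<noteq> 0 ==> x \<noteq> w ==> ell x < ell w" "x \<noteq> w ==> cf (KLe w) x \<in> AN"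
proof -
  obtain n where n: "w \<in> Wn n" using Wn_ex by blast
  have *: "{x. cf (KLe w - Tb w) x \<noteq> 0} \<subseteq> {y. (y, w) \<in> (brel n)\<^sup>+}"
    using KLe_ex[OF n] unfolding span_Tb by blast
  show "cf (KLe w) x \<noteq> 0 ==> x \<noteq> w ==> ell x < ell w"
    using *[THEN subsetD, of x] brel_ell[of x w n] by (auto simp: cf_Tb)
  show "cf (KLe w) w = 1"
    using *[THEN subsetD, of w] brel_ell[of w w n] by auto
  show "x \<noteq> w ==> cf (KLe w) x \<in> AN" using asym_KLe[of w] by (auto simp: asymT_def cf_Tb dest: spec[of _ x])
qed
lemma cf_KLe_brel: "w \<in> Wn n ==> cf (KLe w) x \<noteq> 0 ==> x \<noteq> w ==> (x, w) \<in> (brel n)\<^sup>+"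
proof -
  assume n: "w \<in> Wn n" and x: "cf (KLe w) x \<noteq> 0" "x \<noteq> w"
  have "{x. cf (KLe w - Tb w) x \<noteq> 0} \<subseteq> {y. (y, w) \<in> (brel n)\<^sup>+}"
    using KLe_ex[OF n] unfolding span_Tb by blast
  then have "x \<in> {x. cf (KLe w - Tb w) x \<noteq> 0} ==> ?thesis" by blast
  then show ?thesis using x by (simp add: cf_Tb)
qed
lemma cf_KLe_Wn: "w \<in> Wn n ==> cf (KLe w) x \<noteq> 0 ==> x \<in> Wn n"
  using cf_KLe_brel[of w n x] brel_ell[of x w n] by (cases "x = w") simp_all

lemma KLe_inj: "KLe x = KLe y \<longleftrightarrow> x = y"
proof
  assume e: "KLe x = KLe y"
  show "x = y"
  proof (rule ccontr)
    assume n: "x \<noteq> y"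
    have "ell y < ell x" using cf_KLe(2)[of x y] cf_KLe(1)[of y] e n by simp
    moreover have "ell x < ell y" using cf_KLe(2)[of y x] cf_KLe(1)[of x] e n by simp
    ultimately show False by simp
  qed
qed simp

lemma KLe_indep: "hk.independent (range KLe)"
  unfolding hk.independent_explicit_module
proof (intro allI impI)
  fix t u v assume t: "finite t" "t \<subseteq> range KLe" "(\<Sum>v\<in>t. sc (u v) v) = 0" "v \<in> t"
  define S where "S = {w. KLe w \<in> t}"
  have tS: "t = KLe ` S" using t(2) by (auto simp: S_def)
  have inj: "inj_on KLe S" by (auto simp: inj_on_def KLe_inj)
  have fS: "finite S" using t(1) inj unfolding tS by (rule finite_imageD)
  obtain w where w: "w \<in> S" "v = KLe w" using t(4) tS by auto
  have "(\<Sum>w\<in>S. sc (u (KLe w)) (KLe w)) = 0" using t(3) unfolding tS by (simp add: sum.reindex[OF inj])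
  from lead_indep[OF fS _ _ this w(1), of "\<lambda>w. w"] asym_KLe w(2) show "u v = 0" by auto
qed

lemma Tb_span_KLe: "w \<in> Wn n ==> Tb w \<in> spC (Wn n)"
proof (induction "ell w" arbitrary: w rule: less_induct)
  case less
  have "KLe w - Tb w \<in> spC (Wn n)"
  proof -
    have "spT {y. (y, w) \<in> (brel n)\<^sup>+} \<subseteq> spC (Wn n)"
      using less.hyps brel_ell by (intro hk.span_minimal) auto
    then show ?thesis using KLe_ex[OF less.prems] by blast
  qed
  moreover have "KLe w \<in> spC (Wn n)" using less.prems by (auto intro: hk.span_base)
  ultimately have "KLe w - (KLe w - Tb w) \<in> spC (Wn n)" by (rule hk.span_diff[rotated])
  then show ?case by simp
qed

lemma span_KLe_Wn: "spC (Wn n) = spT (Wn n)"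
proof
  show "spT (Wn n) \<subseteq> spC (Wn n)" using Tb_span_KLe by (intro hk.span_minimal) auto
  show "spC (Wn n) \<subseteq> spT (Wn n)"
    using cf_KLe_Wn by (intro hk.span_minimal) (auto simp: span_Tb)
qed

lemma span_KLe_UNIV: "h \<in> hk.span (range KLe)"
proof -
  have "Tb w \<in> hk.span (range KLe)" for w
  proof -
    obtain n where "w \<in> Wn n" using Wn_ex by blast
    then show ?thesis using Tb_span_KLe hk.span_mono[of "KLe ` Wn n" "range KLe"] by blast
  qed
  then show ?thesis by (subst hk_expand[of h]) (auto intro!: hk.span_sum hk.span_scale)
qed

definition kc :: "hk => bperm => laurent" where "kc h z = hk.representation (range KLe) h (KLe z)"

lemma kc_add: "kc (h + k) z = kc h z + kc k z"
  unfolding kc_def by (simp add: hk.representation_add[OF KLe_indep span_KLe_UNIV span_KLe_UNIV] add.commute)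
lemma kc_sc: "kc (sc c h) z = c * kc h z"
  unfolding kc_def by (simp add: hk.representation_scale[OF KLe_indep span_KLe_UNIV])
lemma kc_KLe: "kc (KLe y) z = (if z = y then 1 else 0)"
  unfolding kc_def by (subst hk.representation_basis[OF KLe_indep]) (auto simp: KLe_inj)
lemma kc_0 [simp]: "kc 0 z = 0" using kc_sc[of 0 0 z] by simp
lemma kc_diff: "kc (h - k) z = kc h z - kc k z"
  using kc_add[of h "sc (-1) k" z] kc_sc[of "-1" k z] by simp
lemma kc_sum: "kc (sum f A) z = (\<Sum>i\<in>A. kc (f i) z)"
  by (induction A rule: infinite_finite_induct) (auto simp: kc_add)

lemma finite_kc [simp]: "finite {z. kc h z \<noteq> 0}"
proof -
  have "finite {b. hk.representation (range KLe) h b \<noteq> 0}" by (rule hk.finite_representation)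
  then have "finite (KLe ` {z. kc h z \<noteq> 0})" by (rule rev_finite_subset) (auto simp: kc_def)
  then show ?thesis by (rule finite_imageD) (auto simp: inj_on_def KLe_inj)
qed

lemma kc_expand: "h = (\<Sum>z | kc h z \<noteq> 0. sc (kc h z) (KLe z))"
proof -
  have "{b. hk.representation (range KLe) h b \<noteq> 0} = KLe ` {z. kc h z \<noteq> 0}"
    using hk.representation_ne_zero by (fastforce simp: kc_def)
  moreover have "inj_on KLe {z. kc h z \<noteq> 0}" by (auto simp: inj_on_def KLe_inj)
  ultimately show ?thesis
    using hk.sum_nonzero_representation_eq[OF KLe_indep span_KLe_UNIV, of h]
    by (simp add: sum.reindex kc_def)
qed

lemma kc_span: "h \<in> spC F \<longleftrightarrow> (\<forall>z. kc h z \<noteq> 0 --> z \<in> F)"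
proof
  assume "h \<in> spC F"
  then show "\<forall>z. kc h z \<noteq> 0 --> z \<in> F"
    by (induction rule: hk.span_induct_alt)
      (auto simp: kc_add kc_sc kc_KLe split: if_splits)
next
  assume "\<forall>z. kc h z \<noteq> 0 --> z \<in> F"
  then show "h \<in> spC F"
    by (subst kc_expand[of h], intro hk.span_sum hk.span_scale hk.span_base) auto
qed

lemma kc_eqI: assumes "finite S" "h = (\<Sum>z\<in>S. sc (c z) (KLe z))" shows "kc h z = (if z \<in> S then c z else 0)"
  unfolding assms(2) kc_sum kc_sc kc_KLe using assms(1) by (simp add: if_distrib cong: if_cong)

section \<open>The element of a_m, parabolic subgroups and a basis graded by sign changes\<close>

section \<open>The elements of the algebra attached to the $a_m$\<close>

lemma ell_gen_gen: "i \<noteq> j ==> ell (gen i * gen j) = 2"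
proof -
  assume "i \<noteq> j"
  have "gen i * gen j \<noteq> 1"
  proof
    assume "gen i * gen j = 1"
    then have "gen j = gen i" by (metis gen_gen(2) mult.right_neutral)
    then show False using \<open>i \<noteq> j\<close> by simp
  qed
  then have "ell (gen i * gen j) \<noteq> 0" by simp
  then show ?thesis using ell_left_cases[of i "gen j"] by auto
qed

lemma tt_tt: "i \<noteq> j ==> tt i * tt j = Tb (gen i * gen j)"
  by (rule Tb_mult) (simp add: ell_gen_gen)

lemma gen_comm: "Suc i < j ==> gen i * gen j = gen j * gen i"
  by (rule bperm_eqI_pos) (simp add: gen_apply)

lemma tt_comm: "Suc i < j \<or> Suc j < i ==> tt i * tt j = tt j * tt i"
  using gen_comm[of i j] gen_comm[of j i] by (auto simp: tt_tt)

lemma gen_braid: "i > 0 ==> gen i * (gen (Suc i) * gen i) = gen (Suc i) * (gen i * gen (Suc i))"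
  by (rule bperm_eqI_pos) (simp add: gen_apply)

lemma tt_braid: assumes "i > 0" shows "tt i * tt (Suc i) * tt i = tt (Suc i) * tt i * tt (Suc i)"
proof -
  have "ell (gen i * (gen (Suc i) * gen i)) > ell (gen (Suc i) * gen i)"
    using ell_left_cases[of i "gen (Suc i) * gen i"] ell_less_left[of i "gen (Suc i) * gen i"] assms
    by (auto simp: ra_def rb_def gen_apply)
  moreover have "ell (gen (Suc i) * (gen i * gen (Suc i))) > ell (gen i * gen (Suc i))"
    using ell_left_cases[of "Suc i" "gen i * gen (Suc i)"] ell_less_left[of "Suc i" "gen i * gen (Suc i)"] assms
    by (auto simp: ra_def rb_def gen_apply)
  ultimately show ?thesis unfolding mult.assoc using assms gen_braid by (simp add: tt_tt) (simp add: tt_Tb)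
qed

lemma gen_braid0: "gen 0 * (gen 1 * (gen 0 * gen 1)) = gen 1 * (gen 0 * (gen 1 * gen 0))"
  by (rule bperm_eqI_pos) (simp add: gen_apply)

lemma tt_braid0: "tt 0 * tt 1 * tt 0 * tt 1 = tt 1 * tt 0 * tt 1 * tt 0"
proof -
  have l: "ell (gen 1 * (gen 0 * gen 1)) > ell (gen 0 * gen 1)" "ell (gen 0 * (gen 1 * gen 0)) > ell (gen 1 * gen 0)"
    using ell_left_cases[of 1 "gen 0 * gen 1"] ell_less_left[of 1 "gen 0 * gen 1"]
      ell_left_cases[of 0 "gen 1 * gen 0"] ell_less_left[of 0 "gen 1 * gen 0"]
    by (auto simp: ra_def rb_def gen_apply)
  have l2: "ell (gen 0 * (gen 1 * (gen 0 * gen 1))) > ell (gen 1 * (gen 0 * gen 1))"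
     "ell (gen 1 * (gen 0 * (gen 1 * gen 0))) > ell (gen 0 * (gen 1 * gen 0))"
    using ell_left_cases[of 0 "gen 1 * (gen 0 * gen 1)"] ell_less_left[of 0 "gen 1 * (gen 0 * gen 1)"]
      ell_left_cases[of 1 "gen 0 * (gen 1 * gen 0)"] ell_less_left[of 1 "gen 0 * (gen 1 * gen 0)"]
    by (auto simp: ra_def rb_def gen_apply)
  have "tt 0 * (tt 1 * (tt 0 * tt 1)) = tt 1 * (tt 0 * (tt 1 * tt 0))"
    unfolding tt_tt[OF zero_neq_one] tt_tt[OF one_neq_zero] using l l2 gen_braid0 by (simp add: tt_Tb)
  then show ?thesis by (simp only: mult.assoc)
qed

lemma ti_comm: assumes "x * tt j = tt j * x" shows "x * ti j = ti j * x"
  by (simp add: ti_def algebra_simps assms)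

lemma ti_swap: assumes "tt k * x = x * tt j" shows "x * ti j = ti k * x"
proof -
  have "ti k * (tt k * x) * ti j = ti k * (x * tt j) * ti j" by (simp add: assms)
  then show ?thesis by (simp add: mult.assoc)
qed

text \<open>\<open>Pm m\<close> is the basis element of s_1 ... s_m and \<open>Qm m\<close> its bar
  image. \<open>Zm\<close> and \<open>Zi\<close> are the same products with all indices raised by
  one, so that they commute with T_t.\<close>

primrec Pm :: "nat => hk" where "Pm 0 = 1" | "Pm (Suc m) = Pm m * tt (Suc m)"
primrec Qm :: "nat => hk" where "Qm 0 = 1" | "Qm (Suc m) = Qm m * ti (Suc m)"
primrec Zm :: "nat => hk" where "Zm 0 = 1" | "Zm (Suc m) = Zm m * tt (Suc (Suc m))"
primrec Zi :: "nat => hk" where "Zi 0 = 1" | "Zi (Suc m) = Zi m * ti (Suc (Suc m))"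

lemma Pm_Zm: "Pm (Suc k) = tt 1 * Zm k" by (induction k) (auto simp: mult.assoc)
lemma Qm_Zi: "Qm (Suc k) = ti 1 * Zi k" by (induction k) (auto simp: mult.assoc)

lemma tt_Pm_far: "j > Suc m ==> tt j * Pm m = Pm m * tt j"
  by (induction m) (simp_all add: mult.assoc tt_comm, metis mult.assoc tt_comm)
lemma tt_Qm_far: "j > Suc m ==> tt j * Qm m = Qm m * tt j"
proof (induction m)
  case (Suc m)
  then have "tt j * ti (Suc m) = ti (Suc m) * tt j" by (intro ti_comm tt_comm) auto
  then show ?case using Suc by (simp add: mult.assoc) (metis Suc_lessD mult.assoc)
qed simp
lemma tt0_Zm: "tt 0 * Zm m = Zm m * tt 0"
  by (induction m) (simp_all add: mult.assoc tt_comm, metis mult.assoc)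
lemma tt0_Zi: "tt 0 * Zi m = Zi m * tt 0"
proof (induction m)
  case (Suc m)
  have "tt 0 * ti (Suc (Suc m)) = ti (Suc (Suc m)) * tt 0" by (intro ti_comm tt_comm) auto
  then show ?case using Suc by (simp add: mult.assoc) (metis mult.assoc)
qed simp

text \<open>Conjugation by the cycle s_1 ... s_m raises the index of a generator by one; the braid
  relation enters where i meets the last two factors. \<open>Qm_shift\<close> is the analogue for
  inverse generators.\<close>

lemma Pm_shift: "i > 0 ==> i < m ==> tt (Suc i) * Pm m = Pm m * tt i"
proof (induction m)
  case (Suc m)
  show ?case
  proof (cases "i = m")
    case True
    then obtain k where k: "m = Suc k" using Suc by (cases m) auto
    have "tt (Suc (Suc k)) * Pm k = Pm k * tt (Suc (Suc k))" by (rule tt_Pm_far) simp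
    then have "tt (Suc m) * Pm (Suc m) = Pm k * (tt (Suc (Suc k)) * tt (Suc k) * tt (Suc (Suc k)))"
      unfolding k by (simp add: mult.assoc[symmetric])
    also have "\<dots> = Pm k * (tt (Suc k) * tt (Suc (Suc k)) * tt (Suc k))" using tt_braid[of "Suc k"] by simp
    finally show ?thesis by (simp add: True k mult.assoc)
  next
    case False
    then have "tt (Suc i) * Pm (Suc m) = Pm m * (tt i * tt (Suc m))"
      using Suc by (simp add: mult.assoc[symmetric])
    also have "tt i * tt (Suc m) = tt (Suc m) * tt i" using False Suc.prems by (intro tt_comm) auto
    finally show ?thesis by (simp add: mult.assoc)
  qed
qed simp

lemma ti_braid: assumes "i > 0" shows "tt (Suc i) * ti i * ti (Suc i) = ti i * ti (Suc i) * tt i"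
proof -
  have "tt i * (tt (Suc i) * tt i) = tt (Suc i) * tt i * tt (Suc i)" using tt_braid[OF assms] by (simp add: mult.assoc)
  then have "ti i * (tt i * (tt (Suc i) * tt i)) * (ti (Suc i)) = ti i * (tt (Suc i) * tt i * tt (Suc i)) * ti (Suc i)" by simp
  then have 1: "tt (Suc i) * (tt i * ti (Suc i)) = ti i * (tt (Suc i) * tt i)" by (simp add: mult.assoc)
  have "tt i * (tt (Suc i) * ti i) = ti (Suc i) * (tt i * tt (Suc i))"
  proof -
    have "ti (Suc i) * (tt (Suc i) * tt i * tt (Suc i)) * ti i = ti (Suc i) * (tt i * tt (Suc i) * tt i) * ti i"
      using tt_braid[OF assms] by simp
    then show ?thesis by (simp add: mult.assoc)
  qed
  have "tt i * (tt (Suc i) * (ti i * ti (Suc i))) = ti (Suc i) * tt i"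
    using \<open>tt i * (tt (Suc i) * ti i) = ti (Suc i) * (tt i * tt (Suc i))\<close> by (simp add: mult.assoc[symmetric]) (simp add: mult.assoc)
  then have "ti (Suc i) * tt i = tt i * (tt (Suc i) * (ti i * ti (Suc i)))" by simp
  then have "ti i * (ti (Suc i) * tt i) = tt (Suc i) * (ti i * ti (Suc i))" by simp
  then show ?thesis by (simp add: mult.assoc)
qed

lemma Qm_shift: "i > 0 ==> i < m ==> tt (Suc i) * Qm m = Qm m * tt i"
proof (induction m)
  case (Suc m)
  show ?case
  proof (cases "i = m")
    case True
    then obtain k where k: "m = Suc k" using Suc by (cases m) auto
    have "tt (Suc (Suc k)) * Qm k = Qm k * tt (Suc (Suc k))" by (rule tt_Qm_far) simp
    then have "tt (Suc m) * Qm (Suc m) = Qm k * (tt (Suc (Suc k)) * ti (Suc k) * ti (Suc (Suc k)))"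
      unfolding k by (simp add: mult.assoc[symmetric])
    also have "\<dots> = Qm k * (ti (Suc k) * ti (Suc (Suc k)) * tt (Suc k))" using ti_braid[of "Suc k"] by simp
    finally show ?thesis by (simp add: True k mult.assoc)
  next
    case False
    then have "tt (Suc i) * Qm (Suc m) = Qm m * (tt i * ti (Suc m))"
      using Suc by (simp add: mult.assoc[symmetric])
    also have "tt i * ti (Suc m) = ti (Suc m) * tt i" using False Suc.prems by (intro ti_comm tt_comm) auto
    finally show ?thesis by (simp add: mult.assoc)
  qed
qed simp

lemma Zm_Pm: "j < m ==> Zm j * Pm m = Pm m * Pm j"
proof (induction j)
  case (Suc j)
  then have "Zm (Suc j) * Pm m = Zm j * (Pm m * tt (Suc j))" using Pm_shift[of "Suc j" m] by (simp add: mult.assoc)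
  then show ?case using Suc by (simp add: mult.assoc[symmetric])
qed simp
lemma Zi_Pm: "j < m ==> Zi j * Pm m = Pm m * Qm j"
proof (induction j)
  case (Suc j)
  then have "Pm m * ti (Suc j) = ti (Suc (Suc j)) * Pm m" by (intro ti_swap Pm_shift) auto
  then have "Zi (Suc j) * Pm m = Zi j * (Pm m * ti (Suc j))" by (simp add: mult.assoc)
  then show ?case using Suc by (simp add: mult.assoc[symmetric])
qed simp
lemma Zi_Qm: "j < m ==> Zi j * Qm m = Qm m * Qm j"
proof (induction j)
  case (Suc j)
  then have "Qm m * ti (Suc j) = ti (Suc (Suc j)) * Qm m" by (intro ti_swap Qm_shift) auto
  then have "Zi (Suc j) * Qm m = Zi j * (Qm m * ti (Suc j))" by (simp add: mult.assoc)
  then show ?case using Suc by (simp add: mult.assoc[symmetric])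
qed simp

text \<open>\<open>CA m\<close> will turn out to be the Kazhdan--Lusztig basis element of $a_m$.\<close>

primrec CA :: "nat => hk" where
  "CA 0 = 1"
| "CA (Suc m) = (tt 0 * Pm m + sc (vgi 0) (Qm m)) * CA m"

text \<open>\<open>h * CA m\<close> is an eigenvector of T_t for the eigenvalue V.\<close>

definition vact :: "nat => hk => bool" where
  "vact m h \<longleftrightarrow> tt 0 * (h * CA m) = sc (vg 0) (h * CA m)"

lemma vact_add: "vact m h ==> vact m k ==> vact m (h + k)" and vact_sc: "vact m h ==> vact m (sc c h)"
  by (auto simp: vact_def algebra_simps hk.scale_right_distrib mult.commute)

lemma CA_far: "i > m ==> tt i * CA m = CA m * tt i"
proof (induction m)
  case (Suc m)
  have "tt i * (tt 0 * Pm m + sc (vgi 0) (Qm m)) = (tt 0 * Pm m + sc (vgi 0) (Qm m)) * tt i"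
    using Suc.prems tt_Pm_far[of m i] tt_Qm_far[of m i] tt_comm[of i 0]
    by (simp add: distrib_left distrib_right) (metis mult.assoc)
  moreover have "tt i * CA m = CA m * tt i" using Suc by simp
  ultimately show ?case by (simp add: mult.assoc) (metis mult.assoc)
qed simp

lemma Qm_CA_right:
  assumes "\<And>i. 0 < i ==> i < m ==> tt i * CA m = CA m * tt (m - i)" "k < m"
  shows "\<exists>h. Qm k * CA m = CA m * h" "\<exists>h. Pm k * CA m = CA m * h"
proof -
  have "\<exists>h. Qm k * CA m = CA m * h \<and> (\<exists>h. Pm k * CA m = CA m * h)"
    using assms(2)
  proof (induction k)
    case (Suc k)
    then obtain h h' where h: "Qm k * CA m = CA m * h" "Pm k * CA m = CA m * h'" by auto
    have a: "tt (Suc k) * CA m = CA m * tt (m - Suc k)" using assms(1)[of "Suc k"] Suc by simp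
    then have "CA m * ti (m - Suc k) = ti (Suc k) * CA m" by (rule ti_swap)
    then have "Qm (Suc k) * CA m = CA m * (h * ti (m - Suc k))" using h by (simp add: mult.assoc) (metis mult.assoc)
    moreover have "Pm (Suc k) * CA m = CA m * (h' * tt (m - Suc k))" using h a by (simp add: mult.assoc) (metis mult.assoc)
    ultimately show ?case by blast
  next
    case 0 show ?case by (intro exI[of _ 1] conjI) simp_all
  qed
  then show "\<exists>h. Qm k * CA m = CA m * h" "\<exists>h. Pm k * CA m = CA m * h" by auto
qed

text \<open>The difference of \<open>Pm m\<close> and its bar image is what threatens bar invariance
  of the recursion; it lands in the V-eigenspace of T_t. Peeling off the last factor leaves
  \<open>xg\<close> times \<open>Qm k\<close>, which for k < m can be moved to the right of
  \<open>CA m\<close>. R collects the peeled factors.\<close>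

lemma vact_PQ:
  assumes F1: "\<And>i. 0 < i ==> i < m ==> tt i * CA m = CA m * tt (m - i)"
    and F3: "m > 0 ==> tt 0 * CA m = sc (vg 0) (CA m)"
  shows "k \<le> m ==> (\<And>j. j < k ==> tt j * R = R * tt j) ==> vact m ((Pm k - Qm k) * R)"
proof (induction k arbitrary: R)
  case 0 then show ?case by (simp add: vact_def)
next
  case (Suc k)
  have c: "tt j * R = R * tt j" if "j < Suc k" for j using Suc.prems that by blast
  have "(Pm (Suc k) - Qm (Suc k)) * R = (Pm k - Qm k) * (tt (Suc k) * R) + sc (xg (Suc k)) (Qm k * R)"
    by (simp add: ti_def algebra_simps)
  moreover have "vact m ((Pm k - Qm k) * (tt (Suc k) * R))"
  proof (rule Suc.IH)
    fix j assume j: "j < k"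
    have "tt j * tt (Suc k) = tt (Suc k) * tt j" using j by (intro tt_comm) auto
    then show "tt j * (tt (Suc k) * R) = tt (Suc k) * R * tt j" using c[of j] j
      by (metis mult.assoc less_SucI)
  qed (use Suc.prems in auto)
  moreover have "vact m (Qm k * R)"
  proof -
    have "Qm j * R = R * Qm j" if "j \<le> k" for j
      using that
    proof (induction j)
      case (Suc j)
      have "R * ti (Suc j) = ti (Suc j) * R" by (rule ti_comm) (use c[of "Suc j"] Suc in auto)
      then show ?case using Suc by (simp add: mult.assoc) (metis Suc_leD mult.assoc)
    qed simp
    then have 1: "Qm k * R * CA m = R * (Qm k * CA m)" by (simp add: mult.assoc)
    have "k < m" using Suc.prems by simp
    from Qm_CA_right(1)[OF F1 this] obtain h where h: "Qm k * CA m = CA m * h" by blast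
    have "tt 0 * (R * (CA m * h)) = R * (tt 0 * CA m) * h" using c[of 0] by (simp add: mult.assoc[symmetric])
    then show ?thesis using F3 Suc.prems unfolding vact_def 1 h by (simp add: mult.assoc)
  qed
  ultimately show ?case using vact_add vact_sc by simp
qed

lemma tt_sq2: "tt i * (tt i * h) = h + sc (xg i) (tt i * h)"
  using tt_sq[of i] by (simp add: mult.assoc[symmetric] distrib_right)

text \<open>The shift lemmas do not reach s_1, which has to pass two factors of the recursion at
  once. Their product is expanded in powers of \<open>vgi 0\<close>; each coefficient turns s_1 into
  s_(k+1), the leading one by the braid relation of order 4 and the middle one by the quadratic
  relation.\<close>

lemma CA_swap1:
  "tt 1 * CA (Suc (Suc k)) = CA (Suc (Suc k)) * tt (Suc k)"
proof -
  let ?m = "Suc k"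
  define B where "B = Zi k * Pm k"
  have far: "tt ?m * CA k = CA k * tt ?m" by (rule CA_far) simp
  have xgm: "xg ?m = xg 1" by (simp add: xg_def vg_def vgi_def)
  have Pm: "Pm ?m = tt 1 * Zm k" "Pm ?m = Pm k * tt ?m" using Pm_Zm by auto
  have Qm: "Qm ?m = ti 1 * Zi k" "Qm ?m = Qm k * ti ?m" using Qm_Zi by auto
  have a: "tt 1 * (tt 0 * Pm ?m * (tt 0 * Pm k)) = tt 0 * Pm ?m * (tt 0 * Pm k) * tt ?m"
  proof -
    have l: "tt 0 * Pm ?m * (tt 0 * Pm k) = tt 0 * tt 1 * tt 0 * (Zm k * Pm k)"
      unfolding Pm(1) using tt0_Zm[of k] by (metis mult.assoc)
    have "tt 0 * Pm ?m * (tt 0 * Pm k) * tt ?m = tt 0 * tt 1 * tt 0 * (Zm k * Pm ?m)"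
      unfolding l unfolding Pm(2) by (simp only: mult.assoc)
    also have "\<dots> = tt 0 * tt 1 * tt 0 * (tt 1 * Zm k * Pm k)" using Zm_Pm[of k ?m] Pm(1) by simp
    also have "\<dots> = tt 0 * tt 1 * tt 0 * tt 1 * (Zm k * Pm k)" by (simp only: mult.assoc)
    also have "\<dots> = tt 1 * tt 0 * tt 1 * tt 0 * (Zm k * Pm k)" using tt_braid0 by simp
    finally show ?thesis unfolding l by (simp only: mult.assoc)
  qed
  have b: "tt 1 * (Qm ?m * Qm k) = Qm ?m * Qm k * tt ?m"
  proof -
    have "Qm ?m * Qm k * tt ?m = Zi k * (Qm k * ti ?m) * tt ?m" using Zi_Qm[of k ?m] Qm(2) by simp
    also have "\<dots> = Zi k * Qm k" by (simp add: mult.assoc)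
    finally have 1: "Qm ?m * Qm k * tt ?m = Zi k * Qm k" .
    show ?thesis unfolding 1 unfolding Qm(1) by (simp add: mult.assoc)
  qed
  have c1: "tt 0 * Pm ?m * Qm k = tt 0 * B * tt ?m"
    using Zi_Pm[of k ?m] unfolding B_def Pm(2) by (simp add: mult.assoc)
  have c2: "Qm ?m * (tt 0 * Pm k) = ti 1 * (tt 0 * B)"
    unfolding Qm(1) B_def using tt0_Zi[of k] by (metis mult.assoc)
  have c: "tt 1 * (tt 0 * Pm ?m * Qm k + Qm ?m * (tt 0 * Pm k)) = (tt 0 * Pm ?m * Qm k + Qm ?m * (tt 0 * Pm k)) * tt ?m"
  proof -
    have s: "tt 0 * B * tt ?m * tt ?m = tt 0 * B + sc (xg 1) (tt 0 * B * tt ?m)"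
      using tt_sq[of ?m] xgm by (simp add: mult.assoc distrib_left)
    show ?thesis unfolding c1 c2 distrib_left distrib_right s by (simp add: ti_eq algebra_simps tt_sq2)
  qed
  let ?M = "(tt 0 * Pm ?m + sc (vgi 0) (Qm ?m)) * (tt 0 * Pm k + sc (vgi 0) (Qm k))"
  have M: "?M = tt 0 * Pm ?m * (tt 0 * Pm k) + sc (vgi 0) (tt 0 * Pm ?m * Qm k + Qm ?m * (tt 0 * Pm k)) + sc (vgi 0 * vgi 0) (Qm ?m * Qm k)"
    by (simp add: distrib_left distrib_right hk.scale_right_distrib del: Pm.simps Qm.simps)
  have "tt 1 * ?M = ?M * tt ?m"
    unfolding M distrib_left[of "tt 1"] distrib_right[of _ _ "tt ?m"] sc_mult_left sc_mult_right a b
      c[unfolded distrib_left[of "tt 1"] distrib_right[of _ _ "tt ?m"]] ..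
  then have "tt 1 * (?M * CA k) = ?M * (tt ?m * CA k)" unfolding mult.assoc[symmetric] by (rule arg_cong)
  also have "\<dots> = ?M * CA k * tt ?m" unfolding far by (rule mult.assoc[symmetric])
  finally show ?thesis unfolding CA.simps mult.assoc .
qed

text \<open>The three facts are proved together: the commutation rule and the eigenvalue for m give
  the relation \<open>key\<close> through \<open>vact_PQ\<close>, and from \<open>key\<close> the
  eigenvalue and bar invariance for m + 1 follow by expansion.\<close>

lemma CA_facts:
  "(\<forall>i. 0 < i --> i < m --> tt i * CA m = CA m * tt (m - i)) \<and> (m > 0 --> tt 0 * CA m = sc (vg 0) (CA m)) \<and> bar (CA m) = CA m"
proof (induction m)
  case (Suc m)
  then have F1: "\<And>i. 0 < i ==> i < m ==> tt i * CA m = CA m * tt (m - i)"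
    and F3: "m > 0 ==> tt 0 * CA m = sc (vg 0) (CA m)" and F4: "bar (CA m) = CA m" by auto
  have "vact m ((Pm m - Qm m) * 1)" by (rule vact_PQ) (use F1 F3 in auto)
  then have key: "tt 0 * (Pm m * CA m) = tt 0 * (Qm m * CA m) + sc (vg 0) (Pm m * CA m) - sc (vg 0) (Qm m * CA m)"
    by (simp add: vact_def algebra_simps hk.scale_right_diff_distrib)
  have 1: "tt i * CA (Suc m) = CA (Suc m) * tt (Suc m - i)" if i: "0 < i" "i < Suc m" for i
  proof (cases "i = 1")
    case True
    then obtain k where "m = Suc k" using i by (cases m) auto
    then show ?thesis using CA_swap1[of k] True by simp
  next
    case False
    then obtain j where j: "i = Suc j" "0 < j" "j < m" using i by (cases i) auto
    have "tt i * (tt 0 * Pm m + sc (vgi 0) (Qm m)) = (tt 0 * Pm m + sc (vgi 0) (Qm m)) * tt j"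
      using Pm_shift[OF j(2,3)] Qm_shift[OF j(2,3)] tt_comm[of i 0] j
      by (simp add: distrib_left distrib_right) (metis mult.assoc)
    moreover have "tt j * CA m = CA m * tt (m - j)" using F1 j by simp
    ultimately show ?thesis using j by (simp add: mult.assoc) (metis mult.assoc)
  qed
  have vv: "sc (xg 0) h = sc (vg 0) h - sc (vgi 0) h" for h by (simp add: xg_def hk.scale_left_diff_distrib)
  have 2: "tt 0 * CA (Suc m) = sc (vg 0) (CA (Suc m))"
  proof -
    have "tt 0 * CA (Suc m) = tt 0 * (tt 0 * (Pm m * CA m)) + sc (vgi 0) (tt 0 * (Qm m * CA m))"
      by (simp add: algebra_simps)
    also have "tt 0 * (tt 0 * (Pm m * CA m)) = Pm m * CA m + sc (vg 0) (tt 0 * (Pm m * CA m)) - sc (vgi 0) (tt 0 * (Pm m * CA m))"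
      unfolding tt_sq2 vv by simp
    also have "sc (vgi 0) (tt 0 * (Pm m * CA m)) = sc (vgi 0) (tt 0 * (Qm m * CA m)) + Pm m * CA m - Qm m * CA m"
      unfolding key by (simp add: hk.scale_right_distrib hk.scale_right_diff_distrib)
    finally show ?thesis by (simp add: algebra_simps hk.scale_right_distrib)
  qed
  have barPm: "bar (Pm m) = Qm m" for m by (induction m) auto
  have barQm: "bar (Qm m) = Pm m" for m by (induction m) auto
  have 3: "bar (CA (Suc m)) = CA (Suc m)"
  proof -
    have "bar (CA (Suc m)) = ti 0 * (Qm m * CA m) + sc (vg 0) (Pm m * CA m)"
      by (simp add: F4 barPm barQm distrib_right mult.assoc)
    also have "\<dots> = tt 0 * (Qm m * CA m) - sc (vg 0) (Qm m * CA m) + sc (vgi 0) (Qm m * CA m) + sc (vg 0) (Pm m * CA m)"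
      unfolding ti_eq vv by simp
    also have "\<dots> = tt 0 * (Pm m * CA m) + sc (vgi 0) (Qm m * CA m)" unfolding key by simp
    finally show ?thesis by (simp add: distrib_right mult.assoc)
  qed
  show ?case using 1 2 3 by blast
qed simp

lemma CA_swap: "0 < i ==> i < m ==> tt i * CA m = CA m * tt (m - i)"
  and CA_0: "m > 0 ==> tt 0 * CA m = sc (vg 0) (CA m)" and bar_CA [simp]: "bar (CA m) = CA m"
  using CA_facts[of m] by auto

lemma CA_0_Pm: assumes "k < m" shows "tt 0 * (Pm k * CA m) = sc (vg 0) (Pm k * CA m)"
proof -
  obtain h where "Pm k * CA m = CA m * h" using Qm_CA_right(2)[of m k] CA_swap assms by blast
  then show ?thesis using CA_0[of m] assms by (simp add: mult.assoc[symmetric])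
qed

section \<open>Parabolic subgroups and coset representatives\<close>

text \<open>\<open>Sy n\<close> is the symmetric group of degree n, \<open>WJ m n\<close> its
  parabolic subgroup preserving {1..m}, and \<open>Ym m n\<close> the set of minimal left coset
  representatives of the latter.\<close>

definition Sy :: "nat => bperm set" where "Sy n = {w \<in> Wn n. \<forall>i>0. w $ i > 0}"
definition WJ :: "nat => nat => bperm set" where
  "WJ m n = {w \<in> Sy n. \<forall>i>0. w $ i \<le> int m \<longleftrightarrow> i \<le> int m}"
definition Ym :: "nat => nat => bperm set" where
  "Ym m n = {a \<in> Sy n. \<forall>i>0. i \<noteq> int m --> a $ i < a $ (i + 1)}"

lemma Sy_pos: "w \<in> Sy n ==> 0 < i ==> 0 < w $ i" by (auto simp: Sy_def)
lemma Sy_pos_iff: "w \<in> Sy n ==> 0 < w $ i \<longleftrightarrow> 0 < i"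
proof -
  assume w: "w \<in> Sy n"
  have "w $ i < 0" if "i < 0" using Sy_pos[OF w, of "-i"] that by simp
  then show ?thesis using Sy_pos[OF w] by (metis bap_zero less_asym linorder_neqE less_irrefl)
qed
lemma Sy_Wn: "w \<in> Sy n ==> w \<in> Wn n" by (auto simp: Sy_def)
lemma Sy_one [simp]: "1 \<in> Sy n" by (auto simp: Sy_def)
lemma Sy_times [intro]: "x \<in> Sy n ==> y \<in> Sy n ==> x * y \<in> Sy n" by (auto simp: Sy_def)
lemma Sy_inverse: "x \<in> Sy n ==> inverse x \<in> Sy n"
proof -
  assume x: "x \<in> Sy n"
  have "inverse x $ i > 0" if "i > 0" for i using Sy_pos_iff[OF x, of "inverse x $ i"] that by simp
  then show ?thesis using x by (auto simp: Sy_def)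
qed
lemma Sy_inverse_iff [simp]: "inverse x \<in> Sy n \<longleftrightarrow> x \<in> Sy n"
  using Sy_inverse[of x n] Sy_inverse[of "inverse x" n] by auto
lemma gen_Sy: "0 < i ==> i < n ==> gen i \<in> Sy n"
  by (auto simp: Sy_def gen_apply)
lemma Sy_range: "w \<in> Sy n ==> 0 < i ==> i \<le> int n ==> w $ i \<le> int n"
  using Wn_abs[of w n i] by (auto simp: Sy_def)

lemma WJ_Sy: "w \<in> WJ m n ==> w \<in> Sy n" by (auto simp: WJ_def)
lemma WJ_one [simp]: "1 \<in> WJ m n" by (auto simp: WJ_def)
lemma WJ_times [intro]: "x \<in> WJ m n ==> y \<in> WJ m n ==> x * y \<in> WJ m n"
  using Sy_pos by (fastforce simp: WJ_def)
lemma WJ_inverse: "x \<in> WJ m n ==> inverse x \<in> WJ m n"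
proof -
  assume x: "x \<in> WJ m n"
  then have s: "inverse x \<in> Sy n" using WJ_Sy by simp
  have "inverse x $ i \<le> int m \<longleftrightarrow> i \<le> int m" if "i > 0" for i
  proof -
    have "inverse x $ i > 0" using Sy_pos[OF s that] .
    then have "x $ (inverse x $ i) \<le> int m \<longleftrightarrow> inverse x $ i \<le> int m" using x unfolding WJ_def by blast
    then show ?thesis by simp
  qed
  then show ?thesis using s by (simp add: WJ_def)
qed
lemma gen_WJ: "0 < i ==> i < n ==> i \<noteq> m ==> gen i \<in> WJ m n"
  using gen_Sy[of i n] by (auto simp: WJ_def gen_apply)

lemma Ym_Sy: "a \<in> Ym m n ==> a \<in> Sy n" by (auto simp: Ym_def)
lemma Ym_one [simp]: "1 \<in> Ym m n" by (auto simp: Ym_def)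

lemma int_chain_less:
  fixes f :: "int => int"
  assumes "p < q" "\<And>i. p \<le> i ==> i < q ==> f i < f (i + 1)"
  shows "f p < f q"
proof -
  have "f p < f (p + 1 + int k)" if "p + 1 + int k \<le> q" for k
    using that
  proof (induction k)
    case (Suc k) then show ?case using assms(2)[of "p + 1 + int k"] by (simp add: add.assoc)
  qed (use assms(2)[of p] assms(1) in simp)
  from this[of "nat (q - p - 1)"] assms(1) show ?thesis by simp
qed

lemma Ym_mono: assumes "a \<in> Ym m n" "0 < p" "p < q" "q \<le> int m \<or> int m < p" shows "a $ p < a $ q"
  using assms by (intro int_chain_less[of p q "\<lambda>i. a $ i"]) (auto simp: Ym_def)

lemma ell_add_pos:
  assumes y: "y \<in> Sy n" and *: "\<And>p q. 0 < p ==> p < q ==> inverse y $ q < inverse y $ p ==> x $ p < x $ q"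
  shows "ell (x * y) = ell x + ell y"
proof (rule ell_add)
  fix a b :: int assume ab: "a < b" "a \<noteq> 0" "b \<noteq> 0" "inverse y $ b < inverse y $ a"
  have iy: "inverse y \<in> Sy n" using y by simp
  show "x $ a < x $ b"
  proof (cases "a > 0")
    case True then show ?thesis using * ab by blast
  next
    case False
    then have a: "a < 0" using ab by simp
    then have "inverse y $ a < 0" using Sy_pos_iff[OF iy, of "-a"] by simp
    then have "inverse y $ b < 0" using ab by simp
    then have "b < 0" using Sy_pos_iff[OF iy, of b] ab by linarith
    then have "x $ (- b) < x $ (- a)" using ab by (intro *) auto
    then show ?thesis by simp
  qed
qed

lemma ell_Ym_WJ: assumes "a \<in> Ym m n" "u \<in> WJ m n" shows "ell (a * u) = ell a + ell u"
proof (rule ell_add_pos[OF WJ_Sy[OF assms(2)]])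
  fix p q :: int assume pq: "0 < p" "p < q" "inverse u $ q < inverse u $ p"
  have i: "inverse u \<in> WJ m n" using assms by (simp add: WJ_inverse)
  have "inverse u $ q \<le> int m \<longleftrightarrow> q \<le> int m" "inverse u $ p \<le> int m \<longleftrightarrow> p \<le> int m" using i pq by (auto simp: WJ_def)
  then have "q \<le> int m \<or> int m < p" using pq by linarith
  then show "a $ p < a $ q" using Ym_mono assms(1) pq by blast
qed

lemma Tb_Ym_WJ: "a \<in> Ym m n ==> u \<in> WJ m n ==> Tb (a * u) = Tb a * Tb u"
  by (simp add: Tb_mult ell_Ym_WJ)

lemma ell_right_gt: "w $ ra i < w $ rb i ==> ell (w * gen i) = Suc (ell w)"
  using ell_less_right[of w i] ell_right_cases[of w i] by auto
lemma ell_right_lt: "w $ rb i < w $ ra i ==> ell w = Suc (ell (w * gen i))"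
  using ell_less_right[of w i] ell_right_cases[of w i] by auto

lemma coset_decomp: "x \<in> Sy n ==> \<exists>a\<in>Ym m n. \<exists>u\<in>WJ m n. x = a * u"
proof (induction "ell x" arbitrary: x rule: less_induct)
  case less
  show ?case
  proof (cases "x \<in> Ym m n")
    case True then show ?thesis by (intro bexI[of _ x] bexI[of _ 1]) auto
  next
    case False
    then obtain i where i: "i > 0" "i \<noteq> int m" "\<not> x $ i < x $ (i + 1)" using less.prems by (auto simp: Ym_def)
    define k where "k = nat i"
    have k: "k > 0" "k \<noteq> m" "ra k = i" "rb k = i + 1" using i by (auto simp: k_def ra_def rb_def)
    have "x $ (i + 1) \<noteq> x $ i" by simp
    then have d: "x $ rb k < x $ ra k" using i(3) unfolding k(3,4) by linarith
    have kn: "k < n"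
    proof (rule ccontr)
      assume "\<not> k < n"
      then have "x $ (i + 1) = i + 1" using Wn_fix[OF Sy_Wn[OF less.prems]] k i by (simp add: k_def)
      moreover have "x $ i \<le> i"
      proof (cases "k = n")
        case True
        then have "i = int n" using i(1) unfolding k_def by linarith
        then show ?thesis using Sy_range[OF less.prems, of i] i by simp
      next
        case False then show ?thesis using Wn_fix[OF Sy_Wn[OF less.prems], of i] \<open>\<not> k < n\<close> i by (simp add: k_def)
      qed
      ultimately show False using i by simp
    qed
    have "x * gen k \<in> Sy n" using less.prems kn k gen_Sy by blast
    then obtain a u where au: "a \<in> Ym m n" "u \<in> WJ m n" "x * gen k = a * u"
      using less.hyps[of "x * gen k"] ell_right_lt[OF d] by auto
    then have "x = a * (u * gen k)" by (metis gen_gen_r mult.assoc)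
    moreover have "u * gen k \<in> WJ m n" using au k kn gen_WJ by blast
    ultimately show ?thesis using au by blast
  qed
qed

text \<open>Each of the two representatives is the other one times a parabolic element, and lengths
  add both ways; so that element has length 0.\<close>

lemma Ym_WJ_unique: assumes "a \<in> Ym m n" "a' \<in> Ym m n" "u \<in> WJ m n" "u' \<in> WJ m n" "a * u = a' * u'"
  shows "a = a'" "u = u'"
proof -
  have e: "a = a' * (u' * inverse u)" using assms(5) by (metis binv_right mult.assoc mult.right_neutral)
  have v: "u' * inverse u \<in> WJ m n" using assms WJ_inverse by blast
  have "ell a = ell a' + ell (u' * inverse u)" using ell_Ym_WJ[OF assms(2) v] e by simp
  moreover have "a' = a * inverse (u' * inverse u)" using e by (metis binv_right mult.assoc mult.right_neutral)
  then have "ell a' = ell a + ell (inverse (u' * inverse u))" using ell_Ym_WJ[OF assms(1) WJ_inverse[OF v]] by metis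
  ultimately have "ell (u' * inverse u) = 0" by simp
  then have "u' * inverse u = 1" by (simp del: binv_times)
  then show "a = a'" using e by simp
  then show "u = u'" using assms(5) by simp
qed

lemma Sy_descent: "w \<in> Sy n ==> ell (gen i * w) < ell w ==> 0 < i"
  using Sy_pos[of "inverse w" n 1] by (cases i) (auto simp: ell_less_left ra_def rb_def)

lemma Sy_descent_n: "w \<in> Wn n ==> ell (gen i * w) < ell w ==> i < n"
proof (rule ccontr)
  assume w: "w \<in> Wn n" "ell (gen i * w) < ell w" "\<not> i < n"
  then have "inverse w \<in> Wn i" using Wn_mono[of n i] by simp
  then have "inverse w $ rb i = rb i" "\<bar>ra i\<bar> \<le> int i ==> \<bar>inverse w $ ra i\<bar> \<le> int i"
    by (auto simp: rb_def Wn_fix intro: Wn_abs)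
  moreover have "i = 0 ==> inverse w $ 1 = 1" using Wn_fix[of "inverse w" n 1] w by simp
  ultimately show False using w(2) unfolding ell_less_left by (cases "i = 0") (auto simp: ra_def rb_def)
qed

lemma WJ_descent: "w \<in> WJ m n ==> ell (gen i * w) < ell w ==> 0 < i \<and> i < n \<and> i \<noteq> m"
proof (intro conjI)
  assume w: "w \<in> WJ m n" "ell (gen i * w) < ell w"
  show "0 < i" using Sy_descent WJ_Sy w by blast
  show "i < n" using Sy_descent_n WJ_Sy Sy_Wn w by blast
  show "i \<noteq> m"
  proof
    assume "i = m"
    have "inverse w \<in> WJ m n" using w WJ_inverse by blast
    then have "inverse w $ int m \<le> int m" "\<not> inverse w $ (int m + 1) \<le> int m" using \<open>0 < i\<close> \<open>i = m\<close> unfolding WJ_def by auto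
    then show False using w(2) \<open>i = m\<close> \<open>0 < i\<close> unfolding ell_less_left by (auto simp: ra_def rb_def)
  qed
qed

lemma Sy_WJ: "Sy n = WJ n n"
proof -
  have "w $ i \<le> int n \<longleftrightarrow> i \<le> int n" if "w \<in> Sy n" "i > 0" for w i
    using that Sy_range[of w n i] Wn_fix[OF Sy_Wn[OF that(1)], of i] by (cases "i \<le> int n") auto
  then show ?thesis by (auto simp: WJ_def)
qed

lemma WJ_induct [consumes 1, case_names one step]:
  assumes "w \<in> WJ m n" "P 1"
    "\<And>i w. 0 < i ==> i < n ==> i \<noteq> m ==> w \<in> WJ m n ==> ell (gen i * w) = Suc (ell w) ==> P w ==> P (gen i * w)"
  shows "P w"
  using assms(1)
proof (induction w rule: ell_induct)
  case (step i w)
  have "0 < i \<and> i < n \<and> i \<noteq> m" using WJ_descent[OF step.prems, of i] step.hyps by simp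
  moreover from this have "w \<in> WJ m n" using WJ_times[OF gen_WJ[of i n m] step.prems] by simp
  ultimately show ?case using step assms(3) by blast
qed (use assms in simp)

definition HJ :: "nat => nat => hk set" where "HJ m n = spT (WJ m n)"

lemma HJ_add: "h \<in> HJ m n ==> k \<in> HJ m n ==> h + k \<in> HJ m n"
  unfolding HJ_def by (rule hk.span_add)
lemma HJ_diff: "h \<in> HJ m n ==> k \<in> HJ m n ==> h - k \<in> HJ m n"
  unfolding HJ_def by (rule hk.span_diff)
lemma HJ_sc: "h \<in> HJ m n ==> sc c h \<in> HJ m n"
  unfolding HJ_def by (rule hk.span_scale)
lemma HJ_Tb: "w \<in> WJ m n ==> Tb w \<in> HJ m n"
  unfolding HJ_def by (intro hk.span_base imageI)
lemma HJ_one [simp]: "1 \<in> HJ m n" using HJ_Tb[of 1 m n] by simp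
lemma HJ_iff: "h \<in> HJ m n \<longleftrightarrow> (\<forall>x. cf h x \<noteq> 0 --> x \<in> WJ m n)"
  unfolding HJ_def span_Tb by auto

lemma HJ_tt: "0 < i ==> i < n ==> i \<noteq> m ==> h \<in> HJ m n ==> tt i * h \<in> HJ m n"
  unfolding HJ_def
proof (erule span_mult_left[rotated], clarify)
  fix w assume "0 < i" "i < n" "i \<noteq> m" "w \<in> WJ m n"
  then have "gen i * w \<in> WJ m n" using gen_WJ by blast
  then have "Tb (gen i * w) \<in> spT (WJ m n)" "Tb w \<in> spT (WJ m n)"
    using \<open>w \<in> WJ m n\<close> by (auto intro: hk.span_base)
  then show "tt i * Tb w \<in> spT (WJ m n)"
    by (simp add: tt_Tb hk.span_add hk.span_scale)
qed

lemma HJ_mult: "h \<in> HJ m n ==> k \<in> HJ m n ==> h * k \<in> HJ m n"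
proof -
  assume h: "h \<in> HJ m n" and k: "k \<in> HJ m n"
  have "Tb w * k \<in> HJ m n" if "w \<in> WJ m n" for w
    using that
  proof (induction rule: WJ_induct)
    case (step i w)
    then have "Tb (gen i * w) = tt i * Tb w" by (simp add: tt_Tb)
    then show ?case using HJ_tt step by (simp add: mult.assoc)
  qed (use k in simp)
  then show ?thesis using span_mult_right[of "Tb ` WJ m n" k "Tb ` WJ m n" h] h unfolding HJ_def by blast
qed

lemma Tbar_HJ: "w \<in> WJ m n ==> Tbar w \<in> HJ m n \<and> (\<forall>x. cf (Tbar w) x \<in> VF)"
proof (induction rule: WJ_induct)
  case one have "cf 1 x = (if x = 1 then 1 else 0)" for x using cf_Tb[of 1 x] by simp
  then show ?case by simp
next
  case (step i w)
  have "Tbar (gen i * w) = tt i * Tbar w - sc (xg i) (Tbar w)" using step Tbar_up by (simp add: ti_eq)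
  moreover have "cf (tt i * Tbar w - sc (xg i) (Tbar w)) x \<in> VF" for x
    using step by (auto simp: cf_tt_mult intro!: KS_diff KS_add VF_VF xg_VF)
  ultimately show ?case using step HJ_tt HJ_diff HJ_sc by metis
qed

text \<open>The triangular construction can be run inside the parabolic subalgebra, where it ends in
  the same elements by uniqueness.\<close>

lemma KLe_HJ: assumes "u \<in> WJ m n" shows "KLe u \<in> HJ m n"
proof -
  have "KLe u - Tb u \<in> spT {j \<in> WJ m n. ell j < ell u}"
  proof (rule KLe_triangular[where I = "WJ m n" and rank = ell and w = "\<lambda>w. w" and R = "\<lambda>j i. ell j < ell i"])
    show "finite (WJ m n)" by (rule finite_subset[OF _ finite_Wn[of n]]) (auto simp: WJ_def Sy_def)
    fix w assume w: "w \<in> WJ m n"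
    have "\<And>x. cf (Tbar w) x \<noteq> 0 ==> x \<in> WJ m n" using Tbar_HJ[OF w] HJ_iff by blast
    then show "bar (Tb w) - Tb w \<in> spT {j \<in> WJ m n. ell j < ell w}"
      unfolding span_Tb bar_Tb using cf_Tbar(1)[of w] cf_Tbar(2)[of w] by (auto simp: cf_Tb)
  qed (use assms in \<open>auto simp: asym_Tb\<close>)
  then have "KLe u - Tb u \<in> HJ m n" unfolding HJ_def using hk.span_mono[of "Tb ` {j \<in> WJ m n. ell j < ell u}" "Tb ` WJ m n"] by blast
  then show ?thesis using HJ_add[of "KLe u - Tb u" m n "Tb u"] HJ_Tb[OF assms] by simp
qed

lemma span_KLe_WJ: "HJ m n = spC (WJ m n)"
proof
  show "spC (WJ m n) \<subseteq> HJ m n" unfolding HJ_def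
    using KLe_HJ by (intro hk.span_minimal) (auto simp: HJ_def)
  have "Tb w \<in> spC (WJ m n)" if "w \<in> WJ m n" for w
    using that
  proof (induction "ell w" arbitrary: w rule: less_induct)
    case (less w)
    have "KLe w - Tb w \<in> spT {x \<in> WJ m n. ell x < ell w}"
      unfolding span_Tb using KLe_HJ[OF less.prems] cf_KLe[of w] by (auto simp: cf_Tb HJ_iff)
    moreover have "spT {x \<in> WJ m n. ell x < ell w} \<subseteq> spC (WJ m n)"
      using less.hyps by (intro hk.span_minimal) auto
    moreover have "KLe w \<in> spC (WJ m n)" using less.prems by (auto intro: hk.span_base)
    ultimately have "KLe w - (KLe w - Tb w) \<in> spC (WJ m n)" using hk.span_diff by blast
    then show ?case by simp
  qed
  then show "HJ m n \<subseteq> spC (WJ m n)" unfolding HJ_def by (intro hk.span_minimal) auto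
qed

section \<open>The elements $a_m$\<close>

text \<open>\<open>aw m\<close> is a_m, built up from the left as a_(m+1) = t s_1 ... s_m a_m to
  match the recursion of \<open>CA\<close>. The given \<open>a_elt\<close> grows on the right; both
  send i to i - (m + 1) for 1 \<le> i \<le> m, whence \<open>a_elt_aw\<close>.\<close>

primrec xm :: "nat => bperm" where "xm 0 = 1" | "xm (Suc m) = xm m * gen (Suc m)"
primrec aw :: "nat => bperm" where "aw 0 = 1" | "aw (Suc m) = gen 0 * xm m * aw m"

lemma xm_apply: "i > 0 ==> xm m $ i = (if i \<le> int m then i + 1 else if i = int m + 1 then 1 else i)"
  by (induction m arbitrary: i) (auto simp: gen_apply)
lemma aw_apply: "i > 0 ==> aw m $ i = (if i \<le> int m then i - (int m + 1) else i)"
proof (induction m)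
  case (Suc m)
  show ?case
  proof (cases "i \<le> int m")
    case True
    have "xm m $ (i - (int m + 1)) = - (xm m $ (int m + 1 - i))" by (metis bap_minus minus_diff_eq)
    then show ?thesis using True Suc by (simp add: xm_apply gen_apply)
  next
    case False
    then show ?thesis using Suc by (auto simp: xm_apply gen_apply)
  qed
qed simp

lemma xm_Sy: "m < n ==> xm m \<in> Sy n"
  by (induction m) (auto intro: gen_Sy)
lemma aw_Wn: "m \<le> n ==> aw m \<in> Wn n"
proof (induction m)
  case (Suc m) then show ?case using Sy_Wn[OF xm_Sy[of m n]] by (auto intro!: Wn_times)
qed simp
lemma aw_aw [simp]: "aw m * aw m = 1"
proof (rule bperm_eqI_pos)
  fix i :: int assume "i > 0"
  have "aw m $ (i - (int m + 1)) = - (aw m $ (int m + 1 - i))" by (metis bap_minus minus_diff_eq)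
  then show "(aw m * aw m) $ i = 1 $ i" using \<open>i > 0\<close> by (auto simp: aw_apply)
qed
lemma inverse_aw [simp]: "inverse (aw m) = aw m"
  by (metis aw_aw binv_left2 mult.right_neutral)

lemma Pm_Tb: "Pm m = Tb (xm m)"
proof (induction m)
  case (Suc m)
  have "ell (xm m * gen (Suc m)) > ell (xm m)"
    using ell_right_gt[of "xm m" "Suc m"] by (simp add: xm_apply ra_def rb_def)
  then show ?case using Suc by (simp add: Tb_tt)
qed simp

lemma tt0_Pm: "tt 0 * Pm m = Tb (gen 0 * xm m)"
proof -
  have "inverse (xm m) $ 1 = int m + 1" by (rule binv_bapI) (simp add: xm_apply)
  then have "\<not> ell (gen 0 * xm m) < ell (xm m)" unfolding ell_less_left by (simp add: ra_def rb_def)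
  then show ?thesis by (simp add: Pm_Tb tt_Tb)
qed

lemma Wn_inversion: assumes "y \<in> Wn m" "a < b" "inverse y $ b < inverse y $ a" shows "b \<le> int m" "- int m \<le> a"
proof -
  have fx: "inverse y $ c = c" if "\<bar>c\<bar> > int m" for c
    using that Wn_fix[of "inverse y" m c] Wn_fix[of "inverse y" m "-c"] assms(1) by (cases "c > 0") auto
  have abs: "\<bar>inverse y $ c\<bar> \<le> int m" if "\<bar>c\<bar> \<le> int m" for c using Wn_abs[of "inverse y" m c] assms(1) that by simp
  show "b \<le> int m"
  proof (rule ccontr)
    assume n: "\<not> b \<le> int m"
    then have "inverse y $ b = b" by (intro fx) simp
    then show False using n assms(2,3) fx[of a] abs[of a] by (cases "\<bar>a\<bar> > int m") simp_all
  qed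
  show "- int m \<le> a"
  proof (rule ccontr)
    assume n: "\<not> - int m \<le> a"
    then have "inverse y $ a = a" by (intro fx) simp
    then show False using n assms(2,3) fx[of b] abs[of b] by (cases "\<bar>b\<bar> > int m") simp_all
  qed
qed

text \<open>t s_1 ... s_m sends i to i + 1 and -i to -(i + 1) for 0 < i \<le> m, so it preserves the
  order of the points that y can rearrange.\<close>

lemma ell_cyc: assumes "y \<in> Wn m" shows "ell (gen 0 * xm m * y) = ell (gen 0 * xm m) + ell y"
proof (rule ell_add)
  fix a b :: int assume ab: "a < b" "a \<noteq> 0" "b \<noteq> 0" "inverse y $ b < inverse y $ a"
  have r: "b \<le> int m" "- int m \<le> a" using Wn_inversion[OF assms ab(1,4)] by auto
  have c: "(gen 0 * xm m) $ i = i + 1" if "0 < i" "i \<le> int m" for i using that by (simp add: xm_apply gen_apply)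
  have c': "(gen 0 * xm m) $ i = i - 1" if "i < 0" "- int m \<le> i" for i using c[of "-i"] that by (simp del: bap_times)
  show "(gen 0 * xm m) $ a < (gen 0 * xm m) $ b"
    using c[of a] c'[of a] c[of b] c'[of b] ab r by (cases "a > 0"; cases "b > 0") auto
qed

abbreviation VLe :: "(int \<times> int) set" where "VLe \<equiv> {(i, j). i \<le> 0}"

lemma cf_tt_KS:
  assumes "\<And>x. cf h x \<in> KS S" "i > 0" "\<And>a b. (a, b) \<in> S ==> \<forall>c. (a, c) \<in> S"
  shows "cf (tt i * h) x \<in> KS S" "cf (ti i * h) x \<in> KS S" "cf (h * tt i) x \<in> KS S"
proof -
  have m: "xg i * cf h x \<in> KS S" for x
    using xg_VF[OF assms(2)] assms(1)[of x] by (rule KS_mult) (use assms(3) in \<open>auto simp: Vzero_def\<close>)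
  then show "cf (tt i * h) x \<in> KS S" "cf (h * tt i) x \<in> KS S" using assms(1) by (auto simp: cf_tt_mult cf_mult_tt intro!: KS_add)
  then show "cf (ti i * h) x \<in> KS S" using m by (auto simp: ti_eq intro: KS_diff)
qed

lemma cf_Qm_KS:
  assumes "\<And>x. cf h x \<in> KS S" "\<And>a b. (a, b) \<in> S ==> \<forall>c. (a, c) \<in> S"
  shows "cf (Qm m * h) x \<in> KS S"
  using assms(1)
proof (induction m arbitrary: h x)
  case (Suc m)
  have "cf (Qm m * (ti (Suc m) * h)) x \<in> KS S"
    by (rule Suc.IH) (rule cf_tt_KS(2)[OF Suc.prems], use assms(2) in auto)
  then show ?case by (simp add: mult.assoc)
qed simp

lemma hkn_tt: "i < n ==> h \<in> spT (Wn n) ==> tt i * h \<in> spT (Wn n)"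
proof (erule span_mult_left[rotated], clarify)
  fix w assume "i < n" "w \<in> Wn n"
  then have "gen i * w \<in> Wn n" by auto
  then have "Tb (gen i * w) \<in> spT (Wn n)" "Tb w \<in> spT (Wn n)"
    using \<open>w \<in> Wn n\<close> by (auto intro: hk.span_base)
  then show "tt i * Tb w \<in> spT (Wn n)"
    by (simp add: tt_Tb hk.span_add hk.span_scale)
qed
lemma hkn_ti: "i < n ==> h \<in> spT (Wn n) ==> ti i * h \<in> spT (Wn n)"
  by (simp add: ti_eq hkn_tt hk.span_diff hk.span_scale)
lemma hkn_Qm: "m < n ==> h \<in> spT (Wn n) ==> Qm m * h \<in> spT (Wn n)"
  by (induction m arbitrary: h) (auto simp: mult.assoc hkn_ti)

text \<open>Multiplying by t s_1 ... s_m only translates the support, as lengths add; the second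
  summand of the recursion carries V^-1, and \<open>Qm\<close> contains no V. Negative V-degree,
  stronger than membership in \<open>AN\<close>, is recorded because later factors T_\<sigma>
  contribute arbitrary powers of v.\<close>

lemma CA_asym: "CA m \<in> spT (Wn m) \<and> (\<forall>x. cf (CA m) x - cf (Tb (aw m)) x \<in> VN)"
proof (induction m)
  case 0
  have "Tb 1 \<in> spT (Wn 0)" by (intro hk.span_base imageI) simp
  then show ?case by simp
next
  case (Suc m)
  then have s: "CA m \<in> spT (Wn m)" and v: "\<And>x. cf (CA m - Tb (aw m)) x \<in> VN" by auto
  have suppW: "cf (CA m) x = 0" if "x \<notin> Wn m" for x using s that unfolding span_Tb by auto
  let ?c = "gen 0 * xm m"
  have cT: "tt 0 * Pm m * Tb y = Tb (?c * y)" if "y \<in> Wn m" for y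
    unfolding tt0_Pm using ell_cyc[OF that] by (simp add: Tb_mult)
  have e: "CA m = (\<Sum>y\<in>Wn m. sc (cf (CA m) y) (Tb y))" by (rule hk_expand_on) (use s in \<open>auto simp: span_Tb\<close>)
  have P: "tt 0 * Pm m * CA m = (\<Sum>y\<in>Wn m. sc (cf (CA m) y) (Tb (?c * y)))"
    by (subst e) (simp add: sum_distrib_left cT)
  have cfP: "cf (tt 0 * Pm m * CA m) x = cf (CA m) (inverse ?c * x)" for x
  proof -
    have "cf (tt 0 * Pm m * CA m) x = (\<Sum>y\<in>Wn m. if y = inverse ?c * x then cf (CA m) y else 0)"
      unfolding P cf_sum cf_sc by (rule sum.cong) (auto simp: cf_Tb mult.assoc)
    then show ?thesis using suppW by (simp add: sum.delta)
  qed
  have v': "cf (CA m) x - (if x = aw m then 1 else 0) \<in> VN" for x using v[of x] by (simp add: cf_Tb)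
  have 1: "cf (tt 0 * Pm m * CA m) x - cf (Tb (aw (Suc m))) x \<in> VN" for x
  proof -
    have "x = ?c * aw m \<longleftrightarrow> inverse ?c * x = aw m" by (metis binv_left2 binv_right2)
    then show ?thesis unfolding cfP using v'[of "inverse ?c * x"] by (simp add: cf_Tb)
  qed
  have "cf (CA m) x \<in> KS VLe" for x
  proof -
    have "cf (Tb (aw m)) x \<in> KS VLe" by (auto simp: cf_Tb one_KS)
    moreover have "cf (CA m - Tb (aw m)) x \<in> KS VLe" using v[of x] by (rule KS_mono) (auto simp: Vneg_def)
    ultimately show ?thesis using KS_add[of "cf (CA m - Tb (aw m)) x" VLe "cf (Tb (aw m)) x"] by simp
  qed
  then have "cf (Qm m * CA m) x \<in> KS VLe" for x by (rule cf_Qm_KS) auto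
  then have 2: "vgi 0 * cf (Qm m * CA m) x \<in> VN" for x
    by (rule KS_mult[OF vgi_VN]) (auto simp: Vneg_def)
  have "cf (CA (Suc m)) x - cf (Tb (aw (Suc m))) x \<in> VN" for x
    using KS_add[OF 1[of x] 2[of x]] by (simp add: distrib_right algebra_simps del: aw.simps)
  moreover have "CA (Suc m) \<in> spT (Wn (Suc m))"
  proof -
    have "Tb ` Wn m \<subseteq> Tb ` Wn (Suc m)" using Wn_mono[of m "Suc m"] by (intro image_mono) auto
    then have s': "CA m \<in> spT (Wn (Suc m))" using s hk.span_mono by blast
    have "?c * y \<in> Wn (Suc m)" if "y \<in> Wn m" for y
      using that Wn_mono[of m "Suc m" y] Sy_Wn[OF xm_Sy[of m "Suc m"]] by (intro Wn_times) auto
    then have "tt 0 * Pm m * CA m \<in> spT (Wn (Suc m))"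
      unfolding P by (intro hk.span_sum hk.span_scale hk.span_base) auto
    moreover have "Qm m * CA m \<in> spT (Wn (Suc m))" by (rule hkn_Qm[OF _ s']) simp
    ultimately show ?thesis by (simp add: distrib_right hk.span_add hk.span_scale)
  qed
  ultimately show ?case by blast
qed

section \<open>A basis adapted to the number of sign changes\<close>

lemma finite_Sy [simp]: "finite (Sy n)" by (rule finite_subset[OF _ finite_Wn[of n]]) (auto simp: Sy_def)
lemma finite_WJ [simp]: "finite (WJ m n)" by (rule finite_subset[OF _ finite_Sy[of n]]) (auto simp: WJ_def)
lemma finite_Ym [simp]: "finite (Ym m n)" by (rule finite_subset[OF _ finite_Sy[of n]]) (auto simp: Ym_def)

lemma HJ_sub: "h \<in> HJ m n ==> h \<in> HJ n n"
  unfolding HJ_iff using WJ_Sy Sy_WJ by blast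

text \<open>Conjugation by a_m reverses the numbering of s_1, ..., s_(m-1) and fixes the s_i with i
  > m, so \<open>CA m\<close> normalises the parabolic subalgebra.\<close>

lemma CA_conj: "w \<in> WJ m n ==> m \<le> n ==> \<exists>h\<in>HJ m n. CA m * Tb w = h * CA m"
proof (induction rule: WJ_induct)
  case one show ?case by (intro bexI[of _ 1]) auto
next
  case (step i w)
  then obtain h where h: "h \<in> HJ m n" "CA m * Tb w = h * CA m" by blast
  have T: "Tb (gen i * w) = tt i * Tb w" using step by (simp add: tt_Tb)
  define j where "j = (if i < m then m - i else i)"
  have j: "0 < j" "j \<noteq> m" "CA m * tt i = tt j * CA m"
    using step CA_swap[of "m - i" m] CA_far[of m i] by (auto simp: j_def)
  have "w \<in> Sy n" using step WJ_Sy by blast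
  have "j < n" using step by (auto simp: j_def)
  have "CA m * Tb (gen i * w) = tt j * h * CA m" unfolding T
    using h(2) j(3) by (metis mult.assoc)
  then show ?case using HJ_tt[OF j(1) \<open>j < n\<close> j(2) h(1)] by blast
qed

type_synonym idx = "nat \<times> bperm \<times> bperm \<times> bperm"

text \<open>Every element of \<open>W n\<close> is $a u a_m b^{-1}$ for a unique index in \<open>Idx n\<close>, where \<open>m\<close> is its number of sign changes.
  The elements \<open>Eb\<close> are bar invariant up to terms of smaller rank, hence triangular with respect to the Kazhdan--Lusztig basis.\<close>

fun yel :: "idx => bperm" where "yel (m, a, u, b) = a * u * aw m * inverse b"
fun Eb :: "idx => hk" where "Eb (m, a, u, b) = Tb a * KLe u * CA m * Tb (inverse b)"
abbreviation spE :: "idx set => hk set" where "spE S \<equiv> hk.span (Eb ` S)"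
definition Idx :: "nat => idx set" where
  "Idx n = {(m, a, u, b). m \<le> n \<and> a \<in> Ym m n \<and> u \<in> WJ m n \<and> b \<in> Ym m n}"
fun Rl :: "idx => idx => bool" where
  "Rl (m', a', u', b') (m, a, u, b) \<longleftrightarrow> m' = m \<and> ell a' \<le> ell a \<and> ell b' \<le> ell b \<and> ell a' + ell b' < ell a + ell b"
fun rk :: "idx => nat" where "rk (m, a, u, b) = ell a + ell b"

lemma Eb_span_u:
  assumes "k \<in> HJ m n" shows "Tb a * k * CA m * Tb (inverse b) \<in> spE {(m, a, u, b) | u. u \<in> WJ m n}"
  using assms unfolding span_KLe_WJ
proof (induction rule: hk.span_induct_alt)
  case (step c x y)
  then obtain u where u: "u \<in> WJ m n" "x = KLe u" by auto
  have "Eb (m, a, u, b) \<in> spE {(m, a, u, b) | u. u \<in> WJ m n}" using u by (intro hk.span_base imageI) auto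
  then show ?case using step u by (auto simp: distrib_left distrib_right intro!: hk.span_add hk.span_scale)
qed (simp add: hk.span_zero)

lemma Eb_span_x:
  assumes "x \<in> Sy n" "k \<in> HJ m n"
  shows "Tb x * k * CA m * Tb (inverse b) \<in> spE {(m, a, u, b) | a u. a \<in> Ym m n \<and> u \<in> WJ m n \<and> ell a \<le> ell x}"
proof -
  obtain a w where aw: "a \<in> Ym m n" "w \<in> WJ m n" "x = a * w" using coset_decomp[OF assms(1)] by blast
  have "Tb w * k \<in> HJ m n" using HJ_mult HJ_Tb aw assms by blast
  then have "Tb a * (Tb w * k) * CA m * Tb (inverse b) \<in> spE {(m, a, u, b) | u. u \<in> WJ m n}" by (rule Eb_span_u)
  moreover have "{(m, a, u, b) | u. u \<in> WJ m n} \<subseteq> {(m, a, u, b) | a u. a \<in> Ym m n \<and> u \<in> WJ m n \<and> ell a \<le> ell x}"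
    using aw ell_Ym_WJ by auto
  ultimately show ?thesis using aw Tb_Ym_WJ[OF aw(1,2)] hk.span_mono[OF image_mono] by (simp add: mult.assoc) blast
qed

text \<open>The parabolic part of x is absorbed by k; that of x' is moved through
  \<open>CA m\<close> by \<open>CA_conj\<close> and absorbed as well. No coset representative is
  longer than the element it comes from, which is the control required by \<open>Rl\<close>.\<close>

lemma Eb_span_xx:
  assumes "x \<in> Sy n" "k \<in> HJ m n" "x' \<in> Sy n" "m \<le> n"
  shows "Tb x * k * CA m * Tb x' \<in>
    spE {(m, a, u, b) | a u b. a \<in> Ym m n \<and> u \<in> WJ m n \<and> b \<in> Ym m n \<and> ell a \<le> ell x \<and> ell b \<le> ell x'}"
proof -
  obtain b w where bw: "b \<in> Ym m n" "w \<in> WJ m n" "inverse x' = b * w" using coset_decomp[of "inverse x'" n m] assms by auto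
  have x': "x' = inverse w * inverse b" using bw(3) by (metis binv_binv binv_times)
  have el: "ell x' = ell b + ell w" using ell_Ym_WJ[OF bw(1,2)] bw(3) by (metis ell_inverse)
  have T: "Tb x' = Tb (inverse w) * Tb (inverse b)" unfolding x' by (rule Tb_mult[symmetric]) (use el x' in simp)
  obtain h where h: "h \<in> HJ m n" "CA m * Tb (inverse w) = h * CA m" using CA_conj[OF WJ_inverse[OF bw(2)] assms(4)] by blast
  have "Tb x * k * CA m * Tb x' = Tb x * (k * h) * CA m * Tb (inverse b)" unfolding T using h(2) by (metis mult.assoc)
  also have "\<dots> \<in> spE {(m, a, u, b) | a u. a \<in> Ym m n \<and> u \<in> WJ m n \<and> ell a \<le> ell x}"
    by (rule Eb_span_x) (use assms HJ_mult h in auto)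
  also have "\<dots> \<subseteq> spE {(m, a, u, b) | a u b. a \<in> Ym m n \<and> u \<in> WJ m n \<and> b \<in> Ym m n \<and> ell a \<le> ell x \<and> ell b \<le> ell x'}"
    using bw el by (intro hk.span_mono image_mono) auto
  finally show ?thesis .
qed

lemma span_HJ_induct:
  assumes "k \<in> HJ m n" "\<And>x. x \<in> WJ m n ==> f (Tb x) \<in> hk.span R" "lin f"
  shows "f k \<in> hk.span R"
  using assms(1) unfolding HJ_def
proof (induction rule: hk.span_induct_alt)
  case base show ?case by (simp add: lin_0[OF assms(3)] hk.span_zero)
next
  case (step c x y)
  then have "f x \<in> hk.span R" using assms(2) by auto
  then show ?case using step by (simp add: lin_add[OF assms(3)] lin_sc[OF assms(3)] hk.span_add hk.span_scale)
qed

lemma Eb_span_k: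
  assumes "k \<in> HJ n n"
  shows "k * CA m * Tb (inverse b) \<in> spE {(m, a, u, b) | a u. a \<in> Ym m n \<and> u \<in> WJ m n}"
proof -
  have "(\<lambda>k. k * (CA m * Tb (inverse b))) k \<in> spE {(m, a, u, b) | a u. a \<in> Ym m n \<and> u \<in> WJ m n}"
  proof (rule span_HJ_induct[OF assms])
    fix x assume "x \<in> WJ n n"
    then have "Tb x * 1 * CA m * Tb (inverse b) \<in> spE {(m, a, u, b) | a u. a \<in> Ym m n \<and> u \<in> WJ m n \<and> ell a \<le> ell x}"
      by (intro Eb_span_x) (auto simp: WJ_Sy)
    also have "\<dots> \<subseteq> spE {(m, a, u, b) | a u. a \<in> Ym m n \<and> u \<in> WJ m n}" by (intro hk.span_mono image_mono) auto
    finally show "Tb x * (CA m * Tb (inverse b)) \<in> spE {(m, a, u, b) | a u. a \<in> Ym m n \<and> u \<in> WJ m n}" by (simp add: mult.assoc)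
  qed (auto simp: lin_def distrib_right)
  then show ?thesis by (simp add: mult.assoc)
qed

lemma Eb_span_kk:
  assumes "k \<in> HJ n n" "k' \<in> HJ n n" "m \<le> n"
  shows "k * CA m * k' \<in> spE {(m, a, u, b) | a u b. a \<in> Ym m n \<and> u \<in> WJ m n \<and> b \<in> Ym m n}" (is "_ \<in> ?S")
proof -
  have "(\<lambda>k'. k * CA m * k') k' \<in> ?S"
  proof (rule span_HJ_induct[OF assms(2)])
    fix x' assume x': "x' \<in> WJ n n"
    have "(\<lambda>k. k * (CA m * Tb x')) k \<in> ?S"
    proof (rule span_HJ_induct[OF assms(1)])
      fix x assume "x \<in> WJ n n"
      then have "Tb x * 1 * CA m * Tb x' \<in> spE {(m, a, u, b) | a u b. a \<in> Ym m n \<and> u \<in> WJ m n \<and> b \<in> Ym m n \<and> ell a \<le> ell x \<and> ell b \<le> ell x'}"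
        using x' assms(3) by (intro Eb_span_xx) (auto simp: WJ_Sy)
      also have "\<dots> \<subseteq> ?S" by (intro hk.span_mono image_mono) auto
      finally show "Tb x * (CA m * Tb x') \<in> ?S" by (simp add: mult.assoc)
    qed (auto simp: lin_def distrib_right)
    then show "k * CA m * Tb x' \<in> ?S" by (simp add: mult.assoc)
  qed (auto simp: lin_def distrib_left)
  then show ?thesis by simp
qed

lemma VN_left: assumes "w \<in> Sy n" "\<And>x. cf h x \<in> VN" shows "cf (Tb w * h) x \<in> VN"
proof -
  have "w \<in> WJ n n" using assms Sy_WJ by simp
  then have "\<forall>x. cf (Tb w * h) x \<in> VN"
  proof (induction rule: WJ_induct)
    case (step i w)
    have "Tb (gen i * w) * h = tt i * (Tb w * h)" using step by (simp add: tt_Tb mult.assoc[symmetric])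
    then show ?case using cf_tt_KS(1)[of "Tb w * h" Vneg i] step by (auto simp: Vneg_def)
  qed (use assms in simp)
  then show ?thesis by blast
qed

lemma VN_right: assumes "w \<in> Sy n" "\<And>x. cf h x \<in> VN" shows "cf (h * Tb (inverse w)) x \<in> VN"
proof -
  have "w \<in> WJ n n" using assms Sy_WJ by simp
  then have "\<forall>x. cf (h * Tb (inverse w)) x \<in> VN"
  proof (induction rule: WJ_induct)
    case (step i w)
    have "ell (inverse w * gen i) > ell (inverse w)" using step ell_inverse[of "gen i * w"] by simp
    then have "h * Tb (inverse (gen i * w)) = (h * Tb (inverse w)) * tt i" by (simp add: Tb_tt mult.assoc)
    then show ?case using cf_tt_KS(3)[of "h * Tb (inverse w)" Vneg i] step by (auto simp: Vneg_def)
  qed (use assms in simp)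
  then show ?thesis by blast
qed

text \<open>a_m reverses only pairs of opposite signs, and elements of \<open>Sy n\<close> preserve
  signs.\<close>

lemma ell_aw: assumes "x \<in> Sy n" shows "ell (x * aw m) = ell x + ell (aw m)"
proof (rule ell_add)
  fix a b :: int assume ab: "a < b" "a \<noteq> 0" "b \<noteq> 0" "inverse (aw m) $ b < inverse (aw m) $ a"
  have pos: "aw m $ p < aw m $ q" if "0 < p" "p < q" for p q using that by (auto simp: aw_apply)
  have "\<not> 0 < a" using pos[of a b] ab by auto
  moreover have "\<not> b < 0" using pos[of "-b" "-a"] ab by auto
  ultimately have "x $ a < 0" "0 < x $ b" using Sy_pos_iff[OF assms, of b] Sy_pos_iff[OF assms, of "-a"] ab by auto
  then show "x $ a < x $ b" by simp
qed

text \<open>b reverses only pairs with p \<le> m < q, and a_m makes the first point negative while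
  the second stays positive.\<close>

lemma ell_aw_b: assumes "x \<in> Sy n" "b \<in> Ym m n" shows "ell (x * aw m * inverse b) = ell (x * aw m) + ell b"
proof -
  have "ell (x * aw m * inverse b) = ell (x * aw m) + ell (inverse b)"
  proof (rule ell_add_pos)
    show "inverse b \<in> Sy n" using assms Ym_Sy by simp
    fix p q :: int assume pq: "0 < p" "p < q" "inverse (inverse b) $ q < inverse (inverse b) $ p"
    then have "\<not> (q \<le> int m \<or> int m < p)" using Ym_mono[OF assms(2), of p q] by auto
    then have "x $ (aw m $ p) < 0" "0 < x $ (aw m $ q)"
      using Sy_pos_iff[OF assms(1), of "int m + 1 - p"] Sy_pos[OF assms(1), of q] pq bap_minus[of x "int m + 1 - p"]
      by (auto simp: aw_apply)
    then show "(x * aw m) $ p < (x * aw m) $ q" by simp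
  qed
  then show ?thesis by simp
qed

lemma Tb_aw_b: assumes "x \<in> Sy n" "b \<in> Ym m n" shows "Tb x * Tb (aw m) * Tb (inverse b) = Tb (x * aw m * inverse b)"
  using Tb_mult[OF ell_aw[OF assms(1)]] Tb_mult[of "x * aw m" "inverse b"] ell_aw_b[OF assms] by simp

lemma AN1: "p - (if b then 1 else 0) \<in> AN ==> p \<in> KS (insert 0 Neg)"
proof -
  assume p: "p - (if b then 1 else 0) \<in> AN"
  have "(if b then 1 else 0) \<in> KS (insert 0 Neg)" by (simp add: one_KS zero_prod_def)
  moreover have "p - (if b then 1 else 0) \<in> KS (insert 0 Neg)" using p by (rule KS_mono) auto
  ultimately have "p - (if b then 1 else 0) + (if b then 1 else 0) \<in> KS (insert 0 Neg)" by (rule KS_add[rotated])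
  then show ?thesis by simp
qed

text \<open>With \<open>Tb (aw m)\<close> in place of \<open>CA m\<close> lengths add, so the
  coefficients of h are merely relocated. The remainder has negative V-degree, which factors from
  the symmetric group cannot raise, and multiplying by coefficients with exponents at most 0 keeps
  it in \<open>AN\<close>.\<close>

lemma asym_CA:
  assumes h: "h \<in> HJ n n" "asymT \<sigma> h" and b: "b \<in> Ym m n"
  shows "asymT (\<sigma> * aw m * inverse b) (h * CA m * Tb (inverse b))"
proof -
  define p where "p x = cf h x" for x
  have p: "p x - (if x = \<sigma> then 1 else 0) \<in> AN" for x using h(2) by (auto simp: asymT_def p_def cf_Tb)
  have hs: "h = (\<Sum>x\<in>Sy n. sc (p x) (Tb x))" unfolding p_def by (rule hk_expand_on) (use h(1) HJ_iff Sy_WJ in auto)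
  define D where "D = CA m - Tb (aw m)"
  have D: "cf D x \<in> VN" for x using CA_asym[of m] by (simp add: D_def)
  have C: "CA m = Tb (aw m) + D" by (simp add: D_def)
  have e: "h * CA m * Tb (inverse b) = (\<Sum>x\<in>Sy n. sc (p x) (Tb (x * aw m * inverse b))) + (\<Sum>x\<in>Sy n. sc (p x) (Tb x * D * Tb (inverse b)))"
    unfolding C by (subst hs) (simp add: distrib_left distrib_right sum_distrib_right sum.distrib Tb_aw_b[OF _ b])
  show ?thesis
    unfolding asymT_def
  proof
    fix z
    have v: "cf (Tb x * D * Tb (inverse b)) z \<in> VN" if "x \<in> Sy n" for x
      by (rule VN_right[OF Ym_Sy[OF b]]) (rule VN_left[OF that D])
    have "(\<Sum>x\<in>Sy n. p x * cf (Tb x * D * Tb (inverse b)) z) \<in> AN"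
    proof (rule KS_sum)
      fix x assume "x \<in> Sy n"
      show "p x * cf (Tb x * D * Tb (inverse b)) z \<in> AN"
        by (rule KS_mult[OF AN1[OF p] v[OF \<open>x \<in> Sy n\<close>]]) (auto simp: Neg_def Vneg_def)
    qed
    moreover have "(\<Sum>x\<in>Sy n. p x * cf (Tb (x * aw m * inverse b)) z) - cf (Tb (\<sigma> * aw m * inverse b)) z \<in> AN"
    proof -
      define x0 where "x0 = z * b * aw m"
      have x0: "z = x * aw m * inverse b \<longleftrightarrow> x = x0" for x
        unfolding x0_def by (metis aw_aw binv_left binv_right mult.assoc mult.right_neutral)
      have "(\<Sum>x\<in>Sy n. p x * cf (Tb (x * aw m * inverse b)) z) = (\<Sum>x\<in>Sy n. if x = x0 then p x else 0)"
        by (rule sum.cong) (auto simp: cf_Tb x0)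
      also have "\<dots> = p x0"
        using h(1) Sy_WJ[of n] by (simp add: p_def HJ_iff) blast
      finally have "(\<Sum>x\<in>Sy n. p x * cf (Tb (x * aw m * inverse b)) z) = p x0" .
      then show ?thesis using p[of x0] by (simp add: cf_Tb x0 eq_commute[of \<sigma>])
    qed
    ultimately have "(\<Sum>x\<in>Sy n. p x * cf (Tb (x * aw m * inverse b)) z) - cf (Tb (\<sigma> * aw m * inverse b)) z +
       (\<Sum>x\<in>Sy n. p x * cf (Tb x * D * Tb (inverse b)) z) \<in> AN" using KS_add by blast
    then show "cf (h * CA m * Tb (inverse b)) z - cf (Tb (\<sigma> * aw m * inverse b)) z \<in> AN"
      unfolding e by (simp add: algebra_simps)
  qed
qed

lemma asym_Ym_WJ: assumes "a \<in> Ym m n" "u \<in> WJ m n" shows "asymT (a * u) (Tb a * KLe u)"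
  unfolding asymT_def
proof
  fix z
  have K: "KLe u = (\<Sum>w\<in>WJ m n. sc (cf (KLe u) w) (Tb w))" by (rule hk_expand_on) (use KLe_HJ[OF assms(2)] HJ_iff in auto)
  have "Tb a * KLe u = (\<Sum>w\<in>WJ m n. sc (cf (KLe u) w) (Tb (a * w)))"
    by (subst K) (simp add: sum_distrib_left Tb_Ym_WJ[OF assms(1)])
  then have "cf (Tb a * KLe u) z = (\<Sum>w\<in>WJ m n. cf (KLe u) w * cf (Tb (a * w)) z)" by simp
  also have "\<dots> = (\<Sum>w\<in>WJ m n. if w = inverse a * z then cf (KLe u) w else 0)"
    by (rule sum.cong) (auto simp: cf_Tb)
  also have "\<dots> = cf (KLe u) (inverse a * z)" using KLe_HJ[OF assms(2)] by (simp add: HJ_iff) blast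
  finally have "cf (Tb a * KLe u) z = cf (KLe u) (inverse a * z)" .
  moreover have "z = a * u \<longleftrightarrow> inverse a * z = u" by (metis binv_left2 binv_right2)
  ultimately show "cf (Tb a * KLe u) z - cf (Tb (a * u)) z \<in> AN"
    using asym_KLe[of u] by (simp add: asymT_def cf_Tb)
qed

lemma asym_Eb: "i \<in> Idx n ==> asymT (yel i) (Eb i)"
proof -
  assume "i \<in> Idx n"
  then obtain m a u b where i: "i = (m, a, u, b)" "a \<in> Ym m n" "u \<in> WJ m n" "b \<in> Ym m n" by (auto simp: Idx_def)
  have "a \<in> WJ n n" using i(2) Ym_Sy Sy_WJ by blast
  then have "Tb a * KLe u \<in> HJ n n" by (intro HJ_mult HJ_Tb HJ_sub[OF KLe_HJ[OF i(3)]])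
  then show ?thesis using asym_CA[OF _ asym_Ym_WJ[OF i(2,3)] i(4)] i by simp
qed

lemma Ym_image_eq: assumes b: "b \<in> Ym m n" "b' \<in> Ym m n" and eq: "\<And>p. p > 0 ==> inverse b $ p \<le> int m \<longleftrightarrow> inverse b' $ p \<le> int m"
  shows "b = b'"
proof -
  have "inverse b * b' \<in> Sy n" using b Ym_Sy by auto
  moreover have "(inverse b * b') $ i \<le> int m \<longleftrightarrow> i \<le> int m" if "i > 0" for i
    using eq[of "b' $ i"] Sy_pos[OF Ym_Sy[OF b(2)] that] by simp
  ultimately have "inverse b * b' \<in> WJ m n" by (simp add: WJ_def)
  then have "b' = b" using Ym_WJ_unique(1)[OF b(2,1) WJ_one, of "inverse b * b'"] by simp
  then show ?thesis by simp
qed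

lemma yel_neg: assumes "(m, a, u, b) \<in> Idx n" "p > 0" shows "yel (m, a, u, b) $ p < 0 \<longleftrightarrow> inverse b $ p \<le> int m"
proof -
  have s: "a * u \<in> Sy n" "b \<in> Sy n" using assms Ym_Sy WJ_Sy by (auto simp: Idx_def)
  define q where "q = inverse b $ p"
  have q: "q > 0" using s assms Sy_pos[of "inverse b" n p] by (simp add: q_def)
  have y: "yel (m, a, u, b) $ p = (a * u) $ (aw m $ q)" by (simp add: q_def)
  show ?thesis
  proof (cases "q \<le> int m")
    case True
    then show ?thesis using q y Sy_pos[OF s(1), of "int m + 1 - q"] bap_minus[of "a * u" "int m + 1 - q"]
      by (simp add: aw_apply q_def)
  next
    case False
    then show ?thesis using q y Sy_pos[OF s(1), of q] by (simp add: aw_apply q_def)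
  qed
qed

text \<open>The positive points at which \<open>yel\<close> is negative are b 1, ..., b m, which
  determine m and the minimal representative b; the rest is unique factorisation along the parabolic
  subgroup.\<close>

lemma yel_inj: "inj_on yel (Idx n)"
proof (rule inj_onI)
  fix i j assume i: "i \<in> Idx n" and j: "j \<in> Idx n" and e: "yel i = yel j"
  obtain m a u b where ii: "i = (m, a, u, b)" by (cases i)
  obtain m' a' u' b' where jj: "j = (m', a', u', b')" by (cases j)
  have I: "m \<le> n" "a \<in> Ym m n" "u \<in> WJ m n" "b \<in> Ym m n" "m' \<le> n" "a' \<in> Ym m' n" "u' \<in> WJ m' n" "b' \<in> Ym m' n"
    using i j by (auto simp: Idx_def ii jj)
  have eq: "inverse b $ p \<le> int m \<longleftrightarrow> inverse b' $ p \<le> int m'" if "p > 0" for p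
    using yel_neg[of m a u b n p] yel_neg[of m' a' u' b' n p] i j e that unfolding ii jj by (simp del: yel.simps)
  have set: "{p. p > 0 \<and> inverse b $ p \<le> int m} = (\<lambda>q. b $ q) ` {1..int m}" if "b \<in> Ym m n" for b m
  proof -
    have s: "b \<in> Sy n" using that Ym_Sy by blast
    have "p \<in> (\<lambda>q. b $ q) ` {1..int m}" if "p > 0" "inverse b $ p \<le> int m" for p
      using that Sy_pos[of "inverse b" n p] s by (intro image_eqI[of _ _ "inverse b $ p"]) auto
    then show ?thesis using Sy_pos[OF s] by auto
  qed
  have card: "card ((\<lambda>q. b $ q) ` {1..int m}) = m" for b m by (subst card_image) (auto simp: inj_on_def)
  have "{p. p > 0 \<and> inverse b $ p \<le> int m} = {p. p > 0 \<and> inverse b' $ p \<le> int m'}" using eq by auto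
  then have "m = m'" unfolding set[OF I(4)] set[OF I(8)] using card by metis
  then have bb: "b = b'" using Ym_image_eq[of b m n b'] I eq by auto
  have "a * u = a' * u'" using e \<open>m = m'\<close> bb by (simp add: ii jj)
  then have "a = a'" "u = u'" using Ym_WJ_unique[of a m n a' u u'] I \<open>m = m'\<close> by auto
  then show "i = j" using ii jj \<open>m = m'\<close> bb by simp
qed

lemma finite_Idx [simp]: "finite (Idx n)"
  by (rule finite_subset[of _ "{..n} \<times> Sy n \<times> Sy n \<times> Sy n"]) (auto simp: Idx_def Ym_Sy WJ_Sy)

lemma Tbar_Sy_lower: assumes "w \<in> Sy n"
  shows "Tbar w \<in> spT {x \<in> Sy n. ell x \<le> ell w}" "Tbar w - Tb w \<in> spT {x \<in> Sy n. ell x < ell w}"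
proof -
  have H: "\<And>x. cf (Tbar w) x \<noteq> 0 ==> x \<in> Sy n" using Tbar_HJ[of w n n] assms unfolding HJ_iff Sy_WJ[symmetric] by blast
  show "Tbar w \<in> spT {x \<in> Sy n. ell x \<le> ell w}"
    unfolding span_Tb using H cf_Tbar(1)[of w] by (auto, metis nat_le_linear not_le)
  show "Tbar w - Tb w \<in> spT {x \<in> Sy n. ell x < ell w}"
    unfolding span_Tb using H cf_Tbar[of w] by (auto simp: cf_Tb)
qed

lemma span_bilinear:
  assumes "h \<in> spT A" "h' \<in> spT B"
    "\<And>x y. x \<in> A ==> y \<in> B ==> Tb x * k * Tb y \<in> hk.span R"
  shows "h * k * h' \<in> hk.span R"
proof -
  have 1: "Tb x * k * h' \<in> hk.span R" if "x \<in> A" for x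
    by (rule span_mult_left[OF _ assms(2)]) (use assms(3) that in auto)
  have "h * (k * h') \<in> hk.span R" by (rule span_mult_right[OF _ assms(1)]) (use 1 in \<open>auto simp: mult.assoc\<close>)
  then show ?thesis by (simp add: mult.assoc)
qed

text \<open>\<open>KLe u\<close> and \<open>CA m\<close> are bar fixed, so only the outer factors
  change, and \<open>Tbar\<close> of a or of the inverse of b differs from \<open>Tb\<close> by
  shorter elements of the symmetric group.\<close>

lemma bar_Eb_lower: assumes "i \<in> Idx n" shows "bar (Eb i) - Eb i \<in> spE {j \<in> Idx n. Rl j i}"
proof -
  obtain m a u b where i: "i = (m, a, u, b)" "m \<le> n" "a \<in> Ym m n" "u \<in> WJ m n" "b \<in> Ym m n" using assms by (auto simp: Idx_def)
  let ?K = "KLe u * CA m"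
  let ?S = "spE {j \<in> Idx n. Rl j i}"
  have as: "a \<in> Sy n" "inverse b \<in> Sy n" using i Ym_Sy by auto
  have gen: "Tb x * ?K * Tb y \<in> ?S" if "x \<in> Sy n" "y \<in> Sy n" "ell x \<le> ell a" "ell y \<le> ell b" "ell x + ell y < ell a + ell b" for x y
  proof -
    have "Tb x * KLe u * CA m * Tb y \<in> spE {(m, a, u, b) | a u b. a \<in> Ym m n \<and> u \<in> WJ m n \<and> b \<in> Ym m n \<and> ell a \<le> ell x \<and> ell b \<le> ell y}"
      by (rule Eb_span_xx) (use that KLe_HJ i in auto)
    also have "\<dots> \<subseteq> ?S" using that i by (intro hk.span_mono image_mono) (auto simp: Idx_def)
    finally show ?thesis by (simp add: mult.assoc)
  qed
  have 1: "(Tbar a - Tb a) * ?K * Tb (inverse b) \<in> ?S"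
    by (rule span_bilinear[OF Tbar_Sy_lower(2)[OF as(1)], of _ "{inverse b}"]) (use gen as in \<open>auto intro: hk.span_base\<close>)
  have 2: "Tbar a * ?K * (Tbar (inverse b) - Tb (inverse b)) \<in> ?S"
    by (rule span_bilinear[OF Tbar_Sy_lower(1)[OF as(1)] Tbar_Sy_lower(2)[OF as(2)]]) (use gen in auto)
  have "bar (Eb i) - Eb i = (Tbar a - Tb a) * ?K * Tb (inverse b) + Tbar a * ?K * (Tbar (inverse b) - Tb (inverse b))"
    by (simp add: i(1) bar_Tb algebra_simps)
  then show ?thesis using hk.span_add[OF 1 2] by simp
qed

lemma KLe_Eb: assumes "i \<in> Idx n" shows "KLe (yel i) - Eb i \<in> spE {j \<in> Idx n. Rl j i}"
proof (rule KLe_triangular[where I = "Idx n" and rank = rk and w = yel and R = Rl and E = Eb])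
  show "Rl j i ==> rk j < rk i" for i j by (cases i; cases j) auto
  show "Rl k j ==> Rl j i ==> Rl k i" for i j k by (cases i; cases j; cases k) auto
qed (use assms yel_inj asym_Eb bar_Eb_lower in auto)

text \<open>An index set closed under \<open>Rl\<close> is triangular within itself in both
  directions. Spans of Kazhdan-Lusztig elements can thus be traded for spans of the computable
  \<open>Eb\<close>.\<close>

lemma span_KLe_Eb:
  assumes "\<Phi> \<subseteq> Idx n" "\<And>i j. i \<in> \<Phi> ==> j \<in> Idx n ==> Rl j i ==> j \<in> \<Phi>"
  shows "spC (yel ` \<Phi>) = spE \<Phi>"
proof
  have sub: "spE {j \<in> Idx n. Rl j i} \<subseteq> spE \<Phi>" if "i \<in> \<Phi>" for i
    using assms(2)[OF that] by (intro hk.span_mono image_mono) blast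
  have "KLe (yel i) \<in> spE \<Phi>" if "i \<in> \<Phi>" for i
  proof -
    have "KLe (yel i) - Eb i \<in> spE \<Phi>" using KLe_Eb[of i n] assms(1) that sub[OF that] by blast
    moreover have "Eb i \<in> spE \<Phi>" using that by (intro hk.span_base imageI)
    ultimately have "KLe (yel i) - Eb i + Eb i \<in> spE \<Phi>" by (rule hk.span_add)
    then show ?thesis by simp
  qed
  then show "spC (yel ` \<Phi>) \<subseteq> spE \<Phi>" by (intro hk.span_minimal) auto
  have "Eb i \<in> spC (yel ` \<Phi>)" if "i \<in> \<Phi>" for i
    using that
  proof (induction "rk i" arbitrary: i rule: less_induct)
    case (less i)
    have r: "Rl j i ==> rk j < rk i" for j by (cases i; cases j) auto
    have "spE {j \<in> Idx n. Rl j i} \<subseteq> spC (yel ` \<Phi>)"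
      using less.hyps r assms(2)[OF less.prems] by (intro hk.span_minimal) auto
    then have "KLe (yel i) - Eb i \<in> spC (yel ` \<Phi>)" using KLe_Eb[of i n] assms(1) less.prems by blast
    moreover have "KLe (yel i) \<in> spC (yel ` \<Phi>)" using less.prems by (intro hk.span_base imageI)
    ultimately have "KLe (yel i) - (KLe (yel i) - Eb i) \<in> spC (yel ` \<Phi>)" by (rule hk.span_diff[rotated])
    then show ?case by simp
  qed
  then show "spE \<Phi> \<subseteq> spC (yel ` \<Phi>)" by (intro hk.span_minimal) auto
qed

section \<open>Left ideals, the action of T_t and the removal of coset representatives\<close>

section \<open>The action of $T_t$\<close>

text \<open>Let k + 1 be the point that \<sigma> sends to 1 and write \<sigma> = g s_1 ... s_k with
  g fixing 1, so that T_g commutes with T_t. For k < m, \<open>CA_0_Pm\<close> gives the eigenvalue.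
  For k \<ge> m, \<open>Pm k\<close> splits as \<open>Pm m * R\<close> with R commuting with
  \<open>CA m\<close>, and solving the recursion for \<open>tt 0 * Pm m * CA m\<close> produces the
  two terms.\<close>

lemma tt0_Tb_CA:
  assumes s: "\<sigma> \<in> Sy n" and mn: "m \<le> n" and n0: "0 < n"
  shows "inverse \<sigma> $ 1 \<le> int m ==> tt 0 * (Tb \<sigma> * CA m) = sc (vg 0) (Tb \<sigma> * CA m)"
    and "\<not> inverse \<sigma> $ 1 \<le> int m ==> m < n \<and> (\<exists>\<rho>\<in>HJ n n. (\<forall>x. cf \<rho> x \<in> VF) \<and>
      (\<exists>h1\<in>HJ n n. \<exists>h2\<in>HJ n n. tt 0 * (Tb \<sigma> * CA m) = h1 * CA (Suc m) * h2 - sc (vgi 0) (\<rho> * CA m)))"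
proof -
  have si: "inverse \<sigma> \<in> Sy n" using s by simp
  define k where "k = nat (inverse \<sigma> $ 1 - 1)"
  have k: "int k + 1 = inverse \<sigma> $ 1" using Sy_pos[OF si, of 1] by (simp add: k_def)
  have kn: "k < n"
    using Sy_range[OF si, of 1] k n0 by simp
  define g where "g = \<sigma> * inverse (xm k)"
  have xk: "xm k \<in> Sy n" using xm_Sy kn by blast
  have gS: "g \<in> Sy n" using s xk by (auto simp: g_def)
  have \<sigma>: "\<sigma> = g * xm k" by (simp add: g_def mult.assoc)
  have x1: "inverse (xm k) $ 1 = int k + 1" by (rule binv_bapI) (simp add: xm_apply)
  have g1: "g $ 1 = 1" unfolding g_def using x1 k by simp
  have ixm: "inverse (xm k) $ i = (if i = 1 then int k + 1 else if i \<le> int k + 1 then i - 1 else i)" if "i > 0" for i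
    using that by (intro binv_bapI) (auto simp: xm_apply)
  have T: "Tb \<sigma> = Tb g * Pm k"
    unfolding \<sigma> Pm_Tb
  proof (rule Tb_mult[symmetric], rule ell_add_pos[OF xk])
    fix p q :: int assume pq: "0 < p" "p < q" "inverse (xm k) $ q < inverse (xm k) $ p"
    have "p = 1" using pq ixm[of p] ixm[of q] by (auto split: if_splits)
    moreover have "g $ q > 0" "g $ q \<noteq> g $ 1" using Sy_pos[OF gS, of q] pq by auto
    ultimately show "g $ p < g $ q" using g1 by simp
  qed
  have gg: "gen 0 * g = g * gen 0"
  proof (rule bperm_eqI_pos)
    fix i :: int assume "i > 0"
    have "g $ i > 0" "i \<noteq> 1 ==> g $ i \<noteq> g $ 1" using Sy_pos[OF gS \<open>i > 0\<close>] by auto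
    then show "(gen 0 * g) $ i = (g * gen 0) $ i" using g1 \<open>i > 0\<close> bap_minus[of g 1] by (auto simp: gen_apply)
  qed
  have ig: "inverse g $ 1 = 1" using g1 by (rule binv_bapI)
  have up: "\<not> ell (gen 0 * g) < ell g" unfolding ell_less_left using ig by (simp add: ra_def rb_def)
  have "\<not> ell (g * gen 0) < ell g" using up gg by simp
  then have tg: "tt 0 * Tb g = Tb g * tt 0" using up gg by (simp add: tt_Tb Tb_tt)
  have e: "tt 0 * (Tb \<sigma> * CA m) = Tb g * (tt 0 * (Pm k * CA m))" unfolding T using tg by (metis mult.assoc)
  show "tt 0 * (Tb \<sigma> * CA m) = sc (vg 0) (Tb \<sigma> * CA m)" if "inverse \<sigma> $ 1 \<le> int m"
    unfolding e using CA_0_Pm[of k m] that k by (simp add: T mult.assoc)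
  assume "\<not> inverse \<sigma> $ 1 \<le> int m"
  then have mk: "m \<le> k" using k by simp
  have "\<exists>R\<in>HJ n n. (\<forall>x. cf R x \<in> VF) \<and> Pm k = Pm m * R \<and> R * CA m = CA m * R"
    using mk kn
  proof (induction rule: dec_induct)
    case base
    have "cf 1 x = (if x = 1 then 1 else 0)" for x using cf_Tb[of 1 x] by simp
    then show ?case by (intro bexI[of _ 1]) auto
  next
    case (step j)
    then obtain R where R: "R \<in> HJ n n" "\<And>x. cf R x \<in> VF" "Pm j = Pm m * R" "R * CA m = CA m * R" by auto
    have "R * tt (Suc j) \<in> HJ n n" using HJ_mult[OF R(1)] HJ_Tb[of "gen (Suc j)" n n] gen_Sy[of "Suc j" n] step Sy_WJ by auto
    moreover have "R * tt (Suc j) * CA m = CA m * (R * tt (Suc j))"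
      using R(4) CA_far[of m "Suc j"] step by (simp add: mult.assoc) (metis mult.assoc)
    moreover have "cf (R * tt (Suc j)) x \<in> VF" for x by (rule cf_tt_KS(3)[OF R(2)]) (auto simp: Vzero_def)
    ultimately show ?case using R(3) by (intro bexI[of _ "R * tt (Suc j)"]) (auto simp: mult.assoc)
  qed
  then obtain R where R: "R \<in> HJ n n" "\<And>x. cf R x \<in> VF" "Pm k = Pm m * R" "R * CA m = CA m * R" by auto
  have QR: "cf (Qm m * R) x \<in> VF" for x by (rule cf_Qm_KS[OF R(2)]) (auto simp: Vzero_def)
  have gQ: "cf (Tb g * (Qm m * R)) x \<in> VF" for x
  proof -
    have "g \<in> WJ n n" using gS Sy_WJ by simp
    then have "\<forall>x. cf (Tb g * (Qm m * R)) x \<in> VF"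
    proof (induction rule: WJ_induct)
      case (step i w)
      have "Tb (gen i * w) * (Qm m * R) = tt i * (Tb w * (Qm m * R))" using step by (simp add: tt_Tb mult.assoc[symmetric])
      then show ?case using cf_tt_KS(1)[of "Tb w * (Qm m * R)" Vzero i] step by (auto simp: Vzero_def)
    qed (use QR in simp)
    then show ?thesis by blast
  qed
  have QmH: "Qm j * h \<in> HJ n n" if "j < n" "h \<in> HJ n n" for j h
    using that
  proof (induction j arbitrary: h)
    case (Suc j)
    have "tt (Suc j) * h - sc (xg (Suc j)) h \<in> HJ n n" using HJ_tt[of "Suc j" n n h] Suc HJ_diff HJ_sc by auto
    then show ?case using Suc.IH Suc.prems by (simp add: mult.assoc ti_eq)
  qed simp
  have gH: "Tb g \<in> HJ n n" using HJ_Tb gS Sy_WJ by simp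
  have "tt 0 * (Pm k * CA m) = (tt 0 * Pm m * CA m) * R" unfolding R(3) using R(4) by (metis mult.assoc)
  also have "tt 0 * Pm m * CA m = CA (Suc m) - sc (vgi 0) (Qm m * CA m)" by (simp add: distrib_right)
  also have "(CA (Suc m) - sc (vgi 0) (Qm m * CA m)) * R = CA (Suc m) * R - sc (vgi 0) (Qm m * R * CA m)"
    using R(4) by (simp add: left_diff_distrib mult.assoc del: CA.simps)
  finally have "tt 0 * (Tb \<sigma> * CA m) = Tb g * CA (Suc m) * R - sc (vgi 0) (Tb g * (Qm m * R) * CA m)"
    unfolding e by (simp add: right_diff_distrib mult.assoc del: CA.simps)
  note fin = this
  have rH: "Tb g * (Qm m * R) \<in> HJ n n" using HJ_mult[OF gH QmH[of m R]] R(1) mk kn by simp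
  have "\<exists>h1\<in>HJ n n. \<exists>h2\<in>HJ n n. tt 0 * (Tb \<sigma> * CA m) = h1 * CA (Suc m) * h2 - sc (vgi 0) (Tb g * (Qm m * R) * CA m)"
    using fin gH R(1) by blast
  note B = this
  have mn': "m < n" using mk kn by simp
  have A: "\<forall>x. cf (Tb g * (Qm m * R)) x \<in> VF" using gQ by blast
  show "m < n \<and> (\<exists>\<rho>\<in>HJ n n. (\<forall>x. cf \<rho> x \<in> VF) \<and>
      (\<exists>h1\<in>HJ n n. \<exists>h2\<in>HJ n n. tt 0 * (Tb \<sigma> * CA m) = h1 * CA (Suc m) * h2 - sc (vgi 0) (\<rho> * CA m)))"
  proof (rule conjI[OF mn'])
    show "\<exists>\<rho>\<in>HJ n n. (\<forall>x. cf \<rho> x \<in> VF) \<and>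
      (\<exists>h1\<in>HJ n n. \<exists>h2\<in>HJ n n. tt 0 * (Tb \<sigma> * CA m) = h1 * CA (Suc m) * h2 - sc (vgi 0) (\<rho> * CA m))"
      by (rule bexI[where x = "Tb g * (Qm m * R)"]) (rule conjI[OF A B], rule rH)
  qed
qed

section \<open>Left-closed sets\<close>

text \<open>The Kazhdan-Lusztig elements of F span a left ideal. Sets closed downwards for the left
  preorder are handled in this form because it can be checked on another spanning set, such as the
  \<open>Eb\<close>.\<close>

definition lclosed :: "nat => bperm set => bool" where
  "lclosed n F \<longleftrightarrow> F \<subseteq> Wn n \<and> (\<forall>y\<in>F. \<forall>i<n. tt i * KLe y \<in> spC F)"

lemma lclosed_left: "lclosed n F ==> i < n ==> h \<in> spC F ==> tt i * h \<in> spC F"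
  unfolding lclosed_def by (rule span_mult_left[of "KLe ` F"]) auto

lemma yel_Wn: assumes "i \<in> Idx n" shows "yel i \<in> Wn n"
proof -
  obtain m a u b where i: "i = (m, a, u, b)" "m \<le> n" "a \<in> Ym m n" "u \<in> WJ m n" "b \<in> Ym m n" using assms by (auto simp: Idx_def)
  have "a \<in> Wn n" "u \<in> Wn n" "aw m \<in> Wn n" "inverse b \<in> Wn n" using Sy_Wn[OF Ym_Sy[OF i(3)]] Sy_Wn[OF WJ_Sy[OF i(4)]] aw_Wn[OF i(2)] Sy_Wn[OF Ym_Sy[OF i(5)]] by auto
  then show ?thesis unfolding i(1) yel.simps by (intro Wn_times)
qed

lemma tt0_Eb:
  assumes "(m, a, u, b) \<in> Idx n" "0 < n"
  shows "tt 0 * Eb (m, a, u, b) \<in> spE ({(m, a', u', b) | a' u'. a' \<in> Ym m n \<and> u' \<in> WJ m n} \<union>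
     {(Suc m, a', u', b') | a' u' b'. Suc m \<le> n \<and> a' \<in> Ym (Suc m) n \<and> u' \<in> WJ (Suc m) n \<and> b' \<in> Ym (Suc m) n})"
    (is "_ \<in> spE (?A \<union> ?B)")
proof -
  have I: "m \<le> n" "a \<in> Ym m n" "u \<in> WJ m n" "b \<in> Ym m n" using assms by (auto simp: Idx_def)
  have "inverse b \<in> Sy n" using I Ym_Sy by simp
  then have bS: "inverse b \<in> WJ n n" unfolding Sy_WJ .
  have "a \<in> WJ n n" using I Ym_Sy unfolding Sy_WJ by blast
  then have k: "Tb a * KLe u \<in> HJ n n" by (intro HJ_mult HJ_Tb HJ_sub[OF KLe_HJ[OF I(3)]])
  have A: "h * CA m * Tb (inverse b) \<in> spE (?A \<union> ?B)" if "h \<in> HJ n n" for h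
    using Eb_span_k[OF that, of m b] hk.span_mono[of "Eb ` ?A" "Eb ` (?A \<union> ?B)"] by blast
  have B: "h * CA (Suc m) * h' \<in> spE (?A \<union> ?B)" if "h \<in> HJ n n" "h' \<in> HJ n n" "Suc m \<le> n" for h h'
  proof -
    have "{(Suc m, a, u, b) | a u b. a \<in> Ym (Suc m) n \<and> u \<in> WJ (Suc m) n \<and> b \<in> Ym (Suc m) n} \<subseteq> ?A \<union> ?B" using that(3) by blast
    then have "spE {(Suc m, a, u, b) | a u b. a \<in> Ym (Suc m) n \<and> u \<in> WJ (Suc m) n \<and> b \<in> Ym (Suc m) n} \<subseteq> spE (?A \<union> ?B)"
      by (intro hk.span_mono image_mono)
    then show ?thesis using Eb_span_kk[OF that] by blast
  qed
  have "(\<lambda>h. tt 0 * (h * CA m) * Tb (inverse b)) (Tb a * KLe u) \<in> spE (?A \<union> ?B)"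
  proof (rule span_HJ_induct[OF k])
    fix x assume x: "x \<in> WJ n n"
    then have xS: "x \<in> Sy n" using Sy_WJ by simp
    show "tt 0 * (Tb x * CA m) * Tb (inverse b) \<in> spE (?A \<union> ?B)"
    proof (cases "inverse x $ 1 \<le> int m")
      case True
      have "tt 0 * (Tb x * CA m) * Tb (inverse b) = sc (vg 0) (Tb x * CA m * Tb (inverse b))"
        unfolding tt0_Tb_CA(1)[OF xS I(1) assms(2) True] by simp
      then show ?thesis using A[OF HJ_Tb[OF x]] hk.span_scale by simp
    next
      case False
      obtain \<rho> h1 h2 where r: "m < n" "\<rho> \<in> HJ n n" "h1 \<in> HJ n n" "h2 \<in> HJ n n"
        "tt 0 * (Tb x * CA m) = h1 * CA (Suc m) * h2 - sc (vgi 0) (\<rho> * CA m)"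
        using tt0_Tb_CA(2)[OF xS I(1) assms(2) False] by blast
      have "tt 0 * (Tb x * CA m) * Tb (inverse b) = h1 * CA (Suc m) * (h2 * Tb (inverse b)) - sc (vgi 0) (\<rho> * CA m * Tb (inverse b))"
        unfolding r(5) by (simp add: left_diff_distrib mult.assoc del: CA.simps)
      moreover have "h2 * Tb (inverse b) \<in> HJ n n" using HJ_mult HJ_Tb bS r by blast
      ultimately show ?thesis using A[OF r(2)] B[OF r(3), of "h2 * Tb (inverse b)"] r(1)
        by (simp add: hk.span_diff hk.span_scale del: CA.simps)
    qed
  qed (auto simp: lin_def distrib_left distrib_right)
  then show ?thesis by (simp add: mult.assoc)
qed

lemma tti_Eb:
  assumes "(m, a, u, b) \<in> Idx n" "0 < i" "i < n"
  shows "tt i * Eb (m, a, u, b) \<in> spE {(m, a', u', b) | a' u'. a' \<in> Ym m n \<and> u' \<in> WJ m n}"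
proof -
  have I: "m \<le> n" "a \<in> Ym m n" "u \<in> WJ m n" "b \<in> Ym m n" using assms by (auto simp: Idx_def)
  have "a \<in> WJ n n" using I Ym_Sy Sy_WJ by blast
  then have k: "Tb a * KLe u \<in> HJ n n" by (intro HJ_mult HJ_Tb HJ_sub[OF KLe_HJ[OF I(3)]])
  have "tt i * (Tb a * KLe u) \<in> HJ n n" using HJ_tt[OF assms(2,3) _ k] assms by simp
  from Eb_span_k[OF this, of m b] show ?thesis by (simp add: mult.assoc)
qed

text \<open>The closure conditions mirror the action on \<open>Eb\<close>: s_i keeps m and b, while
  T_t keeps them or raises m by one with b arbitrary.\<close>

lemma lclosed_yel:
  assumes n: "0 < n" and P: "\<Phi> \<subseteq> Idx n" "\<And>i j. i \<in> \<Phi> ==> j \<in> Idx n ==> Rl j i ==> j \<in> \<Phi>"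
    and P1: "\<And>m a u b a' u'. (m, a, u, b) \<in> \<Phi> ==> (m, a', u', b) \<in> Idx n ==> (m, a', u', b) \<in> \<Phi>"
    and P2: "\<And>m a u b a' u' b'. (m, a, u, b) \<in> \<Phi> ==> (Suc m, a', u', b') \<in> Idx n ==> (Suc m, a', u', b') \<in> \<Phi>"
  shows "lclosed n (yel ` \<Phi>)"
proof -
  have s: "spC (yel ` \<Phi>) = spE \<Phi>" by (rule span_KLe_Eb[OF P])
  have st: "tt i * Eb j \<in> spE \<Phi>" if "j \<in> \<Phi>" "i < n" for i j
  proof -
    obtain m a u b where j: "j = (m, a, u, b)" by (cases j)
    have jI: "(m, a, u, b) \<in> Idx n" using that P j by auto
    then have mb: "m \<le> n" "b \<in> Ym m n" by (auto simp: Idx_def)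
    have A: "{(m, a', u', b) | a' u'. a' \<in> Ym m n \<and> u' \<in> WJ m n} \<subseteq> \<Phi>"
    proof clarify
      fix a' u' assume "a' \<in> Ym m n" "u' \<in> WJ m n"
      then have "(m, a', u', b) \<in> Idx n" using mb by (simp add: Idx_def)
      then show "(m, a', u', b) \<in> \<Phi>" using P1 that(1) j by blast
    qed
    have B: "{(Suc m, a', u', b') | a' u' b'. Suc m \<le> n \<and> a' \<in> Ym (Suc m) n \<and> u' \<in> WJ (Suc m) n \<and> b' \<in> Ym (Suc m) n} \<subseteq> \<Phi>"
    proof clarify
      fix a' u' b' assume "Suc m \<le> n" "a' \<in> Ym (Suc m) n" "u' \<in> WJ (Suc m) n" "b' \<in> Ym (Suc m) n"
      then have "(Suc m, a', u', b') \<in> Idx n" by (simp add: Idx_def)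
      then show "(Suc m, a', u', b') \<in> \<Phi>" using P2 that(1) j by blast
    qed
    show ?thesis
    proof (cases "i = 0")
      case True
      then show ?thesis unfolding j using tt0_Eb[OF jI n] hk.span_mono[OF image_mono[OF Un_least[OF A B]]] by blast
    next
      case False
      then show ?thesis unfolding j using tti_Eb[OF jI _ that(2)] hk.span_mono[OF image_mono[OF A]] by blast
    qed
  qed
  show ?thesis
    unfolding lclosed_def s
  proof (intro conjI ballI allI impI)
    show "yel ` \<Phi> \<subseteq> Wn n" using P(1) yel_Wn by blast
    fix y i assume "y \<in> yel ` \<Phi>" "i < n"
    then have "KLe y \<in> spE \<Phi>" using s hk.span_base[of "KLe y" "KLe ` yel ` \<Phi>"] by auto
    then show "tt i * KLe y \<in> spE \<Phi>" by (rule span_mult_left[rotated]) (use st \<open>i < n\<close> in auto)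
  qed
qed

text \<open>\<open>More l n\<close> consists of the elements with more than l sign changes; for l
  \<le> n, \<open>AtL l n\<close> adds the elements \<sigma> a_l with \<sigma> in
  \<open>Sy n\<close>. Both are left closed, so their difference is a union of left cells.\<close>

definition More :: "nat => nat => bperm set" where
  "More l n = yel ` {(m, a, u, b) \<in> Idx n. l < m}"
definition AtL :: "nat => nat => bperm set" where
  "AtL l n = yel ` {(m, a, u, b) \<in> Idx n. l < m \<or> m = l \<and> b = 1}"

lemma lclosed_More: "0 < n ==> lclosed n (More l n)"
  unfolding More_def by (rule lclosed_yel) (auto simp: Idx_def)
lemma lclosed_AtL: "0 < n ==> lclosed n (AtL l n)"
  unfolding AtL_def by (rule lclosed_yel) (auto simp: Idx_def)

lemma AtL_cases: assumes "y \<in> AtL l n" "y \<notin> More l n" "l \<le> n" shows "\<exists>\<sigma>\<in>Sy n. y = \<sigma> * aw l"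
proof -
  obtain m a u b where y: "y = yel (m, a, u, b)" "(m, a, u, b) \<in> Idx n" "l < m \<or> m = l \<and> b = 1" using assms(1) unfolding AtL_def by blast
  have "\<not> l < m" using assms(2) y unfolding More_def by blast
  then have ml: "m = l" "b = 1" using y by auto
  have "a * u \<in> Sy n" using y(2) Ym_Sy WJ_Sy by (auto simp: Idx_def)
  then show ?thesis using y(1) ml by (intro bexI[of _ "a * u"]) simp_all
qed

lemma Sy_aw_AtL: assumes "\<sigma> \<in> Sy n" "l \<le> n" shows "\<sigma> * aw l \<in> AtL l n" "\<sigma> * aw l \<notin> More l n"
proof -
  obtain a u where au: "a \<in> Ym l n" "u \<in> WJ l n" "\<sigma> = a * u" using coset_decomp[OF assms(1)] by blast
  have i: "(l, a, u, 1) \<in> Idx n" "yel (l, a, u, 1) = \<sigma> * aw l" using au assms by (auto simp: Idx_def)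
  then show "\<sigma> * aw l \<in> AtL l n" unfolding AtL_def by (intro image_eqI[of _ _ "(l, a, u, 1)"]) auto
  show "\<sigma> * aw l \<notin> More l n"
  proof
    assume "\<sigma> * aw l \<in> More l n"
    then obtain j where j: "\<sigma> * aw l = yel j" "j \<in> {(m, a, u, b) \<in> Idx n. l < m}" unfolding More_def by (rule imageE)
    obtain m a' u' b' where jj: "j = (m, a', u', b')" by (cases j)
    have jI: "j \<in> Idx n" "l < m" using j(2) unfolding jj by simp_all
    have "yel j = yel (l, a, u, 1)" unfolding i(2) j(1) ..
    from inj_onD[OF yel_inj this jI(1) i(1)] have "m = l" unfolding jj by simp
    then show False using jI by simp
  qed
qed

section \<open>Independence of the coset part\<close>

text \<open>Both factors are bar fixed and \<open>asym_CA\<close> identifies the leading term, so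
  uniqueness applies.\<close>

lemma KLe_Sy_aw: assumes "\<sigma> \<in> Sy n" shows "KLe (\<sigma> * aw l) = KLe \<sigma> * CA l"
proof -
  have "\<sigma> \<in> WJ n n" using assms Sy_WJ by simp
  then have "asymT (\<sigma> * aw l * inverse 1) (KLe \<sigma> * CA l * Tb (inverse 1))"
    by (intro asym_CA[OF KLe_HJ asym_KLe Ym_one])
  then show ?thesis by (intro KLe_unique[symmetric]) auto
qed

lemma HJ_kc: assumes "h \<in> HJ n n" shows "h = (\<Sum>\<sigma>\<in>Sy n. sc (kc h \<sigma>) (KLe \<sigma>))" "kc h z \<noteq> 0 ==> z \<in> Sy n"
proof -
  have k: "\<And>z. kc h z \<noteq> 0 ==> z \<in> Sy n" using assms unfolding span_KLe_WJ kc_span Sy_WJ by blast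
  then show "kc h z \<noteq> 0 ==> z \<in> Sy n" .
  have "(\<Sum>\<sigma>\<in>Sy n. sc (kc h \<sigma>) (KLe \<sigma>)) = (\<Sum>z | kc h z \<noteq> 0. sc (kc h z) (KLe z))"
    by (rule sum.mono_neutral_right) (use k in auto)
  then show "h = (\<Sum>\<sigma>\<in>Sy n. sc (kc h \<sigma>) (KLe \<sigma>))" using kc_expand[of h] by simp
qed

text \<open>Right multiplication by \<open>CA l\<close> carries the Kazhdan-Lusztig elements of
  \<open>Sy n\<close> to those of its translate by a_l, by \<open>KLe_Sy_aw\<close>; in particular
  it is injective on the subalgebra.\<close>

lemma kc_CA: assumes "h \<in> HJ n n" shows "kc (h * CA l) (\<sigma> * aw l) = kc h \<sigma>"
proof -
  have "h * CA l = (\<Sum>\<sigma>\<in>Sy n. sc (kc h \<sigma>) (KLe (\<sigma> * aw l)))"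
    by (subst HJ_kc(1)[OF assms]) (simp add: sum_distrib_right KLe_Sy_aw)
  then have "kc (h * CA l) (\<sigma> * aw l) = (\<Sum>\<tau>\<in>Sy n. kc h \<tau> * (if \<sigma> * aw l = \<tau> * aw l then 1 else 0))"
    by (simp add: kc_sum kc_sc kc_KLe)
  also have "\<dots> = (\<Sum>\<tau>\<in>Sy n. if \<tau> = \<sigma> then kc h \<tau> else 0)" by (rule sum.cong) auto
  also have "\<dots> = kc h \<sigma>" using HJ_kc(2)[OF assms, of \<sigma>] by auto
  finally show ?thesis .
qed

lemma kc_CA_other: assumes "h \<in> HJ n n" "kc (h * CA l) z \<noteq> 0" shows "\<exists>\<sigma>\<in>Sy n. z = \<sigma> * aw l"
proof -
  have "h * CA l = (\<Sum>\<sigma>\<in>Sy n. sc (kc h \<sigma>) (KLe (\<sigma> * aw l)))"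
    by (subst HJ_kc(1)[OF assms(1)]) (simp add: sum_distrib_right KLe_Sy_aw)
  then have "h * CA l \<in> spC ((\<lambda>\<sigma>. \<sigma> * aw l) ` Sy n)"
    by (simp, intro hk.span_sum hk.span_scale hk.span_base) auto
  then show ?thesis using assms(2) unfolding kc_span by blast
qed

lemma restr_mult_VF: assumes "q \<in> VF" shows "restr Vzero (p * q) = restr Vzero p * q"
proof -
  have 1: "restr Vzero (p * q) = restr Vzero (restr Vzero p * q) + restr Vzero (restr (- Vzero) p * q)"
  proof -
    have "p = restr Vzero p + restr (- Vzero) p" by (rule poly_mapping_eqI) (simp add: lookup_add lookup_restr)
    then have "p * q = restr Vzero p * q + restr (- Vzero) p * q" by (metis distrib_right)
    then show ?thesis by (intro poly_mapping_eqI) (simp add: lookup_restr lookup_add)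
  qed
  have id: "restr S r = r" if "r \<in> KS S" for r S
    by (rule poly_mapping_eqI) (use that in \<open>auto simp: lookup_restr KS_def in_keys_iff subset_iff\<close>)
  have z: "restr S r = 0" if "r \<in> KS (- S)" for r S
    by (rule poly_mapping_eqI) (use that in \<open>auto simp: lookup_restr KS_def in_keys_iff subset_iff\<close>)
  have rS: "restr S r \<in> KS S" for r S by (auto simp: KS_def in_keys_iff lookup_restr split: if_splits)
  have "restr Vzero p * q \<in> VF" using VF_VF rS assms by blast
  moreover have "restr (- Vzero) p * q \<in> KS (- Vzero)"
    by (rule KS_mult[OF rS assms]) (auto simp: Vzero_def)
  ultimately show ?thesis using 1 id z by simp
qed

lemma restr_KS: "p \<in> KS S ==> restr R p \<in> KS (S \<inter> R)"
  by (auto simp: KS_def in_keys_iff lookup_restr subset_iff split: if_splits)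
lemma restr_add: "restr S (p + q) = restr S p + restr S q"
  and restr_diff: "restr S (p - q) = restr S p - restr S q"
  by (rule poly_mapping_eqI; simp add: lookup_restr lookup_add lookup_minus)+
lemma restr_0 [simp]: "restr S 0 = 0" by (rule poly_mapping_eqI) (simp add: lookup_restr)
lemma restr_sum: "restr S (sum f A) = (\<Sum>i\<in>A. restr S (f i))"
  by (induction A rule: infinite_finite_induct) (auto simp: restr_add)
lemma restr_bar: "restr Vzero (laurent_bar p) = laurent_bar (restr Vzero p)"
  by (rule poly_mapping_eqI, rename_tac k, case_tac k) (auto simp: lookup_restr lookup_bar Vzero_def)
lemma restr_VF: "p \<in> VF ==> restr Vzero p = p"
  by (rule poly_mapping_eqI) (auto simp: lookup_restr KS_def in_keys_iff subset_iff)
lemma restr_VF_iff: "restr Vzero p \<in> VF" by (rule KS_mono[OF restr_KS[of p UNIV]]) (auto simp: KS_def)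

definition hrestr :: "hk => hk" where "hrestr h = (\<Sum>w | cf h w \<noteq> 0. sc (restr Vzero (cf h w)) (Tb w))"

lemma cf_hrestr: "cf (hrestr h) x = restr Vzero (cf h x)"
proof -
  have "cf (hrestr h) x = (\<Sum>w | cf h w \<noteq> 0. if w = x then restr Vzero (cf h w) else 0)"
    unfolding hrestr_def cf_sum by (rule sum.cong) (auto simp: cf_Tb)
  then show ?thesis by (simp add: sum.delta)
qed

text \<open>The part of degree 0 in V is again bar fixed, because the bar involution on
  \<open>Sy n\<close> involves no V, and it has the same leading term. By uniqueness it is the whole
  element.\<close>

lemma KLe_VF: assumes "\<sigma> \<in> Sy n" shows "cf (KLe \<sigma>) x \<in> VF"
proof -
  have s: "cf (KLe \<sigma>) w \<noteq> 0 ==> w \<in> WJ n n" for w using KLe_HJ[of \<sigma> n n] assms Sy_WJ HJ_iff by blast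
  have sub: "{w. cf (hrestr (KLe \<sigma>)) w \<noteq> 0} \<subseteq> {w. cf (KLe \<sigma>) w \<noteq> 0}" by (auto simp: cf_hrestr)
  have "bar (hrestr (KLe \<sigma>)) = hrestr (KLe \<sigma>)"
  proof (rule hk_eqI)
    fix x
    have "cf (bar (hrestr (KLe \<sigma>))) x = (\<Sum>w | cf (KLe \<sigma>) w \<noteq> 0. laurent_bar (restr Vzero (cf (KLe \<sigma>) w)) * cf (Tbar w) x)"
      unfolding bar_on[OF finite_cf sub] by (simp add: cf_hrestr)
    also have "\<dots> = (\<Sum>w | cf (KLe \<sigma>) w \<noteq> 0. restr Vzero (laurent_bar (cf (KLe \<sigma>) w) * cf (Tbar w) x))"
    proof (rule sum.cong[OF refl])
      fix w assume "w \<in> {w. cf (KLe \<sigma>) w \<noteq> 0}"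
      then have "cf (Tbar w) x \<in> VF" using Tbar_HJ s by blast
      then show "laurent_bar (restr Vzero (cf (KLe \<sigma>) w)) * cf (Tbar w) x = restr Vzero (laurent_bar (cf (KLe \<sigma>) w) * cf (Tbar w) x)"
        by (simp add: restr_mult_VF restr_bar)
    qed
    also have "\<dots> = restr Vzero (cf (bar (KLe \<sigma>)) x)" by (simp add: bar_def restr_sum del: bar_KLe)
    finally show "cf (bar (hrestr (KLe \<sigma>))) x = cf (hrestr (KLe \<sigma>)) x" by (simp add: cf_hrestr)
  qed
  moreover have "asymT \<sigma> (hrestr (KLe \<sigma>))"
    unfolding asymT_def
  proof
    fix x
    have "cf (Tb \<sigma>) x = restr Vzero (cf (Tb \<sigma>) x)" by (auto simp: cf_Tb restr_VF)
    then have "cf (hrestr (KLe \<sigma>)) x - cf (Tb \<sigma>) x = restr Vzero (cf (KLe \<sigma>) x - cf (Tb \<sigma>) x)"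
      by (simp add: cf_hrestr restr_diff)
    then show "cf (hrestr (KLe \<sigma>)) x - cf (Tb \<sigma>) x \<in> AN"
      using restr_KS[of _ Neg Vzero] asym_KLe[of \<sigma>] KS_mono by (metis asymT_def inf_le1)
  qed
  ultimately have "hrestr (KLe \<sigma>) = KLe \<sigma>" by (rule KLe_unique)
  then have "cf (KLe \<sigma>) x = restr Vzero (cf (KLe \<sigma>) x)" by (metis cf_hrestr)
  then show ?thesis using restr_VF_iff by metis
qed

lemma kc_VF: assumes "h \<in> HJ n n" "\<And>x. cf h x \<in> VF" shows "kc h \<sigma> \<in> VF"
proof -
  have "h = (\<Sum>\<sigma>\<in>Sy n. sc (restr Vzero (kc h \<sigma>)) (KLe \<sigma>))"
  proof (rule hk_eqI)
    fix x
    have "cf h x = restr Vzero (cf h x)" using restr_VF assms(2) by metis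
    also have "\<dots> = (\<Sum>\<sigma>\<in>Sy n. restr Vzero (kc h \<sigma>) * cf (KLe \<sigma>) x)"
      by (subst HJ_kc(1)[OF assms(1)]) (simp add: restr_sum restr_mult_VF KLe_VF)
    finally show "cf h x = cf (\<Sum>\<sigma>\<in>Sy n. sc (restr Vzero (kc h \<sigma>)) (KLe \<sigma>)) x" by simp
  qed
  from kc_eqI[OF finite_Sy this, of \<sigma>] have "kc h \<sigma> = (if \<sigma> \<in> Sy n then restr Vzero (kc h \<sigma>) else 0)" .
  then show ?thesis using restr_VF_iff by (metis KS_0)
qed

lemma VF_sep: assumes "p \<in> VF" "q \<in> VF" "vg 0 * p = vgi 0 * q" shows "p = 0"
proof (rule poly_mapping_eqI)
  fix k :: "int \<times> int"
  obtain i j where k: "k = (i, j)" by (cases k)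
  have "p = laurent_monom (-1) 0 * (laurent_monom 1 0 * p)" by (simp add: mult.assoc[symmetric] laurent_monom_mult laurent_monom_1)
  also have "laurent_monom 1 0 * p = laurent_monom (-1) 0 * q" using assms(3) by (simp add: vg_def vgi_def)
  finally have "p = laurent_monom (-2) 0 * q" by (simp add: mult.assoc[symmetric] laurent_monom_mult)
  then have e: "Poly_Mapping.lookup p (i, j) = Poly_Mapping.lookup q (i + 2, j)" using lookup_monom_mult[of "-2" 0 q i j] by simp
  show "Poly_Mapping.lookup p k = Poly_Mapping.lookup 0 k"
  proof (rule ccontr)
    assume n: "Poly_Mapping.lookup p k \<noteq> Poly_Mapping.lookup 0 k"
    then have "(i, j) \<in> Vzero" "(i + 2, j) \<in> Vzero" using assms(1,2) e k by (auto simp: KS_def in_keys_iff subset_iff)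
    then show False by (simp add: Vzero_def)
  qed
qed

definition hproj :: "bperm set => hk => hk" where "hproj S h = (\<Sum>w | cf h w \<noteq> 0 \<and> w \<in> S. sc (cf h w) (Tb w))"

lemma cf_hproj: "cf (hproj S h) x = (if x \<in> S then cf h x else 0)"
proof -
  have "cf (hproj S h) x = (\<Sum>w | cf h w \<noteq> 0 \<and> w \<in> S. if w = x then cf h w else 0)"
    unfolding hproj_def cf_sum by (rule sum.cong) (auto simp: cf_Tb)
  moreover have "finite {w. cf h w \<noteq> 0 \<and> w \<in> S}" by (rule finite_subset[OF _ finite_cf[of h]]) auto
  ultimately show ?thesis by (simp add: sum.delta)
qed

text \<open>$T_t$ multiplies $T_\sigma C_{a_l}$ by $V$ if $\sigma^{-1}(1) \le l$, and otherwise by a coefficient of negative $V$-degree, up to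
  elements with more sign changes. For coefficients free of \<open>V\<close>, comparing leading terms in \<open>V\<close> therefore splits off the
  terms of the first kind inside a left ideal; iteration isolates the terms in the parabolic subgroup.\<close>

context
  fixes n l :: nat and F :: "bperm set"
  assumes n: "0 < n" and ln: "l \<le> n" and F: "lclosed n F" and FM: "More l n \<subseteq> F"
begin

text \<open>The left ideal of the Hecke algebra of \<open>Sy n\<close> that right multiplication by
  \<open>CA l\<close> sends into the span of F; by \<open>NF_iff\<close> it is itself spanned by
  Kazhdan-Lusztig elements.\<close>

definition NF :: "hk set" where "NF = {x \<in> HJ n n. x * CA l \<in> spC F}"

lemma NF_iff: "x \<in> NF \<longleftrightarrow> x \<in> HJ n n \<and> (\<forall>\<sigma>. kc x \<sigma> \<noteq> 0 --> \<sigma> * aw l \<in> F)"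
  unfolding NF_def kc_span using kc_CA kc_CA_other by fastforce

lemma NF_tt: "x \<in> NF ==> 0 < i ==> i < n ==> tt i * x \<in> NF"
  using HJ_tt[of i n n x] lclosed_left[OF F, of i "x * CA l"] by (auto simp: NF_def mult.assoc)
lemma NF_diff: "x \<in> NF ==> y \<in> NF ==> x - y \<in> NF"
  by (auto simp: NF_def HJ_diff left_diff_distrib hk.span_diff)
lemma NF_sc: "x \<in> NF ==> sc c x \<in> NF"
  by (auto simp: NF_def HJ_sc hk.span_scale)
lemma NF_ti: "x \<in> NF ==> 0 < i ==> i < n ==> ti i * x \<in> NF"
  by (simp add: ti_eq NF_diff NF_sc NF_tt)
lemma NF_Tb: assumes "x \<in> NF" "w \<in> Sy n" shows "Tb w * x \<in> NF"
proof -
  have "w \<in> WJ n n" using assms Sy_WJ by simp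
  then show ?thesis
  proof (induction rule: WJ_induct)
    case (step i w)
    have "Tb (gen i * w) * x = tt i * (Tb w * x)" using step by (simp add: tt_Tb mult.assoc[symmetric])
    then show ?case using NF_tt step by simp
  qed (use assms in simp)
qed

lemma NF_pi:
  assumes x: "x \<in> NF" "\<And>z. cf x z \<in> VF"
  shows "hproj {\<sigma>. inverse \<sigma> $ 1 \<le> int l} x \<in> NF"
proof -
  let ?G = "{\<sigma>. inverse \<sigma> $ 1 \<le> int l}"
  have xH: "x \<in> HJ n n" using x by (simp add: NF_def)
  have xs: "x = (\<Sum>\<sigma>\<in>Sy n. sc (cf x \<sigma>) (Tb \<sigma>))" by (rule hk_expand_on) (use xH HJ_iff Sy_WJ in auto)
  have "\<forall>\<sigma>\<in>Sy n - ?G. \<exists>\<rho>. \<rho> \<in> HJ n n \<and> (\<forall>x. cf \<rho> x \<in> VF) \<and> (\<exists>h1\<in>HJ n n. \<exists>h2\<in>HJ n n. l < n \<and>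
     tt 0 * (Tb \<sigma> * CA l) = h1 * CA (Suc l) * h2 - sc (vgi 0) (\<rho> * CA l))"
    using tt0_Tb_CA(2)[OF _ ln n] by blast
  then obtain \<rho> where \<rho>: "\<And>\<sigma>. \<sigma> \<in> Sy n - ?G ==> \<rho> \<sigma> \<in> HJ n n \<and> (\<forall>x. cf (\<rho> \<sigma>) x \<in> VF) \<and> (\<exists>h1\<in>HJ n n. \<exists>h2\<in>HJ n n. l < n \<and>
     tt 0 * (Tb \<sigma> * CA l) = h1 * CA (Suc l) * h2 - sc (vgi 0) (\<rho> \<sigma> * CA l))" by metis
  have up: "h1 * CA (Suc l) * h2 \<in> spC F" if "h1 \<in> HJ n n" "h2 \<in> HJ n n" "l < n" for h1 h2
  proof -
    have "h1 * CA (Suc l) * h2 \<in> spE {(Suc l, a, u, b) | a u b. a \<in> Ym (Suc l) n \<and> u \<in> WJ (Suc l) n \<and> b \<in> Ym (Suc l) n}"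
      using Eb_span_kk[OF that(1,2), of "Suc l"] that(3) by simp
    also have "\<dots> \<subseteq> spE {(m, a, u, b) \<in> Idx n. l < m}" using that(3) by (intro hk.span_mono image_mono) (auto simp: Idx_def)
    also have "\<dots> = spC (yel ` {(m, a, u, b) \<in> Idx n. l < m})" by (rule span_KLe_Eb[symmetric]) auto
    also have "\<dots> \<subseteq> spC F" using FM unfolding More_def by (intro hk.span_mono image_mono)
    finally show ?thesis .
  qed
  define p where "p = hproj ?G x"
  define r where "r = (\<Sum>\<sigma>\<in>Sy n - ?G. sc (cf x \<sigma>) (\<rho> \<sigma>))"
  have ps: "p = (\<Sum>\<sigma>\<in>Sy n \<inter> ?G. sc (cf x \<sigma>) (Tb \<sigma>))"
  proof -
    have "cf p w = cf x w" if "w \<in> Sy n \<inter> ?G" for w using that by (simp add: p_def cf_hproj)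
    moreover have "p = (\<Sum>\<sigma>\<in>Sy n \<inter> ?G. sc (cf p \<sigma>) (Tb \<sigma>))"
      by (rule hk_expand_on) (use xH in \<open>auto simp: p_def cf_hproj HJ_iff Sy_WJ\<close>)
    ultimately show ?thesis by simp
  qed
  have pH: "p \<in> HJ n n" using xH by (auto simp: HJ_iff p_def cf_hproj split: if_splits)
  have pV: "cf p z \<in> VF" for z using x(2) by (simp add: p_def cf_hproj)
  have rH: "r \<in> HJ n n" unfolding r_def HJ_def using \<rho> by (intro hk.span_sum hk.span_scale) (auto simp: HJ_def)
  have rV: "cf r z \<in> VF" for z unfolding r_def cf_sum cf_sc using \<rho> x(2) by (intro KS_sum VF_VF) blast+
  have "tt 0 * (x * CA l) - (sc (vg 0) p - sc (vgi 0) r) * CA l \<in> spC F"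
  proof -
    define q where "q = (\<Sum>\<sigma>\<in>Sy n - ?G. sc (cf x \<sigma>) (Tb \<sigma>))"
    have xpq: "x = p + q"
      unfolding ps q_def by (subst xs) (rule sum.Int_Diff[OF finite_Sy])
    have "tt 0 * (x * CA l) = tt 0 * (p * CA l) + tt 0 * (q * CA l)"
      by (subst xpq) (simp only: distrib_left distrib_right)
    also have "tt 0 * (q * CA l) = (\<Sum>\<sigma>\<in>Sy n - ?G. sc (cf x \<sigma>) (tt 0 * (Tb \<sigma> * CA l)))"
      unfolding q_def by (simp add: sum_distrib_left sum_distrib_right)
    finally have "tt 0 * (x * CA l) = tt 0 * (p * CA l) + (\<Sum>\<sigma>\<in>Sy n - ?G. sc (cf x \<sigma>) (tt 0 * (Tb \<sigma> * CA l)))" .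
    moreover have "tt 0 * (p * CA l) = sc (vg 0) (p * CA l)"
      unfolding ps using tt0_Tb_CA(1)[OF _ ln n]
      by (simp add: sum_distrib_left sum_distrib_right hk.scale_sum_right mult.commute)
    moreover have "(\<Sum>\<sigma>\<in>Sy n - ?G. sc (cf x \<sigma>) (tt 0 * (Tb \<sigma> * CA l))) + sc (vgi 0) (r * CA l) =
      (\<Sum>\<sigma>\<in>Sy n - ?G. sc (cf x \<sigma>) (tt 0 * (Tb \<sigma> * CA l) + sc (vgi 0) (\<rho> \<sigma> * CA l)))"
      unfolding r_def by (simp add: sum_distrib_right hk.scale_sum_right sum.distrib hk.scale_right_distrib mult.commute)
    moreover have "\<dots> \<in> spC F"
    proof (intro hk.span_sum hk.span_scale)
      fix \<sigma> assume "\<sigma> \<in> Sy n - ?G"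
      then obtain h1 h2 where "h1 \<in> HJ n n" "h2 \<in> HJ n n" "l < n" "tt 0 * (Tb \<sigma> * CA l) = h1 * CA (Suc l) * h2 - sc (vgi 0) (\<rho> \<sigma> * CA l)"
        using \<rho> by blast
      then show "tt 0 * (Tb \<sigma> * CA l) + sc (vgi 0) (\<rho> \<sigma> * CA l) \<in> spC F" using up[of h1 h2] by (simp del: CA.simps)
    qed
    ultimately show ?thesis by (simp add: algebra_simps)
  qed
  moreover have "tt 0 * (x * CA l) \<in> spC F" using lclosed_left[OF F n] x(1) by (simp add: NF_def)
  ultimately have "tt 0 * (x * CA l) - (tt 0 * (x * CA l) - (sc (vg 0) p - sc (vgi 0) r) * CA l) \<in> spC F"
    by (rule hk.span_diff[rotated])
  then have y: "sc (vg 0) p - sc (vgi 0) r \<in> NF" using pH rH by (simp add: NF_def HJ_diff HJ_sc)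
  have "p \<in> NF"
    unfolding NF_iff
  proof (intro conjI allI impI pH)
    fix \<sigma> assume k: "kc p \<sigma> \<noteq> 0"
    \<comment> \<open>p and r are free of V, so the V-degrees 1 and -1 cannot cancel: every basis
      element occurring in p occurs in the combination.\<close>
    have "kc (sc (vg 0) p - sc (vgi 0) r) \<sigma> \<noteq> 0"
      using VF_sep[OF kc_VF[OF pH pV] kc_VF[OF rH rV], of \<sigma> \<sigma>] k by (auto simp: kc_diff kc_sc)
    then show "\<sigma> * aw l \<in> F" using y NF_iff by blast
  qed
  then show ?thesis by (simp add: p_def)
qed

lemma NF_Pm_cancel: "Pm j * y \<in> NF ==> j < n ==> y \<in> NF"
proof (induction j arbitrary: y)
  case (Suc j)
  then have "tt (Suc j) * y \<in> NF" by (simp add: mult.assoc)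
  then have "ti (Suc j) * (tt (Suc j) * y) \<in> NF" using NF_ti Suc.prems by blast
  then show ?case by simp
qed simp

text \<open>Multiplying by the basis element of s_1 ... s_j brings the point j + 1 to place 1, where
  \<open>NF_pi\<close> tests it. On elements violating the condition at j + 1 lengths add, and on
  the others the condition is stable, so the projection splits the product exactly;
  \<open>NF_Pm_cancel\<close> then removes the factor.\<close>

lemma NF_proj:
  assumes x: "x \<in> NF" "\<And>z. cf x z \<in> VF" and "j \<le> l"
  shows "hproj {\<sigma>. \<forall>i. 0 < i --> i \<le> int j --> inverse \<sigma> $ i \<le> int l} x \<in> NF"
  using assms(3)
proof (induction j)
  case 0
  have "hproj {\<sigma>. \<forall>i. 0 < i --> i \<le> int 0 --> inverse \<sigma> $ i \<le> int l} x = x"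
    by (rule hk_eqI) (simp add: cf_hproj)
  then show ?case using x by simp
next
  case (Suc j)
  define Gd where "Gd j = {\<sigma>. \<forall>i. 0 < i --> i \<le> int j --> inverse \<sigma> $ i \<le> int l}" for j
  define z where "z = hproj (Gd j) x"
  have zN: "z \<in> NF" using Suc by (simp add: z_def Gd_def)
  have zH: "z \<in> HJ n n" using zN by (simp add: NF_def)
  define z1 z2 where "z1 = hproj (Gd (Suc j)) x" and "z2 = z - z1"
  have sub: "Gd (Suc j) \<subseteq> Gd j" by (auto simp: Gd_def)
  have c1: "cf z1 w \<noteq> 0 ==> w \<in> Sy n \<and> w \<in> Gd (Suc j)" for w
    using x(1) by (auto simp: z1_def cf_hproj NF_def HJ_iff Sy_WJ split: if_splits)
  have c2: "cf z2 w \<noteq> 0 ==> w \<in> Sy n \<and> w \<in> Gd j - Gd (Suc j)" for w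
    using x(1) sub by (auto simp: z1_def z2_def z_def cf_hproj NF_def HJ_iff Sy_WJ split: if_splits)
  have jn: "j < n" using Suc.prems ln by simp
  have stable: "gen i * \<sigma> \<in> Gd (Suc j)" if "0 < i" "i \<le> j" "\<sigma> \<in> Gd (Suc j)" for i \<sigma>
    using that by (auto simp: Gd_def gen_apply)
  have P1: "Pm k * h \<in> spT (Gd (Suc j))" if "k \<le> j" "h \<in> spT (Gd (Suc j))" for k h
    using that
  proof (induction k arbitrary: h)
    case (Suc k)
    have "tt (Suc k) * h \<in> spT (Gd (Suc j))"
    proof (rule span_mult_left[OF _ Suc.prems(2)])
      fix y assume "y \<in> Tb ` Gd (Suc j)"
      then obtain \<sigma> where s: "\<sigma> \<in> Gd (Suc j)" "y = Tb \<sigma>" by blast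
      then have "Tb \<sigma> \<in> spT (Gd (Suc j))" "Tb (gen (Suc k) * \<sigma>) \<in> spT (Gd (Suc j))"
        using stable[of "Suc k" \<sigma>] Suc.prems by (intro hk.span_base imageI; simp)+
      then show "tt (Suc k) * y \<in> spT (Gd (Suc j))" unfolding s(2) by (simp add: tt_Tb hk.span_add hk.span_scale)
    qed
    then show ?case using Suc by (simp add: mult.assoc)
  qed simp
  have P2: "Pm j * h \<in> spT {\<sigma>. \<not> inverse \<sigma> $ 1 \<le> int l}" if "h \<in> spT (Sy n \<inter> (Gd j - Gd (Suc j)))" for h
  proof (rule span_mult_left[OF _ that])
    fix y assume "y \<in> Tb ` (Sy n \<inter> (Gd j - Gd (Suc j)))"
    then obtain \<sigma> where s: "\<sigma> \<in> Sy n" "\<sigma> \<in> Gd j" "\<sigma> \<notin> Gd (Suc j)" "y = Tb \<sigma>" by blast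
    have bad: "\<not> inverse \<sigma> $ (int j + 1) \<le> int l"
    proof
      assume a: "inverse \<sigma> $ (int j + 1) \<le> int l"
      have "i \<le> int (Suc j) \<longleftrightarrow> i \<le> int j \<or> i = int j + 1" for i by auto
      then have "\<sigma> \<in> Gd (Suc j)" using s(2) a by (auto simp: Gd_def)
      then show False using s by simp
    qed
    have "Pm j * Tb \<sigma> = Tb (xm j * \<sigma>)"
      unfolding Pm_Tb
    proof (rule Tb_mult, rule ell_add_pos[OF s(1)])
      fix p q :: int assume pq: "0 < p" "p < q" "inverse \<sigma> $ q < inverse \<sigma> $ p"
      have "q \<noteq> int j + 1"
      proof
        assume "q = int j + 1"
        then have "inverse \<sigma> $ p \<le> int l" using s(2) pq by (auto simp: Gd_def)
        then show False using bad pq \<open>q = int j + 1\<close> by simp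
      qed
      then show "xm j $ p < xm j $ q" using pq by (auto simp: xm_apply)
    qed
    moreover have "inverse (xm j * \<sigma>) $ 1 = inverse \<sigma> $ (int j + 1)"
    proof -
      have "inverse (xm j) $ 1 = int j + 1" by (rule binv_bapI) (simp add: xm_apply)
      then show ?thesis by simp
    qed
    ultimately show "Pm j * y \<in> spT {\<sigma>. \<not> inverse \<sigma> $ 1 \<le> int l}"
      using bad unfolding s(4) by (simp del: binv_times) (intro hk.span_base imageI, simp del: binv_times)
  qed
  have P1': "Pm j * z1 \<in> spT (Gd (Suc j))" by (rule P1) (use c1 in \<open>auto simp: span_Tb\<close>)
  have P2': "Pm j * z2 \<in> spT {\<sigma>. \<not> inverse \<sigma> $ 1 \<le> int l}" by (rule P2) (use c2 in \<open>auto simp: span_Tb\<close>)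
  have "hproj {\<sigma>. inverse \<sigma> $ 1 \<le> int l} (Pm j * z) = Pm j * z1"
  proof (rule hk_eqI)
    fix w
    have e: "cf (Pm j * z) w = cf (Pm j * z1) w + cf (Pm j * z2) w"
      using cf_simps(2)[of "Pm j * z1" "Pm j * z2" w] by (simp add: z2_def right_diff_distrib)
    have "cf (Pm j * z1) w \<noteq> 0 ==> inverse w $ 1 \<le> int l" using P1' unfolding span_Tb by (auto simp: Gd_def)
    moreover have "cf (Pm j * z2) w \<noteq> 0 ==> \<not> inverse w $ 1 \<le> int l" using P2' unfolding span_Tb by auto
    ultimately show "cf (hproj {\<sigma>. inverse \<sigma> $ 1 \<le> int l} (Pm j * z)) w = cf (Pm j * z1) w"
      unfolding cf_hproj e by auto
  qed
  moreover have "hproj {\<sigma>. inverse \<sigma> $ 1 \<le> int l} (Pm j * z) \<in> NF"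
  proof (rule NF_pi)
    show "Pm j * z \<in> NF" unfolding Pm_Tb using NF_Tb zN xm_Sy jn by blast
    have zV: "cf z w \<in> VF" for w using x(2) by (simp add: z_def cf_hproj)
    have "\<forall>h. (\<forall>w. cf h w \<in> VF) --> (\<forall>w. cf (Pm k * h) w \<in> VF)" for k
    proof (induction k)
      case (Suc k)
      have "cf (tt (Suc k) * h) w \<in> VF" if "\<forall>w. cf h w \<in> VF" for h w
        using cf_tt_KS(1)[of h Vzero "Suc k"] that by (auto simp: Vzero_def)
      then show ?case using Suc by (simp add: mult.assoc)
    qed simp
    then show "cf (Pm j * z) w \<in> VF" for w using zV by blast
  qed
  ultimately have "Pm j * z1 \<in> NF" by simp
  then have "z1 \<in> NF" using jn by (rule NF_Pm_cancel)
  then show ?case by (simp add: z1_def Gd_def)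
qed

end

text \<open>For the form making the \<open>Tb\<close> orthonormal, left multiplication by
  \<open>Tb (inverse a)\<close> is adjoint to that by \<open>Tb a\<close>, and here the product of
  \<open>Tb a\<close> and \<open>Tb w\<close> is \<open>Tb (a * w)\<close>.\<close>

lemma cf_Tb_inverse_mult:
  assumes "ell (a * w) = ell a + ell w" shows "cf (Tb (inverse a) * h) w = cf h (a * w)"
  using assms
proof (induction a arbitrary: h rule: ell_induct)
  case (step i a)
  have e: "ell (a * w) = ell a + ell w" "ell (gen i * (a * w)) = Suc (ell (a * w))"
    using step.prems step.hyps ell_times_le[of a w] ell_left_cases[of i "a * w"] unfolding mult.assoc by linarith+
  have "ell (inverse a * gen i) > ell (inverse a)" using step ell_inverse[of "gen i * a"] by simp
  then have "Tb (inverse (gen i * a)) = Tb (inverse a) * tt i" by (simp add: Tb_tt)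
  then have "cf (Tb (inverse (gen i * a)) * h) w = cf (Tb (inverse a) * (tt i * h)) w" by (simp add: mult.assoc)
  also have "\<dots> = cf (tt i * h) (a * w)" by (rule step.IH[OF e(1)])
  also have "\<dots> = cf h (gen i * (a * w))" using e by (simp add: cf_tt_mult)
  finally show ?case by (simp add: mult.assoc)
qed simp

text \<open>\<open>KLe (a * u)\<close> is \<open>Tb a * KLe u\<close> plus terms with strictly
  shorter representatives, and these live on other cosets of the parabolic subgroup. The expansion
  comes from \<open>KLe_Eb\<close> with b = 1 after cancelling \<open>CA l\<close>.\<close>

lemma KLe_coset_part:
  assumes a: "a \<in> Ym l n" and u: "u \<in> WJ l n" and w: "w \<in> WJ l n" and ln: "l \<le> n"
  shows "cf (KLe (a * u)) (a * w) = cf (KLe u) w"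
proof -
  have auS: "a * u \<in> Sy n" using a u Ym_Sy WJ_Sy by blast
  let ?i = "(l, a, u, 1)"
  have i: "?i \<in> Idx n" using a u ln by (simp add: Idx_def)
  let ?J = "{(a', u') | a' u'. a' \<in> Ym l n \<and> u' \<in> WJ l n \<and> ell a' < ell a}"
  have HJa: "Tb a' * KLe u' \<in> HJ n n" if "a' \<in> Ym l n" "u' \<in> WJ l n" for a' u'
  proof -
    have "a' \<in> WJ n n" using that Ym_Sy Sy_WJ by blast
    then show ?thesis by (intro HJ_mult HJ_Tb HJ_sub[OF KLe_HJ[OF that(2)]])
  qed
  have fJ: "finite ?J" by (rule finite_subset[of _ "Ym l n \<times> WJ l n"]) auto
  have "KLe (yel ?i) - Eb ?i \<in> spE {j \<in> Idx n. Rl j ?i}" by (rule KLe_Eb[OF i])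
  also have "\<dots> \<subseteq> hk.span ((\<lambda>(a', u'). Tb a' * KLe u' * CA l) ` ?J)"
  proof (rule hk.span_mono, clarify)
    fix m' a' u' b' assume j: "(m', a', u', b') \<in> Idx n" "Rl (m', a', u', b') ?i"
    then have "ell b' = 0" "m' = l" "ell a' < ell a" by auto
    then show "Eb (m', a', u', b') \<in> (\<lambda>(a', u'). Tb a' * KLe u' * CA l) ` ?J"
      using j by (intro image_eqI[of _ _ "(a', u')"]) (auto simp: Idx_def)
  qed
  finally obtain r where r: "KLe (yel ?i) - Eb ?i = (\<Sum>j\<in>?J. sc (r j) ((\<lambda>(a', u'). Tb a' * KLe u' * CA l) j))"
    using span_image_sum[OF fJ] by blast
  define D where "D = KLe (a * u) - Tb a * KLe u - (\<Sum>j\<in>?J. sc (r j) (Tb (fst j) * KLe (snd j)))"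
  have "(\<Sum>j\<in>?J. sc (r j) ((\<lambda>(a', u'). Tb a' * KLe u' * CA l) j)) = (\<Sum>j\<in>?J. sc (r j) (Tb (fst j) * KLe (snd j))) * CA l"
    by (simp add: sum_distrib_right case_prod_unfold)
  moreover have "KLe (yel ?i) - Eb ?i = (KLe (a * u) - Tb a * KLe u) * CA l"
    using KLe_Sy_aw[OF auS, of l] by (simp add: left_diff_distrib)
  ultimately have D0: "D * CA l = 0" using r unfolding D_def by (simp add: left_diff_distrib)
  have "D \<in> HJ n n"
  proof -
    have "KLe (a * u) \<in> HJ n n" using KLe_HJ auS Sy_WJ by simp
    moreover have "(\<Sum>j\<in>?J. sc (r j) (Tb (fst j) * KLe (snd j))) \<in> HJ n n"
      unfolding HJ_def using HJa by (intro hk.span_sum hk.span_scale) (auto simp: HJ_def)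
    ultimately show ?thesis unfolding D_def using HJa[OF a u] HJ_diff by blast
  qed
  then have "D = 0" using kc_CA[of D n l] D0 HJ_kc(1)[of D n] by simp
  then have K: "KLe (a * u) = Tb a * KLe u + (\<Sum>j\<in>?J. sc (r j) (Tb (fst j) * KLe (snd j)))"
    unfolding D_def by (simp add: algebra_simps)
  have cfT: "cf (Tb a' * KLe u') (a * w) = (if a' = a then cf (KLe u') w else 0)" if "a' \<in> Ym l n" "u' \<in> WJ l n" for a' u'
  proof -
    have e: "KLe u' = (\<Sum>w\<in>WJ l n. sc (cf (KLe u') w) (Tb w))" by (rule hk_expand_on) (use KLe_HJ[OF that(2)] HJ_iff in auto)
    have "Tb a' * KLe u' = (\<Sum>w\<in>WJ l n. sc (cf (KLe u') w) (Tb (a' * w)))"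
      by (subst e) (simp add: sum_distrib_left Tb_Ym_WJ[OF that(1)])
    then have "cf (Tb a' * KLe u') (a * w) = (\<Sum>w'\<in>WJ l n. if a' = a \<and> w' = w then cf (KLe u') w' else 0)"
      by (simp, intro sum.cong) (use Ym_WJ_unique[OF a that(1) w] in \<open>auto simp: cf_Tb\<close>)
    also have "\<dots> = (if a' = a then cf (KLe u') w else 0)" using w by (cases "a' = a") (auto simp: sum.delta)
    finally show ?thesis .
  qed
  have "(\<Sum>j\<in>?J. r j * cf (Tb (fst j) * KLe (snd j)) (a * w)) = 0"
    by (rule sum.neutral) (use cfT in auto)
  then show ?thesis unfolding K using cfT[OF a u] by simp
qed

text \<open>\<open>Tb (inverse a) * KLe (a * u)\<close> stays in the left ideal. Its projection to
  the elements preserving {1..l} is \<open>KLe u\<close> by \<open>KLe_coset_part\<close>, and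
  \<open>NF_proj\<close> keeps this projection in the ideal.\<close>

lemma coset_left_le:
  assumes n: "0 < n" and ln: "l \<le> n" and F: "lclosed n F" and FM: "More l n \<subseteq> F"
    and a: "a \<in> Ym l n" and u: "u \<in> WJ l n" and auF: "a * u * aw l \<in> F"
  shows "u * aw l \<in> F"
proof -
  note N = NF_iff[OF n ln F FM] NF_Tb[OF n ln F FM] NF_proj[OF n ln F FM]
  have auS: "a * u \<in> Sy n" using a u Ym_Sy WJ_Sy by blast
  then have auW: "a * u \<in> WJ n n" using Sy_WJ by simp
  have 1: "KLe (a * u) \<in> NF n l F" unfolding N(1) using KLe_HJ[OF auW] auF by (simp add: kc_KLe)
  have ia: "inverse a \<in> Sy n" using a Ym_Sy by simp
  have 2: "Tb (inverse a) * KLe (a * u) \<in> NF n l F" by (rule N(2)[OF 1 ia])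
  have V: "cf (Tb (inverse a) * KLe (a * u)) z \<in> VF" for z
  proof -
    have "inverse a \<in> WJ n n" using ia Sy_WJ by simp
    then have "\<forall>z. cf (Tb (inverse a) * KLe (a * u)) z \<in> VF"
    proof (induction rule: WJ_induct)
      case (step i w)
      have "Tb (gen i * w) * KLe (a * u) = tt i * (Tb w * KLe (a * u))" using step by (simp add: tt_Tb mult.assoc[symmetric])
      then show ?case using cf_tt_KS(1)[of "Tb w * KLe (a * u)" Vzero i] step by (auto simp: Vzero_def)
    qed (use KLe_VF[OF auS] in simp)
    then show ?thesis by blast
  qed
  have 3: "hproj {\<sigma>. \<forall>i. 0 < i --> i \<le> int l --> inverse \<sigma> $ i \<le> int l} (Tb (inverse a) * KLe (a * u)) \<in> NF n l F"
    by (rule N(3)[OF 2 V order_refl])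
  have "hproj {\<sigma>. \<forall>i. 0 < i --> i \<le> int l --> inverse \<sigma> $ i \<le> int l} (Tb (inverse a) * KLe (a * u)) = KLe u"
  proof (rule hk_eqI)
    fix w
    have H: "cf (Tb (inverse a) * KLe (a * u)) z \<noteq> 0 ==> z \<in> Sy n" for z
      using 2 by (simp add: NF_def[OF n ln F FM] HJ_iff Sy_WJ)
    \<comment> \<open>An injective map of {1..l} into itself is onto, so the one-sided condition of
      the projection already gives membership in the parabolic subgroup.\<close>
    have good: "w \<in> WJ l n" if "w \<in> Sy n" and g: "\<forall>i. 0 < i --> i \<le> int l --> inverse w $ i \<le> int l"
    proof -
      have iw: "inverse w \<in> Sy n" using that by simp
      have im: "(\<lambda>i. inverse w $ i) ` {1..int l} \<subseteq> {1..int l}" using g Sy_pos[OF iw] by auto (metis int_one_le_iff_zero_less)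
      have "(\<lambda>i. inverse w $ i) ` {1..int l} = {1..int l}"
        by (rule card_subset_eq[OF _ im]) (auto simp: card_image inj_on_def)
      then have s: "\<exists>j\<in>{1..int l}. i = inverse w $ j" if "i \<in> {1..int l}" for i using that by blast
      have "w $ i \<le> int l \<longleftrightarrow> i \<le> int l" if "i > 0" for i
      proof
        assume "i \<le> int l"
        then obtain j where "j \<in> {1..int l}" "i = inverse w $ j" using s[of i] \<open>i > 0\<close> by auto
        then show "w $ i \<le> int l" by simp
      next
        assume "w $ i \<le> int l"
        then show "i \<le> int l" using g[rule_format, of "w $ i"] Sy_pos[OF \<open>w \<in> Sy n\<close> \<open>i > 0\<close>] by simp
      qed
      then show ?thesis using that(1) by (simp add: WJ_def)
    qed
    show "cf (hproj {\<sigma>. \<forall>i. 0 < i --> i \<le> int l --> inverse \<sigma> $ i \<le> int l} (Tb (inverse a) * KLe (a * u))) w = cf (KLe u) w"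
    proof (cases "w \<in> WJ l n")
      case True
      have "inverse w \<in> WJ l n" using True WJ_inverse by blast
      then have g: "\<forall>i. 0 < i --> i \<le> int l --> inverse w $ i \<le> int l" by (simp add: WJ_def)
      have "cf (Tb (inverse a) * KLe (a * u)) w = cf (KLe u) w"
        using cf_Tb_inverse_mult[OF ell_Ym_WJ[OF a True]] KLe_coset_part[OF a u True ln] by simp
      then show ?thesis using g by (simp add: cf_hproj)
    next
      case False
      then have "cf (KLe u) w = 0" using KLe_HJ[OF u] HJ_iff by blast
      moreover have "cf (hproj {\<sigma>. \<forall>i. 0 < i --> i \<le> int l --> inverse \<sigma> $ i \<le> int l} (Tb (inverse a) * KLe (a * u))) w = 0"
        using good False H[of w] by (auto simp: cf_hproj)
      ultimately show ?thesis by simp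
    qed
  qed
  then have "KLe u \<in> NF n l F" using 3 by simp
  then show ?thesis unfolding N(1) by (simp add: kc_KLe)
qed

section \<open>Structure constants, the left preorder and star operations\<close>

section \<open>Multiplication by a generator in the Kazhdan--Lusztig basis\<close>

definition Cg :: "nat => hk" where "Cg i = tt i + sc (vgi i) 1"

lemma KLe_gen: "KLe (gen i) = Cg i"
proof (rule KLe_unique[symmetric])
  show "bar (Cg i) = Cg i"
    by (simp add: Cg_def ti_def xg_def hk.scale_left_diff_distrib)
  have "cf (Cg i) x - cf (tt i) x = vgi i * cf (Tb 1) x" for x by (simp add: Cg_def)
  then show "asymT (gen i) (Cg i)" by (auto simp: asymT_def cf_Tb vgi_AN simp del: Tb_1)
qed

lemma Cg_left: "Cg i * h = tt i * h + sc (vgi i) h" and Cg_right: "h * Cg i = h * tt i + sc (vgi i) h"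
  by (simp_all add: Cg_def distrib_left distrib_right)

lemma Cg_tt: "Cg i * tt i = sc (vg i) (Cg i)"
  by (rule hk_eqI) (simp add: Cg_left tt_sq xg_def Cg_def algebra_simps)

abbreviation LeZ :: "(int \<times> int) set" where "LeZ \<equiv> insert 0 Neg"

lemma KLe_LeZ: "cf (KLe w) x \<in> KS LeZ"
  using cf_KLe(1)[of w] cf_KLe(3)[of x w] by (cases "x = w") (auto simp: one_KS zero_prod_def intro: KS_mono)

lemma restr0_AN: "p \<in> AN ==> restr {0} p = 0"
  using restr_KS[of p Neg "{0}"] by (auto simp: Neg_def zero_prod_def KS_def)
lemma restr0_1: "restr {0} 1 = 1"
  by (rule poly_mapping_eqI) (auto simp: lookup_restr lookup_one)
lemma restr0_bar: "laurent_bar (restr {0} p) = restr {0} p"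
  by (rule poly_mapping_eqI, rename_tac k, case_tac k) (auto simp: lookup_restr lookup_bar zero_prod_def)
lemma restr0_rest: "p \<in> KS LeZ ==> p - restr {0} p \<in> AN"
  unfolding KS_def
proof clarify
  fix a b assume "Poly_Mapping.keys p \<subseteq> LeZ" "(a, b) \<in> Poly_Mapping.keys (p - restr {0} p)"
  moreover from this(2) have "(a, b) \<in> Poly_Mapping.keys p" "(a, b) \<noteq> 0"
    by (auto simp: in_keys_iff lookup_minus lookup_restr split: if_splits)
  ultimately show "(a, b) \<in> Neg" by blast
qed

text \<open>Subtracting the combination given by the constant terms leaves a bar fixed element with
  negative coefficients, which vanishes.\<close>

lemma kc_const:
  assumes b: "bar X = X" and L: "\<And>z. cf X z \<in> KS LeZ"
  shows "kc X z = restr {0} (cf X z)"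
proof -
  define S where "S = {z. cf X z \<noteq> 0}"
  define m where "m z = restr {0} (cf X z)" for z
  have "X - (\<Sum>z\<in>S. sc (m z) (KLe z)) = 0"
  proof (rule bar_fixed_AN_0)
    show "bar (X - (\<Sum>z\<in>S. sc (m z) (KLe z))) = X - (\<Sum>z\<in>S. sc (m z) (KLe z))"
      by (simp add: b bar_sum m_def restr0_bar)
    fix x
    have "(\<Sum>z\<in>S. m z * cf (Tb z) x) = (\<Sum>z\<in>S. if z = x then m x else 0)" by (rule sum.cong) (auto simp: cf_Tb)
    also have "\<dots> = m x" by (auto simp: S_def m_def)
    finally have "cf (X - (\<Sum>z\<in>S. sc (m z) (KLe z))) x = (cf X x - m x) - (\<Sum>z\<in>S. m z * (cf (KLe z) x - cf (Tb z) x))"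
      by (simp add: right_diff_distrib sum_subtractf)
    moreover have "(\<Sum>z\<in>S. m z * (cf (KLe z) x - cf (Tb z) x)) \<in> AN"
    proof (rule KS_sum)
      fix z
      have "m z \<in> KS {0}" unfolding m_def by (rule KS_mono[OF restr_KS[of _ UNIV]]) (auto simp: KS_def)
      moreover have "cf (KLe z) x - cf (Tb z) x \<in> AN" using asym_KLe[of z] by (auto simp: asymT_def)
      ultimately show "m z * (cf (KLe z) x - cf (Tb z) x) \<in> AN" by (rule KS_mult) auto
    qed
    moreover have "cf X x - m x \<in> AN" unfolding m_def by (rule restr0_rest[OF L])
    ultimately show "cf (X - (\<Sum>z\<in>S. sc (m z) (KLe z))) x \<in> AN" by (simp only: KS_diff)
  qed
  then have "X = (\<Sum>z\<in>S. sc (m z) (KLe z))" by simp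
  then have "kc X z = (\<Sum>x\<in>S. m x * kc (KLe x) z)" by (metis (no_types, lifting) kc_sc kc_sum sum.cong)
  also have "\<dots> = (\<Sum>x\<in>S. if x = z then m z else 0)" by (rule sum.cong) (auto simp: kc_KLe)
  also have "\<dots> = m z" by (auto simp: S_def m_def)
  finally show ?thesis by (simp add: m_def)
qed

lemma vg_AN: assumes "p \<in> AN" "i > 0" shows "vg i * p \<in> KS LeZ"
proof -
  have "vg i \<in> KS {(0, 1)}" using assms by (simp add: vg_def KS_monom)
  then show ?thesis using assms(1) by (rule KS_mult) (auto simp: Neg_def zero_prod_def)
qed
lemma vgi_LeZ: "p \<in> KS LeZ ==> vgi i * p \<in> AN"
  by (rule KS_mult[OF vgi_AN]) (auto simp: Neg_def zero_prod_def)
lemma AN_LeZ: "p \<in> AN ==> p \<in> KS LeZ" by (erule KS_mono) auto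

lemma cf_Cg_right: "cf (h * Cg i) z = cf h (z * gen i) + (if ell (z * gen i) < ell z then vg i * cf h z else vgi i * cf h z)"
  by (simp add: Cg_right cf_mult_tt xg_def algebra_simps)
lemma cf_Cg_left: "cf (Cg i * h) z = cf h (gen i * z) + (if ell (gen i * z) < ell z then vg i * cf h z else vgi i * cf h z)"
  by (simp add: Cg_left cf_tt_mult xg_def algebra_simps)

lemma bar_Cg [simp]: "bar (Cg i) = Cg i" using bar_KLe[of "gen i"] by (simp add: KLe_gen)

lemma restr0_KLe: "restr {0} (cf (KLe w) x) = (if x = w then 1 else 0)"
  using cf_KLe(1)[of w] cf_KLe(3)[of x w] by (auto simp: restr0_1 restr0_AN)

text \<open>v is the least monomial above 1, so v times a negative coefficient has exponents at most
  0 and \<open>kc_const\<close> applies; for V this fails, hence i > 0. The parameters s and P stand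
  for translation by the generator and its descent condition, so that both sides of multiplication
  are covered.\<close>

lemma kc_Cg:
  assumes i: "i > 0" and X: "bar X = X" and s: "\<And>z. s z = w \<longleftrightarrow> z = s w" and w: "\<not> P w" "P (s w)"
    and c: "\<And>z. cf X z = cf (KLe w) (s z) + (if P z then vg i * cf (KLe w) z else vgi i * cf (KLe w) z)"
  shows "kc X z = (if P z then (if z = s w then 1 else 0) + restr {0} (vg i * cf (KLe w) z) else 0)"
proof -
  have L: "cf X z \<in> KS LeZ" for z
  proof (cases "P z")
    case True
    then have "cf (KLe w) z \<in> AN" using w(1) by (intro cf_KLe(3)) auto
    then have "vg i * cf (KLe w) z \<in> KS LeZ" using i by (rule vg_AN)
    then show ?thesis using True by (simp add: c KLe_LeZ KS_add)
  next
    case False then show ?thesis by (simp add: c KLe_LeZ vgi_LeZ AN_LeZ KS_add)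
  qed
  have "kc X z = restr {0} (cf X z)" by (rule kc_const[OF X L])
  also have "\<dots> = (if z = s w then 1 else 0) + restr {0} (if P z then vg i * cf (KLe w) z else vgi i * cf (KLe w) z)"
    unfolding c restr_add restr0_KLe s ..
  also have "\<dots> = (if P z then (if z = s w then 1 else 0) + restr {0} (vg i * cf (KLe w) z) else 0)"
    using w(2) by (auto simp: restr0_AN[OF vgi_LeZ[OF KLe_LeZ]])
  finally show ?thesis .
qed

lemma kc_Cg_right:
  assumes "i > 0" "ell w < ell (w * gen i)"
  shows "kc (KLe w * Cg i) z = (if ell (z * gen i) < ell z then (if z = w * gen i then 1 else 0) + restr {0} (vg i * cf (KLe w) z) else 0)"
  by (rule kc_Cg[where P = "\<lambda>z. ell (z * gen i) < ell z", OF assms(1)]) (use assms(2) gen_times_eq in \<open>auto simp: cf_Cg_right\<close>)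

lemma kc_Cg_left:
  assumes "i > 0" "ell w < ell (gen i * w)"
  shows "kc (Cg i * KLe w) z = (if ell (gen i * z) < ell z then (if z = gen i * w then 1 else 0) + restr {0} (vg i * cf (KLe w) z) else 0)"
  by (rule kc_Cg[where P = "\<lambda>z. ell (gen i * z) < ell z", OF assms(1)]) (use assms(2) gen_times_eq in \<open>auto simp: cf_Cg_left\<close>)

text \<open>Write w = y s. In C(y) C(s) the element C(w) has coefficient 1, and all other terms are
  shorter with s as a right descent. The product itself is an eigenvector, so subtracting the terms
  known by induction leaves one.\<close>

lemma KLe_tt_right: "i > 0 ==> ell (w * gen i) < ell w ==> KLe w * tt i = sc (vg i) (KLe w)"
proof (induction "ell w" arbitrary: w rule: less_induct)
  case (less w)
  define y where "y = w * gen i"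
  have y: "ell y < ell (y * gen i)" "y * gen i = w" using less.prems by (auto simp: y_def)
  define X where "X = KLe y * Cg i"
  have X: "X * tt i = sc (vg i) X" unfolding X_def by (simp add: mult.assoc Cg_tt)
  have "cf (KLe y) w = 0" using cf_KLe(2)[of y w] y by force
  then have kw: "kc X w = 1"
    unfolding X_def kc_Cg_right[OF less.prems(1) y(1)] using y less.prems by simp
  define S where "S = {z. kc X z \<noteq> 0}"
  have fS: "finite S" "w \<in> S" using kw by (auto simp: S_def)
  have "X = sc (kc X w) (KLe w) + (\<Sum>z\<in>S - {w}. sc (kc X z) (KLe z))"
    using kc_expand[of X] sum.remove[OF fS, of "\<lambda>z. sc (kc X z) (KLe z)"] by (simp add: S_def)
  then have K: "KLe w = X - (\<Sum>z\<in>S - {w}. sc (kc X z) (KLe z))" using kw by (simp add: algebra_simps)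
  have "KLe z * tt i = sc (vg i) (KLe z)" if "z \<in> S - {w}" for z
  proof (rule less.hyps)
    have "kc X z \<noteq> 0" "z \<noteq> w" using that by (auto simp: S_def)
    then have "ell (z * gen i) < ell z" "restr {0} (vg i * cf (KLe y) z) \<noteq> 0"
      unfolding X_def kc_Cg_right[OF less.prems(1) y(1)] y(2) by (auto split: if_splits)
    moreover from this have "cf (KLe y) z \<noteq> 0" "z \<noteq> y" using y by auto
    then have "ell z < ell y" using cf_KLe(2)[of y z] by blast
    ultimately show "ell z < ell w" "ell (z * gen i) < ell z" using y by auto
  qed (fact less.prems)
  then have "(\<Sum>z\<in>S - {w}. sc (kc X z) (KLe z)) * tt i = sc (vg i) (\<Sum>z\<in>S - {w}. sc (kc X z) (KLe z))"
    by (simp add: sum_distrib_right hk.scale_sum_right mult.commute)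
  then show ?case unfolding K left_diff_distrib X by (simp add: hk.scale_right_diff_distrib)
qed

text \<open>Remove the terms having s as a right descent, which are eigenvectors by
  \<open>KLe_tt_right\<close>. For the remainder k still k T_s = v k; at a longest element b
  occurring in k this equates v times the coefficient at b with the coefficient at b s, which is
  0.\<close>

lemma kc_right_descent:
  assumes i: "i > 0" and h: "h * tt i = sc (vg i) h" and "kc h z \<noteq> 0"
  shows "ell (z * gen i) < ell z"
proof (rule ccontr)
  assume nz: "\<not> ?thesis"
  define S where "S = {z. kc h z \<noteq> 0}"
  define A where "A = {z \<in> S. ell (z * gen i) < ell z}"
  define B where "B = {z \<in> S. \<not> ell (z * gen i) < ell z}"
  have AB: "S = A \<union> B" "A \<inter> B = {}" "finite A" "finite B" by (auto simp: A_def B_def S_def)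
  define k where "k = (\<Sum>z\<in>B. sc (kc h z) (KLe z))"
  have hk: "h = (\<Sum>z\<in>A. sc (kc h z) (KLe z)) + k"
    using kc_expand[of h] AB by (simp add: S_def[symmetric] k_def sum.union_disjoint)
  have "(\<Sum>z\<in>A. sc (kc h z) (KLe z)) * tt i = sc (vg i) (\<Sum>z\<in>A. sc (kc h z) (KLe z))"
    using KLe_tt_right[OF i] by (simp add: sum_distrib_right hk.scale_sum_right A_def mult.commute)
  moreover have "k = h - (\<Sum>z\<in>A. sc (kc h z) (KLe z))" by (subst hk) (rule add_diff_cancel_left'[symmetric])
  ultimately have k: "k * tt i = sc (vg i) k" by (simp only: left_diff_distrib hk.scale_right_diff_distrib h)
  have ne: "B \<noteq> {}" using assms(3) nz by (auto simp: B_def S_def)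
  define m where "m = Max (ell ` B)"
  have "m \<in> ell ` B" unfolding m_def using ne AB by (intro Max_in) auto
  then obtain b where b: "b \<in> B" "ell b = m" by auto
  have mB: "ell x \<le> m" if "x \<in> B" for x unfolding m_def using that AB by (intro Max_ge) auto
  have up: "ell (b * gen i) = Suc (ell b)" using b ell_right_cases[of b i] by (auto simp: B_def)
  have c0: "cf (KLe x) y = 0" if "x \<in> B" "y \<noteq> x" "ell y \<ge> m" for x y
    using cf_KLe(2)[of x y] mB[OF that(1)] that by (metis not_le order_trans)
  have "cf k b = (\<Sum>x\<in>B. if x = b then kc h b else 0)"
    unfolding k_def cf_sum cf_sc using c0 b cf_KLe(1) by (intro sum.cong) auto
  then have kb: "cf k b = kc h b" using b AB by simp
  have "cf k (b * gen i) = (\<Sum>x\<in>B. 0)"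
    unfolding k_def cf_sum cf_sc
  proof (rule sum.cong[OF refl])
    fix x assume "x \<in> B"
    moreover have "b * gen i \<noteq> x" using mB[OF \<open>x \<in> B\<close>] up b by auto
    ultimately show "kc h x * cf (KLe x) (b * gen i) = 0" using c0[of x "b * gen i"] up b by simp
  qed
  then have "cf k (b * gen i) = 0" by simp
  moreover have "cf (k * tt i) b = cf k (b * gen i)" using up by (simp add: cf_mult_tt)
  ultimately have "vg i * kc h b = 0" using k kb by simp
  then have "vgi i * (vg i * kc h b) = 0" by simp
  then have "kc h b = 0" by simp
  then show False using b by (auto simp: B_def S_def)
qed

section \<open>The left preorder\<close>

definition LE :: "nat => (bperm \<times> bperm) set" where
  "LE n = {(z, y). z \<in> Wn n \<and> y \<in> Wn n \<and> (\<exists>i<n. kc (Cg i * KLe y) z \<noteq> 0)}"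

lemma lclosed_LE: assumes "lclosed n F" "y \<in> F" "(z, y) \<in> (LE n)\<^sup>*" shows "z \<in> F"
  using assms(3)
proof (induction rule: converse_rtrancl_induct)
  case (step z x)
  then obtain i where i: "i < n" "kc (Cg i * KLe x) z \<noteq> 0" by (auto simp: LE_def)
  have "KLe x \<in> spC F" using step by (intro hk.span_base) auto
  then have "Cg i * KLe x \<in> spC F" unfolding Cg_left
    using lclosed_left[OF assms(1) i(1)] by (intro hk.span_add hk.span_scale)
  then show ?case using i kc_span by blast
qed (use assms in simp)

lemma LE_Wn: "(z, y) \<in> (LE n)\<^sup>* ==> y \<in> Wn n ==> z \<in> Wn n"
  by (induction rule: converse_rtrancl_induct) (auto simp: LE_def)

lemma lclosed_below: assumes "y \<in> Wn n" shows "lclosed n {z. (z, y) \<in> (LE n)\<^sup>*}"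
  unfolding lclosed_def
proof (intro conjI ballI allI impI)
  let ?F = "{z. (z, y) \<in> (LE n)\<^sup>*}"
  show "?F \<subseteq> Wn n" using LE_Wn assms by blast
  fix x i assume x: "x \<in> ?F" and i: "i < n"
  then have xW: "x \<in> Wn n" using LE_Wn assms by blast
  have "KLe x \<in> spT (Wn n)" unfolding span_Tb using cf_KLe_Wn[OF xW] by blast
  then have "Cg i * KLe x \<in> spT (Wn n)" unfolding Cg_left using hkn_tt[OF i] by (intro hk.span_add hk.span_scale)
  then have "\<And>z. kc (Cg i * KLe x) z \<noteq> 0 ==> z \<in> Wn n" unfolding span_KLe_Wn[symmetric] kc_span by blast
  then have "kc (Cg i * KLe x) z \<noteq> 0 ==> z \<in> ?F" for z
    using x xW i by (auto intro!: converse_rtrancl_into_rtrancl[of z x] simp: LE_def)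
  then have "Cg i * KLe x \<in> spC ?F" unfolding kc_span by blast
  moreover have "KLe x \<in> spC ?F" using x by (intro hk.span_base imageI)
  moreover have "tt i * KLe x = Cg i * KLe x - sc (vgi i) (KLe x)" by (simp add: Cg_left)
  ultimately show "tt i * KLe x \<in> spC ?F" by (simp add: hk.span_diff hk.span_scale)
qed

lemma lclosed_Un: assumes "lclosed n F" "lclosed n G" shows "lclosed n (F \<union> G)"
proof -
  have "spC F \<subseteq> spC (F \<union> G)" "spC G \<subseteq> spC (F \<union> G)"
    by (intro hk.span_mono image_mono; blast)+
  then show ?thesis using assms unfolding lclosed_def by blast
qed

lemma coset_LE:
  assumes "0 < n" "l \<le> n" "a \<in> Ym l n" "u \<in> WJ l n"
  shows "(u * aw l, a * u * aw l) \<in> (LE n)\<^sup>*"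
proof -
  have S: "a * u \<in> Sy n" "u \<in> Sy n" using assms Ym_Sy WJ_Sy by auto
  have y: "a * u * aw l \<in> Wn n" using S(1) aw_Wn[OF assms(2)] Sy_Wn by blast
  \<comment> \<open>\<open>More l n\<close> is adjoined to meet the hypothesis of
    \<open>coset_left_le\<close>; the element u a_l, with exactly l sign changes, does not lie in
    it.\<close>
  let ?F = "{z. (z, a * u * aw l) \<in> (LE n)\<^sup>*} \<union> More l n"
  have "u * aw l \<in> ?F"
    by (rule coset_left_le[OF assms(1,2) lclosed_Un[OF lclosed_below[OF y] lclosed_More[OF assms(1)]] _ assms(3,4)]) auto
  then show ?thesis using Sy_aw_AtL(2)[OF S(2) assms(2)] by blast
qed

lemma LE_up: assumes "0 < i" "i < n" "y \<in> Wn n" "ell y < ell (gen i * y)" shows "(gen i * y, y) \<in> LE n"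
proof -
  have "cf (KLe y) (gen i * y) = 0" using cf_KLe(2)[of y "gen i * y"] assms(4) by force
  then have "kc (Cg i * KLe y) (gen i * y) = 1" unfolding kc_Cg_left[OF assms(1,4)] using assms(4) by simp
  then show ?thesis using assms by (auto simp: LE_def)
qed

text \<open>Let w be \<open>gen i * y\<close>. The coefficient of \<open>Tb y\<close> in C(w) is
  v^-1, so C(y) occurs in C(s_j) C(w), as j is a left descent of y but not of w. With
  \<open>LE_up\<close> this makes y and w left equivalent.\<close>

lemma LE_knuth:
  assumes "0 < i" "i < n" "0 < j" "j < n" "y \<in> Wn n"
    "ell y < ell (gen i * y)" "ell (gen j * y) < ell y" "ell (gen i * y) < ell (gen j * (gen i * y))"
  shows "(y, gen i * y) \<in> LE n"
proof -
  define w where "w = gen i * y"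
  define X where "X = Cg i * KLe y"
  define S where "S = {z. kc X z \<noteq> 0}"
  have y0: "cf (KLe y) w = 0" using cf_KLe(2)[of y w] assms(6) by (force simp: w_def)
  then have kw: "kc X w = 1"
    unfolding X_def kc_Cg_left[OF assms(1,6)] using assms(6) by (simp add: w_def)
  have S: "finite S" "w \<in> S" using kw by (auto simp: S_def)
  have low: "cf (KLe z) y = 0" if "z \<in> S - {w}" for z
  proof -
    have "kc X z \<noteq> 0" "z \<noteq> w" using that by (auto simp: S_def)
    then have "ell (gen i * z) < ell z" "restr {0} (vg i * cf (KLe y) z) \<noteq> 0"
      unfolding X_def kc_Cg_left[OF assms(1,6)] w_def by (auto split: if_splits)
    moreover from this have "cf (KLe y) z \<noteq> 0" "z \<noteq> y" using assms by auto
    then have "ell z < ell y" "z \<noteq> y" using cf_KLe(2)[of y z] by blast+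
    then show ?thesis using cf_KLe(2)[of z y] by (metis less_asym)
  qed
  have "cf X y = cf (\<Sum>z\<in>S. sc (kc X z) (KLe z)) y" using kc_expand[of X] by (simp add: S_def[symmetric])
  also have "\<dots> = kc X w * cf (KLe w) y + (\<Sum>z\<in>S - {w}. kc X z * cf (KLe z) y)"
    using sum.remove[OF S, of "\<lambda>z. kc X z * cf (KLe z) y"] by simp
  also have "\<dots> = cf (KLe w) y" using kw low by simp
  finally have "cf (KLe w) y = cf X y" by simp
  moreover have "cf X y = vgi i"
    unfolding X_def cf_Cg_left using assms(6) y0 cf_KLe(1)[of y] by (simp add: w_def)
  ultimately have c: "cf (KLe w) y = vgi i" by simp
  have "vg j = vg i" using vg_pos assms by blast
  then have "kc (Cg j * KLe w) y = (if y = gen j * w then 1 else 0) + 1"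
    using assms(7,8) kc_Cg_left[OF assms(3), of w y] by (simp add: w_def[symmetric] c restr0_1)
  \<comment> \<open>The coefficient is 1, or 2 if y were \<open>gen j * w\<close>; it is nonzero
    either way.\<close>
  moreover have "(if b then 1 else 0) + 1 \<noteq> (0 :: laurent)" for b
  proof -
    have "Poly_Mapping.lookup ((if b then 1 else 0) + 1 :: laurent) 0 \<noteq> 0" by (simp add: lookup_add lookup_one)
    then show ?thesis by (metis lookup_zero)
  qed
  ultimately have "kc (Cg j * KLe w) y \<noteq> 0" by simp
  moreover have "w \<in> Wn n" using assms by (auto simp: w_def)
  ultimately show ?thesis using assms unfolding LE_def w_def by blast
qed

section \<open>Star operations\<close>

definition DS :: "nat => nat => bperm => bool" where
  "DS i j w \<longleftrightarrow> ell (w * gen i) < ell w \<and> ell w < ell (w * gen j)"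
text \<open>The Kazhdan-Lusztig star operation on the right: for adjacent i and j and
  \<open>DS i j w\<close>, exactly one of w s_i and w s_j has j but not i as a right
  descent.\<close>

definition star :: "nat => nat => bperm => bperm" where
  "star i j w = (if ell (w * gen j) < ell (w * gen j * gen i) then w * gen j else w * gen i)"

definition adj :: "nat => nat => bool" where "adj i j \<longleftrightarrow> 0 < i \<and> 0 < j \<and> (j = Suc i \<or> i = Suc j)"

lemma ell_right_less: "ell w < ell (w * gen i) \<longleftrightarrow> w $ ra i < w $ rb i"
  using ell_less_right[of w i] ell_right_cases[of w i] less_flip[of w i] by auto

lemma gen_vals:
  assumes "0 < k"
  shows "gen k $ int k = int k + 1" "gen k $ (int k + 1) = int k" "gen k $ (int k + 2) = int k + 2"
    "gen (Suc k) $ int k = int k" "gen (Suc k) $ (int k + 1) = int k + 2" "gen (Suc k) $ (int k + 2) = int k + 1"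
  using assms by (simp_all add: gen_apply)

lemma ra_rb_vals: "0 < k ==> ra k = int k" "rb k = int k + 1" "ra (Suc k) = int k + 1" "int k + 1 + 1 = int k + 2" "2 + int k = int k + 2"
  by (simp_all add: ra_def rb_def)

lemma DS_Suc:
  assumes "0 < k"
  shows "DS k (Suc k) w \<longleftrightarrow> w $ (int k + 1) < w $ int k \<and> w $ (int k + 1) < w $ (int k + 2)"
    "DS (Suc k) k w \<longleftrightarrow> w $ (int k + 2) < w $ (int k + 1) \<and> w $ int k < w $ (int k + 1)"
  using assms by (simp_all add: DS_def ell_less_right ell_right_less ra_rb_vals)

lemma star_Suc:
  assumes "0 < k"
  shows "star k (Suc k) w = (if w $ int k < w $ (int k + 2) then w * gen (Suc k) else w * gen k)"
    "star (Suc k) k w = (if w $ int k < w $ (int k + 2) then w * gen k else w * gen (Suc k))"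
  using assms by (simp_all add: star_def ell_right_less ra_rb_vals gen_vals)

lemma star_rules:
  assumes "adj i j" "DS i j w"
  shows "DS j i (star i j w)" "star j i (star i j w) = w"
    "ell (w * gen j) < ell (w * gen j * gen i) \<longleftrightarrow> \<not> ell (w * gen i * gen j) < ell (w * gen i)"
proof -
  define k where "k = min i j"
  have k: "0 < k" "i = k \<and> j = Suc k \<or> i = Suc k \<and> j = k" using assms by (auto simp: adj_def k_def)
  note r = DS_Suc[OF k(1)] star_Suc[OF k(1)] gen_vals[OF k(1)]
  have "w $ int k \<noteq> w $ (int k + 2)" by simp
  then have ne: "\<not> w $ int k < w $ (int k + 2) \<longleftrightarrow> w $ (int k + 2) < w $ int k" by linarith
  show "DS j i (star i j w)" using k(2) assms(2) ne by (auto simp: r)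
  show "star j i (star i j w) = w" using k(2) assms(2) ne by (auto simp: r)
  show "ell (w * gen j) < ell (w * gen j * gen i) \<longleftrightarrow> \<not> ell (w * gen i * gen j) < ell (w * gen i)"
    using k(2) ne by (auto simp: ell_right_less ell_less_right ra_rb_vals k(1) r)
qed

lemma star_Wn: "w \<in> Wn n ==> i < n ==> j < n ==> star i j w \<in> Wn n"
  by (auto simp: star_def)

text \<open>A left ideal by \<open>KK_left\<close>. Modulo it, star operations become right
  multiplication by \<open>Cg j\<close>.\<close>

definition KK :: "nat => nat => hk set" where
  "KK i j = spC {z. ell (z * gen i) < ell z \<and> ell (z * gen j) < ell z}"

lemma KK_left: assumes "0 < i" "0 < j" "h \<in> KK i j" shows "a * h \<in> KK i j"
proof -
  have e: "h * tt k = sc (vg k) h" if "k = i \<or> k = j" for k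
    using assms(3) unfolding KK_def
  proof (induction rule: hk.span_induct_alt)
    case (step c x y)
    then obtain z where z: "ell (z * gen i) < ell z" "ell (z * gen j) < ell z" "x = KLe z" by blast
    have "x * tt k = sc (vg k) x" unfolding z(3) by (rule KLe_tt_right) (use that assms z in auto)
    then show ?case using step by (simp add: distrib_right hk.scale_right_distrib mult.commute)
  qed simp
  have e': "a * h * tt k = sc (vg k) (a * h)" if "k = i \<or> k = j" for k using e[OF that] by (simp add: mult.assoc)
  show ?thesis unfolding KK_def kc_span
    using kc_right_descent[OF assms(1) e'[of i]] kc_right_descent[OF assms(2) e'[of j]] by blast
qed

text \<open>If i is not a right descent of z, the eigenvector property turns v times the coefficient
  of C(w) at z into its coefficient at z s_i, whose constant term is nonzero only for z s_i = w. So
  only w s_i and w s_j compete, and \<open>star_rules\<close> selects the star.\<close>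

lemma KLe_star:
  assumes a: "adj i j" and D: "DS i j w"
  shows "KLe w * Cg j - KLe (star i j w) \<in> KK i j"
proof -
  have ij: "0 < i" "0 < j" using a by (auto simp: adj_def)
  have up: "ell w < ell (w * gen j)" and dn: "ell (w * gen i) < ell w" using D by (auto simp: DS_def)
  let ?w = "star i j w"
  have vij: "vg j = vg i" using vg_pos ij by blast
  have rel: "cf (KLe w) (z * gen i) = vg i * cf (KLe w) z" if "\<not> ell (z * gen i) < ell z" for z
    using arg_cong[OF KLe_tt_right[OF ij(1) dn], of "\<lambda>h. cf h z"] that by (simp add: cf_mult_tt)
  have st: "ell (?w * gen j) < ell ?w" "\<not> ell (?w * gen i) < ell ?w" using star_rules(1)[OF a D] by (auto simp: DS_def)
  have k: "kc (KLe w * Cg j) z = (if z = ?w then 1 else 0)" if z: "\<not> ell (z * gen i) < ell z" for z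
  proof -
    have g: "z * gen i = w \<longleftrightarrow> z = w * gen i" using gen_times_eq by blast
    have "kc (KLe w * Cg j) z = (if ell (z * gen j) < ell z then (if z = w * gen j then 1 else 0) + (if z = w * gen i then 1 else 0) else 0)"
      unfolding kc_Cg_right[OF ij(2) up] vij rel[OF z, symmetric] restr0_KLe g ..
    also have "\<dots> = (if z = ?w then 1 else 0)"
    proof -
      have ne: "w * gen j \<noteq> w * gen i" using a by (auto simp: adj_def)
      have r: "ell (w * gen j) < ell (w * gen j * gen i) \<longleftrightarrow> \<not> ell (w * gen i * gen j) < ell (w * gen i)" by (rule star_rules(3)[OF a D])
      show ?thesis
      proof (cases "ell (w * gen j) < ell (w * gen j * gen i)")
        case True
        then have "?w = w * gen j" by (simp add: star_def)
        then show ?thesis using True r ne up by auto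
      next
        case False
        then have w: "?w = w * gen i" by (simp add: star_def)
        have "ell (w * gen j * gen i) < ell (w * gen j)" using False ell_right_cases[of "w * gen j" i] by auto
        then have "z \<noteq> w * gen j" using z by auto
        then show ?thesis using w False r ne by auto
      qed
    qed
    finally show ?thesis .
  qed
  show ?thesis
    unfolding KK_def kc_span
  proof (intro allI impI)
    fix z assume nz: "kc (KLe w * Cg j - KLe ?w) z \<noteq> 0"
    have zi: "ell (z * gen i) < ell z"
      using nz k[of z] by (auto simp: kc_diff kc_KLe)
    moreover have "z \<noteq> ?w" using zi st by auto
    then have "kc (KLe w * Cg j) z \<noteq> 0" using nz by (simp add: kc_diff kc_KLe)
    then have "ell (z * gen j) < ell z" unfolding kc_Cg_right[OF ij(2) up] by (auto split: if_splits)
    ultimately show "z \<in> {z. ell (z * gen i) < ell z \<and> ell (z * gen j) < ell z}" by blast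
  qed
qed

text \<open>C(y) T_s = v C(y) persists under left multiplication, so every basis element occurring
  in the product has s as a right descent too.\<close>

lemma LE_descent: assumes "(z, y) \<in> (LE n)\<^sup>*" "0 < i" "ell (y * gen i) < ell y" shows "ell (z * gen i) < ell z"
  using assms(1)
proof (induction rule: converse_rtrancl_induct)
  case (step z x)
  then obtain r where "kc (Cg r * KLe x) z \<noteq> 0" by (auto simp: LE_def)
  moreover have "Cg r * KLe x * tt i = sc (vg i) (Cg r * KLe x)" using KLe_tt_right[OF assms(2) step.IH] by (simp add: mult.assoc)
  ultimately show ?case using kc_right_descent[OF assms(2)] by blast
qed (use assms in simp)

text \<open>Multiply the expansion of \<open>Cg r * KLe y\<close> on the right by
  \<open>Cg j\<close> and reduce modulo \<open>KK i j\<close>: terms with right descent i but not j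
  become their stars, all others vanish. The star is injective on the former, so the coefficient at
  z reappears at its star.\<close>

lemma LE_star1:
  assumes a: "adj i j" "i < n" "j < n" and zy: "(z, y) \<in> LE n" "DS i j y" "DS i j z"
  shows "(star i j z, star i j y) \<in> LE n"
proof -
  have ij: "0 < i" "0 < j" using a by (auto simp: adj_def)
  obtain r where r: "r < n" "kc (Cg r * KLe y) z \<noteq> 0" "z \<in> Wn n" "y \<in> Wn n" using zy by (auto simp: LE_def)
  define X where "X = Cg r * KLe y"
  define S where "S = {x. kc X x \<noteq> 0}"
  have X: "X = (\<Sum>x\<in>S. sc (kc X x) (KLe x))" using kc_expand[of X] by (simp add: S_def)
  have fS: "finite S" by (simp add: S_def)
  have Si: "ell (x * gen i) < ell x" if "x \<in> S" for x
  proof -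
    have "X * tt i = sc (vg i) X" using KLe_tt_right[OF ij(1)] zy(2) by (simp add: X_def DS_def mult.assoc)
    then show ?thesis using kc_right_descent[OF ij(1)] that by (simp add: S_def)
  qed
  define SD where "SD = {x \<in> S. DS i j x}"
  have k1: "Cg r * KLe (star i j y) - X * Cg j \<in> KK i j"
  proof -
    have "Cg r * (KLe y * Cg j - KLe (star i j y)) \<in> KK i j" by (rule KK_left[OF ij KLe_star[OF a(1) zy(2)]])
    then have "- (Cg r * (KLe y * Cg j - KLe (star i j y))) \<in> KK i j" unfolding KK_def by (rule hk.span_neg)
    then show ?thesis by (simp add: X_def algebra_simps)
  qed
  have k2: "X * Cg j - (\<Sum>x\<in>SD. sc (kc X x) (KLe (star i j x))) \<in> KK i j"
  proof -
    have "X * Cg j = (\<Sum>x\<in>S. sc (kc X x) (KLe x * Cg j))" by (subst X) (simp add: sum_distrib_right)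
    also have "\<dots> = (\<Sum>x\<in>SD. sc (kc X x) (KLe x * Cg j)) + (\<Sum>x\<in>S - SD. sc (kc X x) (KLe x * Cg j))"
      using sum.subset_diff[of SD S] fS by (simp add: SD_def add.commute)
    finally have "X * Cg j - (\<Sum>x\<in>SD. sc (kc X x) (KLe (star i j x))) =
      (\<Sum>x\<in>SD. sc (kc X x) (KLe x * Cg j - KLe (star i j x))) + (\<Sum>x\<in>S - SD. sc (kc X x) (KLe x * Cg j))"
      by (simp add: hk.scale_right_diff_distrib sum_subtractf)
    moreover have "(\<Sum>x\<in>SD. sc (kc X x) (KLe x * Cg j - KLe (star i j x))) \<in> KK i j"
      unfolding KK_def using KLe_star[OF a(1)] by (intro hk.span_sum hk.span_scale) (auto simp: SD_def KK_def)
    moreover have "(\<Sum>x\<in>S - SD. sc (kc X x) (KLe x * Cg j)) \<in> KK i j"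
      unfolding KK_def
    proof (intro hk.span_sum hk.span_scale)
      fix x assume x: "x \<in> S - SD"
      then have "\<not> ell x < ell (x * gen j)" using Si by (auto simp: SD_def DS_def)
      then have xj: "ell (x * gen j) < ell x" using ell_right_cases[of x j] by auto
      have "KLe x * Cg j = sc (vg j) (KLe x) + sc (vgi j) (KLe x)" unfolding Cg_right KLe_tt_right[OF ij(2) xj] ..
      moreover have "KLe x \<in> spC {z. ell (z * gen i) < ell z \<and> ell (z * gen j) < ell z}"
        using xj Si x by (intro hk.span_base) auto
      ultimately show "KLe x * Cg j \<in> spC {z. ell (z * gen i) < ell z \<and> ell (z * gen j) < ell z}"
        by (simp add: hk.span_add hk.span_scale)
    qed
    ultimately show ?thesis unfolding KK_def by (simp add: hk.span_add)
  qed
  have k3: "Cg r * KLe (star i j y) - (\<Sum>x\<in>SD. sc (kc X x) (KLe (star i j x))) \<in> KK i j"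
    using hk.span_add[OF k1[unfolded KK_def] k2[unfolded KK_def]] by (simp add: KK_def)
  have sz: "\<not> ell (star i j z * gen i) < ell (star i j z)" using star_rules(1)[OF a(1) zy(3)] by (auto simp: DS_def)
  have "kc (Cg r * KLe (star i j y) - (\<Sum>x\<in>SD. sc (kc X x) (KLe (star i j x)))) (star i j z) = 0"
    using k3 sz unfolding KK_def kc_span by blast
  then have "kc (Cg r * KLe (star i j y)) (star i j z) = (\<Sum>x\<in>SD. kc X x * (if star i j z = star i j x then 1 else 0))"
    by (simp add: kc_diff kc_sum kc_sc kc_KLe)
  also have "\<dots> = (\<Sum>x\<in>SD. if x = z then kc X z else 0)"
  proof (rule sum.cong[OF refl])
    fix x assume "x \<in> SD"
    then have "star j i (star i j x) = x" using star_rules(2)[OF a(1)] by (simp add: SD_def)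
    then have "star i j z = star i j x \<longleftrightarrow> x = z" using star_rules(2)[OF a(1) zy(3)] by metis
    then show "kc X x * (if star i j z = star i j x then 1 else 0) = (if x = z then kc X z else 0)" by auto
  qed
  also have "\<dots> = kc X z" using zy(3) r(2) fS by (simp add: SD_def S_def X_def)
  finally have "kc (Cg r * KLe (star i j y)) (star i j z) \<noteq> 0" using r(2) by (simp add: X_def)
  then show ?thesis using r star_Wn a unfolding LE_def by blast
qed

lemma LE_star:
  assumes a: "adj i j" "i < n" "j < n" and "(z, y) \<in> (LE n)\<^sup>*" "DS i j y" "DS i j z"
  shows "(star i j z, star i j y) \<in> (LE n)\<^sup>*"
  using assms(4,6)
proof (induction rule: converse_rtrancl_induct)
  case (step z x)
  have ij: "0 < i" "0 < j" using a by (auto simp: adj_def)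
  have "ell (x * gen i) < ell x" using LE_descent[OF step(2) ij(1)] assms(5) by (simp add: DS_def)
  moreover have "\<not> ell (x * gen j) < ell x" using LE_descent[OF r_into_rtrancl[OF step(1)] ij(2)] step.prems by (auto simp: DS_def)
  then have "ell x < ell (x * gen j)" using ell_right_cases[of x j] by auto
  ultimately have D: "DS i j x" by (simp add: DS_def)
  show ?case using LE_star1[OF a step(1) D step.prems] step.IH[OF D] by (rule converse_rtrancl_into_rtrancl)
qed simp

definition LS :: "nat => bperm => bperm => bool" where
  "LS n x y \<longleftrightarrow> x \<in> Wn n \<and> y \<in> Wn n \<and> (x, y) \<in> (LE n)\<^sup>* \<and> (y, x) \<in> (LE n)\<^sup>*"

lemma LS_descent: "LS n x y ==> 0 < i ==> ell (x * gen i) < ell x \<longleftrightarrow> ell (y * gen i) < ell y"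
  using LE_descent unfolding LS_def by blast

lemma LS_DS: assumes "LS n x y" "adj i j" shows "DS i j x \<longleftrightarrow> DS i j y"
proof -
  have "0 < i" "0 < j" using assms by (auto simp: adj_def)
  then show ?thesis using LS_descent[OF assms(1), of i] LS_descent[OF assms(1), of j] ell_right_cases[of x j] ell_right_cases[of y j]
    unfolding DS_def by auto
qed

lemma LS_star: assumes "LS n x y" "adj i j" "i < n" "j < n" "DS i j x" shows "LS n (star i j x) (star i j y)"
  using assms LE_star[OF assms(2-4)] LS_DS[OF assms(1,2)] star_Wn unfolding LS_def by blast

lemma LS_sym: "LS n x y ==> LS n y x" by (auto simp: LS_def)
lemma LS_trans: "LS n x y ==> LS n y z ==> LS n x z" by (auto simp: LS_def)

lemma LS_aw: assumes "LS n (\<sigma> * aw l) y" "\<sigma> \<in> Sy n" "l \<le> n" "0 < n" shows "\<exists>\<tau>\<in>Sy n. y = \<tau> * aw l"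
proof (rule AtL_cases[OF _ _ assms(3)])
  have le: "(y, \<sigma> * aw l) \<in> (LE n)\<^sup>*" "(\<sigma> * aw l, y) \<in> (LE n)\<^sup>*" using assms(1) by (simp_all add: LS_def)
  show "y \<in> AtL l n" by (rule lclosed_LE[OF lclosed_AtL[OF assms(4)] Sy_aw_AtL(1)[OF assms(2,3)] le(1)])
  show "y \<notin> More l n"
    using lclosed_LE[OF lclosed_More[OF assms(4)] _ le(2)] Sy_aw_AtL(2)[OF assms(2,3)] by blast
qed

section \<open>Combinatorics of lattice words and of decreasing subsequences\<close>

section \<open>Words with partition content\<close>

text \<open>One of the two types of Knuth relations, the witness b standing in front of the
  exchanged letters. It is the type realised by left multiplication in
  \<open>LS_move\<close>.\<close>

inductive mv :: "nat list => nat list => bool" where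
  mv1: "a \<le> b ==> b < c ==> mv (h @ [b, a, c] @ t) (h @ [b, c, a] @ t)"
| mv2: "a \<le> b ==> b < c ==> mv (h @ [b, c, a] @ t) (h @ [b, a, c] @ t)"

lemma mv_ctx: "mv w w' ==> mv (u @ w @ v) (u @ w' @ v)"
proof (induction rule: mv.induct)
  case (mv1 a b c h t)
  then show ?case using mv.mv1[of a b c "u @ h" "t @ v"] by simp
next
  case (mv2 a b c h t)
  then show ?case using mv.mv2[of a b c "u @ h" "t @ v"] by simp
qed

lemma mv_ctxs: "mv\<^sup>*\<^sup>* w w' ==> mv\<^sup>*\<^sup>* (u @ w @ v) (u @ w' @ v)"
proof (induction rule: rtranclp_induct)
  case (step y z)
  show ?case by (rule rtranclp.rtrancl_into_rtrancl[OF step.IH mv_ctx[OF step(2)]])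
qed simp

lemma mv_sym: "mv w w' ==> mv w' w"
  by (induction rule: mv.induct) (erule (1) mv2, erule (1) mv1)
lemma mv_syms: "mv\<^sup>*\<^sup>* w w' ==> mv\<^sup>*\<^sup>* w' w"
  by (induction rule: rtranclp_induct) (auto intro: converse_rtranclp_into_rtranclp mv_sym)

definition parti :: "nat => nat multiset => bool" where
  "parti m M \<longleftrightarrow> (\<forall>x\<in>#M. m \<le> x) \<and> (\<forall>r\<ge>m. count M (Suc r) \<le> count M r)"

text \<open>Lattice (Yamanouchi) words on the letters from m on. They encode standard fillings by
  listing the rows of the successive entries.\<close>

definition lat :: "nat => nat list => bool" where
  "lat m w \<longleftrightarrow> (\<forall>k. parti m (mset (take k w)))"

lemma lat_Nil: "lat m []" by (simp add: lat_def parti_def)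
lemma lat_snoc: "lat m (w @ [p]) \<longleftrightarrow> lat m w \<and> parti m (add_mset p (mset w))"
proof
  assume a: "lat m (w @ [p])"
  have "parti m (mset (take k w))" for k
  proof (cases "k \<le> length w")
    case True then show ?thesis using a[unfolded lat_def, rule_format, of k] by simp
  next
    case False then show ?thesis using a[unfolded lat_def, rule_format, of "length w"] by simp
  qed
  then show "lat m w \<and> parti m (add_mset p (mset w))" using a[unfolded lat_def, rule_format, of "Suc (length w)"] by (simp add: lat_def)
next
  assume a: "lat m w \<and> parti m (add_mset p (mset w))"
  have "parti m (mset (take k (w @ [p])))" for k
  proof (cases "k \<le> length w")
    case True then show ?thesis using a by (simp add: lat_def)
  next
    case False then show ?thesis using a by simp
  qed
  then show "lat m (w @ [p])" by (simp add: lat_def)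
qed
lemma lat_parti: "lat m w ==> parti m (mset w)"
  unfolding lat_def using take_all[of w "length w"] by (metis order_refl)

text \<open>A largest letter can be put last: it stands for the bottom row, whose last box is
  removable.\<close>

lemma lat_ex: "parti m M ==> \<exists>w. lat m w \<and> mset w = M"
proof (induction "size M" arbitrary: M)
  case 0
  then show ?case using lat_Nil[of m] by (intro exI[of _ "[]"]) simp
next
  case (Suc k)
  define q where "q = Max (set_mset M)"
  have "set_mset M \<noteq> {}" using Suc(2) by auto
  then have q: "q \<in># M" "\<And>x. x \<in># M ==> x \<le> q" unfolding q_def by (auto intro: Max_in)
  have "Suc q \<notin># M" using q(2)[of "Suc q"] by auto
  then have "count M (Suc q) = 0" by (simp add: not_in_iff)
  then have "count (M - {#q#}) (Suc r) \<le> count (M - {#q#}) r" if "m \<le> r" for r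
    using Suc(3) that unfolding parti_def by (cases "r = q") (auto intro: diff_le_mono order_trans[OF diff_le_self])
  then have p: "parti m (M - {#q#})" using Suc(3) by (auto simp: parti_def dest: in_diffD)
  have "size (M - {#q#}) = k" using Suc(2) q(1) by (simp add: size_Diff_singleton)
  then obtain w where w: "lat m w" "mset w = M - {#q#}" using Suc(1)[OF _ p] by metis
  have "add_mset q (M - {#q#}) = M" using q(1) by simp
  then show ?case using w Suc(3) by (intro exI[of _ "w @ [q]"]) (simp add: lat_snoc)
qed

text \<open>Rows p and q both end in a removable corner. Once a box is gone from row q, one can be
  taken from row q' = q - 1 as well; if q' = p, the corner condition at p provides the second box
  there.\<close>

lemma parti_corners:
  assumes M: "parti m M" and p: "p \<in># M" "parti m (M - {#p#})" and q: "q \<in># M" "parti m (M - {#q#})" and pq: "p < q"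
  shows "\<exists>N q'. q = Suc q' \<and> p \<le> q' \<and> M = N + {#p, q, q'#} \<and> parti m N \<and> parti m (add_mset q' N)"
proof -
  obtain q' where q': "q = Suc q'" "p \<le> q'" using pq by (cases q) auto
  have mp: "m \<le> p" "m \<le> q" using M p q by (auto simp: parti_def)
  define N where "N = M - {#p, q, q'#}"
  have A: "count M (Suc r) - (if Suc r = p then 1 else 0) \<le> count M r - (if r = p then 1 else 0)"
    and B: "count M (Suc r) - (if Suc r = q then 1 else 0) \<le> count M r - (if r = q then 1 else 0)" if "m \<le> r" for r
    using p(2) q(2) that unfolding parti_def by (auto simp: count_single split: if_splits)
  have c: "count M p \<ge> 1" "count M q \<ge> 1" using p q by (simp_all add: count_greater_eq_one_iff)
  have c2: "count M q' \<ge> 2" if "q' = p"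
  proof -
    have "count M q \<le> count M p - 1" using A[of p] mp q' that by simp
    then show ?thesis unfolding that using c by linarith
  qed
  have c1: "count M q' \<ge> 1"
  proof (cases "q' = p")
    case False
    then have "count M q \<le> count M q'" using A[of q'] mp q' by simp
    then show ?thesis using c by linarith
  qed (use c in simp)
  have sub: "{#p, q, q'#} \<subseteq># M" unfolding subseteq_mset_def
  proof
    fix x show "count {#p, q, q'#} x \<le> count M x"
      using c c1 c2 pq q' by (cases "x = p"; cases "x = q"; cases "x = q'") (simp_all del: count_greater_eq_one_iff)
  qed
  have N: "count N r = count M r - ((if r = p then 1 else 0) + (if r = q then 1 else 0) + (if r = q' then 1 else 0))" for r
    by (simp add: N_def)
  have "count N (Suc r) \<le> count N r" if r: "m \<le> r" for r
  proof -
    consider "r = p" "r = q'" | "r = p" "r \<noteq> q'" | "r \<noteq> p" "r = q'" | "r = q" | "r \<noteq> p" "r \<noteq> q" "r \<noteq> q'" using q' by force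
    then show ?thesis
    proof cases
      case 5 then show ?thesis using A[OF r] unfolding N by auto
    qed (use A[OF r] B[OF r] q' pq in \<open>auto simp: N\<close>)
  qed
  then have "parti m N" using M by (auto simp: parti_def N_def dest: in_diffD)
  moreover have "count (add_mset q' N) (Suc r) \<le> count (add_mset q' N) r" if r: "m \<le> r" for r
  proof -
    have N': "count (add_mset q' N) r = count M r - ((if r = p then 1 else 0) + (if r = q then 1 else 0))" for r
    proof (cases "q' = p")
      case True then show ?thesis using c2[OF True] q' by (auto simp: N)
    next
      case False then show ?thesis using c1 q' by (auto simp: N)
    qed
    consider "r = p" | "r = q" | "r \<noteq> p" "r \<noteq> q" by blast
    then show ?thesis using A[OF r] B[OF r] q' pq unfolding N' by cases auto
  qed
  then have "parti m (add_mset q' N)" using M mp q' by (auto simp: parti_def N_def dest: in_diffD)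
  moreover have "M = N + {#p, q, q'#}" unfolding N_def using sub by (simp only: subset_mset.diff_add)
  ultimately show ?thesis using q' by blast
qed

text \<open>For words ending in p < q, pass through words with the same beginning and the endings q'
  q p and q' p q, where q' = q - 1. As p \<le> q' < q, these differ by one exchange, and induction
  connects the prefixes.\<close>

theorem lat_connected: "lat m w ==> lat m w' ==> mset w = mset w' ==> mv\<^sup>*\<^sup>* w w'"
proof (induction "length w" arbitrary: w w' rule: less_induct)
  case less
  have lw: "length w = length w'" using less.prems(3) by (metis size_mset)
  show ?case
  proof (cases w rule: rev_cases)
    case Nil then show ?thesis using lw by simp
  next
    case (snoc h p)
    then obtain h' q where w': "w' = h' @ [q]" using lw by (cases w' rule: rev_cases) auto
    have L: "lat m h" "lat m h'" using less.prems(1,2) unfolding snoc w' lat_snoc by blast+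
    have main: "mv\<^sup>*\<^sup>* (h @ [p]) (h' @ [q])"
      if pq: "p < q" and L: "lat m h" "lat m h'" "parti m (add_mset p (mset h))" "add_mset p (mset h) = add_mset q (mset h')"
        and len: "length h < length w" "length h' < length w" for h h' p q
    proof -
      define M where "M = add_mset p (mset h)"
      have M2: "M = add_mset q (mset h')" unfolding M_def by (rule L(4))
      have hM: "mset h = M - {#p#}" "mset h' = M - {#q#}" "p \<in># M" "q \<in># M"
        by (simp add: M_def, simp add: M2, simp add: M_def, simp add: M2)
      have "parti m M" "parti m (M - {#p#})" "parti m (M - {#q#})"
        unfolding hM(1,2)[symmetric] by (unfold M_def, rule L(3), rule lat_parti[OF L(1)], rule lat_parti[OF L(2)])
      then obtain N q' where N: "q = Suc q'" "p \<le> q'" "M = N + {#p, q, q'#}" "parti m N" "parti m (add_mset q' N)"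
        using parti_corners[OF _ hM(3) _ hM(4) _ pq, of m] by blast
      obtain k where k: "lat m k" "mset k = N" using lat_ex[OF N(4)] by blast
      have mh: "mset h = mset (k @ [q', q])" "mset h' = mset (k @ [q', p])" unfolding hM(1,2) N(3) by (simp_all add: k)
      have k': "lat m (k @ [q'])" unfolding lat_snoc using k N(5) by simp
      have "lat m ((k @ [q']) @ [q])" "lat m ((k @ [q']) @ [p])"
        using k' lat_parti[OF L(1)] lat_parti[OF L(2)] unfolding mh lat_snoc[of m "k @ [q']"] by (simp_all add: add_mset_commute)
      then have "lat m (k @ [q', q])" "lat m (k @ [q', p])" by simp_all
      then have "mv\<^sup>*\<^sup>* h (k @ [q', q])" "mv\<^sup>*\<^sup>* h' (k @ [q', p])" using less.hyps len L mh by blast+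
      from mv_ctxs[OF this(1), of "[]" "[p]"] mv_ctxs[OF mv_syms[OF this(2)], of "[]" "[q]"]
      have "mv\<^sup>*\<^sup>* (h @ [p]) (k @ [q', q, p])" "mv\<^sup>*\<^sup>* (k @ [q', p, q]) (h' @ [q])" by simp_all
      moreover have "mv (k @ [q', q, p]) (k @ [q', p, q])" using mv2[of p q' q k "[]"] N by simp
      ultimately show ?thesis by (meson rtranclp.rtrancl_into_rtrancl rtranclp_trans)
    qed
    have P1: "parti m (add_mset p (mset h))" using less.prems(1) unfolding snoc lat_snoc by blast
    have P2: "parti m (add_mset q (mset h'))" using less.prems(2) unfolding w' lat_snoc by blast
    have P3: "add_mset p (mset h) = add_mset q (mset h')" using less.prems(3) unfolding snoc w' by simp
    have P4: "length h < length w" "length h' < length w" using lw unfolding snoc w' by simp_all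
    consider "p = q" | "p < q" | "q < p" by linarith
    then show ?thesis
    proof cases
      case 1
      then have "mset h = mset h'" using P3 by simp
      then have "mv\<^sup>*\<^sup>* h h'" by (rule less.hyps[OF P4(1) L])
      from mv_ctxs[OF this, of "[]" "[p]"] show ?thesis using snoc w' 1 by simp
    next
      case 2 show ?thesis unfolding snoc w' by (rule main[OF 2 L P1 P3 P4])
    next
      case 3 show ?thesis unfolding snoc w' by (rule mv_syms[OF main[OF 3 L(2,1) P2 P3[symmetric] P4(2,1)]])
    qed
  qed
qed

section \<open>Sorting two blocks by Knuth moves\<close>

text \<open>A star operation on three consecutive positions, recorded on bit patterns: a pair
  \<open>False\<close>, \<open>True\<close> is exchanged next to a third letter that serves as
  witness.\<close>

inductive sw :: "bool list => bool list => bool" where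
  sw1: "sw (u @ [False, False, True] @ v) (u @ [False, True, False] @ v)"
| sw2: "sw (u @ [False, True, True] @ v) (u @ [True, False, True] @ v)"

lemma sw_ctx: "sw w w' ==> sw (u @ w @ v) (u @ w' @ v)"
proof (induction rule: sw.induct)
  case (sw1 h t)
  then show ?case using sw.sw1[of "u @ h" "t @ v"] by simp
next
  case (sw2 h t)
  then show ?case using sw.sw2[of "u @ h" "t @ v"] by simp
qed

lemma sw_ctxs: "sw\<^sup>*\<^sup>* w w' ==> sw\<^sup>*\<^sup>* (u @ w @ v) (u @ w' @ v)"
proof (induction rule: rtranclp_induct)
  case (step y z)
  show ?case by (rule rtranclp.rtrancl_into_rtrancl[OF step.IH sw_ctx[OF step(2)]])
qed simp

definition FT :: "nat => bool list" where "FT b = concat (replicate b [False, True])"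
lemma FT_simps [simp]: "FT 0 = []" "FT (Suc b) = False # True # FT b" "length (FT b) = 2 * b" by (simp_all add: FT_def, induction b) auto
lemma FT_snoc: "FT b @ [False, True] = FT (Suc b)" by (induction b) auto

lemma sw_F: "sw\<^sup>*\<^sup>* (False # FT b) (FT b @ [False])"
proof (induction b)
  case (Suc b)
  have "sw (False # FT (Suc b)) ([False, True] @ (False # FT b))" using sw1[of "[]" "FT b"] by simp
  moreover have "sw\<^sup>*\<^sup>* ([False, True] @ (False # FT b)) (FT (Suc b) @ [False])" using sw_ctxs[OF Suc, of "[False, True]" "[]"] by simp
  ultimately show ?case by (rule converse_rtranclp_into_rtranclp)
qed simp

text \<open>A surplus \<open>False\<close> travels to the right through the alternating part, where
  it pairs with the next \<open>True\<close>. The letters end up in as many adjacent ascents as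
  possible.\<close>

lemma sw_FT1: "b \<le> a ==> sw\<^sup>*\<^sup>* (replicate a False @ replicate b True) (replicate (a - b) False @ FT b)"
proof (induction b)
  case (Suc b)
  have "sw\<^sup>*\<^sup>* (replicate a False @ replicate (Suc b) True) (replicate (a - b) False @ FT b @ [True])"
    using sw_ctxs[OF Suc.IH, of "[]" "[True]"] Suc.prems by (simp add: replicate_append_same[symmetric])
  also have "replicate (a - b) False @ FT b @ [True] = replicate (a - Suc b) False @ (False # FT b) @ [True]"
  proof -
    have "a - b = Suc (a - Suc b)" using Suc.prems by simp
    then show ?thesis by (simp add: replicate_app_Cons_same)
  qed
  also have "sw\<^sup>*\<^sup>* \<dots> (replicate (a - Suc b) False @ (FT b @ [False]) @ [True])" by (rule sw_ctxs[OF sw_F])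
  also have "\<dots> = replicate (a - Suc b) False @ FT (Suc b)" using FT_snoc[of b] by simp
  finally show ?case .
qed simp

lemma sw_FT2: "b \<le> a ==> sw\<^sup>*\<^sup>* (replicate b False @ replicate a True) (FT b @ replicate (a - b) True)"
proof (induction b)
  case (Suc b)
  have "sw\<^sup>*\<^sup>* (replicate (Suc b) False @ replicate a True) ([] @ (False # FT b) @ replicate (a - b) True)"
    using sw_ctxs[OF Suc.IH, of "[False]" "[]"] Suc.prems by simp
  also have "sw\<^sup>*\<^sup>* \<dots> ([] @ (FT b @ [False]) @ replicate (a - b) True)" by (rule sw_ctxs[OF sw_F])
  also have "\<dots> = FT (Suc b) @ replicate (a - Suc b) True"
  proof -
    have "a - b = Suc (a - Suc b)" using Suc.prems by simp
    then show ?thesis by (simp add: FT_snoc[symmetric] del: FT_simps)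
  qed
  finally show ?case .
qed simp

lemma FT_nth: "k < b ==> FT b ! (2 * k) = False" "k < b ==> FT b ! Suc (2 * k) = True"
proof (induction b arbitrary: k)
  case (Suc b)
  case 1 then show ?case using Suc.IH(1)[of "k - 1"] by (cases k) simp_all
  case 2 then show ?case using Suc.IH(2)[of "k - 1"] by (cases k) simp_all
qed simp_all

section \<open>Decreasing subsequences in windows\<close>

definition decr :: "bperm => int set => bool" where
  "decr w P \<longleftrightarrow> (\<forall>p\<in>P. \<forall>q\<in>P. p < q --> w $ q < w $ p)"

lemma decrD: "decr w P ==> p \<in> P ==> q \<in> P ==> p < q ==> w $ q < w $ p" by (auto simp: decr_def)

lemma decr_swap:
  assumes "0 < k" "0 < a" "a \<le> int k" "int k + 1 \<le> b" "P \<subseteq> {a..b}" "decr w P" "\<not> (int k \<in> P \<and> int k + 1 \<in> P)"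
  shows "\<exists>P'\<subseteq>{a..b}. card P' = card P \<and> decr (w * gen k) P'"
proof (intro exI conjI)
  show "(\<lambda>p. gen k $ p) ` P \<subseteq> {a..b}" using assms(1-5) by (auto simp: gen_apply)
  show "card ((\<lambda>p. gen k $ p) ` P) = card P" by (rule card_image) (auto simp: inj_on_def)
  show "decr (w * gen k) ((\<lambda>p. gen k $ p) ` P)"
    unfolding decr_def
  proof clarify
    fix p q assume pq: "p \<in> P" "q \<in> P" "gen k $ p < gen k $ q"
    have pos: "0 < p" "0 < q" using pq assms(2,5) by auto
    have "p < q"
    proof (rule ccontr)
      assume "\<not> p < q"
      then have "p = int k + 1 \<and> q = int k" using pq(3) pos assms(1) by (auto simp: gen_apply split: if_splits)
      then show False using pq assms(7) by auto
    qed
    then show "(w * gen k) $ (gen k $ q) < (w * gen k) $ (gen k $ p)" using decrD[OF assms(6) pq(1,2)] by simp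
  qed
qed

text \<open>The witness value at k + 2 lies between those at k + 1 and k. After the exchange, the
  value from k sits at k + 1 and is followed by the witness, which takes the part of the value from
  k + 1.\<close>

lemma decr_star_down:
  assumes k: "0 < k" and P: "P \<subseteq> {a..b}" "0 < a" "int k + 2 \<le> b" "decr w P"
    and w: "w $ (int k + 1) < w $ (int k + 2)" "w $ (int k + 2) < w $ int k" and kP: "int k \<in> P" "int k + 1 \<in> P"
  shows "\<exists>P'\<subseteq>{a..b}. card P' = card P \<and> decr (w * gen k) P'"
proof (intro exI conjI)
  let ?P = "insert (int k + 2) (P - {int k})"
  have n2: "int k + 2 \<notin> P" using decrD[OF P(4) kP(2), of "int k + 2"] w by auto
  have "finite P" using P(1) finite_subset by blast
  then show "card ?P = card P" using n2 card.remove[OF _ kP(1)] by simp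
  show "?P \<subseteq> {a..b}" using P kP by auto
  have v: "(w * gen k) $ p = (if p = int k + 1 then w $ int k else w $ p)" if "p \<in> ?P" for p
    using that P k by (auto simp: gen_apply)
  show "decr (w * gen k) ?P" unfolding decr_def
  proof (intro ballI impI)
    fix p q assume pq: "p \<in> ?P" "q \<in> ?P" "p < q"
    note d = decrD[OF P(4)]
    have "(if q = int k + 1 then w $ int k else w $ q) < (if p = int k + 1 then w $ int k else w $ p)"
    proof (cases "p = int k + 1")
      case True
      then show ?thesis using pq d[OF kP(1), of q] w by auto
    next
      case False
      show ?thesis
      proof (cases "p = int k + 2")
        case True then show ?thesis using pq d[OF kP(2), of q] w by auto
      next
        case p2: False
        then have "p \<in> P" using pq by auto
        then show ?thesis using False p2 pq d[of p q] d[of p "int k"] d[of "int k" p] kP w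
          by (cases "q = int k + 1"; cases "q = int k + 2"; cases "p < int k") auto
      qed
    qed
    then show "(w * gen k) $ q < (w * gen k) $ p" unfolding v[OF pq(1)] v[OF pq(2)] .
  qed
qed

text \<open>Mirror image: the witness at k takes the part of the value from k + 1 and is followed by
  the value from k + 2, now at k + 1.\<close>

lemma decr_star_up:
  assumes k: "0 < k" and P: "P \<subseteq> {a..b}" "0 < a" "a \<le> int k" "decr w P"
    and w: "w $ int k < w $ (int k + 1)" "w $ (int k + 2) < w $ int k" and kP: "int k + 1 \<in> P" "int k + 2 \<in> P"
  shows "\<exists>P'\<subseteq>{a..b}. card P' = card P \<and> decr (w * gen (Suc k)) P'"
proof (intro exI conjI)
  let ?P = "insert (int k) (P - {int k + 2})"
  have n2: "int k \<notin> P" using decrD[OF P(4) _ kP(1), of "int k"] w by auto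
  have "finite P" using P(1) finite_subset by blast
  then show "card ?P = card P" using n2 card.remove[OF _ kP(2)] by simp
  show "?P \<subseteq> {a..b}" using P kP by auto
  have v: "(w * gen (Suc k)) $ p = (if p = int k + 1 then w $ (int k + 2) else w $ p)" if "p \<in> ?P" for p
  proof (cases "p = int k + 1")
    case True then show ?thesis using gen_vals(5)[OF k] by simp
  next
    case False
    moreover have "0 < p" "p \<noteq> int k + 2" using that P k by auto
    ultimately show ?thesis by (auto simp: gen_apply)
  qed
  show "decr (w * gen (Suc k)) ?P" unfolding decr_def
  proof (intro ballI impI)
    fix p q assume pq: "p \<in> ?P" "q \<in> ?P" "p < q"
    note d = decrD[OF P(4)]
    have "(if q = int k + 1 then w $ (int k + 2) else w $ q) < (if p = int k + 1 then w $ (int k + 2) else w $ p)"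
    proof (cases "q = int k + 1")
      case True
      then show ?thesis using pq d[OF _ kP(2), of p] w by auto
    next
      case False
      show ?thesis
      proof (cases "q = int k")
        case True then show ?thesis using pq d[OF _ kP(1), of p] w by auto
      next
        case q2: False
        then have "q \<in> P" "q \<noteq> int k + 2" using pq by auto
        then show ?thesis using False q2 pq d[of p q] d[of "int k + 2" q] d[of q "int k + 2"] kP w
          by (cases "p = int k + 1"; cases "p = int k"; cases "int k + 2 < q") auto
      qed
    qed
    then show "(w * gen (Suc k)) $ q < (w * gen (Suc k)) $ p" unfolding v[OF pq(1)] v[OF pq(2)] .
  qed
qed

text \<open>A star operation is a Knuth move on the values in the window, and these preserve lengths
  of decreasing subsequences. If the two exchanged positions are not both in P, the subsequence is
  simply carried along.\<close>

lemma decr_star: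
  assumes k: "0 < k" and ij: "i = k \<and> j = Suc k \<or> i = Suc k \<and> j = k" and D: "DS i j w"
    and P: "P \<subseteq> {a..b}" "0 < a" "a \<le> int k" "int k + 2 \<le> b" "decr w P"
  shows "\<exists>P'\<subseteq>{a..b}. card P' = card P \<and> decr (star i j w) P'"
proof -
  have ne: "w $ int k \<noteq> w $ (int k + 2)" by simp
  have S: "int (Suc k) = int k + 1" "int (Suc k) + 1 = int k + 2" by simp_all
  from ij show ?thesis
  proof
    assume i: "i = k \<and> j = Suc k"
    then have d: "w $ (int k + 1) < w $ int k" "w $ (int k + 1) < w $ (int k + 2)" using D DS_Suc(1)[OF k] by auto
    show ?thesis
    proof (cases "w $ int k < w $ (int k + 2)")
      case True
      then have st: "star i j w = w * gen (Suc k)" using i star_Suc(1)[OF k] by simp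
      have "\<not> (int k + 1 \<in> P \<and> int k + 2 \<in> P)" using decrD[OF P(5), of "int k + 1" "int k + 2"] d(2) by linarith
      then have "\<not> (int (Suc k) \<in> P \<and> int (Suc k) + 1 \<in> P)" unfolding S(2) unfolding S(1) .
      from decr_swap[OF _ P(2) _ _ P(1,5) this] show ?thesis unfolding st using P by auto
    next
      case False
      then have st: "star i j w = w * gen k" using i star_Suc(1)[OF k] by simp
      show ?thesis
      proof (cases "int k \<in> P \<and> int k + 1 \<in> P")
        case True then show ?thesis unfolding st using decr_star_down[OF k P(1,2,4,5) d(2)] False ne by auto
      next
        case F: False then show ?thesis unfolding st using decr_swap[OF k P(2,3) _ P(1,5)] P by auto
      qed
    qed
  next
    assume i: "i = Suc k \<and> j = k"
    then have d: "w $ (int k + 2) < w $ (int k + 1)" "w $ int k < w $ (int k + 1)" using D DS_Suc(2)[OF k] by auto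
    show ?thesis
    proof (cases "w $ int k < w $ (int k + 2)")
      case True
      then have st: "star i j w = w * gen k" using i star_Suc(2)[OF k] by simp
      have "\<not> (int k \<in> P \<and> int k + 1 \<in> P)" using decrD[OF P(5), of "int k" "int k + 1"] d by auto
      from decr_swap[OF k P(2,3) _ P(1,5) this] show ?thesis unfolding st using P by auto
    next
      case False
      then have st: "star i j w = w * gen (Suc k)" using i star_Suc(2)[OF k] by simp
      show ?thesis
      proof (cases "int k + 1 \<in> P \<and> int k + 2 \<in> P")
        case True then show ?thesis unfolding st using decr_star_up[OF k P(1,2,3,5) d(2)] False ne by auto
      next
        case F: False
        then have "\<not> (int (Suc k) \<in> P \<and> int (Suc k) + 1 \<in> P)" unfolding S(2) unfolding S(1) .
        from decr_swap[OF _ P(2) _ _ P(1,5) this] show ?thesis unfolding st using P by auto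
      qed
    qed
  qed
qed

text \<open>The bits of a pattern split a window of \<open>x\<close> into two decreasing subsequences, the letters \<open>False\<close> being
  smaller than those \<open>True\<close> standing to their right.\<close>

definition pat :: "nat => bool list => bperm => bool" where
  "pat s v x \<longleftrightarrow> (\<forall>i j. i < j --> j < length v --> (x $ (int s + 1 + int i) < x $ (int s + 1 + int j) \<longleftrightarrow> \<not> v ! i \<and> v ! j))"

lemma pat_swap:
  assumes "pat s (u @ [False, True] @ t) x"
  shows "pat s (u @ [True, False] @ t) (x * gen (s + 1 + length u))"
  unfolding pat_def
proof (intro allI impI)
  let ?v = "u @ [False, True] @ t" and ?v' = "u @ [True, False] @ t" and ?k = "s + 1 + length u"
  define f where "f a = (if a = length u then Suc (length u) else if a = Suc (length u) then length u else a)" for a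
  have g: "(x * gen ?k) $ (int s + 1 + int a) = x $ (int s + 1 + int (f a))" for a
    by (auto simp: gen_apply f_def)
  have v: "?v' ! a = ?v ! f a" for a
    by (auto simp: f_def nth_append nth_Cons split: nat.split)
  fix a b assume ab: "a < b" "b < length ?v'"
  show "(x * gen ?k) $ (int s + 1 + int a) < (x * gen ?k) $ (int s + 1 + int b) \<longleftrightarrow> \<not> ?v' ! a \<and> ?v' ! b"
  proof (cases "f a < f b")
    case True
    moreover have "f b < length ?v" using ab by (auto simp: f_def)
    ultimately show ?thesis unfolding g v using assms unfolding pat_def by blast
  next
    case False
    then have e: "a = length u" "b = Suc (length u)" using ab by (auto simp: f_def split: if_splits)
    have "x $ (int s + 1 + int (length u)) < x $ (int s + 1 + int (Suc (length u)))"
      using assms[unfolded pat_def, rule_format, of "length u" "Suc (length u)"] by (simp add: nth_append)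
    then show ?thesis unfolding g v by (simp add: e f_def nth_append)
  qed
qed

text \<open>The star operation is applied to x and y simultaneously: lying in one left cell, they
  have the same right descents, so it is defined for both. For x the pattern follows the move, for y
  only the decreasing subsequence is tracked.\<close>

lemma sw_step:
  assumes "sw v v'" "LS n x y" "pat s v x" "s + length v \<le> n" "P \<subseteq> {int s + 1..int (s + length v)}" "decr y P"
  shows "\<exists>x' y'. LS n x' y' \<and> pat s v' x' \<and> (\<exists>P'\<subseteq>{int s + 1..int (s + length v)}. card P' = card P \<and> decr y' P')"
  using assms(1)
proof cases
  case (sw1 u t)
  define k where "k = s + 1 + length u"
  have k: "0 < k" "int s + 1 + int (length u) = int k" "int s + 1 + int (Suc (length u)) = int k + 1" "int s + 1 + int (Suc (Suc (length u))) = int k + 2"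
    by (simp_all add: k_def)
  note p = assms(3)[unfolded pat_def sw1(1), rule_format]
  have "\<not> x $ int k < x $ (int k + 1)" "x $ (int k + 1) < x $ (int k + 2)" "x $ int k < x $ (int k + 2)"
    using p[of "length u" "Suc (length u)"] p[of "Suc (length u)" "Suc (Suc (length u))"] p[of "length u" "Suc (Suc (length u))"]
    unfolding k by (simp_all add: nth_append)
  moreover have "x $ int k \<noteq> x $ (int k + 1)" by simp
  ultimately have "x $ (int k + 1) < x $ int k" "x $ (int k + 1) < x $ (int k + 2)" "x $ int k < x $ (int k + 2)" by linarith+
  then have D: "DS k (Suc k) x" and st: "star k (Suc k) x = x * gen (Suc k)" using DS_Suc[OF k(1)] star_Suc[OF k(1)] by auto
  have a: "adj k (Suc k)" using k(1) by (simp add: adj_def)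
  have len: "Suc k < n" "k + 2 \<le> s + length v" using assms(4) by (simp_all add: sw1 k_def)
  have L: "LS n (star k (Suc k) x) (star k (Suc k) y)" by (rule LS_star[OF assms(2) a _ _ D]) (use len in simp_all)
  have p': "pat s ((u @ [False]) @ [True, False] @ t) (x * gen (s + 1 + length (u @ [False])))"
    by (rule pat_swap) (use assms(3) sw1 in simp)
  have "pat s v' (star k (Suc k) x)" unfolding st using p' by (simp add: sw1 k_def)
  moreover have "\<exists>P'\<subseteq>{int s + 1..int (s + length v)}. card P' = card P \<and> decr (star k (Suc k) y) P'"
    by (rule decr_star[OF k(1) _ _ assms(5) _ _ _ assms(6)]) (use LS_DS[OF assms(2) a] D len in \<open>auto simp: k_def\<close>)
  ultimately show ?thesis using L by blast
next
  case (sw2 u t)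
  define k where "k = s + 1 + length u"
  have k: "0 < k" "int s + 1 + int (length u) = int k" "int s + 1 + int (Suc (length u)) = int k + 1" "int s + 1 + int (Suc (Suc (length u))) = int k + 2"
    by (simp_all add: k_def)
  note p = assms(3)[unfolded pat_def sw2(1), rule_format]
  have "\<not> x $ (int k + 1) < x $ (int k + 2)" "x $ int k < x $ (int k + 1)" "x $ int k < x $ (int k + 2)"
    using p[of "length u" "Suc (length u)"] p[of "Suc (length u)" "Suc (Suc (length u))"] p[of "length u" "Suc (Suc (length u))"]
    unfolding k by (simp_all add: nth_append)
  moreover have "x $ (int k + 1) \<noteq> x $ (int k + 2)" by simp
  ultimately have "x $ (int k + 2) < x $ (int k + 1)" "x $ int k < x $ (int k + 1)" "x $ int k < x $ (int k + 2)" by linarith+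
  then have D: "DS (Suc k) k x" and st: "star (Suc k) k x = x * gen k" using DS_Suc[OF k(1)] star_Suc[OF k(1)] by auto
  have a: "adj (Suc k) k" using k(1) by (simp add: adj_def)
  have len: "Suc k < n" "k + 2 \<le> s + length v" using assms(4) by (simp_all add: sw2 k_def)
  have L: "LS n (star (Suc k) k x) (star (Suc k) k y)" by (rule LS_star[OF assms(2) a _ _ D]) (use len in simp_all)
  have p': "pat s (u @ [True, False] @ (True # t)) (x * gen (s + 1 + length u))"
    by (rule pat_swap) (use assms(3) sw2 in simp)
  have "pat s v' (star (Suc k) k x)" unfolding st using p' by (simp add: sw2 k_def)
  moreover have "\<exists>P'\<subseteq>{int s + 1..int (s + length v)}. card P' = card P \<and> decr (star (Suc k) k y) P'"
    by (rule decr_star[OF k(1) _ _ assms(5) _ _ _ assms(6)]) (use LS_DS[OF assms(2) a] D len in \<open>auto simp: k_def\<close>)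
  ultimately show ?thesis using L by blast
qed

lemma sw_length: "sw v v' ==> length v' = length v" by (induction rule: sw.induct) auto

lemma sw_steps:
  assumes "sw\<^sup>*\<^sup>* v v'" "LS n x y" "pat s v x" "s + length v \<le> n" "P \<subseteq> {int s + 1..int (s + length v)}" "decr y P"
  shows "\<exists>x' y'. LS n x' y' \<and> pat s v' x' \<and> (\<exists>P'\<subseteq>{int s + 1..int (s + length v)}. card P' = card P \<and> decr y' P') \<and> length v' = length v"
  using assms(1)
proof (induction rule: rtranclp_induct)
  case base then show ?case using assms by blast
next
  case (step w w')
  then obtain x' y' P' where *: "LS n x' y'" "pat s w x'" "P' \<subseteq> {int s + 1..int (s + length v)}" "card P' = card P" "decr y' P'" "length w = length v" by blast
  have "s + length w \<le> n" "P' \<subseteq> {int s + 1..int (s + length w)}" using * assms(4) by simp_all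
  from sw_step[OF step(2) *(1,2) this *(5)] show ?case using *(4,6) sw_length[OF step(2)] by metis
qed

text \<open>Within each pair of the alternating part x ascends, hence so does y, since right
  descents agree on a left cell. A decreasing subsequence of y thus uses at most one position of
  each pair.\<close>

lemma FT_bound:
  assumes L: "LS n x y" and p: "pat s v x" and v: "v = replicate c False @ FT b @ replicate e True" and n: "s + length v \<le> n"
    and P: "P \<subseteq> {int s + 1..int (s + length v)}" "decr y P"
  shows "card P \<le> c + b + e"
proof -
  \<comment> \<open>Numbers the single positions and the pairs consecutively, which gives c + b + e
    classes.\<close>
  define f where "f q = (let i = nat (q - int s - 1) in if i < c then i else if i < c + 2 * b then c + (i - c) div 2 else i - b)" for q
  have lv: "length v = c + 2 * b + e" by (simp add: v)
  have asc: "y $ (int s + 1 + int (c + 2 * k)) < y $ (int s + 1 + int (c + 2 * k) + 1)" if "k < b" for k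
  proof -
    have "v ! (c + 2 * k) = False" "v ! Suc (c + 2 * k) = True"
      using that FT_nth[OF that] by (simp_all add: v nth_append)
    then have "x $ (int s + 1 + int (c + 2 * k)) < x $ (int s + 1 + int (Suc (c + 2 * k)))"
      using p[unfolded pat_def, rule_format, of "c + 2 * k" "Suc (c + 2 * k)"] lv that by simp
    then have "\<not> ell (x * gen (s + 1 + (c + 2 * k))) < ell x" unfolding ell_less_right by (simp add: ra_def rb_def add_ac)
    then have "\<not> ell (y * gen (s + 1 + (c + 2 * k))) < ell y" using LS_descent[OF L] by simp
    then have "\<not> y $ (int s + 1 + int (c + 2 * k) + 1) < y $ (int s + 1 + int (c + 2 * k))"
      unfolding ell_less_right by (simp add: ra_def rb_def add_ac)
    moreover have "y $ (int s + 1 + int (c + 2 * k) + 1) \<noteq> y $ (int s + 1 + int (c + 2 * k))" by simp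
    ultimately show ?thesis by linarith
  qed
  have inj: "False" if pq: "p \<in> P" "q \<in> P" "p < q" "f p = f q" for p q
  proof -
    define i j where "i = nat (p - int s - 1)" and "j = nat (q - int s - 1)"
    have e: "p = int s + 1 + int i" "q = int s + 1 + int j" "i < j" using P(1) pq by (auto simp: i_def j_def)
    have ff: "(if i < c then i else if i < c + 2 * b then c + (i - c) div 2 else i - b) =
      (if j < c then j else if j < c + 2 * b then c + (j - c) div 2 else j - b)"
      using pq(4) by (simp add: f_def Let_def i_def[symmetric] j_def[symmetric])
    define k where "k = (i - c) div 2"
    have "k < b \<and> i = c + 2 * k \<and> j = Suc i"
    proof -
      have "\<not> i < c" using ff e(3) by (auto split: if_splits)
      moreover have "j < c + 2 * b" using ff e(3) by (auto split: if_splits)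
      ultimately have "(i - c) div 2 = (j - c) div 2" "c \<le> i" "j < c + 2 * b" using ff e(3) by auto
      then have "(i - c) div 2 = (j - c) div 2" "i - c < j - c" "j - c < 2 * b" "i = c + (i - c)" "j = c + (j - c)"
        using e(3) by simp_all
      then obtain i' j' where ij: "i = c + i'" "j = c + j'" "i' div 2 = j' div 2" "i' < j'" "j' < 2 * b" by blast
      have "j' = Suc i'" "i' = 2 * (i' div 2)" using ij(3,4) by arith+
      moreover have "k = i' div 2" by (simp add: k_def ij(1))
      ultimately show ?thesis using ij(1,2,5) by (intro conjI; linarith)
    qed
    then have "k < b" "p = int s + 1 + int (c + 2 * k)" "q = int s + 1 + int (c + 2 * k) + 1" using e by simp_all
    then have "y $ p < y $ q" using asc by metis
    then show False using decrD[OF P(2) pq(1-3)] by simp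
  qed
  have "inj_on f P" unfolding inj_on_def using inj by (metis linorder_neqE)
  moreover have "f ` P \<subseteq> {..<c + b + e}"
  proof clarify
    fix q assume "q \<in> P"
    then have "q \<in> {int s + 1..int (s + length v)}" using P(1) by blast
    then have "nat (q - int s - 1) < c + 2 * b + e" unfolding lv by auto
    then show "f q < c + b + e" unfolding f_def Let_def by auto
  qed
  ultimately show ?thesis using card_inj_on_le[of f P "{..<c + b + e}"] by simp
qed

lemma window_bound:
  assumes "LS n x y" "pat s (replicate a False @ replicate b True) x" "s + (a + b) \<le> n"
    "P \<subseteq> {int s + 1..int (s + (a + b))}" "decr y P"
  shows "card P \<le> max a b"
proof -
  have len: "length (replicate a False @ replicate b True) = a + b" by simp
  show ?thesis
  proof (cases "b \<le> a")
    case True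
    from sw_steps[OF sw_FT1[OF True] assms(1,2), of P, unfolded len, OF assms(3-5)] obtain x' y' P' where
      *: "LS n x' y'" "pat s (replicate (a - b) False @ FT b) x'" "P' \<subseteq> {int s + 1..int (s + (a + b))}" "card P' = card P" "decr y' P'"
      by blast
    have "card P' \<le> (a - b) + b + 0" by (rule FT_bound[OF *(1,2)]) (use *(3,5) assms(3) True in \<open>simp_all add: mult_2\<close>)
    then show ?thesis using *(4) True by simp
  next
    case False
    then have ab: "a \<le> b" by simp
    from sw_steps[OF sw_FT2[OF ab] assms(1,2), of P, unfolded len, OF assms(3-5)] obtain x' y' P' where
      *: "LS n x' y'" "pat s (FT a @ replicate (b - a) True) x'" "P' \<subseteq> {int s + 1..int (s + (a + b))}" "card P' = card P" "decr y' P'"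
      by blast
    have "card P' \<le> 0 + a + (b - a)" by (rule FT_bound[OF *(1,2)]) (use *(3,5) assms(3) ab in \<open>simp_all add: mult_2\<close>)
    then show ?thesis using *(4) ab by simp
  qed
qed

section \<open>The left cell as the set of standard fillings\<close>

section \<open>The left cell of a row-reversing permutation\<close>

text \<open>The row \<open>r\<close> of the initial bitableau consists of the entries \<open>off r + 1, \<dots>, off (Suc r)\<close>; the rows below \<open>m\<close> form
  the first component.\<close>

locale rows =
  fixes n l m :: nat and off :: "nat => nat" and \<rho> :: "int => nat" and \<sigma> :: bperm
  assumes n0: "0 < n" and offl: "off m = l" and off_n: "off r \<le> n" and off_Suc: "off r \<le> off (Suc r)"
    and rho1: "0 < v ==> v \<le> int n ==> int (off (\<rho> v)) < v \<and> v \<le> int (off (Suc (\<rho> v)))"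
    and rho2: "int (off r) < v ==> v \<le> int (off (Suc r)) ==> \<rho> v = r"
    and shape: "Suc r \<noteq> m ==> off (Suc (Suc r)) + off r \<le> 2 * off (Suc r)"
    and sig: "\<sigma> \<in> Sy n" and sig_row: "0 < v ==> v \<le> int n ==> \<rho> (\<sigma> $ v) = \<rho> v"
    and sig_rev: "0 < v ==> v < v' ==> v' \<le> int n ==> \<rho> v = \<rho> v' ==> \<sigma> $ v' < \<sigma> $ v"
begin

lemma l_n: "l \<le> n" using off_n[of m] offl by simp
lemma off_mono: "r \<le> r' ==> off r \<le> off r'" by (rule lift_Suc_mono_le[of off]) (rule off_Suc)

lemma rho_mono: assumes "0 < v" "v \<le> v'" "v' \<le> int n" shows "\<rho> v \<le> \<rho> v'"
proof (rule ccontr)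
  assume "\<not> ?thesis"
  then have "off (Suc (\<rho> v')) \<le> off (\<rho> v)" by (intro off_mono) simp
  then show False using rho1[of v] rho1[of v'] assms by linarith
qed

lemma rho_m: assumes "0 < v" "v \<le> int n" shows "\<rho> v < m \<longleftrightarrow> v \<le> int l"
proof
  assume "\<rho> v < m"
  then have "off (Suc (\<rho> v)) \<le> l" unfolding offl[symmetric] by (intro off_mono) simp
  then show "v \<le> int l" using rho1[OF assms] by linarith
next
  assume v: "v \<le> int l"
  show "\<rho> v < m"
  proof (rule ccontr)
    assume "\<not> ?thesis"
    then have "l \<le> off (\<rho> v)" unfolding offl[symmetric] by (intro off_mono) simp
    then show False using rho1[OF assms] v by linarith
  qed
qed

lemma Sy_range': "w \<in> Sy n ==> 0 < v ==> v \<le> int n ==> 0 < w $ v \<and> w $ v \<le> int n"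
  using Sy_pos Sy_range by blast

definition inc :: "bperm => bool" where
  "inc d \<longleftrightarrow> (\<forall>p q. 0 < p \<and> p < q \<and> q \<le> int n \<and> \<rho> p = \<rho> q --> d $ p < d $ q)"
lemma incD: "inc d ==> 0 < p ==> p < q ==> q \<le> int n ==> \<rho> p = \<rho> q ==> d $ p < d $ q" by (auto simp: inc_def)

text \<open>Length of row r. In the initial filling the box above an entry v of row r + 1 contains
  \<open>v - sz r\<close>; this is how \<open>std\<close> expresses the column condition, which is
  omitted between the two components.\<close>

definition sz :: "nat => int" where "sz r = int (off (Suc r)) - int (off r)"

definition std :: "bperm => bool" where
  "std d \<longleftrightarrow> d \<in> Sy n \<and> inc d \<and> (\<forall>v r. 0 < v \<and> v \<le> int n \<and> \<rho> v = Suc r \<and> Suc r \<noteq> m --> d $ (v - sz r) < d $ v)"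

lemma above: assumes "0 < v" "v \<le> int n" "\<rho> v = Suc r" "Suc r \<noteq> m"
  shows "0 < v - sz r" "v - sz r < v" "\<rho> (v - sz r) = r" "v - sz r \<le> int n"
proof -
  have b: "int (off (Suc r)) < v" "v \<le> int (off (Suc (Suc r)))" using rho1[OF assms(1,2)] assms(3) by auto
  have s: "int (off (Suc (Suc r))) + int (off r) \<le> 2 * int (off (Suc r))" using shape[OF assms(4)] by linarith
  show "0 < v - sz r" "v - sz r < v" "v - sz r \<le> int n" using b s assms(2) unfolding sz_def by linarith+
  show "\<rho> (v - sz r) = r" by (rule rho2) (use b s in \<open>simp_all add: sz_def\<close>)
qed

lemma rev_less:
  assumes w: "w \<in> Sy n" "\<And>v. 0 < v ==> v \<le> int n ==> \<rho> (w $ v) = \<rho> v"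
    and rev: "\<rho> p = \<rho> q ==> w $ q < w $ p" and pq: "0 < p" "p < q" "q \<le> int n"
  shows "w $ p < w $ q \<longleftrightarrow> \<rho> p \<noteq> \<rho> q"
proof (cases "\<rho> p = \<rho> q")
  case True then show ?thesis using rev by simp
next
  case False
  have "\<not> w $ q \<le> w $ p"
  proof
    assume "w $ q \<le> w $ p"
    then have "\<rho> (w $ q) \<le> \<rho> (w $ p)" using Sy_range'[OF w(1), of q] Sy_range'[OF w(1), of p] pq by (intro rho_mono) auto
    then show False using False rho_mono[of p q] w(2)[of p] w(2)[of q] pq by simp
  qed
  then show ?thesis using False by simp
qed

lemma sig_less: "0 < p ==> p < q ==> q \<le> int n ==> \<sigma> $ p < \<sigma> $ q \<longleftrightarrow> \<rho> p \<noteq> \<rho> q"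
  by (rule rev_less[OF sig sig_row sig_rev])

lemma sigi: "inverse \<sigma> \<in> Sy n" using sig by simp
lemma sigi_row: assumes "0 < v" "v \<le> int n" shows "\<rho> (inverse \<sigma> $ v) = \<rho> v"
  using sig_row[of "inverse \<sigma> $ v"] Sy_range'[OF sigi assms] by simp
lemma sigi_rev: assumes "0 < p" "p < q" "q \<le> int n" "\<rho> p = \<rho> q" shows "inverse \<sigma> $ q < inverse \<sigma> $ p"
proof (rule ccontr)
  assume "\<not> ?thesis"
  moreover have "inverse \<sigma> $ q \<noteq> inverse \<sigma> $ p" using assms(2) by simp
  ultimately have a: "inverse \<sigma> $ p < inverse \<sigma> $ q" by linarith
  then have "\<sigma> $ (inverse \<sigma> $ q) < \<sigma> $ (inverse \<sigma> $ p)"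
    using sigi_row[of p] sigi_row[of q] Sy_range'[OF sigi, of p] Sy_range'[OF sigi, of q] assms by (intro sig_rev) auto
  then show False using assms(2) by simp
qed
lemma sigi_less: "0 < p ==> p < q ==> q \<le> int n ==> inverse \<sigma> $ p < inverse \<sigma> $ q \<longleftrightarrow> \<rho> p \<noteq> \<rho> q"
  by (rule rev_less[OF sigi sigi_row sigi_rev])

lemma ell_inc_sig: assumes "inc d" shows "ell (d * \<sigma>) = ell d + ell \<sigma>"
proof (rule ell_add_pos[OF sig])
  fix p q :: int assume pq: "0 < p" "p < q" "inverse \<sigma> $ q < inverse \<sigma> $ p"
  have "q \<le> int n"
  proof (rule ccontr)
    assume q: "\<not> q \<le> int n"
    have fx: "inverse \<sigma> $ v = v" if "v > int n" for v using Wn_fix[OF Sy_Wn[OF sigi] that] .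
    show False
    proof (cases "p \<le> int n")
      case True then show False using pq q fx[of q] Sy_range'[OF sigi, of p] by simp
    next
      case False then show False using pq q fx[of q] fx[of p] by simp
    qed
  qed
  then show "d $ p < d $ q" using incD[OF assms pq(1,2)] sigi_less[OF pq(1,2)] pq(3) by auto
qed

lemma sig_WJ: "\<sigma> \<in> WJ l n"
  unfolding WJ_def
proof (intro CollectI conjI allI impI)
  fix i :: int assume i: "0 < i"
  show "\<sigma> $ i \<le> int l \<longleftrightarrow> i \<le> int l"
  proof (cases "i \<le> int n")
    case True
    then show ?thesis using rho_m[of i] rho_m[of "\<sigma> $ i"] sig_row[of i] Sy_range'[OF sig i True] i by simp
  next
    case False then show ?thesis using Wn_fix[OF Sy_Wn[OF sig], of i] by simp
  qed
qed (rule sig)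

abbreviation Y :: "bperm => bperm" where "Y u \<equiv> u * \<sigma> * aw l"

definition f :: "bperm => nat => nat" where "f u i = \<rho> (inverse u $ int i)"

text \<open>On either side of l the element a_l preserves order, so only u and \<sigma> matter.
  Within a row u increases and \<sigma> reverses, while \<sigma> leaves the order of different rows
  alone; equal letters therefore count as a descent.\<close>

lemma Y_descent:
  assumes u: "u \<in> WJ l n" "inc u" and i: "0 < i" "i < n" "i \<noteq> l"
  shows "ell (gen i * Y u) < ell (Y u) \<longleftrightarrow> \<not> f u i < f u (Suc i)"
proof -
  have uS: "u \<in> Sy n" and ui: "inverse u \<in> WJ l n" "inverse u \<in> Sy n" using u WJ_Sy WJ_inverse by auto
  define a b where "a = inverse u $ int i" and "b = inverse u $ (int i + 1)"
  have ab: "0 < a" "a \<le> int n" "0 < b" "b \<le> int n" "a \<noteq> b" using Sy_range'[OF ui(2), of "int i"] Sy_range'[OF ui(2), of "int i + 1"] i by (auto simp: a_def b_def)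
  have side: "a \<le> int l \<longleftrightarrow> b \<le> int l" using ui(1) i by (auto simp: WJ_def a_def b_def)
  have uab: "u $ a = int i" "u $ b = int i + 1" by (simp_all add: a_def b_def)
  have sW: "inverse \<sigma> \<in> WJ l n" using sig_WJ by (rule WJ_inverse)
  define a' b' where "a' = inverse \<sigma> $ a" and "b' = inverse \<sigma> $ b"
  have ab': "0 < a'" "0 < b'" "a' \<le> int l \<longleftrightarrow> b' \<le> int l" using Sy_range'[OF sigi] ab side sW by (auto simp: WJ_def a'_def b'_def)
  have "ell (gen i * Y u) < ell (Y u) \<longleftrightarrow> aw l $ b' < aw l $ a'"
    unfolding ell_less_left using i by (simp add: a'_def b'_def a_def b_def ra_def rb_def binv_times)
  also have "\<dots> \<longleftrightarrow> b' < a'" using ab' by (auto simp: aw_apply)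
  also have "\<dots> \<longleftrightarrow> \<not> \<rho> a < \<rho> b"
  proof (cases "a < b")
    case True
    have "b' \<noteq> a'" using ab by (simp add: a'_def b'_def)
    then have "b' < a' \<longleftrightarrow> \<not> a' < b'" by linarith
    then show ?thesis using sigi_less[OF ab(1) True ab(4)] rho_mono[OF ab(1) _ ab(4)] True by (auto simp: a'_def b'_def)
  next
    case False
    then have ba: "b < a" using ab by simp
    have "\<rho> b \<noteq> \<rho> a" using incD[OF u(2) ab(3) ba ab(2)] uab by auto
    then have "b' < a'" using sigi_less[OF ab(3) ba ab(2)] by (simp add: a'_def b'_def)
    then show ?thesis using rho_mono[OF ab(3) _ ab(2)] ba by auto
  qed
  finally show ?thesis by (simp add: f_def a_def b_def add.commute)
qed

lemma Y_Wn: "u \<in> Sy n ==> Y u \<in> Wn n" using Sy_Wn sig aw_Wn[OF l_n] by blast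

lemma f_gen: "0 < i ==> f (gen i * u) j = (if j = i then f u (Suc i) else if j = Suc i then f u i else f u j)"
  by (auto simp: f_def binv_times gen_apply algebra_simps)

lemma gen_inc: assumes "u \<in> Sy n" "inc u" "0 < i" "i < n" "f u i \<noteq> f u (Suc i)" shows "inc (gen i * u)"
  unfolding inc_def
proof (intro allI impI)
  fix p q assume pq: "0 < p \<and> p < q \<and> q \<le> int n \<and> \<rho> p = \<rho> q"
  then have lt: "u $ p < u $ q" using incD[OF assms(2)] by blast
  have pos: "0 < u $ p" "0 < u $ q" using Sy_pos[OF assms(1)] pq by auto
  have "\<not> (u $ p = int i \<and> u $ q = int i + 1)"
  proof
    assume a: "u $ p = int i \<and> u $ q = int i + 1"
    then have "inverse u $ int i = p" "inverse u $ (int i + 1) = q" using bap_inverse(1)[of u p] bap_inverse(1)[of u q] by simp_all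
    then show False using assms(5) pq by (simp add: f_def add.commute)
  qed
  then show "(gen i * u) $ p < (gen i * u) $ q" using lt pos assms(3) by (auto simp: gen_apply)
qed

text \<open>The letter at i is at least the first and less than the second of the exchanged letters,
  so i is a left descent before the exchange and not after it. This is the situation of
  \<open>LE_knuth\<close>.\<close>

lemma LS_move:
  assumes u: "u \<in> WJ l n" "inc u" and i: "Suc (Suc i) < n \<or> Suc (Suc i) = n" "0 < i" "Suc (Suc i) \<le> l \<or> l < i"
    and abc: "f u (Suc i) \<le> f u i" "f u i < f u (Suc (Suc i))"
  shows "gen (Suc i) * u \<in> WJ l n \<and> inc (gen (Suc i) * u) \<and> LS n (Y u) (Y (gen (Suc i) * u))"
proof -
  have uS: "u \<in> Sy n" using u WJ_Sy by blast
  let ?u = "gen (Suc i) * u"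
  have u': "?u \<in> WJ l n" using u i by (intro WJ_times gen_WJ) auto
  have inc': "inc ?u" by (rule gen_inc[OF uS u(2)]) (use i abc in auto)
  have Y': "Y ?u = gen (Suc i) * Y u" by (simp add: mult.assoc)
  have d1: "ell (Y u) < ell (gen (Suc i) * Y u)"
    using Y_descent[OF u, of "Suc i"] i abc ell_left_cases[of "Suc i" "Y u"] by auto
  have d2: "ell (gen i * Y u) < ell (Y u)" using Y_descent[OF u, of i] i abc by auto
  have "\<not> ell (gen i * Y ?u) < ell (Y ?u)" using Y_descent[OF u' inc', of i] i abc by (auto simp: f_gen)
  then have d3: "ell (gen (Suc i) * Y u) < ell (gen i * (gen (Suc i) * Y u))" unfolding Y' using ell_left_cases[of i "gen (Suc i) * Y u"] by auto
  have "(Y u, Y ?u) \<in> LE n" unfolding Y' by (rule LE_knuth[of _ _ i]) (use i d1 d2 d3 Y_Wn[OF uS] in auto)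
  moreover have "(Y ?u, Y u) \<in> LE n" unfolding Y' by (rule LE_up) (use i d1 Y_Wn[OF uS] in auto)
  ultimately show ?thesis using u' inc' Y_Wn[OF uS] Y_Wn[OF WJ_Sy[OF u']] by (auto simp: LS_def)
qed

definition word :: "bperm => nat list" where "word u = map (f u) [1..<Suc n]"

lemma word_length [simp]: "length (word u) = n" by (simp add: word_def)
lemma word_nth: "k < n ==> word u ! k = f u (Suc k)" by (simp add: word_def del: upt_Suc)

lemma word_gen:
  assumes "word u = h @ [b, a, c] @ t"
  shows "word (gen (Suc (Suc (length h))) * u) = h @ [b, c, a] @ t"
proof (rule nth_equalityI)
  have n: "n = length h + 3 + length t" using arg_cong[OF assms, of length] by simp
  then show "length (word (gen (Suc (Suc (length h))) * u)) = length (h @ [b, c, a] @ t)" unfolding word_length by simp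
  fix k assume "k < length (word (gen (Suc (Suc (length h))) * u))"
  then have k: "k < n" by simp
  have w: "f u (Suc j) = (h @ [b, a, c] @ t) ! j" if "j < n" for j using word_nth[OF that, of u] assms by simp
  have "word (gen (Suc (Suc (length h))) * u) ! k = f u (Suc (if k = Suc (length h) then Suc (Suc (length h)) else if k = Suc (Suc (length h)) then Suc (length h) else k))"
    unfolding word_nth[OF k] by (auto simp: f_gen)
  also have "\<dots> = (h @ [b, a, c] @ t) ! (if k = Suc (length h) then Suc (Suc (length h)) else if k = Suc (Suc (length h)) then Suc (length h) else k)"
    by (rule w) (use k n in auto)
  also have "\<dots> = (h @ [b, c, a] @ t) ! k" by (auto simp: nth_append nth_Cons split: nat.split)
  finally show "word (gen (Suc (Suc (length h))) * u) ! k = (h @ [b, c, a] @ t) ! k" .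
qed

lemma mv_follow:
  assumes u: "u \<in> WJ l n" "inc u" and w: "word u = h1 @ w @ t1" and m: "mv w w'" and b: "length h1 + length w \<le> l \<or> l \<le> length h1"
  shows "\<exists>u'. u' \<in> WJ l n \<and> inc u' \<and> word u' = h1 @ w' @ t1 \<and> LS n (Y u) (Y u')"
  using m
proof cases
  case (mv1 a b c h t)
  define i where "i = Suc (length h1 + length h)"
  have W: "word u = (h1 @ h) @ [b, a, c] @ (t @ t1)" using w mv1 by simp
  have n: "n = length h1 + length h + 3 + length t + length t1" using arg_cong[OF W, of length] by simp
  have fs: "f u i = b" "f u (Suc i) = a" "f u (Suc (Suc i)) = c"
    using word_nth[of "length h1 + length h" u] word_nth[of "Suc (length h1 + length h)" u] word_nth[of "Suc (Suc (length h1 + length h))" u]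
    unfolding W using n by (simp_all add: i_def nth_append)
  have "gen (Suc i) * u \<in> WJ l n \<and> inc (gen (Suc i) * u) \<and> LS n (Y u) (Y (gen (Suc i) * u))"
    by (rule LS_move[OF u]) (use fs mv1 n b in \<open>auto simp: i_def\<close>)
  moreover have "word (gen (Suc i) * u) = h1 @ w' @ t1" using word_gen[OF W] mv1 by (simp add: i_def)
  ultimately show ?thesis by blast
next
  case (mv2 a b c h t)
  define i where "i = Suc (length h1 + length h)"
  define u' where "u' = gen (Suc i) * u"
  have uS: "u \<in> Sy n" using u WJ_Sy by blast
  have W: "word u = (h1 @ h) @ [b, c, a] @ (t @ t1)" using w mv2 by simp
  have n: "n = length h1 + length h + 3 + length t + length t1" using arg_cong[OF W, of length] by simp
  have W': "word u' = (h1 @ h) @ [b, a, c] @ (t @ t1)" using word_gen[OF W] by (simp add: u'_def i_def)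
  have fs: "f u (Suc i) = c" "f u (Suc (Suc i)) = a"
    using word_nth[of "Suc (length h1 + length h)" u] word_nth[of "Suc (Suc (length h1 + length h))" u]
    unfolding W using n by (simp_all add: i_def nth_append)
  have fs': "f u' i = b" "f u' (Suc i) = a" "f u' (Suc (Suc i)) = c"
    using word_nth[of "length h1 + length h" u'] word_nth[of "Suc (length h1 + length h)" u'] word_nth[of "Suc (Suc (length h1 + length h))" u']
    unfolding W' using n by (simp_all add: i_def nth_append)
  have u'W: "u' \<in> WJ l n" unfolding u'_def using u n b mv2 by (intro WJ_times gen_WJ) (auto simp: i_def)
  have inc': "inc u'" unfolding u'_def by (rule gen_inc[OF uS u(2)]) (use fs mv2 n in \<open>auto simp: i_def\<close>)
  have "LS n (Y u') (Y (gen (Suc i) * u'))"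
    using LS_move[OF u'W inc', of i] fs' mv2 n b by (auto simp: i_def)
  then have "LS n (Y u) (Y u')" by (simp add: u'_def LS_sym)
  then show ?thesis using u'W inc' W' mv2 by auto
qed

lemma mvs_follow:
  assumes "mv\<^sup>*\<^sup>* w w'" and u: "u \<in> WJ l n" "inc u" and w: "word u = h1 @ w @ t1" and b: "length h1 + length w \<le> l \<or> l \<le> length h1"
  shows "\<exists>u'. u' \<in> WJ l n \<and> inc u' \<and> word u' = h1 @ w' @ t1 \<and> LS n (Y u) (Y u')"
  using assms(1)
proof (induction rule: rtranclp_induct)
  case base
  have "LS n (Y u) (Y u)" using Y_Wn[OF WJ_Sy[OF u(1)]] by (simp add: LS_def)
  then show ?case using u w by blast
next
  case (step v v')
  then obtain u' where u': "u' \<in> WJ l n" "inc u'" "word u' = h1 @ v @ t1" "LS n (Y u) (Y u')" by blast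
  have "length v = length w" using arg_cong[OF u'(3), of length] arg_cong[OF w, of length] unfolding length_append word_length by simp
  then have "length h1 + length v \<le> l \<or> l \<le> length h1" using b by simp
  from mv_follow[OF u'(1-3) step(2) this] show ?case using LS_trans[OF u'(4)] by blast
qed

lemma Sy_mono_one: assumes "d \<in> Sy n" "\<And>p q. 0 < p ==> p < q ==> q \<le> int n ==> d $ p < d $ q" shows "d = 1"
proof (rule ccontr)
  assume "d \<noteq> 1"
  then have "inverse d \<noteq> 1" using binv_right[of d] by (cases "inverse d = 1") simp_all
  moreover have "inverse d \<in> Wn n" using Sy_Wn[OF assms(1)] by simp
  ultimately obtain i where "i < n" "ell (inverse d) = Suc (ell (gen i * inverse d))" using ex_left_descent by blast
  then have i: "i < n" "ell (gen i * inverse d) < ell (inverse d)" by simp_all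
  have "0 < i" using Sy_descent[of "inverse d" n i] i(2) assms(1) by simp
  then show False using i(1) i(2)[unfolded ell_less_left] assms(2)[of "int i" "int i + 1"] by (auto simp: ra_def rb_def)
qed

text \<open>The word fixes the set of entries of each row, and \<open>inc\<close> their
  order.\<close>

lemma word_inj: assumes u: "u \<in> Sy n" "inc u" and u': "u' \<in> Sy n" "inc u'" and w: "word u = word u'" shows "u = u'"
proof -
  define d where "d = inverse u * u'"
  have ff: "\<rho> (inverse u $ v) = \<rho> (inverse u' $ v)" if "0 < v" "v \<le> int n" for v
  proof -
    have "nat v - 1 < n" "int (Suc (nat v - 1)) = v" using that by auto
    then show ?thesis using word_nth[of "nat v - 1" u] word_nth[of "nat v - 1" u'] w by (simp add: f_def)
  qed
  have dS: "d \<in> Sy n" unfolding d_def using u u' by auto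
  have dr: "\<rho> (d $ v) = \<rho> v" if "0 < v" "v \<le> int n" for v
    using ff[of "u' $ v"] Sy_range'[OF u'(1) that] by (simp add: d_def)
  have "d = 1"
  proof (rule Sy_mono_one[OF dS])
    fix p q assume pq: "0 < p" "p < q" "q \<le> int n"
    have r: "0 < d $ p" "d $ p \<le> int n" "0 < d $ q" "d $ q \<le> int n" using Sy_range'[OF dS, of p] Sy_range'[OF dS, of q] pq by auto
    show "d $ p < d $ q"
    proof (rule ccontr)
      assume "\<not> ?thesis"
      moreover have "d $ p \<noteq> d $ q" using pq by simp
      ultimately have lt: "d $ q < d $ p" by linarith
      then have "\<rho> q \<le> \<rho> p" using rho_mono[OF r(3) _ r(2)] dr[of p] dr[of q] pq by simp
      then have e: "\<rho> p = \<rho> q" using rho_mono[of p q] pq by simp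
      have "u $ (d $ q) < u $ (d $ p)" by (rule incD[OF u(2) r(3) lt r(2)]) (use e dr pq in simp)
      then have "u' $ q < u' $ p" by (simp add: d_def)
      then show False using incD[OF u'(2) pq e] by simp
    qed
  qed
  then have "u * d = u" by simp
  then show ?thesis by (simp add: d_def)
qed

end

lemma count_map_upt: "count (mset (map g [a..<b])) r = card {i \<in> {a..<b}. g i = r}"
proof -
  have "count (mset (map g xs)) r = length (filter (\<lambda>i. g i = r) xs)" for xs by (induction xs) auto
  moreover have "length (filter (\<lambda>i. g i = r) [a..<b]) = card (set (filter (\<lambda>i. g i = r) [a..<b]))" by (rule distinct_card[symmetric]) simp
  moreover have "set (filter (\<lambda>i. g i = r) [a..<b]) = {i \<in> {a..<b}. g i = r}" by auto
  ultimately show ?thesis by (simp only:)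
qed

context rows
begin

text \<open>The windows of the two components: entries 1, ..., l with letters from 0 on, and entries
  l + 1, ..., n with letters from m on.\<close>

definition block :: "nat => nat => nat => bool" where "block p q k \<longleftrightarrow> p = 0 \<and> q = l \<and> k = 0 \<or> p = l \<and> q = n \<and> k = m"

lemma block_WJ: assumes "block p q k" "u \<in> WJ l n" "int p < i" "i \<le> int q" shows "int p < u $ i" "u $ i \<le> int q"
proof -
  have "0 < u $ i \<and> u $ i \<le> int n" using assms l_n by (intro Sy_range'[OF WJ_Sy[OF assms(2)]]) (auto simp: block_def)
  moreover have "u $ i \<le> int l \<longleftrightarrow> i \<le> int l" using assms(2,3) by (auto simp: WJ_def)
  ultimately show "int p < u $ i" "u $ i \<le> int q" using assms(1,3,4) by (auto simp: block_def)
qed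

text \<open>Sending an entry to the one above it injects the entries of row r + 1 in a prefix of the
  segment into those of row r. For r + 1 = m there is no box above, but that letter does not occur
  in the first segment.\<close>

lemma lat_seg:
  assumes u: "u \<in> WJ l n" "std u" and pq: "block p q k"
  shows "lat k (map (f u) [Suc p..<Suc q])"
  unfolding lat_def
proof
  fix j
  have pq': "p \<le> q" "q \<le> n" using pq l_n by (auto simp: block_def)
  have ui: "inverse u \<in> WJ l n" by (rule WJ_inverse[OF u(1)])
  define q' where "q' = min (p + j) q"
  have tk: "take j (map (f u) [Suc p..<Suc q]) = map (f u) [Suc p..<Suc q']"
    using pq' by (cases "p + j \<le> q") (simp_all add: take_map q'_def min_def del: upt_Suc)
  have v: "int p < inverse u $ int i" "inverse u $ int i \<le> int q" "0 < inverse u $ int i" "inverse u $ int i \<le> int n"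
    if "i \<in> {Suc p..<Suc q'}" for i
  proof -
    have i: "int p < int i" "int i \<le> int q" using that by (auto simp: q'_def)
    show "int p < inverse u $ int i" "inverse u $ int i \<le> int q" "0 < inverse u $ int i" "inverse u $ int i \<le> int n"
      using block_WJ[OF pq ui i] pq' by linarith+
  qed
  have m: "k \<le> f u i" "k = 0 ==> p = 0 ==> q = l ==> f u i < m" if "i \<in> {Suc p..<Suc q'}" for i
    using rho_m[OF v(3,4)[OF that]] v(1,2)[OF that] pq by (auto simp: block_def f_def)
  show "parti k (mset (take j (map (f u) [Suc p..<Suc q])))"
    unfolding tk parti_def
  proof (intro conjI allI impI ballI)
    show "\<And>x. x \<in># mset (map (f u) [Suc p..<Suc q']) ==> k \<le> x" using m by auto
    fix r assume r: "k \<le> r"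
    let ?A = "{i \<in> {Suc p..<Suc q'}. f u i = Suc r}" and ?B = "{i \<in> {Suc p..<Suc q'}. f u i = r}"
    have "card ?A \<le> card ?B"
    proof (cases "Suc r = m")
      case True
      then have "p = 0 \<and> q = l \<and> k = 0" using r pq by (auto simp: block_def)
      then have "?A = {}" using m(2) True by fastforce
      then show ?thesis by (simp only: card.empty)
    next
      case False
      define g where "g i = nat (u $ (inverse u $ int i - sz r))" for i
      have g: "0 < u $ (inverse u $ int i - sz r)" "g i \<in> ?B" if "i \<in> ?A" for i
      proof -
        have i: "i \<in> {Suc p..<Suc q'}" and fi: "\<rho> (inverse u $ int i) = Suc r" using that by (auto simp: f_def)
        let ?v = "inverse u $ int i"
        note a = above[OF v(3,4)[OF i] fi False]
        have lt: "u $ (?v - sz r) < int i" using u(2) v(3,4)[OF i] fi False unfolding std_def by force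
        have "int p < ?v - sz r"
        proof (cases "p = 0")
          case True then show ?thesis using a by simp
        next
          case p: False
          then have "p = l" "k = m" using pq by (auto simp: block_def)
          then show ?thesis using rho_m[OF a(1,4)] a(3) r by simp
        qed
        then have b: "int p < u $ (?v - sz r)" "u $ (?v - sz r) \<le> int q"
          using block_WJ[OF pq u(1)] a(2) v(2)[OF i] by auto
        then have ig: "int (g i) = u $ (?v - sz r)" by (simp add: g_def)
        show "0 < u $ (?v - sz r)" using b by simp
        have "f u (g i) = r" unfolding f_def ig using a(3) by simp
        moreover have "g i \<in> {Suc p..<Suc q'}" using b lt i ig by auto
        ultimately show "g i \<in> ?B" by simp
      qed
      have "inj_on g ?A"
      proof (rule inj_onI)
        fix i j assume ij: "i \<in> ?A" "j \<in> ?A" "g i = g j"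
        then have "u $ (inverse u $ int i - sz r) = u $ (inverse u $ int j - sz r)" using g(1)[OF ij(1)] g(1)[OF ij(2)] unfolding g_def by linarith
        then show "i = j" by simp
      qed
      moreover have "g ` ?A \<subseteq> ?B" using g(2) by blast
      ultimately show ?thesis by (rule card_inj_on_le) simp
    qed
    then show "count (mset (map (f u) [Suc p..<Suc q'])) (Suc r) \<le> count (mset (map (f u) [Suc p..<Suc q'])) r"
      unfolding count_map_upt .
  qed
qed

lemma mset_seg:
  assumes u: "u \<in> WJ l n" and pq: "block p q k"
  shows "mset (map (f u) [Suc p..<Suc q]) = mset (map (f 1) [Suc p..<Suc q])"
proof (rule multiset_eqI)
  fix r
  let ?A = "{i \<in> {Suc p..<Suc q}. f 1 i = r}" and ?B = "{i \<in> {Suc p..<Suc q}. f u i = r}"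
  define g where "g i = nat (u $ int i)" for i
  have g: "int (g i) = u $ int i" "int p < u $ int i" "u $ int i \<le> int q" if "i \<in> {Suc p..<Suc q}" for i
    using block_WJ[OF pq u, of "int i"] that by (auto simp: g_def)
  have "bij_betw g ?A ?B"
  proof (rule bij_betwI')
    show "g x = g y \<longleftrightarrow> x = y" if "x \<in> ?A" "y \<in> ?A" for x y using g(1)[of x] g(1)[of y] that by (metis (no_types, lifting) bap_eq mem_Collect_eq of_nat_eq_iff)
    show "g x \<in> ?B" if "x \<in> ?A" for x
    proof -
      have x: "x \<in> {Suc p..<Suc q}" "\<rho> (int x) = r" using that by (auto simp: f_def)
      have "f u (g x) = r" unfolding f_def g(1)[OF x(1)] using x by simp
      moreover have "g x \<in> {Suc p..<Suc q}" using g[OF x(1)] by auto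
      ultimately show ?thesis by simp
    qed
    show "\<exists>x\<in>?A. y = g x" if "y \<in> ?B" for y
    proof -
      have y: "y \<in> {Suc p..<Suc q}" "\<rho> (inverse u $ int y) = r" using that by (auto simp: f_def)
      have b: "int p < inverse u $ int y" "inverse u $ int y \<le> int q" using block_WJ[OF pq WJ_inverse[OF u], of "int y"] y by auto
      define x where "x = nat (inverse u $ int y)"
      have x: "int x = inverse u $ int y" using b by (simp add: x_def)
      have "f 1 x = r" unfolding f_def x using y by simp
      moreover have "x \<in> {Suc p..<Suc q}" using b x by auto
      moreover have "y = g x" by (simp add: g_def x)
      ultimately show ?thesis by blast
    qed
  qed
  then have "card ?A = card ?B" by (rule bij_betw_same_card)
  then show "count (mset (map (f u) [Suc p..<Suc q])) r = count (mset (map (f 1) [Suc p..<Suc q])) r"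
    unfolding count_map_upt by simp
qed

lemma std_one: "std 1"
  using above by (auto simp: std_def inc_def)

text \<open>The word of u is changed into that of 1 one component at a time; since words determine
  increasing elements, the end point is 1.\<close>

lemma std_WJ_LS: assumes u: "u \<in> WJ l n" "std u" shows "LS n (Y u) (Y 1)"
proof -
  let ?w1 = "\<lambda>u. map (f u) [Suc 0..<Suc l]" and ?w2 = "\<lambda>u. map (f u) [Suc l..<Suc n]"
  have W: "word v = ?w1 v @ ?w2 v" for v
  proof -
    have "[1..<Suc n] = [1..<Suc l] @ [Suc l..<Suc n]" using upt_add_eq_append[of 1 "Suc l" "n - l"] l_n by simp
    then show ?thesis unfolding word_def map_append[symmetric] by simp
  qed
  have b: "block 0 l 0" "block l n m" by (auto simp: block_def)
  have p: "mv\<^sup>*\<^sup>* (map (f u) [Suc p..<Suc q]) (map (f 1) [Suc p..<Suc q])" if "block p q k" for p q k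
    by (rule lat_connected[OF lat_seg[OF u that] lat_seg[OF WJ_one std_one that] mset_seg[OF u(1) that]])
  have "inc u" using u by (simp add: std_def)
  from mvs_follow[OF p[OF b(1)] u(1) this, of "[]" "?w2 u"] W[of u]
  obtain u' where u': "u' \<in> WJ l n" "inc u'" "word u' = ?w1 1 @ ?w2 u" "LS n (Y u) (Y u')" by (auto simp del: upt_Suc)
  from mvs_follow[OF p[OF b(2)] u'(1,2), of "?w1 1" "[]"] u'(3)
  obtain u'' where u'': "u'' \<in> WJ l n" "inc u''" "word u'' = ?w1 1 @ ?w2 1" "LS n (Y u') (Y u'')" by (auto simp del: upt_Suc)
  have "inc 1" by (simp add: inc_def)
  then have "u'' = 1" using word_inj[OF WJ_Sy[OF u''(1)] u''(2) Sy_one] u''(3) W[of 1] by simp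
  then show ?thesis using LS_trans[OF u'(4) u''(4)] by simp
qed

lemma LE_add: "d \<in> Sy n ==> z \<in> Wn n ==> ell (d * z) = ell d + ell z ==> (d * z, z) \<in> (LE n)\<^sup>*"
  unfolding Sy_WJ
proof (induction d rule: WJ_induct)
  case (step i w)
  have S: "w \<in> Sy n" using step(4) by (simp add: Sy_WJ)
  have "ell (gen i * (w * z)) = Suc (ell w) + ell z" using step by (simp add: mult.assoc)
  moreover have "ell (w * z) \<le> ell w + ell z" by (rule ell_times_le)
  moreover have "ell (gen i * (w * z)) \<le> Suc (ell (w * z))" using ell_left_cases[of i "w * z"] by auto
  ultimately have e: "ell (w * z) = ell w + ell z" "ell (w * z) < ell (gen i * (w * z))" by simp_all
  have "w * z \<in> Wn n" using Sy_Wn[OF S] step by blast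
  then have "(gen i * (w * z), w * z) \<in> LE n" by (rule LE_up[OF step(1,2) _ e(2)])
  then show ?case using step.IH[OF step.prems(1) e(1)] by (simp add: mult.assoc)
qed simp

text \<open>u inherits standardness from d: row and column conditions compare only entries of the
  same component, which u keeps on the same side of l, and a preserves order on each side.\<close>

theorem std_LS: assumes d: "std d" shows "LS n (Y 1) (Y d)"
proof -
  have dS: "d \<in> Sy n" "inc d" using d by (auto simp: std_def)
  obtain a u where au: "a \<in> Ym l n" "u \<in> WJ l n" "d = a * u" using coset_decomp[OF dS(1)] by blast
  have uS: "u \<in> Sy n" by (rule WJ_Sy[OF au(2)])
  have side: "u $ p \<le> int l \<longleftrightarrow> p \<le> int l" if "0 < p" for p using au(2) that by (auto simp: WJ_def)
  have less: "u $ p < u $ q" if pq: "0 < p" "0 < q" "d $ p < d $ q" "p \<le> int l \<longleftrightarrow> q \<le> int l" for p q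
  proof (rule ccontr)
    assume "\<not> ?thesis"
    moreover have "u $ p \<noteq> u $ q" using pq(3) by auto
    ultimately have "u $ q < u $ p" by linarith
    moreover have "0 < u $ q" using Sy_pos[OF uS pq(2)] .
    moreover have "u $ p \<le> int l \<or> int l < u $ q" using side[OF pq(1)] side[OF pq(2)] pq(4) by linarith
    ultimately have "a $ (u $ q) < a $ (u $ p)" by (intro Ym_mono[OF au(1)])
    then show False using pq(3) au(3) by simp
  qed
  have "std u" unfolding std_def
  proof (intro conjI allI impI)
    show "u \<in> Sy n" by (rule uS)
    show "inc u" unfolding inc_def
    proof (intro allI impI)
      fix p q assume pq: "0 < p \<and> p < q \<and> q \<le> int n \<and> \<rho> p = \<rho> q"
      then have "p \<le> int l \<longleftrightarrow> q \<le> int l" using rho_m[of p] rho_m[of q] by auto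
      then show "u $ p < u $ q" using less[of p q] incD[OF dS(2), of p q] pq by auto
    qed
    fix v r assume v: "0 < v \<and> v \<le> int n \<and> \<rho> v = Suc r \<and> Suc r \<noteq> m"
    then have a: "0 < v - sz r" "v - sz r < v" "\<rho> (v - sz r) = r" "v - sz r \<le> int n" using above by blast+
    have "v - sz r \<le> int l \<longleftrightarrow> v \<le> int l" using rho_m[OF a(1,4)] rho_m[of v] v a(3) by auto
    moreover have "d $ (v - sz r) < d $ v" using d v unfolding std_def by blast
    ultimately show "u $ (v - sz r) < u $ v" using less a v by blast
  qed
  then have L: "LS n (Y u) (Y 1)" by (rule std_WJ_LS[OF au(2)])
  have us: "u * \<sigma> \<in> WJ l n" using au(2) sig_WJ by (rule WJ_times)
  have Yd: "Y d = a * (u * \<sigma>) * aw l" "Y d = a * Y u" using au by (simp_all add: mult.assoc)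
  have 1: "(Y u, Y d) \<in> (LE n)\<^sup>*" unfolding Yd(1) by (rule coset_LE[OF n0 l_n au(1) us])
  have "ell (Y d) = ell a + ell (Y u)"
    unfolding Yd(1) using ell_aw[of "a * (u * \<sigma>)" n l] ell_aw[of "u * \<sigma>" n l] ell_Ym_WJ[OF au(1) us] WJ_Sy[OF us] Sy_times[OF Ym_Sy[OF au(1)] WJ_Sy[OF us]] by (simp only: add.assoc)
  then have 2: "(Y d, Y u) \<in> (LE n)\<^sup>*" unfolding Yd(2) by (intro LE_add Ym_Sy[OF au(1)] Y_Wn uS)
  have "LS n (Y u) (Y d)" unfolding LS_def using 1 2 Y_Wn[OF uS] Y_Wn[OF dS(1)] by blast
  then show ?thesis by (rule LS_trans[OF LS_sym[OF L]])
qed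

lemma aw_low: "0 < p ==> p \<le> int l ==> (\<tau> * aw l) $ (int l + 1 - p) = - (\<tau> $ p)"
  by (simp add: aw_apply flip: bap_minus)
lemma aw_high: "int l < p ==> (\<tau> * aw l) $ p = \<tau> $ p"
  by (simp add: aw_apply)

theorem LS_std: assumes L: "LS n (Y 1) y" shows "\<exists>d. std d \<and> y = Y d"
proof -
  have x: "Y 1 = \<sigma> * aw l" by simp
  obtain \<tau> where \<tau>: "\<tau> \<in> Sy n" "y = \<tau> * aw l" using LS_aw[OF L[unfolded x] sig l_n n0] by blast
  define d where "d = \<tau> * inverse \<sigma>"
  have yd: "y = Y d" by (simp add: d_def \<tau> mult.assoc)
  have dS: "d \<in> Sy n" unfolding d_def using \<tau>(1) sigi by (rule Sy_times)
  have d\<tau>: "d $ v = \<tau> $ (inverse \<sigma> $ v)" for v by (simp add: d_def)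
  \<comment> \<open>Adjacent positions in a row yield right descents of \<sigma> a_l. Positions p
    \<le> l are found at l + 1 - p with negated values, and the two reversals again give a
    descent.\<close>
  have desc: "\<tau> $ (p + 1) < \<tau> $ p" if p: "0 < p" "p < int n" "\<rho> p = \<rho> (p + 1)" for p
  proof -
    have s: "\<sigma> $ (p + 1) < \<sigma> $ p" using sig_rev[of p "p + 1"] p by simp
    show ?thesis
    proof (cases "int l < p")
      case True
      have i: "0 < nat p" "ra (nat p) = p" "rb (nat p) = p + 1" using p by (simp_all add: ra_def rb_def)
      have "ell (\<sigma> * aw l * gen (nat p)) < ell (\<sigma> * aw l)" unfolding ell_less_right i using aw_high[of p \<sigma>] aw_high[of "p + 1" \<sigma>] s True by simp
      then have "ell (y * gen (nat p)) < ell y" using LS_descent[OF L i(1)] x by simp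
      then show ?thesis unfolding ell_less_right i \<tau>(2) using aw_high[of p \<tau>] aw_high[of "p + 1" \<tau>] True by simp
    next
      case False
      then have pl: "p + 1 \<le> int l" using rho_m[of p] rho_m[of "p + 1"] p by auto
      have i: "0 < nat (int l - p)" "ra (nat (int l - p)) = int l + 1 - (p + 1)" "rb (nat (int l - p)) = int l + 1 - p" using pl p by (simp_all add: ra_def rb_def)
      have "ell (\<sigma> * aw l * gen (nat (int l - p))) < ell (\<sigma> * aw l)"
        unfolding ell_less_right i using aw_low[of p \<sigma>] aw_low[of "p + 1" \<sigma>] s pl p by simp
      then have "ell (y * gen (nat (int l - p))) < ell y" using LS_descent[OF L i(1)] x by simp
      then show ?thesis unfolding ell_less_right i \<tau>(2) using aw_low[of p \<tau>] aw_low[of "p + 1" \<tau>] pl p by simp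
    qed
  qed
  have dec: "\<tau> $ q < \<tau> $ p" if pq: "0 < p" "p < q" "q \<le> int n" "\<rho> p = \<rho> q" for p q
  proof -
    have "- (\<tau> $ p) < - (\<tau> $ q)"
    proof (rule int_chain_less[OF pq(2), of "\<lambda>i. - (\<tau> $ i)"])
      fix i assume i: "p \<le> i" "i < q"
      then have "\<rho> i = \<rho> (i + 1)" using rho_mono[of p i] rho_mono[of i "i + 1"] rho_mono[of "i + 1" q] pq by auto
      then show "- (\<tau> $ i) < - (\<tau> $ (i + 1))" using desc[of i] i pq by auto
    qed
    then show ?thesis by simp
  qed
  have inc: "inc d" unfolding inc_def
  proof (intro allI impI)
    fix p q assume pq: "0 < p \<and> p < q \<and> q \<le> int n \<and> \<rho> p = \<rho> q"
    then have "inverse \<sigma> $ q < inverse \<sigma> $ p" using sigi_rev by blast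
    moreover have "0 < inverse \<sigma> $ q" "inverse \<sigma> $ p \<le> int n" using Sy_range'[OF sigi, of p] Sy_range'[OF sigi, of q] pq by auto
    ultimately show "d $ p < d $ q" unfolding d\<tau> using sigi_row[of p] sigi_row[of q] pq by (intro dec) auto
  qed
  have col: "d $ (v - sz r) < d $ v" if v: "0 < v" "v \<le> int n" "\<rho> v = Suc r" "Suc r \<noteq> m" for v r
  proof (rule ccontr)
    assume nl: "\<not> ?thesis"
    note a = above[OF v]
    have "d $ (v - sz r) \<noteq> d $ v" using a(2) by simp
    then have gt: "d $ v < d $ (v - sz r)" using nl by linarith
    \<comment> \<open>The initial entries from the box above v up to v form the end of row r and the
      beginning of row r + 1, one more than the length of row r. Taken back by \<sigma>, they are
      positions along which \<tau> decreases.\<close>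
    define P where "P = (\<lambda>g. inverse \<sigma> $ g) ` {v - sz r..v}"
    have cP: "card P = Suc (nat (sz r))" unfolding P_def by (subst card_image) (use a in \<open>auto simp: inj_on_def\<close>)
    have row: "\<rho> g = r \<or> \<rho> g = Suc r" if "g \<in> {v - sz r..v}" for g
      using that rho_mono[OF a(1), of g] rho_mono[of g v] a v by (auto simp: le_Suc_eq)
    have rng: "0 < g" "g \<le> int n" if "g \<in> {v - sz r..v}" for g using that a v by auto
    have PP: "0 < p" "p \<le> int n" "\<rho> p = r \<or> \<rho> p = Suc r" if "p \<in> P" for p
    proof -
      obtain g where g: "g \<in> {v - sz r..v}" "p = inverse \<sigma> $ g" using \<open>p \<in> P\<close> by (auto simp: P_def)
      show "0 < p" "p \<le> int n" "\<rho> p = r \<or> \<rho> p = Suc r"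
        using g row[OF g(1)] Sy_range'[OF sigi rng[OF g(1)]] sigi_row[OF rng[OF g(1)]] by simp_all
    qed
    have dP: "decr \<tau> P" unfolding decr_def
    proof (intro ballI impI)
      fix p q assume pq: "p \<in> P" "q \<in> P" "p < q"
      show "\<tau> $ q < \<tau> $ p"
      proof (cases "\<rho> p = \<rho> q")
        case True then show ?thesis using dec[of p q] PP[OF pq(1)] PP[OF pq(2)] pq(3) by auto
      next
        case False
        have "\<rho> p \<le> \<rho> q" using rho_mono[of p q] PP[OF pq(1)] PP[OF pq(2)] pq(3) by auto
        then have r: "\<rho> p = r" "\<rho> q = Suc r" using False PP(3)[OF pq(1)] PP(3)[OF pq(2)] by auto
        obtain g h where gh: "g \<in> {v - sz r..v}" "h \<in> {v - sz r..v}" "p = inverse \<sigma> $ g" "q = inverse \<sigma> $ h" using pq by (auto simp: P_def)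
        then have rg: "\<rho> g = r" "\<rho> h = Suc r" using sigi_row[of g] sigi_row[of h] rng[of g] rng[of h] r by simp_all
        have "d $ (v - sz r) \<le> d $ g" using incD[OF inc a(1), of g] gh rng[of g] a(3) rg by (cases "g = v - sz r") auto
        moreover have "d $ h \<le> d $ v" using incD[OF inc, of h v] gh rng[of h] v rg by (cases "h = v") auto
        ultimately show ?thesis using gt gh d\<tau> by simp
      qed
    qed
    have oS: "off r \<le> off (Suc r)" "off (Suc r) \<le> off (Suc (Suc r))" "off (Suc (Suc r)) \<le> n" by (rule off_Suc off_n)+
    define A B where "A = off (Suc r) - off r" and "B = off (Suc (Suc r)) - off (Suc r)"
    have BA: "B \<le> A" "int A = sz r" "off r + (A + B) = off (Suc (Suc r))" "off r + A = off (Suc r)"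
      using shape[OF v(4)] oS by (simp_all add: A_def B_def sz_def)
    have offP: "int (off r) < p \<and> p \<le> int (off (Suc (Suc r)))" if "p \<in> P" for p
      using rho1[OF PP(1,2)[OF that]] PP(3)[OF that] oS by auto
    show False
    proof (cases "m \<le> r")
      case True
      then have lr: "l \<le> off r" using off_mono offl by blast
      \<comment> \<open>a_l does not touch positions beyond l, so the window shows \<sigma>: each
        row decreasing, and all values of the second row larger than those of the first.\<close>
      have pt: "pat (off r) (replicate A False @ replicate B True) (Y 1)"
        unfolding pat_def
      proof (intro allI impI)
        fix i j assume ij: "i < j" "j < length (replicate A False @ replicate B True)"
        let ?i = "int (off r) + 1 + int i" and ?j = "int (off r) + 1 + int j"
        have j: "j < A + B" using ij(2) by simp
        have ro: "\<rho> (int (off r) + 1 + int k) = (if k < A then r else Suc r)" if "k < A + B" for k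
          by (cases "k < A") (use that BA in \<open>auto intro!: rho2\<close>)
        have "Y 1 $ ?i < Y 1 $ ?j \<longleftrightarrow> \<sigma> $ ?i < \<sigma> $ ?j" using aw_high[of ?i \<sigma>] aw_high[of ?j \<sigma>] lr by simp
        also have "\<dots> \<longleftrightarrow> \<rho> ?i \<noteq> \<rho> ?j" by (rule sig_less) (use ij j BA oS in auto)
        also have "\<dots> \<longleftrightarrow> \<not> (replicate A False @ replicate B True) ! i \<and> (replicate A False @ replicate B True) ! j"
          using ij(1) j by (simp add: ro nth_append)
        finally show "(Y 1 $ ?i < Y 1 $ ?j) = (\<not> (replicate A False @ replicate B True) ! i \<and> (replicate A False @ replicate B True) ! j)" .
      qed
      have "decr y P" using dP offP lr unfolding decr_def \<tau>(2) by (metis aw_high less_le_trans not_le of_nat_le_iff order.strict_trans1)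
      moreover have "P \<subseteq> {int (off r) + 1..int (off r + (A + B))}"
      proof
        fix x assume "x \<in> P"
        then show "x \<in> {int (off r) + 1..int (off r + (A + B))}" unfolding BA(3) using offP[of x] by auto
      qed
      ultimately have "card P \<le> max A B" using window_bound[OF L pt _ ] BA oS by simp
      then show False using cP BA by simp
    next
      case False
      then have rl: "off (Suc (Suc r)) \<le> l" using off_mono[of "Suc (Suc r)" m] offl v(4) by simp
      \<comment> \<open>In the first component a_l reverses positions and negates values. The window
        therefore begins at \<open>l + 1 - off (Suc (Suc r))\<close> and shows row r + 1 before row
        r.\<close>
      define s where "s = l - off (Suc (Suc r))"
      have s: "int s = int l - int (off (Suc (Suc r)))" "s + (B + A) \<le> n" using rl BA l_n by (simp_all add: s_def)
      have pt: "pat s (replicate B False @ replicate A True) (Y 1)"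
        unfolding pat_def
      proof (intro allI impI)
        fix i j assume ij: "i < j" "j < length (replicate B False @ replicate A True)"
        have j: "j < B + A" using ij(2) by simp
        define p where "p k = int (off (Suc (Suc r))) - int k" for k
        have pk: "int s + 1 + int k = int l + 1 - p k" for k using s by (simp add: p_def)
        have pr: "0 < p k" "p k \<le> int l" "p k \<le> int n" if "k < B + A" for k using that BA rl l_n by (auto simp: p_def)
        have ro: "\<rho> (p k) = (if k < B then Suc r else r)" if "k < B + A" for k
          by (cases "k < B") (use that BA in \<open>auto intro!: rho2 simp: p_def\<close>)
        have "Y 1 $ (int s + 1 + int i) < Y 1 $ (int s + 1 + int j) \<longleftrightarrow> \<sigma> $ p j < \<sigma> $ p i"
          using aw_low[of "p i" \<sigma>] aw_low[of "p j" \<sigma>] pr[of i] pr[of j] ij j unfolding pk by simp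
        also have "\<dots> \<longleftrightarrow> \<rho> (p j) \<noteq> \<rho> (p i)" by (rule sig_less) (use ij j pr in \<open>auto simp: p_def\<close>)
        also have "\<dots> \<longleftrightarrow> \<not> (replicate B False @ replicate A True) ! i \<and> (replicate B False @ replicate A True) ! j"
          using ij(1) j by (simp add: ro nth_append)
        finally show "(Y 1 $ (int s + 1 + int i) < Y 1 $ (int s + 1 + int j)) = (\<not> (replicate B False @ replicate A True) ! i \<and> (replicate B False @ replicate A True) ! j)" .
      qed
      define P' where "P' = (\<lambda>p. int l + 1 - p) ` P"
      have cP': "card P' = card P" unfolding P'_def by (rule card_image) (auto simp: inj_on_def)
      have "decr y P'" unfolding decr_def P'_def
      proof clarify
        fix p q assume pq: "p \<in> P" "q \<in> P" "int l + 1 - p < int l + 1 - q"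
        have "\<tau> $ p < \<tau> $ q" using decrD[OF dP pq(2,1)] pq(3) by simp
        then show "y $ (int l + 1 - q) < y $ (int l + 1 - p)"
          unfolding \<tau>(2) using aw_low[of p \<tau>] aw_low[of q \<tau>] PP[OF pq(1)] PP[OF pq(2)] offP[OF pq(1)] offP[OF pq(2)] rl by simp
      qed
      moreover have "P' \<subseteq> {int s + 1..int (s + (B + A))}"
      proof
        fix x assume "x \<in> P'"
        then obtain p where "p \<in> P" "x = int l + 1 - p" by (auto simp: P'_def)
        then show "x \<in> {int s + 1..int (s + (B + A))}" using offP[of p] BA s by auto
      qed
      ultimately have "card P' \<le> max B A" using window_bound[OF L pt s(2)] by simp
      then show False using cP cP' BA by simp
    qed
  qed
  have "std d" unfolding std_def using dS inc col by blast
  then show ?thesis using yd by blast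
qed

end

section \<open>Transfer to the function-based definitions\<close>

section \<open>Comparison with the given definitions\<close>

lemma bap_mult: "bap (x * y) = bap x \<circ> bap y" by transfer simp
lemma bap_one': "bap 1 = id" by transfer simp
lemma bap_inv: "bap (inverse x) = inv (bap x)" by transfer simp
lemma bap_gen: "bap (gen i) = gen_fun i" by (simp add: gen.rep_eq)
lemma bap_inj [simp]: "bap x = bap y \<longleftrightarrow> x = y" by (simp add: bap_inject)

lemma Abs_bap [simp]: "Abs_bperm (bap w) = w" by (rule type_definition.Rep_inverse[OF type_definition_bperm])

lemma W_eq: "W n = bap ` Wn n" by (rule bap_image_Wn[symmetric])
lemma bap_W [simp]: "bap w \<in> W n \<longleftrightarrow> w \<in> Wn n" unfolding W_eq by auto

lemma gens_eq: assumes "0 < n" shows "gens n = (\<lambda>i. bap (gen i)) ` {..<n}"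
proof -
  have "{..<n} = insert 0 {1..<n}" using assms by auto
  moreover have "(\<lambda>i. bap (gen i)) ` {1..<n} = gen_s ` {1..<n}" by (rule image_cong) (auto simp only: bap_gen gen_fun_def atLeastLessThan_iff split: if_splits)
  moreover have "bap (gen 0) = gen_t" by (simp add: bap_gen gen_fun_def)
  ultimately show ?thesis by (simp only: gens_def image_insert)
qed

lemma word_prod_wprod: "word_prod (map (\<lambda>i. bap (gen i)) is) = bap (wprod is)"
  by (induction "is") (simp_all add: word_prod_def bap_one' bap_mult)

lemma len_ell: assumes "0 < n" "w \<in> Wn n" shows "len n (bap w) = ell w"
  unfolding len_def
proof (rule Least_equality)
  obtain js where js: "set js \<subseteq> {..<n}" "length js = ell w" "wprod js = w" using wprod_ex[OF assms(2)] by blast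
  show "\<exists>ss. set ss \<subseteq> gens n \<and> length ss = ell w \<and> word_prod ss = bap w"
    using js by (intro exI[of _ "map (\<lambda>i. bap (gen i)) js"]) (auto simp: gens_eq[OF assms(1)] word_prod_wprod)
next
  fix k assume "\<exists>ss. set ss \<subseteq> gens n \<and> length ss = k \<and> word_prod ss = bap w"
  then obtain ss where ss: "set ss \<subseteq> (\<lambda>i. bap (gen i)) ` {..<n}" "length ss = k" "word_prod ss = bap w" unfolding gens_eq[OF assms(1)] by blast
  from ss(1) have "ss \<in> lists ((\<lambda>i. bap (gen i)) ` {..<n})" by (auto simp: lists_eq_set)
  then have "\<exists>js. ss = map (\<lambda>i. bap (gen i)) js" by (auto simp: lists_image)
  then obtain js where "ss = map (\<lambda>i. bap (gen i)) js" by blast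
  then have "wprod js = w" "length js = k" using ss by (auto simp: word_prod_wprod)
  then show "ell w \<le> k" using ell_wprod[of js] by simp
qed

lemma reflections_eq: assumes "0 < n" shows "reflections n = bap ` brefl n"
proof (intro set_eqI iffI)
  fix z assume "z \<in> reflections n"
  then obtain g s where gs: "z = g \<circ> s \<circ> inv g" "g \<in> bap ` Wn n" "s \<in> (\<lambda>i. bap (gen i)) ` {..<n}"
    unfolding reflections_def gens_eq[OF assms] W_eq by (elim CollectE exE conjE) (rule that)
  from gs(2,3) obtain x i where "g = bap x" "x \<in> Wn n" "s = bap (gen i)" "i < n" by auto
  with gs(1) have "z = bap x \<circ> bap (gen i) \<circ> inv (bap x)" "x \<in> Wn n" "i < n" by simp_all
  then have "z = bap (x * gen i * inverse x)" "x * gen i * inverse x \<in> brefl n" by (auto simp: bap_mult bap_inv brefl_def)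
  then show "z \<in> bap ` brefl n" by blast
next
  fix z assume "z \<in> bap ` brefl n"
  then obtain x i where "z = bap (x * gen i * inverse x)" "x \<in> Wn n" "i < n" by (auto simp: brefl_def)
  then show "z \<in> reflections n" unfolding reflections_def gens_eq[OF assms] bap_mult bap_inv
    by (intro CollectI exI[of _ "bap x"] exI[of _ "bap (gen i)"] conjI imageI) simp_all
qed

text \<open>Paths of R stay in \<open>W n\<close>, hence in the range of \<open>bap\<close>, and can
  be lifted step by step.\<close>

lemma trancl_bap:
  assumes R: "\<And>x y. (bap x, bap y) \<in> R \<longleftrightarrow> (x, y) \<in> S" and W: "\<And>f g. (f, g) \<in> R ==> f \<in> W n"
  shows "(bap x, bap y) \<in> R\<^sup>+ \<longleftrightarrow> (x, y) \<in> S\<^sup>+"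
proof
  assume "(x, y) \<in> S\<^sup>+"
  then show "(bap x, bap y) \<in> R\<^sup>+"
  proof (induction rule: trancl_induct)
    case (base y) then show ?case using R by (intro r_into_trancl) simp
  next
    case (step y z) then show ?case using R by (intro trancl_into_trancl[OF step.IH]) simp
  qed
next
  assume "(bap x, bap y) \<in> R\<^sup>+"
  then have "\<forall>z. bap y = bap z --> (x, z) \<in> S\<^sup>+"
  proof (induction rule: trancl_induct)
    case (base f) then show ?case using R by auto
  next
    case (step f h)
    obtain u where "f = bap u" using W[OF step(2)] unfolding W_eq by blast
    then show ?case using step R by (metis trancl.trancl_into_trancl)
  qed
  then show "(x, y) \<in> S\<^sup>+" by simp
qed

lemma bruhat_eq: assumes "0 < n" shows "(bap x, bap y) \<in> bruhat_less n \<longleftrightarrow> (x, y) \<in> (brel n)\<^sup>+"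
    "(f, g) \<in> bruhat_less n ==> f \<in> W n \<and> g \<in> W n"
proof -
  define R where "R = {(x, y). x \<in> W n \<and> y \<in> W n \<and> len n x < len n y \<and> (\<exists>r \<in> reflections n. y = r \<circ> x)}"
  have B: "bruhat_less n = R\<^sup>+" by (simp add: bruhat_less_def R_def)
  have RW: "f \<in> W n \<and> g \<in> W n" if "(f, g) \<in> R" for f g using that by (auto simp: R_def)
  have R: "(bap x, bap y) \<in> R \<longleftrightarrow> (x, y) \<in> brel n" for x y
  proof -
    have "(\<exists>r\<in>reflections n. bap y = r \<circ> bap x) \<longleftrightarrow> (\<exists>r\<in>brefl n. y = r * x)"
      unfolding reflections_eq[OF assms] bex_simps bap_mult[symmetric] bap_inj ..
    then show ?thesis using len_ell[OF assms, of x] len_ell[OF assms, of y] by (auto simp only: R_def brel_def mem_Collect_eq prod.case bap_W)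
  qed
  show "f \<in> W n \<and> g \<in> W n" if "(f, g) \<in> bruhat_less n"
    using that unfolding B by (induction rule: trancl_induct) (use RW in blast)+
  show "(bap x, bap y) \<in> bruhat_less n \<longleftrightarrow> (x, y) \<in> (brel n)\<^sup>+"
    unfolding B by (rule trancl_bap) (use R RW in blast)+
qed

text \<open>\<open>emb\<close> reads only coefficients on \<open>W n\<close>. On \<open>H n\<close>
  it is a bijection onto the span of the \<open>Tb w\<close> with w in \<open>Wn n\<close>, and
  \<open>unemb\<close> is its inverse, extended by 0.\<close>

definition emb :: "nat => hecke => hk" where "emb n h = (\<Sum>w\<in>Wn n. sc (h (bap w)) (Tb w))"
definition unemb :: "nat => hk => hecke" where "unemb n k = (\<lambda>x. if x \<in> W n then cf k (Abs_bperm x) else 0)"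
abbreviation SP :: "nat => hk set" where "SP n \<equiv> spT (Wn n)"

lemma cf_emb: "cf (emb n h) w = (if w \<in> Wn n then h (bap w) else 0)"
proof -
  have "(\<Sum>x\<in>Wn n. h (bap x) * (if w = x then 1 else 0)) = (\<Sum>x\<in>Wn n. if w = x then h (bap w) else 0)"
    by (rule sum.cong) auto
  then show ?thesis by (simp add: emb_def cf_Tb finite_Wn)
qed

lemma emb_SP: "emb n h \<in> SP n" by (auto simp: span_Tb cf_emb)
lemma unemb_H: "unemb n k \<in> H n" by (simp add: unemb_def H_def)
lemma unemb_bap: "unemb n k (bap w) = (if w \<in> Wn n then cf k w else 0)" by (simp add: unemb_def)
lemma emb_unemb: "k \<in> SP n ==> emb n (unemb n k) = k"
  by (rule hk_eqI) (auto simp: span_Tb cf_emb unemb_bap)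
lemma H_eqI: assumes "h \<in> H n" "k \<in> H n" "emb n h = emb n k" shows "h = k"
proof
  fix x
  show "h x = k x"
  proof (cases "x \<in> W n")
    case True
    then obtain w where w: "w \<in> Wn n" "x = bap w" unfolding W_eq by blast
    then show ?thesis using cf_emb[of n h w] cf_emb[of n k w] assms(3) by simp
  qed (use assms in \<open>auto simp: H_def\<close>)
qed

lemma emb_add: "emb n (hadd h k) = emb n h + emb n k"
  by (rule hk_eqI) (simp add: cf_emb hadd_def)
lemma emb_sc: "emb n (hscale c h) = sc c (emb n h)"
  by (rule hk_eqI) (simp add: cf_emb hscale_def)
lemma emb_T: "w \<in> Wn n ==> emb n (T (bap w)) = Tb w"
  by (rule hk_eqI) (auto simp: cf_emb T_def cf_Tb)
lemma emb_T1: "emb n (T id) = 1" using emb_T[of 1 n] by (simp add: bap_one')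
lemma H_add: "h \<in> H n ==> k \<in> H n ==> hadd h k \<in> H n" by (auto simp: H_def hadd_def)
lemma H_sc: "h \<in> H n ==> hscale c h \<in> H n" by (auto simp: H_def hscale_def)
lemma H_T: "w \<in> Wn n ==> T (bap w) \<in> H n" by (auto simp: H_def T_def)
lemma H_T1: "T id \<in> H n" using H_T[of 1 n] by (simp add: bap_one')

lemma SP_mult: assumes "h \<in> SP n" "k \<in> SP n" shows "h * k \<in> SP n"
proof -
  have "Tb w * k \<in> SP n" if "w \<in> Wn n" for w
    using that
  proof (induction rule: ell_Wn_induct)
    case (step i w)
    have "Tb (gen i * w) = tt i * Tb w" using step by (simp add: tt_Tb)
    then show ?case using hkn_tt[OF step(1,4)] by (simp add: mult.assoc)
  qed (use assms in simp)
  then show ?thesis by (intro span_mult_right[OF _ assms(1)]) auto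
qed

lemma lin_H_eq:
  fixes F G :: "hecke => hk"
  assumes F: "\<And>h k. h \<in> H n ==> k \<in> H n ==> F (hadd h k) = F h + F k" "\<And>c h. h \<in> H n ==> F (hscale c h) = sc c (F h)"
    and G: "\<And>h k. h \<in> H n ==> k \<in> H n ==> G (hadd h k) = G h + G k" "\<And>c h. h \<in> H n ==> G (hscale c h) = sc c (G h)"
    and T: "\<And>w. w \<in> Wn n ==> F (T (bap w)) = G (T (bap w))" and h: "h \<in> H n"
  shows "F h = G h"
proof -
  define r where "r S = (\<lambda>x. if x \<in> bap ` S then h x else 0)" for S
  have rH: "r S \<in> H n" for S using h by (auto simp: r_def H_def)
  have "F (r S) = G (r S)" if "finite S" "S \<subseteq> Wn n" for S
    using that
  proof (induction rule: finite_induct)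
    case empty
    have "r {} = hscale 0 (r {})" by (auto simp: r_def hscale_def)
    then show ?case using F(2)[OF rH[of "{}"], of 0] G(2)[OF rH[of "{}"], of 0] by simp
  next
    case (insert w S)
    have "r (insert w S) = hadd (hscale (h (bap w)) (T (bap w))) (r S)"
    proof
      fix x
      have "bap w \<notin> bap ` S" using insert(2) by auto
      then show "r (insert w S) x = hadd (hscale (h (bap w)) (T (bap w))) (r S) x"
        by (cases "x = bap w") (simp_all add: r_def hadd_def hscale_def T_def)
    qed
    then show ?case using F G T insert rH H_T H_sc by auto
  qed
  from this[of "Wn n"] have "F (r (Wn n)) = G (r (Wn n))" by (simp add: finite_Wn)
  moreover have "r (Wn n) = h" using h by (auto simp: r_def H_def W_eq[symmetric])
  ultimately show ?thesis by simp
qed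

lemma xi_gen: "xi (bap (gen i)) = xg i"
proof -
  have "gen_t = bap (gen 0)" by (simp add: bap_gen gen_fun_def)
  then have "bap (gen i) = gen_t \<longleftrightarrow> gen i = gen 0" by (metis bap_inject)
  then show ?thesis by (simp add: xi_def xg_def vg_def vgi_def gen_eq_iff)
qed

lemma hecke_mult_ex: assumes "0 < n" shows "is_hecke_mult n (\<lambda>h k. unemb n (emb n h * emb n k))"
proof -
  define m where "m h k = unemb n (emb n h * emb n k)" for h k
  have e: "emb n (m h k) = emb n h * emb n k" for h k unfolding m_def by (intro emb_unemb SP_mult emb_SP)
  have mH: "m h k \<in> H n" for h k by (simp add: m_def unemb_H)
  have "m (T (bap (gen i))) (T (bap w)) = T (bap (gen i) \<circ> bap w)" if "i < n" "w \<in> Wn n" "ell w < ell (gen i * w)" for i w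
    unfolding bap_mult[symmetric] using that
    by (intro H_eqI[OF mH]) (auto simp: e emb_T tt_Tb Wn_times intro!: H_T)
  moreover have "m (T (bap (gen i))) (T (bap w)) = hadd (T (bap (gen i) \<circ> bap w)) (hscale (xi (bap (gen i))) (T (bap w)))"
    if "i < n" "w \<in> Wn n" "ell (gen i * w) < ell w" for i w
    unfolding bap_mult[symmetric] xi_gen using that
    by (intro H_eqI[OF mH] H_add H_sc H_T) (auto simp: e emb_T tt_Tb emb_add emb_sc Wn_times)
  ultimately have "is_hecke_mult n m"
    unfolding is_hecke_mult_def
    by (intro conjI ballI allI H_eqI[of _ n])
       (auto simp: mH H_add H_sc H_T1 e emb_add emb_sc emb_T1 distrib_left distrib_right mult.assoc gens_eq[OF assms] W_eq len_ell[OF assms] bap_mult[symmetric] Wn_times)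
  then show ?thesis by (simp add: m_def[abs_def])
qed

text \<open>Associativity forces the left multiplication by each basis element along a reduced word,
  and bilinearity does the rest. Hence the arbitrary choice in \<open>hmult\<close> has no influence
  on \<open>H n\<close>.\<close>

lemma hecke_mult_unique: assumes n: "0 < n" and m: "is_hecke_mult n m" and hk: "h \<in> H n" "k \<in> H n"
  shows "emb n (m h k) = emb n h * emb n k"
proof -
  have mH: "m h k \<in> H n" and a1: "m (hadd g h) k = hadd (m g k) (m h k)" and a2: "m g (hadd h k) = hadd (m g h) (m g k)"
    and s1: "m (hscale c h) k = hscale c (m h k)" and s2: "m h (hscale c k) = hscale c (m h k)"
    and as: "m (m g h) k = m g (m h k)" and u: "m (T id) h = h"
    if "g \<in> H n" "h \<in> H n" "k \<in> H n" for g h k c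
    using m that unfolding is_hecke_mult_def by blast+
  have r: "(len n w < len n (s \<circ> w) --> m (T s) (T w) = T (s \<circ> w)) \<and>
        (len n (s \<circ> w) < len n w --> m (T s) (T w) = hadd (T (s \<circ> w)) (hscale (xi s) (T w)))" if "s \<in> gens n" "w \<in> W n" for s w
    using m that unfolding is_hecke_mult_def by blast
  have up: "m (T (bap (gen i))) (T (bap w)) = T (bap (gen i * w))" if "i < n" "w \<in> Wn n" "ell w < ell (gen i * w)" for i w
    using r[of "bap (gen i)" "bap w"] that by (auto simp: gens_eq[OF n] len_ell[OF n] bap_mult[symmetric] Wn_times)
  have dn: "m (T (bap (gen i))) (T (bap w)) = hadd (T (bap (gen i * w))) (hscale (xg i) (T (bap w)))"
    if "i < n" "w \<in> Wn n" "ell (gen i * w) < ell w" for i w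
    using r[of "bap (gen i)" "bap w"] that by (auto simp: gens_eq[OF n] len_ell[OF n] bap_mult[symmetric] xi_gen Wn_times)
  have tg: "emb n (m (T (bap (gen i))) k) = tt i * emb n k" if "i < n" "k \<in> H n" for i k
  proof (rule lin_H_eq[where F = "\<lambda>k. emb n (m (T (bap (gen i))) k)" and G = "\<lambda>k. tt i * emb n k", OF _ _ _ _ _ that(2)])
    have g: "T (bap (gen i)) \<in> H n" using that by (simp add: H_T)
    show "emb n (m (T (bap (gen i))) (hadd h k)) = emb n (m (T (bap (gen i))) h) + emb n (m (T (bap (gen i))) k)" if "h \<in> H n" "k \<in> H n" for h k
      using a2[OF g that] by (simp add: emb_add)
    show "emb n (m (T (bap (gen i))) (hscale c h)) = sc c (emb n (m (T (bap (gen i))) h))" if "h \<in> H n" for h c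
      using s2[OF g g that] by (simp add: emb_sc)
    fix w assume w: "w \<in> Wn n"
    consider "ell w < ell (gen i * w)" | "ell (gen i * w) < ell w" using ell_left_cases[of i w] by linarith
    then show "emb n (m (T (bap (gen i))) (T (bap w))) = tt i * emb n (T (bap w))"
    proof cases
      case 1 then show ?thesis using up[OF that(1) w] w that by (simp add: emb_T tt_Tb Wn_times)
    next
      case 2 then show ?thesis using dn[OF that(1) w] w that by (simp add: emb_T tt_Tb emb_add emb_sc Wn_times)
    qed
  qed (simp_all add: emb_add emb_sc distrib_left)
  have tw: "emb n (m (T (bap w)) k) = Tb w * emb n k" if "w \<in> Wn n" "k \<in> H n" for w k
    using that
  proof (induction arbitrary: k rule: ell_Wn_induct)
    case one then show ?case unfolding bap_one' u[OF one one one] by simp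
  next
    case (step i w)
    have g: "T (bap (gen i)) \<in> H n" "T (bap w) \<in> H n" using step by (simp_all add: H_T)
    have "m (T (bap (gen i * w))) k = m (T (bap (gen i))) (m (T (bap w)) k)"
      using up[OF step(1,2)] as[OF g step(5)] step(3) by simp
    then have "emb n (m (T (bap (gen i * w))) k) = tt i * (Tb w * emb n k)"
      using tg[OF step(1) mH[OF g step(5)]] step.IH[OF step(5)] mH[OF g(2,2) step(5)] tg[OF step(1)] by simp
    moreover have "Tb (gen i * w) = tt i * Tb w" using step by (simp add: tt_Tb)
    ultimately show ?case by (simp only: mult.assoc)
  qed
  show ?thesis
  proof (rule lin_H_eq[where F = "\<lambda>h. emb n (m h k)" and G = "\<lambda>h. emb n h * emb n k", OF _ _ _ _ _ hk(1)])
    show "emb n (m (hadd h g) k) = emb n (m h k) + emb n (m g k)" if "h \<in> H n" "g \<in> H n" for h g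
      using a1[OF that hk(2)] by (simp add: emb_add)
    show "emb n (m (hscale c h) k) = sc c (emb n (m h k))" if "h \<in> H n" for h c
      using s1[OF that that hk(2)] by (simp add: emb_sc)
  qed (simp_all add: emb_add emb_sc distrib_right tw[OF _ hk(2)] emb_T)
qed

lemma hmult: assumes "0 < n" shows "is_hecke_mult n (hmult n)"
  unfolding hmult_def by (rule someI[of "is_hecke_mult n", OF hecke_mult_ex[OF assms]])
lemma hmult_H: "0 < n ==> h \<in> H n ==> k \<in> H n ==> hmult n h k \<in> H n"
  using hmult[of n] unfolding is_hecke_mult_def by blast
lemma emb_hmult: "0 < n ==> h \<in> H n ==> k \<in> H n ==> emb n (hmult n h k) = emb n h * emb n k"
  by (rule hecke_mult_unique[OF _ hmult])

lemma Tbar_SP: "w \<in> Wn n ==> Tbar w \<in> SP n"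
proof -
  assume w: "w \<in> Wn n"
  have "{y. (y, w) \<in> (brel n)\<^sup>+} \<subseteq> Wn n" using brel_ell by blast
  then have "bar (Tb w) - Tb w \<in> SP n" using Tbar_lower[OF w] hk.span_mono[of "Tb ` {y. (y, w) \<in> (brel n)\<^sup>+}" "Tb ` Wn n"] by blast
  moreover have "Tb w \<in> SP n" using w by (intro hk.span_base imageI)
  ultimately have "bar (Tb w) - Tb w + Tb w \<in> SP n" by (rule hk.span_add)
  then show ?thesis by (simp add: bar_Tb)
qed

lemma T_inverse_bap: assumes n: "0 < n" and w: "w \<in> Wn n" shows "T_inverse n (bap w) = unemb n (Tbar (inverse w))"
  unfolding T_inverse_def
proof (rule the_equality)
  have S: "Tbar (inverse w) \<in> SP n" using w by (simp add: Tbar_SP)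
  have i: "Tb w * Tbar (inverse w) = 1" "Tbar (inverse w) * Tb w = 1" using Tbar_inv[of "inverse w"] by simp_all
  show "unemb n (Tbar (inverse w)) \<in> H n \<and> hmult n (T (bap w)) (unemb n (Tbar (inverse w))) = T id \<and>
      hmult n (unemb n (Tbar (inverse w))) (T (bap w)) = T id"
    using w by (intro conjI unemb_H H_eqI[OF hmult_H[OF n] H_T1]) (simp_all add: unemb_H H_T emb_hmult[OF n] emb_T emb_T1 emb_unemb[OF S] i)
  fix k assume k: "k \<in> H n \<and> hmult n (T (bap w)) k = T id \<and> hmult n k (T (bap w)) = T id"
  then have "Tb w * emb n k = 1" using emb_hmult[OF n H_T[OF w], of k] w by (simp add: emb_T emb_T1)
  then have "emb n k = Tbar (inverse w)" using Tbar_unique[of "inverse w" "emb n k"] by simp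
  then show "k = unemb n (Tbar (inverse w))" using k by (intro H_eqI[OF _ unemb_H]) (simp_all add: emb_unemb[OF S])
qed

lemma hbar_eq: assumes n: "0 < n" shows "hbar n h \<in> H n" "emb n (hbar n h) = bar (emb n h)"
proof -
  have W: "hbar n h x = (\<Sum>w\<in>Wn n. laurent_bar (h (bap w)) * unemb n (Tbar w) x)" for x
  proof -
    have "hbar n h x = (\<Sum>w\<in>Wn n. laurent_bar (h (bap w)) * T_inverse n (inv (bap w)) x)"
      unfolding hbar_def W_eq by (subst sum.reindex) (auto simp: inj_on_def)
    also have "\<dots> = (\<Sum>w\<in>Wn n. laurent_bar (h (bap w)) * unemb n (Tbar w) x)"
      by (rule sum.cong) (simp_all add: bap_inv[symmetric] T_inverse_bap[OF n])
    finally show ?thesis .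
  qed
  show "hbar n h \<in> H n" by (auto simp: H_def W unemb_def)
  show "emb n (hbar n h) = bar (emb n h)"
  proof (rule hk_eqI)
    fix x
    have b: "bar (emb n h) = (\<Sum>w\<in>Wn n. sc (laurent_bar (h (bap w))) (Tbar w))"
      by (simp add: emb_def bar_sum bar_Tb)
    have "cf (Tbar w) x = 0" if "w \<in> Wn n" "x \<notin> Wn n" for w using Tbar_SP[OF that(1)] that by (auto simp: span_Tb)
    then show "cf (emb n (hbar n h)) x = cf (bar (emb n h)) x"
      by (simp add: cf_emb W b unemb_bap)
  qed
qed

lemma KL_bap: assumes n: "0 < n" and w: "w \<in> Wn n" shows "KL n (bap w) = unemb n (KLe w)"
  unfolding KL_def
proof (rule the_equality)
  have S: "KLe w \<in> SP n" using cf_KLe_Wn[OF w] by (auto simp: span_Tb)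
  let ?c = "unemb n (KLe w)"
  have bp: "?c f \<in> AN" if "f \<noteq> bap w" for f using that cf_KLe(3)[of _ w] by (cases "f \<in> W n") (auto simp: unemb_def W_eq)
  have z: "?c f = 0" if "f \<noteq> bap w" "(f, bap w) \<notin> bruhat_less n" for f
  proof (cases "f \<in> W n")
    case True
    then obtain x where x: "x \<in> Wn n" "f = bap x" unfolding W_eq by blast
    then have "(x, w) \<notin> (brel n)\<^sup>+" "x \<noteq> w" using that bruhat_eq(1)[OF n] by auto
    then have "cf (KLe w) x = 0" using cf_KLe_brel[OF w] by blast
    then show ?thesis by (simp add: x unemb_bap)
  qed (simp add: unemb_def)
  show "?c (bap w) = 1 \<and> (\<forall>y. y \<noteq> bap w \<and> (y, bap w) \<in> bruhat_less n --> ?c y \<in> A_neg) \<and>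
      (\<forall>y. y \<noteq> bap w \<and> (y, bap w) \<notin> bruhat_less n --> ?c y = 0) \<and> hbar n ?c = ?c"
    using bp z w cf_KLe(1)[of w] H_eqI[OF hbar_eq(1)[OF n] unemb_H, of ?c "KLe w"]
    by (auto simp: unemb_bap A_neg_eq hbar_eq(2)[OF n] emb_unemb[OF S])
  fix c assume c: "c (bap w) = 1 \<and> (\<forall>y. y \<noteq> bap w \<and> (y, bap w) \<in> bruhat_less n --> c y \<in> A_neg) \<and>
      (\<forall>y. y \<noteq> bap w \<and> (y, bap w) \<notin> bruhat_less n --> c y = 0) \<and> hbar n c = c"
  \<comment> \<open>The conditions defining \<open>KL\<close> range over all functions. Outside
    \<open>W n\<close> there are no Bruhat relations, so they force the value 0 there and c belongs
    to \<open>H n\<close>.\<close>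
  have "c f = 0" if "f \<notin> W n" for f
  proof -
    have "(f, bap w) \<notin> bruhat_less n" using bruhat_eq(2)[OF n] that by blast
    moreover have "f \<noteq> bap w" using that w by auto
    ultimately show ?thesis using c by blast
  qed
  then have cH: "c \<in> H n" by (simp add: H_def)
  have cA: "c y \<in> AN" if "y \<noteq> bap w" for y using c that by (cases "(y, bap w) \<in> bruhat_less n") (auto simp: A_neg_eq)
  have "emb n c = KLe w"
  proof (rule KLe_unique)
    show "bar (emb n c) = emb n c" using hbar_eq(2)[OF n, of c] c by simp
    show "asymT w (emb n c)" unfolding asymT_def using c cA w by (auto simp: cf_emb cf_Tb)
  qed
  then show "c = ?c" by (intro H_eqI[OF cH unemb_H]) (simp add: emb_unemb[OF S])
qed

lemma KL_H: "0 < n ==> w \<in> Wn n ==> KL n (bap w) \<in> H n \<and> emb n (KL n (bap w)) = KLe w"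
  using cf_KLe_Wn[of w n] by (auto simp: KL_bap unemb_H span_Tb intro!: emb_unemb)

lemma KL_coeff_bap: assumes n: "0 < n" and h: "h \<in> H n" and w: "w \<in> Wn n" shows "KL_coeff n h (bap w) = kc (emb n h) w"
proof -
  define c where "c x = (if x \<in> W n then kc (emb n h) (Abs_bperm x) else 0)" for x
  have s: "(\<Sum>z\<in>W n. d z * KL n z x) = (\<Sum>z\<in>Wn n. d (bap z) * KL n (bap z) x)" for d x
    unfolding W_eq by (subst sum.reindex) (auto simp: inj_on_def)
  have e: "emb n (\<lambda>x. \<Sum>z\<in>W n. d z * KL n z x) = (\<Sum>z\<in>Wn n. sc (d (bap z)) (KLe z))" for d
  proof (rule hk_eqI)
    fix x
    have "cf (KLe z) x = (if x \<in> Wn n then KL n (bap z) (bap x) else 0)" if "z \<in> Wn n" for z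
      using KL_H[OF n that] cf_emb by metis
    then show "cf (emb n (\<lambda>x. \<Sum>z\<in>W n. d z * KL n z x)) x = cf (\<Sum>z\<in>Wn n. sc (d (bap z)) (KLe z)) x"
      by (simp add: cf_emb s)
  qed
  have sH: "(\<lambda>x. \<Sum>z\<in>W n. d z * KL n z x) \<in> H n" for d
    unfolding H_def s using KL_H[OF n] by (auto simp: H_def)
  have "KL_coeff n h = c"
    unfolding KL_coeff_def
  proof (rule the_equality)
    have "emb n h \<in> spC (Wn n)" unfolding span_KLe_Wn by (rule emb_SP)
    then have sub: "{z. kc (emb n h) z \<noteq> 0} \<subseteq> Wn n" unfolding kc_span by blast
    have "emb n h = (\<Sum>z | kc (emb n h) z \<noteq> 0. sc (kc (emb n h) z) (KLe z))" by (rule kc_expand)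
    also have "\<dots> = (\<Sum>z\<in>Wn n. sc (c (bap z)) (KLe z))"
      by (rule sum.mono_neutral_cong_left) (use sub in \<open>auto simp: c_def finite_Wn\<close>)
    finally have "h = (\<lambda>x. \<Sum>z\<in>W n. c z * KL n z x)" using e[of c] by (intro H_eqI[OF h sH]) simp
    then show "(\<forall>z. z \<notin> W n --> c z = 0) \<and> h = (\<lambda>x. \<Sum>z\<in>W n. c z * KL n z x)" by (simp add: c_def)
    fix d assume d: "(\<forall>z. z \<notin> W n --> d z = 0) \<and> h = (\<lambda>x. \<Sum>z\<in>W n. d z * KL n z x)"
    then have "emb n h = (\<Sum>z\<in>Wn n. sc (d (bap z)) (KLe z))" using e[of d] by simp
    from kc_eqI[OF finite_Wn this] have k: "kc (emb n h) z = d (bap z)" if "z \<in> Wn n" for z using that by simp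
    show "d = c"
    proof
      fix x show "d x = c x"
      proof (cases "x \<in> W n")
        case True then show ?thesis using k by (auto simp: W_eq c_def)
      qed (use d in \<open>simp add: c_def\<close>)
    qed
  qed
  then show ?thesis using w by (simp add: c_def)
qed

lemma left_le_eq: assumes n: "0 < n" shows "(bap z, bap y) \<in> left_le n \<longleftrightarrow> (z, y) \<in> (LE n)\<^sup>*"
proof -
  define R where "R = {(z, y). z \<in> W n \<and> y \<in> W n \<and> (\<exists>s \<in> gens n. KL_coeff n (hmult n (KL n s) (KL n y)) z \<noteq> 0)}"
  have B: "left_le n = R\<^sup>*" by (simp add: left_le_def R_def)
  have R: "(bap z, bap y) \<in> R \<longleftrightarrow> (z, y) \<in> LE n" for z y
  proof -
    have "KL_coeff n (hmult n (KL n (bap (gen i))) (KL n (bap y))) (bap z) = kc (Cg i * KLe y) z"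
      if "i < n" "z \<in> Wn n" "y \<in> Wn n" for i
    proof -
      have "KL n (bap (gen i)) \<in> H n" "emb n (KL n (bap (gen i))) = Cg i" "KL n (bap y) \<in> H n" "emb n (KL n (bap y)) = KLe y"
        using KL_H[OF n, of "gen i"] KL_H[OF n that(3)] that by (simp_all add: KLe_gen)
      then show ?thesis using KL_coeff_bap[OF n hmult_H[OF n] that(2)] emb_hmult[OF n] by simp
    qed
    then show ?thesis unfolding R_def LE_def gens_eq[OF n] by auto
  qed
  have RW: "f \<in> W n \<and> g \<in> W n" if "(f, g) \<in> R" for f g using that by (auto simp: R_def)
  have "(bap z, bap y) \<in> R\<^sup>+ \<longleftrightarrow> (z, y) \<in> (LE n)\<^sup>+" by (rule trancl_bap) (use R RW in blast)+
  then show ?thesis unfolding B rtrancl_eq_or_trancl by auto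
qed

lemma left_cell_eq: assumes "0 < n" "x \<in> Wn n" shows "left_cell n (bap x) = bap ` {y. LS n x y}"
proof (intro set_eqI iffI)
  fix z assume z: "z \<in> left_cell n (bap x)"
  then obtain y where y: "z = bap y" "y \<in> Wn n" unfolding left_cell_def W_eq by blast
  then have "(y, x) \<in> (LE n)\<^sup>*" "(x, y) \<in> (LE n)\<^sup>*" using z left_le_eq[OF assms(1)] unfolding left_cell_def by blast+
  then show "z \<in> bap ` {y. LS n x y}" using y assms(2) by (simp add: LS_def)
next
  fix z assume "z \<in> bap ` {y. LS n x y}"
  then obtain y where y: "z = bap y" and "LS n x y" by blast
  then have "y \<in> Wn n" "(y, x) \<in> (LE n)\<^sup>*" "(x, y) \<in> (LE n)\<^sup>*" by (simp_all add: LS_def)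
  then show "z \<in> left_cell n (bap x)" unfolding y left_cell_def left_le_eq[OF assms(1)] mem_Collect_eq bap_W by blast
qed

section \<open>Robinson-Schensted shapes and the dictionary between bitableaux and
  permutations\<close>

section \<open>Robinson--Schensted insertion of the words of a standard bitableau\<close>

abbreviation ins :: "tableau => int list => tableau" where "ins \<equiv> foldl (\<lambda>P x. tab_insert x P)"

lemma row_insert_length:
  "snd (row_insert x r) = None ==> length (fst (row_insert x r)) = Suc (length r)"
  "snd (row_insert x r) \<noteq> None ==> length (fst (row_insert x r)) = length r"
  by (induction x r rule: row_insert.induct) (auto split: if_splits prod.splits)

text \<open>Only the shape of the recording tableau matters for the type, and it grows in the same
  box as the insertion tableau. From here on insertion alone is studied.\<close>

lemma record_box_shape: "map length Q = map length P ==> map length (record_box i (tab_insert x P) Q) = map length (tab_insert x P)"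
proof (induction P arbitrary: x Q)
  case (Cons r P)
  obtain q Q' where Q: "Q = q # Q'" "length q = length r" "map length Q' = map length P" using Cons.prems by (cases Q) auto
  obtain r' b where rb: "row_insert x r = (r', b)" by fastforce
  show ?case
  proof (cases b)
    case None then show ?thesis using row_insert_length(1)[of x r] rb Q by simp
  next
    case (Some y)
    then show ?thesis using row_insert_length(2)[of x r] rb Q Cons.IH[OF Q(3), of y] by simp
  qed
qed simp

lemma rs_shape: "map length (snd (rs xs)) = map length (fst (rs xs))"
  and rs_fst: "fst (rs xs) = ins [] (map snd xs)"
proof -
  have "map length (snd (rs xs)) = map length (fst (rs xs)) \<and> fst (rs xs) = ins [] (map snd xs)"
  proof (induction xs rule: rev_induct)
    case Nil then show ?case by (simp add: rs_def)
  next
    case (snoc x xs)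
    obtain P Q where PQ: "rs xs = (P, Q)" by fastforce
    obtain i v where x: "x = (i, v)" by fastforce
    have "rs (xs @ [x]) = (tab_insert v P, record_box i (tab_insert v P) Q)" using PQ x by (simp add: rs_def Let_def)
    then show ?case using snoc PQ x record_box_shape[of Q P i v] by simp
  qed
  then show "map length (snd (rs xs)) = map length (fst (rs xs))" "fst (rs xs) = ins [] (map snd xs)" by auto
qed

lemma row_insert_skip: "\<forall>y\<in>set p. y < x ==> row_insert x (p @ q) = (p @ fst (row_insert x q), snd (row_insert x q))"
  by (induction p) (auto split: prod.splits)

text \<open>p is the part already inserted, s the part still to be displaced. Each new entry passes
  p and replaces the head of s, which is sent on to \<open>ts\<close>; once s is exhausted, entries
  are appended.\<close>

lemma ins_row:
  assumes "sorted_wrt (<) r" "\<forall>y\<in>set p. \<forall>x\<in>set r. y < x" "length s \<le> length r" "\<And>j. j < length s ==> r ! j < s ! j"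
  shows "ins ((p @ s) # ts) r = (p @ r) # ins ts s"
  using assms
proof (induction r arbitrary: p s ts)
  case (Cons x r)
  have p: "\<forall>y\<in>set p. y < x" "\<forall>y\<in>set (p @ [x]). \<forall>z\<in>set r. y < z" "sorted_wrt (<) r" using Cons.prems by auto
  show ?case
  proof (cases s)
    case Nil
    then show ?thesis using row_insert_skip[OF p(1), of "[]"] Cons.IH[OF p(3,2), of "[]" ts] by simp
  next
    case (Cons y s')
    have xy: "x < y" using Cons.prems(4)[of 0] Cons by simp
    have "r ! j < s' ! j" if "j < length s'" for j using Cons.prems(4)[of "Suc j"] Cons that by simp
    moreover have "length s' \<le> length r" using Cons.prems(3) Cons by simp
    ultimately show ?thesis using row_insert_skip[OF p(1), of "y # s'"] Cons.IH[OF p(3,2), of s' "tab_insert y ts"] xy Cons by simp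
  qed
qed simp

definition tab :: "tableau => bool" where "tab t \<longleftrightarrow> is_standard t \<and> is_partition (map length t)"

lemma tab_Cons: "tab (r # t) ==> tab t" "tab (r # t) ==> sorted_wrt (<) r \<and> r \<noteq> []"
  "tab (r # s # t) ==> length s \<le> length r" "tab (r # s # t) ==> j < length s ==> r ! j < s ! j"
proof -
  show "tab t" if "tab (r # t)"
  proof -
    have "t ! i ! j < t ! Suc i ! j" if ij: "Suc i < length t" "j < length (t ! Suc i)" for i j
      using \<open>tab (r # t)\<close>[unfolded tab_def is_standard_def, THEN conjunct1, THEN conjunct2, rule_format, of "Suc i" j] ij by simp
    then show ?thesis using that by (auto simp: tab_def is_standard_def is_partition_def)
  qed
  show "sorted_wrt (<) r \<and> r \<noteq> []" if "tab (r # t)" using that by (auto simp: tab_def is_standard_def is_partition_def)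
  show "length s \<le> length r" if "tab (r # s # t)" using that by (auto simp: tab_def is_partition_def)
  show "r ! j < s ! j" if "tab (r # s # t)" "j < length s"
    using that(1)[unfolded tab_def is_standard_def, THEN conjunct1, THEN conjunct2, rule_format, of 0 j] that(2) by simp
qed

lemma ins_new_row: "sorted_wrt (<) (x # r) ==> ins [] (x # r) = [x # r]"
  using ins_row[of r "[x]" "[]" "[]"] by simp

lemma ins_above: "tab (r # t) ==> ins t r = r # t"
proof (induction t arbitrary: r)
  case Nil
  then show ?case using tab_Cons(2)[OF Nil] ins_new_row by (cases r) auto
next
  case (Cons s t)
  have "ins (([] @ s) # t) r = ([] @ r) # ins t s"
    by (rule ins_row) (use tab_Cons[OF Cons.prems] tab_Cons(3,4)[OF Cons.prems] in auto)
  then show ?case using Cons.IH[OF tab_Cons(1)[OF Cons.prems]] by simp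
qed

lemma ins_rows: "tab t ==> ins [] (concat (rev t)) = t"
proof (induction t)
  case (Cons r t)
  then show ?case using tab_Cons(1) ins_above by simp
qed simp

text \<open>Appends z as a new column, one entry to each successive row, opening rows of length one
  where \<open>ps\<close> has ended.\<close>

fun colapp :: "tableau => int list => tableau" where
  "colapp ps [] = ps"
| "colapp [] (z # zs) = [z] # colapp [] zs"
| "colapp (p # ps) (z # zs) = (p @ [z]) # colapp ps zs"

text \<open>In a decreasing sequence every entry bumps its predecessor from the end of the row. The
  row keeps the least entry, and the others reach the rest of the tableau in their original
  order.\<close>

lemma ins_col_aux:
  "sorted_wrt (<) (z @ [y]) ==> \<forall>a\<in>set p. \<forall>x\<in>set (z @ [y]). a < x ==>
    ins ((p @ [y]) # ps) (rev z) = (p @ [hd (z @ [y])]) # ins ps (rev (tl (z @ [y])))"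
proof (induction z arbitrary: y ps rule: rev_induct)
  case (snoc a z)
  have lt: "a < y" "\<forall>b\<in>set p. b < a" using snoc.prems by (auto simp: sorted_wrt_append)
  have "ins ((p @ [a]) # tab_insert y ps) (rev z) = (p @ [hd (z @ [a])]) # ins (tab_insert y ps) (rev (tl (z @ [a])))"
    by (rule snoc.IH) (use snoc.prems in \<open>auto simp: sorted_wrt_append\<close>)
  moreover have "tab_insert a ((p @ [y]) # ps) = (p @ [a]) # tab_insert y ps" using row_insert_skip[OF lt(2), of "[y]"] lt(1) by simp
  ultimately show ?case by (cases z) simp_all
qed simp

lemma ins_col:
  assumes "sorted_wrt (<) z" "z \<noteq> []" "\<forall>a\<in>set p. \<forall>x\<in>set z. a < x"
  shows "ins (p # ps) (rev z) = (p @ [hd z]) # ins ps (rev (tl z))" "ins [] (rev z) = [hd z] # ins [] (rev (tl z))"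
proof -
  obtain z0 y where z: "z = z0 @ [y]" using assms(2) by (cases z rule: rev_cases) auto
  have "\<forall>a\<in>set p. a < y" using assms z by auto
  then show "ins (p # ps) (rev z) = (p @ [hd z]) # ins ps (rev (tl z))"
    using ins_col_aux[of z0 y p ps] assms row_insert_skip[of p y "[]"] z by simp
  show "ins [] (rev z) = [hd z] # ins [] (rev (tl z))"
    using ins_col_aux[of z0 y "[]" "[]"] assms z by simp
qed

lemma ins_colapp:
  "sorted_wrt (<) z ==> (\<And>i. i < length z ==> i < length ps ==> \<forall>a\<in>set (ps ! i). a < z ! i) ==> ins ps (rev z) = colapp ps z"
proof (induction z arbitrary: ps)
  case (Cons x z)
  show ?case
  proof (cases ps)
    case Nil
    then show ?thesis using ins_col(2)[of "x # z" "[]"] Cons.IH[of "[]"] Cons.prems(1) by (simp del: rev.simps)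
  next
    case ps: (Cons p ps')
    have a: "\<forall>a\<in>set p. a < x" using Cons.prems(2)[of 0] ps by simp
    have "\<forall>a\<in>set p. \<forall>b\<in>set (x # z). a < b" using a Cons.prems(1) by fastforce
    moreover have "ins ps' (rev z) = colapp ps' z"
    proof (rule Cons.IH)
      show "sorted_wrt (<) z" using Cons.prems(1) by simp
      fix i assume "i < length z" "i < length ps'"
      then show "\<forall>a\<in>set (ps' ! i). a < z ! i" using Cons.prems(2)[of "Suc i"] ps by simp
    qed
    ultimately show ?thesis using ins_col(1)[of "x # z" p ps'] Cons.prems(1) ps by (simp del: rev.simps)
  qed
qed simp

lemma colapp_length: "length (colapp ps z) = max (length ps) (length z)"
  by (induction ps z rule: colapp.induct) auto
lemma colapp_nth: "i < length ps \<or> i < length z ==> colapp ps z ! i = (if i < length ps then ps ! i else []) @ (if i < length z then [z ! i] else [])"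
proof (induction ps z arbitrary: i rule: colapp.induct)
  case (2 z zs) then show ?case by (cases i) auto
next
  case (3 p ps z zs) then show ?case by (cases i) auto
qed simp

definition transp :: "tableau => tableau" where
  "transp t = map (\<lambda>i. map (\<lambda>r. r ! i) (filter (\<lambda>r. i < length r) t)) [0..<(if t = [] then 0 else length (hd t))]"

lemma transp_shape: "map length (transp t) = conjugate (map length t)"
  by (simp add: transp_def conjugate_def filter_map comp_def list.map_sel(1))

lemma colapp_transp:
  assumes "t \<noteq> [] ==> length z \<le> length (hd t)"
  shows "colapp (transp t) z = transp (t @ [z])"
proof (rule nth_equalityI)
  show l: "length (colapp (transp t) z) = length (transp (t @ [z]))"
    using assms by (cases t) (simp_all add: colapp_length transp_def)
  fix i assume il: "i < length (colapp (transp t) z)"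
  then have i: "i < length (transp t) \<or> i < length z" by (auto simp: colapp_length)
  have it: "i < length (transp (t @ [z]))" using il unfolding l .
  have t: "transp t ! i = map (\<lambda>r. r ! i) (filter (\<lambda>r. i < length r) t)" if "i < length (transp t)"
    using that by (simp add: transp_def)
  have "filter (\<lambda>r. i < length r) t = []" if "\<not> i < length (transp t)" using that i assms by (cases t) (auto simp: transp_def)
  then show "colapp (transp t) z ! i = transp (t @ [z]) ! i"
    using it t by (subst colapp_nth[OF i]) (auto simp: transp_def)
qed

lemma tab_mono:
  assumes t: "tab t" and "a < b" "b < length t" "i < length (t ! b)"
  shows "t ! a ! i < t ! b ! i"
  using assms(2-4)
proof (induction b)
  case (Suc b)
  have "length (t ! Suc b) \<le> length (t ! b)"
    using t Suc.prems sorted_wrt_nth_less[of "(\<ge>)" "map length t" b "Suc b"] by (auto simp: tab_def is_partition_def)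
  then have i: "i < length (t ! b)" using Suc.prems by simp
  have "t ! b ! i < t ! Suc b ! i" using t Suc.prems unfolding tab_def is_standard_def by blast
  then show ?case using Suc.IH[OF _ _ i] Suc.prems by (cases "a = b") auto
qed simp

lemma tab_take: assumes "tab t" shows "tab (take k t)"
proof -
  have "sorted_wrt (\<ge>) (map length (take k t))" using assms by (simp add: tab_def is_partition_def take_map[symmetric] sorted_wrt_take)
  moreover have "set (take k t) \<subseteq> set t" by (rule set_take_subset)
  ultimately show ?thesis using assms unfolding tab_def is_standard_def is_partition_def by auto
qed

lemma ins_cols: "tab t ==> ins [] (concat (map rev t)) = transp t"
proof (induction t rule: rev_induct)
  case Nil then show ?case by (simp add: transp_def)
next
  case (snoc z t)
  have t: "tab t" using tab_take[OF snoc.prems, of "length t"] by simp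
  have "ins (transp t) (rev z) = colapp (transp t) z"
  proof (rule ins_colapp)
    show "sorted_wrt (<) z" using snoc.prems by (auto simp: tab_def is_standard_def)
    fix i assume i: "i < length z" "i < length (transp t)"
    show "\<forall>a\<in>set (transp t ! i). a < z ! i"
    proof
      fix a assume "a \<in> set (transp t ! i)"
      then obtain r where r: "r \<in> set t" "i < length r" "a = r ! i" using i by (auto simp: transp_def)
      then obtain b where b: "b < length t" "r = t ! b" by (auto simp: in_set_conv_nth)
      show "a < z ! i" using tab_mono[OF snoc.prems, of b "length t" i] b i r by (simp add: nth_append)
    qed
  qed
  moreover have "colapp (transp t) z = transp (t @ [z])"
  proof (rule colapp_transp)
    assume "t \<noteq> []"
    then show "length z \<le> length (hd t)" using snoc.prems by (cases t) (auto simp: tab_def is_partition_def)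
  qed
  ultimately show ?case using snoc.IH[OF t] by simp
qed

section \<open>The initial bitableau and the longest element of its row stabilizer\<close>

lemma word_prod_Nil: "word_prod [] = bap 1" unfolding word_prod_def bap_one' by simp

lemma Sym_eq: "Sym n = bap ` Sy n"
proof (intro set_eqI iffI)
  fix f assume "f \<in> Sym n"
  then obtain ss where ss: "f = word_prod ss" "set ss \<subseteq> gen_s ` {1..<n}" by (auto simp: Sym_def)
  from ss(2) have "word_prod ss \<in> bap ` Sy n"
  proof (induction ss)
    case Nil show ?case unfolding word_prod_Nil by (rule imageI) simp
  next
    case (Cons s ss)
    then obtain w i where w: "word_prod ss = bap w" "w \<in> Sy n" "s = gen_s i" "0 < i" "i < n" by auto
    have "word_prod (s # ss) = bap (gen i * w)" using w by (simp add: word_prod_def bap_mult bap_gen gen_fun_def)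
    then show ?case using Sy_times[OF gen_Sy[OF w(4,5)] w(2)] by blast
  qed
  then show "f \<in> bap ` Sy n" using ss by simp
next
  fix f assume "f \<in> bap ` Sy n"
  then obtain w where w: "f = bap w" "w \<in> WJ n n" by (auto simp: Sy_WJ)
  from w(2) have "\<exists>ss. bap w = word_prod ss \<and> set ss \<subseteq> gen_s ` {1..<n}"
  proof (induction rule: WJ_induct)
    case one show ?case by (intro exI[of _ "[]"] conjI, rule word_prod_Nil[symmetric]) simp
  next
    case (step i w)
    then obtain ss where "bap w = word_prod ss" "set ss \<subseteq> gen_s ` {1..<n}" by blast
    then show ?case using step(1,2)
      by (intro exI[of _ "gen_s i # ss"]) (simp add: word_prod_def bap_mult bap_gen gen_fun_def)
  qed
  then show "f \<in> Sym n" using w by (auto simp: Sym_def)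
qed

lemma a_block_apply: "a_block k i = (if i = 1 then - (int k + 1) else if i = - 1 then int k + 1
   else if 2 \<le> i \<and> i \<le> int k + 1 then i - 1 else if 2 \<le> - i \<and> - i \<le> int k + 1 then i + 1 else i)"
proof (induction k)
  case 0 then show ?case by (auto simp: gen_t_def transpose_def)
next
  case (Suc k)
  have "a_block (Suc k) i = gen_s (Suc k) (a_block k i)" by simp
  also have "\<dots> = gen_fun (Suc k) (a_block k i)" by (simp add: gen_fun_def)
  finally show ?case unfolding Suc.IH gen_fun_apply by auto
qed

lemma a_elt_apply: "a_elt l i = (if 1 \<le> i \<and> i \<le> int l then i - (int l + 1) else if 1 \<le> - i \<and> - i \<le> int l then i + (int l + 1) else i)"
proof (induction l arbitrary: i)
  case (Suc l)
  have "a_elt (Suc l) i = a_elt l (a_block l i)" by simp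
  then show ?case unfolding Suc.IH a_block_apply by auto
qed simp

lemma a_elt_aw: "a_elt l = bap (aw l)"
proof
  fix i :: int
  consider "0 < i" | "i = 0" | "0 < - i" by linarith
  then show "a_elt l i = aw l $ i"
  proof cases
    case 3
    have "aw l $ i = - (aw l $ (- i))" by simp
    then show ?thesis using 3 by (simp only: aw_apply a_elt_apply) auto
  qed (auto simp: aw_apply a_elt_apply)
qed

text \<open>The rows of both components are numbered consecutively: \<open>psum c r\<close> counts
  the boxes before row r of the concatenated shape c, and \<open>prow c v\<close> is the row of v in
  the initial filling.\<close>

definition psum :: "nat list => nat => nat" where "psum c r = sum_list (take r c)"
definition prow :: "nat list => int => nat" where "prow c v = (LEAST r. v \<le> int (psum c (Suc r)))"

lemma psum_Suc: "psum c (Suc r) = psum c r + (if r < length c then c ! r else 0)"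
  by (simp add: psum_def take_Suc_conv_app_nth)
lemma psum_0 [simp]: "psum c 0 = 0" by (simp add: psum_def)
lemma psum_length: "psum c (length c) = sum_list c" by (simp add: psum_def)
lemma psum_le: "psum c r \<le> sum_list c"
  unfolding psum_def using sum_list_append[of "take r c" "drop r c"] by simp
lemma psum_mono: "r \<le> r' ==> psum c r \<le> psum c r'" by (rule lift_Suc_mono_le[of "psum c"]) (simp add: psum_Suc)

lemma prow1: assumes "0 < v" "v \<le> int (sum_list c)" shows "int (psum c (prow c v)) < v \<and> v \<le> int (psum c (Suc (prow c v)))"
proof
  have "v \<le> int (psum c (Suc (length c)))" using assms by (simp add: psum_Suc psum_length)
  then show "v \<le> int (psum c (Suc (prow c v)))" unfolding prow_def by (rule LeastI)
  show "int (psum c (prow c v)) < v"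
  proof (cases "prow c v")
    case (Suc r)
    then have "\<not> v \<le> int (psum c (Suc r))" using not_less_Least[of r "\<lambda>r. v \<le> int (psum c (Suc r))"] by (simp add: prow_def)
    then show ?thesis using Suc by simp
  qed (use assms in simp)
qed

lemma prow2: assumes "int (psum c r) < v" "v \<le> int (psum c (Suc r))" shows "prow c v = r"
  unfolding prow_def
proof (rule Least_equality)
  fix r' assume r': "v \<le> int (psum c (Suc r'))"
  show "r \<le> r'"
  proof (rule ccontr)
    assume "\<not> r \<le> r'"
    then have "psum c (Suc r') \<le> psum c r" by (intro psum_mono) simp
    then show False using r' assms by linarith
  qed
qed (rule assms)

lemma fill_rows_append: "fill_rows k (mu @ nu) = fill_rows k mu @ fill_rows (k + int (sum_list mu)) nu"
  by (induction k mu rule: fill_rows.induct) (simp_all add: add.assoc)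
lemma fill_rows_length [simp]: "length (fill_rows k mu) = length mu"
  by (induction k mu rule: fill_rows.induct) simp_all
lemma fill_rows_shape: "map length (fill_rows k mu) = mu"
  by (induction k mu rule: fill_rows.induct) simp_all
lemma fill_rows_nth: "r < length mu ==> fill_rows k mu ! r = [k + int (psum mu r)..k + int (psum mu (Suc r)) - 1]"
proof (induction k mu arbitrary: r rule: fill_rows.induct)
  case (2 k a mu)
  then show ?case by (cases r) (simp_all add: psum_def add.assoc)
qed simp
lemma concat_fill_rows: "concat (fill_rows k mu) = [k..k + int (sum_list mu) - 1]"
proof (induction k mu rule: fill_rows.induct)
  case (2 k r mu)
  have "[k..k + int r - 1] @ [k + int r..k + int r + s - 1] = [k..k + int r + s - 1]" if "0 \<le> s" for s
    using that upto_split1[of k "k + int r" "k + int r + s - 1"] by (cases "s = 0") simp_all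
  from this[of "int (sum_list mu)"] show ?case using 2 by (simp add: add.assoc)
qed simp

locale biparts =
  fixes n :: nat and la1 la2 :: "nat list"
  assumes n0: "0 < n" and bip: "(la1, la2) \<in> bipartitions n"
begin

abbreviation "c \<equiv> la1 @ la2"
abbreviation "l \<equiv> sum_list la1"
abbreviation "m \<equiv> length la1"
abbreviation "off \<equiv> psum c"
abbreviation "\<rho> \<equiv> prow c"

lemma parts: "is_partition la1" "is_partition la2" and sum_n: "sum_list c = n"
  using bip by (auto simp: bipartitions_def)

definition T0 :: tableau where "T0 = fill_rows 1 c"
lemma T0_split: "t_init (la1, la2) = (take m T0, drop m T0)"
  by (simp add: t_init_def T0_def fill_rows_append add.commute)
lemma T0_nth: "r < length c ==> T0 ! r = [int (off r) + 1..int (off (Suc r))]"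
  by (simp add: T0_def fill_rows_nth add.commute)
lemma T0_length [simp]: "length T0 = length c" by (simp add: T0_def)
lemma T0_concat: "concat T0 = [1..int n]" by (simp add: T0_def concat_fill_rows flip: sum_n)
lemma T0_rows: "set (fst (t_init (la1, la2))) \<union> set (snd (t_init (la1, la2))) = set T0"
  by (simp add: T0_split flip: set_append)

lemma off_l: "off m = l" by (simp add: psum_def)

lemma row_lt: "0 < v ==> v \<le> int n ==> \<rho> v < length c"
  using prow1[of v c] sum_n psum_mono[of "length c" "\<rho> v" c] psum_length[of c] by (cases "\<rho> v < length c") auto

lemma row_set: assumes "r < length c" shows "v \<in> set (T0 ! r) \<longleftrightarrow> 0 < v \<and> v \<le> int n \<and> \<rho> v = r"
proof
  assume "v \<in> set (T0 ! r)"
  then have v: "int (off r) < v" "v \<le> int (off (Suc r))" using T0_nth[OF assms] by auto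
  then show "0 < v \<and> v \<le> int n \<and> \<rho> v = r" using prow2[OF v] psum_le[of c "Suc r"] sum_n by auto
next
  assume "0 < v \<and> v \<le> int n \<and> \<rho> v = r"
  then show "v \<in> set (T0 ! r)" using prow1[of v c] sum_n T0_nth[OF assms] by auto
qed

definition stab :: "bperm set" where "stab = {w \<in> Sy n. \<forall>v. 0 < v \<and> v \<le> int n --> \<rho> (w $ v) = \<rho> v}"

lemma stab_eq: "row_stabilizer n (la1, la2) = bap ` stab"
proof -
  have "(\<forall>row\<in>set T0. bap w ` set row = set row) \<longleftrightarrow> (\<forall>v. 0 < v \<and> v \<le> int n --> \<rho> (w $ v) = \<rho> v)" if w: "w \<in> Sy n" for w
  proof
    assume a: "\<forall>row\<in>set T0. bap w ` set row = set row"
    show "\<forall>v. 0 < v \<and> v \<le> int n --> \<rho> (w $ v) = \<rho> v"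
    proof (intro allI impI)
      fix v assume v: "0 < v \<and> v \<le> int n"
      have r: "\<rho> v < length c" using row_lt v by blast
      have "v \<in> set (T0 ! \<rho> v)" using row_set[OF r] v by simp
      then have "w $ v \<in> bap w ` set (T0 ! \<rho> v)" by (rule imageI)
      moreover have "T0 ! \<rho> v \<in> set T0" using r by (intro nth_mem) simp
      ultimately have "w $ v \<in> set (T0 ! \<rho> v)" using a by simp
      then show "\<rho> (w $ v) = \<rho> v" using row_set[OF r] by simp
    qed
  next
    assume a: "\<forall>v. 0 < v \<and> v \<le> int n --> \<rho> (w $ v) = \<rho> v"
    show "\<forall>row\<in>set T0. bap w ` set row = set row"
    proof
      fix row assume "row \<in> set T0"
      then obtain r where r: "r < length c" "row = T0 ! r" by (metis T0_length in_set_conv_nth)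
      have "bap w ` set row \<subseteq> set row"
      proof clarify
        fix v assume "v \<in> set row"
        then show "w $ v \<in> set row" using row_set[OF r(1)] r(2) a Sy_pos[OF w, of v] Sy_range[OF w, of v] by simp
      qed
      moreover have "card (bap w ` set row) = card (set row)" by (rule card_image) (simp add: inj_on_def)
      ultimately show "bap w ` set row = set row" by (intro card_subset_eq) auto
    qed
  qed
  then show ?thesis unfolding row_stabilizer_def T0_rows Sym_eq stab_def by auto
qed

lemma stab_gen:
  assumes "w \<in> stab" "0 < i" "i < n" "\<rho> (int i) = \<rho> (int i + 1)" shows "w * gen i \<in> stab"
proof -
  have "\<rho> (w $ (gen i $ v)) = \<rho> v" if "0 < v" "v \<le> int n" for v
  proof -
    have "0 < gen i $ v \<and> gen i $ v \<le> int n" using that assms by (auto simp: gen_apply)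
    then have "\<rho> (w $ (gen i $ v)) = \<rho> (gen i $ v)" using assms(1) by (simp add: stab_def)
    also have "\<dots> = \<rho> v" using that assms by (auto simp: gen_apply)
    finally show ?thesis .
  qed
  then show ?thesis using assms Sy_times[OF _ gen_Sy] by (simp add: stab_def)
qed

text \<open>The stabilizer is finite and nonempty, so the arg max is attained; maximality of length
  is the form in which \<open>sigma_rows\<close> uses it.\<close>

lemma sigma_ex: "\<exists>\<sigma>\<in>stab. sigma_elt n (la1, la2) = bap \<sigma> \<and> (\<forall>w\<in>stab. ell w \<le> ell \<sigma>)"
proof -
  let ?P = "\<lambda>w. w \<in> row_stabilizer n (la1, la2)"
  have sW: "w \<in> Wn n" if "w \<in> stab" for w using that Sy_Wn by (auto simp: stab_def)
  have fin: "finite stab" by (rule finite_subset[OF _ finite_Wn[of n]]) (use sW in blast)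
  have "1 \<in> stab" by (simp add: stab_def)
  then have 1: "?P (bap 1)" unfolding stab_eq by (rule imageI)
  have "\<forall>y. ?P y --> len n y < Suc (Max (ell ` stab))"
    unfolding stab_eq using fin len_ell[OF n0] sW by (auto simp: less_Suc_eq_le)
  from arg_max_nat_lemma[of ?P, OF 1 this] have s: "?P (sigma_elt n (la1, la2))" "\<And>y. ?P y ==> len n y \<le> len n (sigma_elt n (la1, la2))"
    unfolding sigma_elt_def by blast+
  obtain \<sigma> where \<sigma>: "\<sigma> \<in> stab" "sigma_elt n (la1, la2) = bap \<sigma>" using s(1) unfolding stab_eq by blast
  have "ell w \<le> ell \<sigma>" if "w \<in> stab" for w
    using s(2)[of "bap w"] that \<sigma> len_ell[OF n0 sW[OF that]] len_ell[OF n0 sW[OF \<sigma>(1)]] unfolding stab_eq by auto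
  then show ?thesis using \<sigma> by blast
qed

text \<open>If \<sigma> increased at two adjacent positions of a row, multiplying by the
  corresponding generator would stay in the stabilizer and increase the length; so \<sigma> reverses
  every row. The shape inequality is the partition condition within each component.\<close>

lemma sigma_rows:
  assumes \<sigma>: "\<sigma> \<in> stab" "\<forall>w\<in>stab. ell w \<le> ell \<sigma>"
  shows "rows n l m off \<rho> \<sigma>"
proof
  show "0 < n" by (rule n0)
  show "off m = l" by (rule off_l)
  show "off r \<le> n" for r using psum_le[of c r] sum_n by simp
  show "off r \<le> off (Suc r)" for r by (rule psum_mono) simp
  show "int (off (\<rho> v)) < v \<and> v \<le> int (off (Suc (\<rho> v)))" if "0 < v" "v \<le> int n" for v using prow1[of v c] that sum_n by simp
  show "\<rho> v = r" if "int (off r) < v" "v \<le> int (off (Suc r))" for r v using that by (rule prow2)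
  show "off (Suc (Suc r)) + off r \<le> 2 * off (Suc r)" if "Suc r \<noteq> m" for r
  proof -
    have "c ! Suc r \<le> c ! r" if "Suc r < length c"
    proof (cases "Suc r < m")
      case True
      then show ?thesis using parts(1) sorted_wrt_nth_less[of "(\<ge>)" la1 r "Suc r"] by (simp add: is_partition_def nth_append)
    next
      case False
      then have "m \<le> r" using \<open>Suc r \<noteq> m\<close> by simp
      then show ?thesis using parts(2) sorted_wrt_nth_less[of "(\<ge>)" la2 "r - m" "Suc r - m"] that
        by (simp add: is_partition_def nth_append Suc_diff_le)
    qed
    then show ?thesis by (simp add: psum_Suc)
  qed
  show S: "\<sigma> \<in> Sy n" using \<sigma>(1) by (simp add: stab_def)
  show "\<rho> (\<sigma> $ v) = \<rho> v" if "0 < v" "v \<le> int n" for v using \<sigma>(1) that by (simp add: stab_def)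
  show "\<sigma> $ v' < \<sigma> $ v" if v: "0 < v" "v < v'" "v' \<le> int n" "\<rho> v = \<rho> v'" for v v'
  proof -
    have "- (\<sigma> $ v) < - (\<sigma> $ v')"
    proof (rule int_chain_less[OF v(2), of "\<lambda>i. - (\<sigma> $ i)"])
      fix i assume i: "v \<le> i" "i < v'"
      have bv: "int (off (\<rho> v)) < v" "v' \<le> int (off (Suc (\<rho> v)))" using prow1[of v c] prow1[of v' c] v sum_n by auto
      have "\<rho> i = \<rho> v" "\<rho> (i + 1) = \<rho> v" by (rule prow2; use bv i in linarith)+
      then have "\<sigma> * gen (nat i) \<in> stab" using i v by (intro stab_gen[OF \<sigma>(1)]) auto
      then have "\<not> ell \<sigma> < ell (\<sigma> * gen (nat i))" using \<sigma>(2) by (simp add: not_less)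
      then have "\<not> \<sigma> $ i < \<sigma> $ (i + 1)" using i v by (simp add: ell_right_less ra_def rb_def)
      moreover have "\<sigma> $ i \<noteq> \<sigma> $ (i + 1)" by simp
      ultimately show "- (\<sigma> $ i) < - (\<sigma> $ (i + 1))" by linarith
    qed
    then show ?thesis by simp
  qed
qed

end

section \<open>Standard bitableaux as permutations\<close>

text \<open>The list is extended to an odd function on {-n..n} and by the identity beyond.\<close>

lemma Sy_of_list: assumes "distinct xs" "set xs = {1..int n}" shows "\<exists>d\<in>Sy n. map (bap d) [1..int n] = xs"
proof -
  have len: "length xs = n" using distinct_card[OF assms(1)] assms(2) by simp
  have xs: "1 \<le> xs ! k \<and> xs ! k \<le> int n" if "k < n" for k using nth_mem[of k xs] assms(2) len that by auto
  define g where "g i = (if 1 \<le> i \<and> i \<le> int n then xs ! nat (i - 1) else if 1 \<le> - i \<and> - i \<le> int n then - (xs ! nat (- i - 1)) else i)" for i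
  define S where "S = {i. 1 \<le> \<bar>i\<bar> \<and> \<bar>i\<bar> \<le> int n}"
  have "finite S" by (rule finite_subset[of _ "{- int n..int n}"]) (auto simp: S_def)
  have gm: "g (- i) = - g i" for i by (auto simp: g_def)
  have gp: "g i = xs ! nat (i - 1)" "1 \<le> g i" "g i \<le> int n" if "1 \<le> i" "i \<le> int n" for i
    using that xs[of "nat (i - 1)"] by (auto simp: g_def)
  have gS: "(1 \<le> i \<and> i \<le> int n \<and> 1 \<le> g i \<and> g i \<le> int n) \<or> (1 \<le> - i \<and> - i \<le> int n \<and> 1 \<le> - g i \<and> - g i \<le> int n)" if "i \<in> S" for i
  proof (cases "1 \<le> i")
    case True then show ?thesis using that gp[of i] by (auto simp: S_def)
  next
    case False then show ?thesis using that gp[of "- i"] gm[of i] by (auto simp: S_def)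
  qed
  have inj1: "i = j" if "1 \<le> i" "i \<le> int n" "1 \<le> j" "j \<le> int n" "g i = g j" for i j
  proof -
    have "xs ! nat (i - 1) = xs ! nat (j - 1)" using that gp by simp
    then have "nat (i - 1) = nat (j - 1)" using nth_eq_iff_index_eq[OF assms(1)] that len by auto
    then show ?thesis using that by linarith
  qed
  have "inj_on g S"
  proof (rule inj_onI)
    fix i j assume ij: "i \<in> S" "j \<in> S" "g i = g j"
    show "i = j"
    proof (cases "1 \<le> i")
      case True
      then have "1 \<le> j" using gS[OF ij(1)] gS[OF ij(2)] ij(3) by auto
      then show ?thesis using inj1[of i j] ij True by (auto simp: S_def)
    next
      case False
      then have "1 \<le> - i" "1 \<le> - j" using gS[OF ij(1)] gS[OF ij(2)] ij(3) by auto
      then show ?thesis using inj1[of "- i" "- j"] ij gm by (auto simp: S_def)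
    qed
  qed
  moreover have "g ` S \<subseteq> S" using gS by (force simp: S_def)
  ultimately have "bij_betw g S S" using endo_inj_surj[OF \<open>finite S\<close>] by (simp add: bij_betw_def)
  then have "g permutes S" by (rule bij_imp_permutes) (auto simp: S_def g_def)
  then have "g \<in> W n" using gm by (auto simp: W_def S_def)
  then obtain d where d: "d \<in> Wn n" "g = bap d" unfolding W_eq by blast
  have "0 < g i" if "0 < i" for i using that gp(2)[of i] by (cases "i \<le> int n") (auto simp: g_def)
  then have "d \<in> Sy n" using d by (simp add: Sy_def)
  moreover have "map (bap d) [1..int n] = xs"
  proof (rule nth_equalityI)
    fix k assume "k < length (map (bap d) [1..int n])"
    then have "k < n" by simp
    then show "map (bap d) [1..int n] ! k = xs ! k" using gp(1)[of "1 + int k"] by (simp add: d(2)[symmetric])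
  qed (simp add: len)
  ultimately show ?thesis by blast
qed

lemma Sy_eqI: assumes "d \<in> Sy n" "d' \<in> Sy n" "map (bap d) [1..int n] = map (bap d') [1..int n]" shows "d = d'"
proof (rule bperm_eqI_pos)
  fix i :: int assume "0 < i"
  then show "d $ i = d' $ i"
    using assms(3) Wn_fix[OF Sy_Wn[OF assms(1)], of i] Wn_fix[OF Sy_Wn[OF assms(2)], of i] by (cases "i \<le> int n") auto
qed

text \<open>The two components are treated as one list of rows, with the column condition left out
  between rows k - 1 and k, where the components meet.\<close>

lemma is_standard_append:
  "is_standard (take k t) \<and> is_standard (drop k t) \<longleftrightarrow> (\<forall>row\<in>set t. sorted_wrt (<) row) \<and>
    (\<forall>r j. Suc r < length t --> Suc r \<noteq> k --> j < length (t ! Suc r) --> t ! r ! j < t ! Suc r ! j)" (is "?L \<longleftrightarrow> ?R")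
proof
  assume L: ?L
  have "set t = set (take k t) \<union> set (drop k t)" by (metis append_take_drop_id set_append)
  moreover have "t ! r ! j < t ! Suc r ! j" if "Suc r < length t" "Suc r \<noteq> k" "j < length (t ! Suc r)" for r j
  proof (cases "Suc r < k")
    case True
    then show ?thesis using L[THEN conjunct1, unfolded is_standard_def, THEN conjunct2, rule_format, of r j] that by simp
  next
    case False
    then have "k \<le> r" using that by simp
    then show ?thesis using L[THEN conjunct2, unfolded is_standard_def, THEN conjunct2, rule_format, of "r - k" j] that by simp
  qed
  ultimately show ?R using L unfolding is_standard_def by blast
next
  assume R: ?R
  then show ?L unfolding is_standard_def using set_take_subset[of k t] set_drop_subset[of k t] by auto
qed

context biparts
begin

definition tab_of :: "bperm => tableau" where "tab_of d = map (map (bap d)) T0"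

lemma T0_nth_length: "r < length c ==> length (T0 ! r) = c ! r" by (simp add: T0_nth psum_Suc)
lemma tab_of_length: "length (tab_of d) = length c" by (simp add: tab_of_def)
lemma tab_of_shape: "map length (tab_of d) = c" by (simp add: tab_of_def T0_def fill_rows_shape comp_def)
lemma tab_of_nth: assumes "r < length c" "j < c ! r" shows "tab_of d ! r ! j = d $ (int (off r) + 1 + int j)"
  using assms by (simp add: tab_of_def T0_nth psum_Suc)
lemma tab_of_concat: "concat (tab_of d) = map (bap d) [1..int n]"
  by (simp add: tab_of_def map_concat[symmetric] T0_concat)

lemma act_tab_of: "act (bap d) (t_init (la1, la2)) = (take m (tab_of d), drop m (tab_of d))"
  by (simp add: T0_split act_def tab_of_def take_map drop_map)

lemma act_iff: assumes "bishape t = (la1, la2)"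
  shows "act (bap d) (t_init (bishape t)) = t \<longleftrightarrow> map (bap d) [1..int n] = concat (fst t @ snd t)"
proof -
  obtain t1 t2 where t: "t = (t1, t2)" by fastforce
  have s: "map length t1 = la1" "map length t2 = la2" using assms t by (auto simp: bishape_def)
  then have l: "length t1 = m" by auto
  have "act (bap d) (t_init (bishape t)) = t \<longleftrightarrow> (take m (tab_of d), drop m (tab_of d)) = (t1, t2)"
    by (simp only: assms act_tab_of) (simp only: t)
  also have "\<dots> \<longleftrightarrow> tab_of d = t1 @ t2"
  proof
    assume "(take m (tab_of d), drop m (tab_of d)) = (t1, t2)"
    then show "tab_of d = t1 @ t2" using append_take_drop_id[of m "tab_of d"] by simp
  qed (simp add: l)
  also have "\<dots> \<longleftrightarrow> concat (tab_of d) = concat (t1 @ t2)"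
  proof (rule sym, rule concat_eq_concat_iff)
    have e: "map length (tab_of d) = map length (t1 @ t2)" unfolding tab_of_shape using s by simp
    show le: "length (tab_of d) = length (t1 @ t2)" using arg_cong[OF e, of length] unfolding length_map .
    show "\<forall>(x, y)\<in>set (zip (tab_of d) (t1 @ t2)). length x = length y"
    proof clarify
      fix x y assume "(x, y) \<in> set (zip (tab_of d) (t1 @ t2))"
      then obtain i where i: "i < length (tab_of d)" "x = tab_of d ! i" "y = (t1 @ t2) ! i" by (auto simp: set_zip)
      then show "length x = length y"
        using arg_cong[OF e, of "\<lambda>xs. xs ! i"] le nth_map[of i "tab_of d" length] nth_map[of i "t1 @ t2" length] by argo
    qed
  qed
  finally show ?thesis unfolding tab_of_concat unfolding t fst_conv snd_conv .
qed

lemma d_elt_eq: assumes "bishape t = (la1, la2)" "d \<in> Sy n" "map (bap d) [1..int n] = concat (fst t @ snd t)"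
  shows "d_elt n t = bap d"
  unfolding d_elt_def
proof (rule the_equality)
  show "bap d \<in> Sym n \<and> act (bap d) (t_init (bishape t)) = t" unfolding act_iff[OF assms(1)] Sym_eq using assms(2,3) by blast
  fix e assume e: "e \<in> Sym n \<and> act e (t_init (bishape t)) = t"
  then obtain d' where d': "e = bap d'" "d' \<in> Sy n" unfolding Sym_eq by blast
  then have "map (bap d') [1..int n] = map (bap d) [1..int n]" using e act_iff[OF assms(1), of d'] assms(3) by simp
  then show "e = bap d" using Sy_eqI[OF d'(2) assms(2)] d'(1) by simp
qed

lemma std_bitableaux_iff: "(t1, t2) \<in> std_bitableaux n la \<longleftrightarrow> bishape (t1, t2) = la \<and>
    distinct (concat (t1 @ t2)) \<and> set (concat (t1 @ t2)) = {1..int n} \<and> is_standard t1 \<and> is_standard t2"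
  by (simp only: std_bitableaux_def mem_Collect_eq prod.case concat_append)

lemma std_bitableaux_d:
  assumes "t \<in> std_bitableaux n (la1, la2)"
  shows "\<exists>d\<in>Sy n. d_elt n t = bap d \<and> t = (take m (tab_of d), drop m (tab_of d))"
proof -
  have b: "bishape t = (la1, la2)" and ds: "distinct (concat (fst t @ snd t))" "set (concat (fst t @ snd t)) = {1..int n}"
    using assms std_bitableaux_iff[of "fst t" "snd t"] by (simp_all only: prod.collapse)
  obtain d where d: "d \<in> Sy n" "map (bap d) [1..int n] = concat (fst t @ snd t)" using Sy_of_list[OF ds] by blast
  have "act (bap d) (t_init (bishape t)) = t" using act_iff[OF b] d(2) by blast
  then show ?thesis using d_elt_eq[OF b d] d(1) unfolding b act_tab_of by metis
qed

lemma tab_of_bitableau: "d \<in> Sy n ==> (take m (tab_of d), drop m (tab_of d)) \<in> std_bitableaux n (la1, la2) \<longleftrightarrow>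
    is_standard (take m (tab_of d)) \<and> is_standard (drop m (tab_of d))"
  and tab_of_bishape: "bishape (take m (tab_of d), drop m (tab_of d)) = (la1, la2)"
proof -
  show b: "bishape (take m (tab_of d), drop m (tab_of d)) = (la1, la2)"
    by (simp add: bishape_def tab_of_shape flip: take_map drop_map)
  assume d: "d \<in> Sy n"
  have cc: "concat (take m (tab_of d) @ drop m (tab_of d)) = map (bap d) [1..int n]"
    by (simp only: append_take_drop_id tab_of_concat)
  have "distinct (map (bap d) [1..int n])" by (simp add: distinct_map inj_on_def)
  moreover have "bap d ` {1..int n} = {1..int n}"
  proof (rule card_subset_eq)
    show "bap d ` {1..int n} \<subseteq> {1..int n}"
    proof clarify
      fix v assume "v \<in> {1..int n}"
      then show "d $ v \<in> {1..int n}" using Sy_pos[OF d, of v] Sy_range[OF d, of v] by auto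
    qed
    show "card (bap d ` {1..int n}) = card {1..int n}" by (rule card_image) (simp add: inj_on_def)
  qed simp
  ultimately show "(take m (tab_of d), drop m (tab_of d)) \<in> std_bitableaux n (la1, la2) \<longleftrightarrow>
    is_standard (take m (tab_of d)) \<and> is_standard (drop m (tab_of d))"
    unfolding std_bitableaux_iff cc using b by (simp only: set_map set_upto simp_thms)
qed

end

locale biparts_sigma = biparts +
  fixes \<sigma> :: bperm
  assumes s_stab: "\<sigma> \<in> stab" and s_max: "\<forall>w\<in>stab. ell w \<le> ell \<sigma>"
begin

sublocale rows n l m off \<rho> \<sigma> by (rule sigma_rows[OF s_stab s_max])

lemma pos_in_row: assumes "0 < v" "v \<le> int n" "\<rho> v = r"
  obtains j where "r < length c" "j < c ! r" "v = int (off r) + 1 + int j"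
proof (rule that[of "nat (v - int (off r) - 1)"])
  show r: "r < length c" using row_lt assms by blast
  have "int (off r) < v" "v \<le> int (off (Suc r))" using rho1[OF assms(1,2)] assms(3) by auto
  then show "nat (v - int (off r) - 1) < c ! r" "v = int (off r) + 1 + int (nat (v - int (off r) - 1))"
    using r by (auto simp: psum_Suc)
qed

lemma row_pos: assumes "r < length c" "j < c ! r"
  shows "0 < int (off r) + 1 + int j" "int (off r) + 1 + int j \<le> int n" "\<rho> (int (off r) + 1 + int j) = r"
proof -
  have b: "int (off r) < int (off r) + 1 + int j" "int (off r) + 1 + int j \<le> int (off (Suc r))" using assms by (auto simp: psum_Suc)
  show "\<rho> (int (off r) + 1 + int j) = r" by (rule rho2[OF b])
  show "0 < int (off r) + 1 + int j" "int (off r) + 1 + int j \<le> int n" using b off_n[of "Suc r"] by linarith+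
qed

lemma std_tab_of: assumes "d \<in> Sy n" shows "std d \<longleftrightarrow> is_standard (take m (tab_of d)) \<and> is_standard (drop m (tab_of d))"
proof -
  have len: "length (tab_of d ! r) = c ! r" if "r < length c" for r using that by (simp add: tab_of_def T0_nth_length)
  have "inc d \<longleftrightarrow> (\<forall>row\<in>set (tab_of d). sorted_wrt (<) row)"
  proof
    assume i: "inc d"
    show "\<forall>row\<in>set (tab_of d). sorted_wrt (<) row"
    proof
      fix row assume "row \<in> set (tab_of d)"
      then obtain r where r: "r < length c" "row = tab_of d ! r" by (metis in_set_conv_nth tab_of_length)
      show "sorted_wrt (<) row" unfolding sorted_wrt_iff_nth_less
      proof (intro allI impI)
        fix j k assume jk: "j < k" "k < length row"
        then have k: "k < c ! r" "j < c ! r" using len[OF r(1)] r(2) by auto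
        show "row ! j < row ! k" unfolding r(2) tab_of_nth[OF r(1) k(1)] tab_of_nth[OF r(1) k(2)]
          by (rule incD[OF i]) (use row_pos[OF r(1) k(1)] row_pos[OF r(1) k(2)] jk in auto)
      qed
    qed
  next
    assume s: "\<forall>row\<in>set (tab_of d). sorted_wrt (<) row"
    show "inc d" unfolding inc_def
    proof (intro allI impI)
      fix p q assume pq: "0 < p \<and> p < q \<and> q \<le> int n \<and> \<rho> p = \<rho> q"
      obtain j where j: "\<rho> q < length c" "j < c ! \<rho> q" "p = int (off (\<rho> q)) + 1 + int j" using pos_in_row[of p "\<rho> q"] pq by auto
      obtain k where k: "k < c ! \<rho> q" "q = int (off (\<rho> q)) + 1 + int k" using pos_in_row[of q "\<rho> q"] pq by auto
      have "sorted_wrt (<) (tab_of d ! \<rho> q)" using s j(1) by (simp add: tab_of_length)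
      moreover have "j < k" using j(3) k(2) pq by linarith
      ultimately have "tab_of d ! \<rho> q ! j < tab_of d ! \<rho> q ! k" using sorted_wrt_nth_less len[OF j(1)] k(1) by metis
      then show "d $ p < d $ q" unfolding tab_of_nth[OF j(1,2)] tab_of_nth[OF j(1) k(1)] j(3)[symmetric] k(2)[symmetric] .
    qed
  qed
  moreover have "(\<forall>v r. 0 < v \<and> v \<le> int n \<and> \<rho> v = Suc r \<and> Suc r \<noteq> m --> d $ (v - sz r) < d $ v) \<longleftrightarrow>
    (\<forall>r j. Suc r < length (tab_of d) --> Suc r \<noteq> m --> j < length (tab_of d ! Suc r) --> tab_of d ! r ! j < tab_of d ! Suc r ! j)" (is "?A \<longleftrightarrow> ?B")
  proof -
    have key: "tab_of d ! r ! j = d $ (v - sz r) \<and> tab_of d ! Suc r ! j = d $ v"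
      if r: "Suc r < length c" "Suc r \<noteq> m" "j < c ! Suc r" "v = int (off (Suc r)) + 1 + int j" for r j v
    proof -
      have "off (Suc (Suc r)) + off r \<le> 2 * off (Suc r)" by (rule shape[OF r(2)])
      then have "c ! Suc r \<le> c ! r" using r(1) by (simp add: psum_Suc)
      then have "tab_of d ! r ! j = d $ (int (off r) + 1 + int j)" using r by (intro tab_of_nth) auto
      moreover have "v - sz r = int (off r) + 1 + int j" using r(4) by (simp add: sz_def)
      ultimately show ?thesis using tab_of_nth[OF r(1,3)] r(4) by simp
    qed
    show ?thesis
    proof
      assume A: ?A
      show ?B
      proof (intro allI impI)
        fix r j assume r: "Suc r < length (tab_of d)" "Suc r \<noteq> m" "j < length (tab_of d ! Suc r)"
        then have r': "Suc r < length c" "j < c ! Suc r" using len[of "Suc r"] by (simp_all add: tab_of_length)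
        show "tab_of d ! r ! j < tab_of d ! Suc r ! j"
          using key[OF r'(1) r(2) r'(2) refl] A row_pos[OF r'] r(2) by metis
      qed
    next
      assume B: ?B
      show ?A
      proof (intro allI impI)
        fix v r assume v: "0 < v \<and> v \<le> int n \<and> \<rho> v = Suc r \<and> Suc r \<noteq> m"
        then obtain j where j: "Suc r < length c" "j < c ! Suc r" "v = int (off (Suc r)) + 1 + int j" using pos_in_row[of v "Suc r"] by blast
        have "tab_of d ! r ! j < tab_of d ! Suc r ! j" using B j v len[OF j(1)] by (simp add: tab_of_length)
        then show "d $ (v - sz r) < d $ v" using key[OF j(1) _ j(2,3)] v by simp
      qed
    qed
  qed
  ultimately show ?thesis unfolding std_def is_standard_append using assms by (simp only: simp_thms)
qed

lemma cell_eq: "left_cell n (bap \<sigma> \<circ> a_elt l) = {d_elt n t \<circ> bap \<sigma> \<circ> a_elt l | t. t \<in> std_bitableaux n (la1, la2)}"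
proof -
  have x: "bap \<sigma> \<circ> a_elt l = bap (Y 1)" by (simp add: a_elt_aw bap_mult[symmetric] del: comp_apply)
  have Y1: "Y 1 \<in> Wn n" by (rule Y_Wn) simp
  have "{y. LS n (Y 1) y} = Y ` {d. std d}" using std_LS LS_std by blast
  then have C: "left_cell n (bap \<sigma> \<circ> a_elt l) = (\<lambda>d. bap d \<circ> bap \<sigma> \<circ> a_elt l) ` {d. std d}"
    unfolding x left_cell_eq[OF n0 Y1] by (simp add: image_image a_elt_aw bap_mult)
  show ?thesis unfolding C
  proof (intro set_eqI iffI)
    fix z assume "z \<in> (\<lambda>d. bap d \<circ> bap \<sigma> \<circ> a_elt l) ` {d. std d}"
    then obtain d where d: "z = bap d \<circ> bap \<sigma> \<circ> a_elt l" "std d" by blast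
    have dS: "d \<in> Sy n" using d(2) by (simp add: std_def)
    let ?t = "(take m (tab_of d), drop m (tab_of d))"
    have t: "?t \<in> std_bitableaux n (la1, la2)" using tab_of_bitableau[OF dS] std_tab_of[OF dS] d(2) by blast
    have "d_elt n ?t = bap d" by (rule d_elt_eq[OF tab_of_bishape dS]) (simp add: tab_of_concat flip: concat_append)
    then show "z \<in> {d_elt n t \<circ> bap \<sigma> \<circ> a_elt l | t. t \<in> std_bitableaux n (la1, la2)}" using d(1) t by (metis (mono_tags, lifting) mem_Collect_eq)
  next
    fix z assume "z \<in> {d_elt n t \<circ> bap \<sigma> \<circ> a_elt l | t. t \<in> std_bitableaux n (la1, la2)}"
    then obtain t where t: "z = d_elt n t \<circ> bap \<sigma> \<circ> a_elt l" "t \<in> std_bitableaux n (la1, la2)" by blast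
    obtain d where d: "d \<in> Sy n" "d_elt n t = bap d" "t = (take m (tab_of d), drop m (tab_of d))" using std_bitableaux_d[OF t(2)] by blast
    have "std d" using tab_of_bitableau[OF d(1)] std_tab_of[OF d(1)] t(2) d(3) by simp
    then show "z \<in> (\<lambda>d. bap d \<circ> bap \<sigma> \<circ> a_elt l) ` {d. std d}" using t(1) d(2) by auto
  qed
qed

lemma len_eq: assumes "t \<in> std_bitableaux n (la1, la2)"
  shows "len n (d_elt n t \<circ> bap \<sigma> \<circ> a_elt l) = len n (d_elt n t) + len n (bap \<sigma> \<circ> a_elt l)"
proof -
  obtain d where d: "d \<in> Sy n" "d_elt n t = bap d" "t = (take m (tab_of d), drop m (tab_of d))" using std_bitableaux_d[OF assms] by blast
  have "std d" using tab_of_bitableau[OF d(1)] std_tab_of[OF d(1)] assms d(3) by simp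
  then have i: "inc d" by (simp add: std_def)
  have W: "Y d \<in> Wn n" "Y 1 \<in> Wn n" "d \<in> Wn n" using Y_Wn[OF d(1)] Y_Wn[OF Sy_one] Sy_Wn[OF d(1)] by auto
  have b: "d_elt n t \<circ> bap \<sigma> \<circ> a_elt l = bap (Y d)" "bap \<sigma> \<circ> a_elt l = bap (Y 1)"
    by (simp_all add: d(2) a_elt_aw bap_mult del: comp_apply)
  have "ell (Y d) = ell d + ell (Y 1)"
    using ell_aw[OF Sy_times[OF d(1) sig], of l] ell_aw[OF sig, of l] ell_inc_sig[OF i] by simp
  then show ?thesis unfolding b unfolding d(2) using len_ell[OF n0] W by simp
qed

text \<open>The reversed image list and the row itself are strictly increasing lists with the same
  elements, hence equal.\<close>

lemma sig_row_rev: assumes "r < length c" shows "map (bap \<sigma>) (T0 ! r) = rev (T0 ! r)"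
proof -
  let ?I = "[int (off r) + 1..int (off (Suc r))]"
  have v: "0 < v \<and> v \<le> int n \<and> \<rho> v = r" if "v \<in> set ?I" for v using row_set[OF assms, of v] that T0_nth[OF assms] by simp
  have "rev (map (bap \<sigma>) ?I) = ?I"
  proof (rule strict_sorted_equal)
    show "sorted_wrt (<) ?I" by simp
    show "sorted_wrt (<) (rev (map (bap \<sigma>) ?I))"
      unfolding sorted_wrt_rev sorted_wrt_map
    proof (rule sorted_wrt_mono_rel[of _ "(<)"])
      fix x y assume xy: "x \<in> set ?I" "y \<in> set ?I" "x < y"
      then show "\<sigma> $ y < \<sigma> $ x" using sig_rev[of x y] v[OF xy(1)] v[OF xy(2)] by simp
    qed simp
    have "\<sigma> $ v \<in> set ?I" if "v \<in> set ?I" for v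
      using row_set[OF assms, of "\<sigma> $ v"] T0_nth[OF assms] v[OF that] sig_row[of v] Sy_range'[OF sig, of v] by simp
    then have "bap \<sigma> ` set ?I \<subseteq> set ?I" by blast
    moreover have "card (bap \<sigma> ` set ?I) = card (set ?I)" by (rule card_image) (simp add: inj_on_def)
    ultimately have "bap \<sigma> ` set ?I = set ?I" by (intro card_subset_eq) auto
    then show "set (rev (map (bap \<sigma>) ?I)) = set ?I" by simp
  qed
  then show ?thesis unfolding T0_nth[OF assms] by (metis rev_rev_ident)
qed

lemma map_rows: "map (map (bap (d * \<sigma>))) T0 = map rev (tab_of d)"
proof (rule nth_equalityI)
  fix r assume "r < length (map (map (bap (d * \<sigma>))) T0)"
  then have r: "r < length c" by simp
  have "map (bap (d * \<sigma>)) (T0 ! r) = map (bap d) (map (bap \<sigma>) (T0 ! r))" by simp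
  also have "\<dots> = rev (map (bap d) (T0 ! r))" unfolding sig_row_rev[OF r] by (rule rev_map[symmetric])
  finally show "map (map (bap (d * \<sigma>))) T0 ! r = map rev (tab_of d) ! r" using r by (simp add: tab_of_def)
qed (simp add: tab_of_def)

lemma T0_parts: "concat (take m T0) = [1..int l]" "concat (drop m T0) = [int l + 1..int n]"
proof -
  show "concat (take m T0) = [1..int l]" by (simp add: T0_def fill_rows_append concat_fill_rows)
  have "int n = int l + int (sum_list la2)" using sum_n by simp
  then show "concat (drop m T0) = [int l + 1..int n]" by (simp add: T0_def fill_rows_append concat_fill_rows add.commute)
qed

lemma dsig_parts:
  "map (bap (d * \<sigma>)) [1..int l] = concat (map rev (take m (tab_of d)))"
  "map (bap (d * \<sigma>)) [int l + 1..int n] = concat (map rev (drop m (tab_of d)))"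
  unfolding T0_parts[symmetric] map_concat take_map[symmetric] drop_map[symmetric] map_rows by simp_all

text \<open>The first l values are negative, the others positive. a_l reverses the first l
  positions, which undoes the reversal of each row by \<sigma> and reverses the order of the rows:
  the negative word lists the rows of the first tableau from last to first. The positive word lists
  the reversed rows of the second tableau in order.\<close>

lemma cell_type: assumes d: "std d" shows "bishape (RS_Q n (bap (Y d))) = (conjugate la2, la1)"
proof -
  have dS: "d \<in> Sy n" using d by (simp add: std_def)
  have ds: "d * \<sigma> \<in> Sy n" using dS sig by (rule Sy_times)
  let ?t1 = "take m (tab_of d)" and ?t2 = "drop m (tab_of d)"
  have sh: "map length ?t1 = la1" "map length ?t2 = la2" using tab_of_bishape[of d] by (simp_all add: bishape_def)
  have t: "tab ?t1" "tab ?t2" using std_tab_of[OF dS] d parts by (simp_all add: tab_def sh)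
  have split: "[1..int n] = [1..int l] @ [int l + 1..int n]"
    unfolding T0_parts[symmetric] concat_append[symmetric] append_take_drop_id T0_concat ..
  have neg: "bap (Y d) i = - ((d * \<sigma>) $ (int l + 1 - i))" "bap (Y d) i < 0" if "1 \<le> i" "i \<le> int l" for i
  proof -
    show e: "bap (Y d) i = - ((d * \<sigma>) $ (int l + 1 - i))" using aw_low[of "int l + 1 - i" "d * \<sigma>"] that by simp
    show "bap (Y d) i < 0" unfolding e using Sy_pos[OF ds, of "int l + 1 - i"] that by simp
  qed
  have pos: "bap (Y d) i = (d * \<sigma>) $ i" "0 < bap (Y d) i" if "int l < i" for i
  proof -
    show e: "bap (Y d) i = (d * \<sigma>) $ i" by (rule aw_high[OF that])
    show "0 < bap (Y d) i" unfolding e using Sy_pos[OF ds, of i] that by simp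
  qed
  have f1: "filter (\<lambda>i. 0 < bap (Y d) i) [1..int n] = [int l + 1..int n]"
  proof -
    have "filter (\<lambda>i. 0 < bap (Y d) i) [1..int l] = []" unfolding filter_empty_conv using neg(2) by fastforce
    moreover have "filter (\<lambda>i. 0 < bap (Y d) i) [int l + 1..int n] = [int l + 1..int n]" unfolding filter_id_conv using pos(2) by auto
    ultimately show ?thesis unfolding split filter_append by simp
  qed
  have f2: "filter (\<lambda>i. bap (Y d) i < 0) [1..int n] = [1..int l]"
  proof -
    have "filter (\<lambda>i. bap (Y d) i < 0) [int l + 1..int n] = []" unfolding filter_empty_conv
    proof
      fix x assume "x \<in> set [int l + 1..int n]"
      then have "int l < x" by simp
      from pos(2)[OF this] show "\<not> bap (Y d) x < 0" by simp
    qed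
    moreover have "filter (\<lambda>i. bap (Y d) i < 0) [1..int l] = [1..int l]" unfolding filter_id_conv using neg(2) by auto
    ultimately show ?thesis unfolding split filter_append by simp
  qed
  have p: "map snd (pos_word n (bap (Y d))) = concat (map rev ?t2)"
  proof -
    have "map snd (pos_word n (bap (Y d))) = map (bap (Y d)) [int l + 1..int n]" unfolding pos_word_def f1 by simp
    also have "\<dots> = map (bap (d * \<sigma>)) [int l + 1..int n]" by (rule map_cong[OF refl]) (use pos(1) in auto)
    finally show ?thesis unfolding dsig_parts .
  qed
  have g: "map snd (neg_word n (bap (Y d))) = concat (rev ?t1)"
  proof -
    have "map snd (neg_word n (bap (Y d))) = map (\<lambda>i. \<bar>bap (Y d) i\<bar>) [1..int l]" unfolding neg_word_def f2 by simp
    also have "\<dots> = map (\<lambda>i. (d * \<sigma>) $ (int l + 1 - i)) [1..int l]"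
    proof (rule map_cong[OF refl])
      fix i assume "i \<in> set [1..int l]"
      then have "1 \<le> i" "i \<le> int l" by auto
      from neg[OF this] show "\<bar>bap (Y d) i\<bar> = (d * \<sigma>) $ (int l + 1 - i)" by linarith
    qed
    also have "\<dots> = rev (map (bap (d * \<sigma>)) [1..int l])"
      by (rule nth_equalityI) (simp_all add: rev_nth)
    also have "\<dots> = concat (rev ?t1)" unfolding dsig_parts by (simp add: rev_concat rev_map[symmetric])
    finally show ?thesis .
  qed
  have "map length (snd (rs (pos_word n (bap (Y d))))) = conjugate la2"
    unfolding rs_shape rs_fst p ins_cols[OF t(2)] transp_shape sh ..
  moreover have "map length (snd (rs (neg_word n (bap (Y d))))) = la1"
    unfolding rs_shape rs_fst g ins_rows[OF t(1)] sh ..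
  ultimately show ?thesis by (simp add: bishape_def RS_Q_def)
qed

end

theorem proposition2p6:
  fixes n l :: nat and la1 la2 :: "nat list" and sigma :: sperm and C :: "sperm set"
  assumes "n \<ge> 2"
    and "(la1, la2) \<in> bipartitions n"
    and "l = sum_list la1"
    and "sigma = sigma_elt n (la1, la2)"
    and "C = left_cell n (sigma \<circ> a_elt l)"
  shows "cell_has_type n C (conjugate la2, la1) \<and>
    C = {d_elt n t \<circ> sigma \<circ> a_elt l | t. t \<in> std_bitableaux n (la1, la2)} \<and>
    (\<forall>t \<in> std_bitableaux n (la1, la2).
       len n (d_elt n t \<circ> sigma \<circ> a_elt l) = len n (d_elt n t) + len n (sigma \<circ> a_elt l))"
proof -
  interpret biparts n la1 la2 by standard (use assms in auto)
  obtain \<sigma> where s: "\<sigma> \<in> stab" "sigma_elt n (la1, la2) = bap \<sigma>" "\<forall>w\<in>stab. ell w \<le> ell \<sigma>" using sigma_ex by blast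
  interpret biparts_sigma n la1 la2 \<sigma> by standard (use s in auto)
  have C: "C = {d_elt n t \<circ> bap \<sigma> \<circ> a_elt l | t. t \<in> std_bitableaux n (la1, la2)}"
    unfolding assms(3-5) s(2) by (rule cell_eq)
  have "cell_has_type n C (conjugate la2, la1)" unfolding cell_has_type_def
  proof
    fix x assume "x \<in> C"
    then obtain t where t: "x = d_elt n t \<circ> bap \<sigma> \<circ> a_elt (sum_list la1)" "t \<in> std_bitableaux n (la1, la2)" unfolding C assms(3) by blast
    obtain d where d: "d \<in> Sy n" "d_elt n t = bap d" "t = (take (length la1) (tab_of d), drop (length la1) (tab_of d))" using std_bitableaux_d[OF t(2)] by blast
    have "std d" using tab_of_bitableau[OF d(1)] std_tab_of[OF d(1)] t(2) d(3) by simp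
    moreover have "x = bap (Y d)" unfolding t(1) d(2) a_elt_aw bap_mult ..
    ultimately show "bishape (RS_Q n x) = (conjugate la2, la1)" using cell_type by simp
  qed
  then show ?thesis using C len_eq unfolding assms(3,4) s(2) by blast
qed

end
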